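(* Let $\{u_h\}_{h\searrow 0}$ be the family of numerical solutions obtained by the stabilized GRP method with initial data $u_h(0,\cdot)=\Pi_Qu_0$, $u_0\in L^\infty(\mathbb T^d)$. Assume that (i) there is a constant $\overline u$ independent of $h,\Delta t$ with $|u_h|\le \overline u$ uniformly for $\Delta t,h\to0$, and (ii) $(\Delta t,h)\in(0,1]^2$ and $\Delta t\le C_2h^{\alpha}$ for some $\alpha>4/3$ and a constant $C_2$ independent of $\Delta t$ and $h$. Then the following holds. (Classical solution) Let $u$ be the weak entropy solution obtained as the weak-$( * )$ limit in $L^\infty((0,T)\times\mathbb T^d)$ of (a subsequence of) $\{u_h\}$, and suppose $u\in C^1([0,T]\times\mathbb T^d)$. Then $u$ is a classical solution of the Burgers equation with initial data $u_0\in C^1(\mathbb T^d)$, and $u_h\to u$ in $L^p((0,T)\times\mathbb T^d)$ as $h\to0$ for any $p\in[1,\infty)$. (Strong solution) Suppose that the Burgers equation admits a strong solution $u$ in the class $W^{1,\infty}((0,T)\times\mathbb T^d)$ emanating from initial data $u_0\in W^{1,\infty}(\mathbb T^d)$. Then $u_h\to u$ in $L^p((0,T)\times\mathbb T^d)$ as $h\to0$ for any $p\in[1,\infty)$.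
   Context: **Burgers equation.** $\partial_t u+\sum_{i=1}^d\partial_{x_i}f(u)=0$ on $(0,T)\times\mathbb T^d$, $u(0,\cdot)=u_0$, $d\in\{2,3\}$, $f(u)=u^2/2$, with entropy pair $\eta(u)=u^2/2$, $q(u)=u^3/3$. Here $\mathbb T^d$ is a flat torus (bounded periodic domain). **Weak (entropy) solution.** $u\in L^\infty((0,T)\times\mathbb T^d)$ such that for every $\tau\in(0,T)$: $\big[\int_{\mathbb T^d}u(t,\cdot)\phi\,dx\big]_{t=0}^{t=\tau}=\int_0^\tau\int_{\mathbb T^d}\big(u\,\partial_t\phi+f(u)\sum_{i=1}^d\partial_{x_i}\phi\big)dx\,dt$ for all $\phi\in W^{1,\infty}((0,T)\times\mathbb T^d)$, and $\big[\int_{\mathbb T^d}\eta(u(t,\cdot))\varphi\,dx\big]_{t=0}^{t=\tau}\le\int_0^\tau\int_{\mathbb T^d}\big(\eta(u)\partial_t\varphi+q(u)\sum_{i=1}^d\partial_{x_i}\varphi\big)dx\,dt$ for all $\varphi\in W^{1,\infty}((0,T)\times\mathbb T^d)$, $\varphi\ge0$ (with $u(0,\cdot)=u_0$). **Mesh.** $\mathbb T^d$ is partitioned into a uniform mesh $\mathcal T_h$ of cubes (squares if $d=2$) $K$ of side $h$, with centers $x_K$, $|K|=h^d$. $\mathcal E$ is the set of faces, $\mathcal E_i$ the faces orthogonal to the basis vector $e_i$, $\mathcal E(K)$ and $\mathcal E_i(K)$ the corresponding faces of $K$; a face $\sigma$ has center $x_\sigma$ and measure $|\sigma|=h^{d-1}$.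 $\int_{\mathcal E}g\,dS:=\sum_{\sigma\in\mathcal E}\int_\sigma g\,dS$. $Q_h$ is the space of functions constant on each cell ($r_K$ is the value on $K$), and $\Pi_Q\phi|_K=\frac1{|K|}\int_K\phi\,dx$. For $\sigma=K|L\in\mathcal E_i$, with $L$ the neighbour of $K$ in direction $+e_i$, and a piecewise linear $v$: $v_\sigma^\pm=\lim_{\delta\to0+}v(x_\sigma\pm\delta e_i)$, average $\{\{v\}\}_\sigma=(v_\sigma^++v_\sigma^-)/2$, jump $[[v]]_\sigma=v_\sigma^+-v_\sigma^-$ (so $[[r]]_\sigma=r_L-r_K$ for $r\in Q_h$). **Reconstruction (minmod).** For $r\in Q_h$, with $s_1,s_2$ the two numbers $[[r]]_\sigma/h$, $\sigma\in\mathcal E_i(K)$: $(\nabla_h^{(i)}r)_K=\min(s_1,s_2)$ if $s_1,s_2>0$, $=\max(s_1,s_2)$ if $s_1,s_2<0$, and $=0$ otherwise. $R_Vr(x)=r_K+(x-x_K)\cdot(\nabla_hr)_K$ for $x\in K$, and $\mathrm{div}_h(r)_K:=\sum_{j=1}^d(\nabla_h^{(j)}r)_K$. **Cases at a face $\sigma$ (with $r=R_Vu_h$).** Case 1: $[[r]]<0,\{\{r\}\}>0$. Case 2: $[[r]]<0,\{\{r\}\}\le0$. Case 3: $0<r_\sigma^-\le r_\sigma^+$. Case 4: $r_\sigma^-\le0\le r_\sigma^+$. Case 5: $r_\sigma^-\le r_\sigma^+<0$. **GRP flux.** $f_\sigma^{GRP}=\frac12|(R_Vu_h)_\sigma^-|^2\big(1-\Delta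 t\,(\mathrm{div}_hu_h)_\sigma^-\big)$ in Cases 1, 3; $\frac12|(R_Vu_h)_\sigma^+|^2\big(1-\Delta t\,(\mathrm{div}_hu_h)_\sigma^+\big)$ in Cases 2, 5; $0$ in Case 4. **Stabilized GRP method.** Fix a constant $C_1\in(0,1/24]$ independent of $\Delta t,h$, and put $f_\sigma^{GRP,New}=f_\sigma^{GRP}$ if $[[u_h]]_\sigma\ge0$, $f_\sigma^{GRP,New}=f_\sigma^{GRP}+(\frac1{24}+C_1)[[u_h]]_\sigma^2$ if $[[u_h]]_\sigma<0$. With $\Delta t=T/N_T$, $t_k=k\Delta t$, the numerical solution $u_h$ takes values in $Q_h$, is constant in time on each $[t_k,t_{k+1})$, satisfies $u_h(0,\cdot)=\Pi_Qu_0$, and at each time level $$\int_{\mathbb T^d}\phi_hD_tu_h\,dx-\int_{\mathcal E}f_\sigma^{GRP,New}[[\phi_h]]\,dS=0\quad\forall\phi_h\in Q_h,\qquad D_tv(t)=\frac{v(t+\Delta t)-v(t)}{\Delta t}.$$ All flux quantities are evaluated at time $t$. *)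

theory Defs
  imports "HOL-Analysis.Analysis"
begin

text \<open>
  The flat torus with side lengths \<open>l $ i\<close> is the quotient of \<open>real ^ 'd\<close> by the lattice spanned by
  the vectors \<open>axis i (l $ i)\<close>.  Functions on it are \<open>l\<close>-periodic functions on \<open>real ^ 'd\<close>, and integrals
  are taken over the fundamental domain \<open>torus l\<close>.  Space-time functions live on \<open>real \<times> (real ^ 'd)\<close>;
  only their values at times in \<open>[0, T]\<close> matter.
\<close>

definition torus :: "real ^ 'd \<Rightarrow> (real ^ 'd) set" where
  "torus l = {x. \<forall>i. 0 \<le> x $ i \<and> x $ i < l $ i}"

definition periodic :: "real ^ 'd \<Rightarrow> (real ^ 'd \<Rightarrow> real) \<Rightarrow> bool" where
  "periodic l r \<longleftrightarrow> (\<forall>x i. r (x + axis i (l $ i)) = r x)"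

definition cylinder :: "real \<Rightarrow> real ^ 'd \<Rightarrow> (real \<times> (real ^ 'd)) set" where
  "cylinder T l = {0<..<T} \<times> torus l"


section \<open>Function spaces\<close>

definition L_infty :: "'a::euclidean_space set \<Rightarrow> ('a \<Rightarrow> real) \<Rightarrow> bool" where
  "L_infty D v \<longleftrightarrow> v \<in> borel_measurable (lebesgue_on D) \<and>
     (\<exists>M. AE z in lebesgue_on D. \<bar>v z\<bar> \<le> M)"

definition weak_star_converges ::
  "'a::euclidean_space set \<Rightarrow> (nat \<Rightarrow> 'a \<Rightarrow> real) \<Rightarrow> ('a \<Rightarrow> real) \<Rightarrow> bool" where
  "weak_star_converges D v u \<longleftrightarrow> L_infty D u \<and> (\<forall>n. L_infty D (v n)) \<and>
     (\<forall>g. set_integrable lebesgue D g \<longrightarrow>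
       (\<lambda>n. LINT z:D|lebesgue. v n z * g z) \<longlonglongrightarrow> (LINT z:D|lebesgue. u z * g z))"

definition Lp_converges ::
  "'a::euclidean_space set \<Rightarrow> real \<Rightarrow> (nat \<Rightarrow> 'a \<Rightarrow> real) \<Rightarrow> ('a \<Rightarrow> real) \<Rightarrow> bool" where
  "Lp_converges D p v u \<longleftrightarrow>
     (\<forall>n. set_integrable lebesgue D (\<lambda>z. \<bar>v n z - u z\<bar> powr p)) \<and>
     (\<lambda>n. (LINT z:D|lebesgue. \<bar>v n z - u z\<bar> powr p) powr (1 / p)) \<longlonglongrightarrow> 0"

definition C1_on :: "'a::euclidean_space set \<Rightarrow> ('a \<Rightarrow> real) \<Rightarrow> bool" where
  "C1_on S v \<longleftrightarrow> (\<exists>G. continuous_on S G \<and>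
     (\<forall>z\<in>S. (v has_derivative (\<lambda>w. G z \<bullet> w)) (at z within S)))"

primrec Ck :: "nat \<Rightarrow> ('a::euclidean_space \<Rightarrow> real) \<Rightarrow> bool" where
  "Ck 0 v \<longleftrightarrow> continuous_on UNIV v"
| "Ck (Suc k) v \<longleftrightarrow> (\<forall>z. v differentiable (at z)) \<and>
     (\<forall>e\<in>Basis. Ck k (\<lambda>z. frechet_derivative v (at z) e))"

definition smooth :: "('a::euclidean_space \<Rightarrow> real) \<Rightarrow> bool" where
  "smooth v \<longleftrightarrow> (\<forall>k. Ck k v)"

definition torus_tests :: "real ^ 'd \<Rightarrow> (real ^ 'd \<Rightarrow> real) set" where
  "torus_tests l = {\<psi>. smooth \<psi> \<and> periodic l \<psi>}"

text \<open>Smooth functions with compact support in \<open>(0, T)\<close> times the torus.\<close>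

definition cylinder_tests :: "real \<Rightarrow> real ^ 'd \<Rightarrow> (real \<times> (real ^ 'd) \<Rightarrow> real) set" where
  "cylinder_tests T l = {\<psi>. smooth \<psi> \<and> (\<forall>t. periodic l (\<lambda>x. \<psi> (t, x))) \<and>
     (\<exists>a b. 0 < a \<and> b < T \<and> (\<forall>t x. t \<notin> {a..b} \<longrightarrow> \<psi> (t, x) = 0))}"

text \<open>
  \<open>G\<close> is the weak gradient of \<open>v\<close>, and it is bounded.  In space-time, \<open>fst (G z)\<close> is the weak time
  derivative and \<open>snd (G z) $ i\<close> the weak derivative in the direction \<open>i\<close>.
\<close>

definition weak_gradient ::
  "('a::euclidean_space \<Rightarrow> real) set \<Rightarrow> 'a set \<Rightarrow> ('a \<Rightarrow> real) \<Rightarrow> ('a \<Rightarrow> 'a) \<Rightarrow> bool" where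
  "weak_gradient tests D v G \<longleftrightarrow> (\<forall>e\<in>Basis. L_infty D (\<lambda>z. G z \<bullet> e) \<and>
     (\<forall>\<psi>\<in>tests. (LINT z:D|lebesgue. v z * frechet_derivative \<psi> (at z) e)
               = - (LINT z:D|lebesgue. (G z \<bullet> e) * \<psi> z)))"

definition W1_infty_torus :: "real ^ 'd \<Rightarrow> (real ^ 'd \<Rightarrow> real) \<Rightarrow> bool" where
  "W1_infty_torus l v \<longleftrightarrow> periodic l v \<and> L_infty (torus l) v \<and>
     (\<exists>G. weak_gradient (torus_tests l) (torus l) v G)"

text \<open>
  Elements of \<open>W\<^sup>1\<^sup>,\<^sup>\<infinity>\<close> on the cylinder are represented by their continuous version on \<open>[0, T]\<close>
  times the torus, so that their values at a fixed time make sense.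
\<close>

definition W1_infty :: "real \<Rightarrow> real ^ 'd \<Rightarrow> (real \<times> (real ^ 'd) \<Rightarrow> real) \<Rightarrow> bool" where
  "W1_infty T l v \<longleftrightarrow> (\<forall>t\<in>{0..T}. periodic l (\<lambda>x. v (t, x))) \<and>
     continuous_on ({0..T} \<times> UNIV) v \<and> L_infty (cylinder T l) v \<and>
     (\<exists>G. weak_gradient (cylinder_tests T l) (cylinder T l) v G)"


section \<open>Solutions of the Burgers equation\<close>

definition flux :: "real \<Rightarrow> real" where "flux v = v\<^sup>2 / 2"

definition entropy :: "real \<Rightarrow> real" where "entropy v = v\<^sup>2 / 2"

definition entropy_flux :: "real \<Rightarrow> real" where "entropy_flux v = v ^ 3 / 3"

text \<open>
  The bracket at \<open>t = 0\<close> is taken with the initial datum \<open>u0\<close>.  The time slices of \<open>u\<close> have to be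
  measurable and bounded for the bracket at \<open>t = \<tau>\<close> to be meaningful.
\<close>

definition weak_entropy_solution ::
  "real \<Rightarrow> real ^ 'd \<Rightarrow> (real ^ 'd \<Rightarrow> real) \<Rightarrow> (real \<times> (real ^ 'd) \<Rightarrow> real) \<Rightarrow> bool" where
  "weak_entropy_solution T l u0 u \<longleftrightarrow>
     L_infty (cylinder T l) u \<and>
     (\<forall>\<tau>\<in>{0<..<T}. periodic l (\<lambda>x. u (\<tau>, x)) \<and> L_infty (torus l) (\<lambda>x. u (\<tau>, x))) \<and>
     (\<forall>\<tau>\<in>{0<..<T}. \<forall>\<phi> G. W1_infty T l \<phi> \<and>
        weak_gradient (cylinder_tests T l) (cylinder T l) \<phi> G \<longrightarrow>
        (LINT x:torus l|lebesgue. u (\<tau>, x) * \<phi> (\<tau>, x)) - (LINT x:torus l|lebesgue. u0 x * \<phi> (0, x))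
        = (LINT z:cylinder \<tau> l|lebesgue.
             u z * fst (G z) + flux (u z) * (\<Sum>i\<in>UNIV. snd (G z) $ i))) \<and>
     (\<forall>\<tau>\<in>{0<..<T}. \<forall>\<phi> G. W1_infty T l \<phi> \<and> (\<forall>t\<in>{0..T}. \<forall>x. 0 \<le> \<phi> (t, x)) \<and>
        weak_gradient (cylinder_tests T l) (cylinder T l) \<phi> G \<longrightarrow>
        (LINT x:torus l|lebesgue. entropy (u (\<tau>, x)) * \<phi> (\<tau>, x))
          - (LINT x:torus l|lebesgue. entropy (u0 x) * \<phi> (0, x))
        \<le> (LINT z:cylinder \<tau> l|lebesgue.
             entropy (u z) * fst (G z) + entropy_flux (u z) * (\<Sum>i\<in>UNIV. snd (G z) $ i)))"

text \<open>The class \<open>C\<^sup>1\<close> on the closed time interval \<open>[0, T]\<close> times the torus.\<close>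

definition C1_cylinder :: "real \<Rightarrow> real ^ 'd \<Rightarrow> (real \<times> (real ^ 'd) \<Rightarrow> real) \<Rightarrow> bool" where
  "C1_cylinder T l u \<longleftrightarrow> (\<forall>t\<in>{0..T}. periodic l (\<lambda>x. u (t, x))) \<and> C1_on ({0..T} \<times> UNIV) u"

text \<open>
  Since \<open>u0\<close> is only determined up to a null set, having \<open>C\<^sup>1\<close> initial datum \<open>u0\<close> means that \<open>u0\<close>
  agrees almost everywhere with the \<open>C\<^sup>1\<close> function \<open>u (0, \<sqdot>)\<close>.
\<close>

definition classical_solution ::
  "real \<Rightarrow> real ^ 'd \<Rightarrow> (real ^ 'd \<Rightarrow> real) \<Rightarrow> (real \<times> (real ^ 'd) \<Rightarrow> real) \<Rightarrow> bool" where
  "classical_solution T l u0 u \<longleftrightarrow> C1_cylinder T l u \<and>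
     (\<forall>t\<in>{0<..<T}. \<forall>x. deriv (\<lambda>s. u (s, x)) t
        + (\<Sum>i\<in>UNIV. deriv (\<lambda>s. flux (u (t, x + s *\<^sub>R axis i 1))) 0) = 0) \<and>
     C1_on UNIV (\<lambda>x. u (0, x)) \<and> (AE x in lebesgue. u (0, x) = u0 x)"

definition strong_solution ::
  "real \<Rightarrow> real ^ 'd \<Rightarrow> (real ^ 'd \<Rightarrow> real) \<Rightarrow> (real \<times> (real ^ 'd) \<Rightarrow> real) \<Rightarrow> bool" where
  "strong_solution T l u0 u \<longleftrightarrow> W1_infty T l u \<and>
     (\<exists>G F. weak_gradient (cylinder_tests T l) (cylinder T l) u G \<and>
        weak_gradient (cylinder_tests T l) (cylinder T l) (\<lambda>z. flux (u z)) F \<and>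
        (AE z in lebesgue_on (cylinder T l). fst (G z) + (\<Sum>i\<in>UNIV. snd (F z) $ i) = 0)) \<and>
     (AE x in lebesgue. u (0, x) = u0 x)"


section \<open>Mesh, discrete functions and reconstruction\<close>

text \<open>
  A uniform mesh is given by its side length \<open>h\<close> and a mesh point \<open>p0\<close>; cells are indexed by integer
  vectors, and indices that agree modulo the numbers of cells \<open>l $ i / h\<close> denote the same cell of the
  torus.  Cells are half-open, so that they cover every point exactly once.  The pair \<open>(k, i)\<close> stands
  for the face orthogonal to \<open>axis i 1\<close> between the cell \<open>k\<close> and its neighbour \<open>k + axis i 1\<close>.
\<close>

definition cell :: "real ^ 'd \<Rightarrow> real \<Rightarrow> int ^ 'd \<Rightarrow> (real ^ 'd) set" where
  "cell p0 h k = {x. \<forall>i. p0 $ i + h * of_int (k $ i) \<le> x $ i \<and> x $ i < p0 $ i + h * (of_int (k $ i) + 1)}"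

definition cell_of :: "real ^ 'd \<Rightarrow> real \<Rightarrow> real ^ 'd \<Rightarrow> int ^ 'd" where
  "cell_of p0 h x = (\<chi> i. \<lfloor>(x $ i - p0 $ i) / h\<rfloor>)"

definition center :: "real ^ 'd \<Rightarrow> real \<Rightarrow> int ^ 'd \<Rightarrow> real ^ 'd" where
  "center p0 h k = (\<chi> i. p0 $ i + h * (of_int (k $ i) + 1 / 2))"

definition face_center :: "real ^ 'd \<Rightarrow> real \<Rightarrow> int ^ 'd \<Rightarrow> 'd \<Rightarrow> real ^ 'd" where
  "face_center p0 h k i = center p0 h k + (h / 2) *\<^sub>R axis i 1"

text \<open>One index for each cell of the torus.\<close>

definition mesh_cells :: "real ^ 'd \<Rightarrow> real \<Rightarrow> (int ^ 'd) set" where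
  "mesh_cells l h = {k. \<forall>i. 0 \<le> k $ i \<and> h * of_int (k $ i) < l $ i}"

definition Qh :: "real ^ 'd \<Rightarrow> real ^ 'd \<Rightarrow> real \<Rightarrow> (real ^ 'd \<Rightarrow> real) set" where
  "Qh l p0 h = {r. periodic l r \<and> (\<forall>k. \<forall>x\<in>cell p0 h k. r x = r (center p0 h k))}"

definition proj_Q :: "real ^ 'd \<Rightarrow> real \<Rightarrow> (real ^ 'd \<Rightarrow> real) \<Rightarrow> real ^ 'd \<Rightarrow> real" where
  "proj_Q p0 h \<phi> x =
     1 / h ^ CARD('d) * (LINT y:cell p0 h (cell_of p0 h x)|lebesgue. \<phi> y)"

definition trace_plus ::
  "real ^ 'd \<Rightarrow> real \<Rightarrow> (real ^ 'd \<Rightarrow> real) \<Rightarrow> int ^ 'd \<Rightarrow> 'd \<Rightarrow> real" where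
  "trace_plus p0 h v k i = Lim (at_right 0) (\<lambda>\<delta>. v (face_center p0 h k i + \<delta> *\<^sub>R axis i 1))"

definition trace_minus ::
  "real ^ 'd \<Rightarrow> real \<Rightarrow> (real ^ 'd \<Rightarrow> real) \<Rightarrow> int ^ 'd \<Rightarrow> 'd \<Rightarrow> real" where
  "trace_minus p0 h v k i = Lim (at_right 0) (\<lambda>\<delta>. v (face_center p0 h k i - \<delta> *\<^sub>R axis i 1))"

definition avg :: "real ^ 'd \<Rightarrow> real \<Rightarrow> (real ^ 'd \<Rightarrow> real) \<Rightarrow> int ^ 'd \<Rightarrow> 'd \<Rightarrow> real" where
  "avg p0 h v k i = (trace_plus p0 h v k i + trace_minus p0 h v k i) / 2"

definition jump :: "real ^ 'd \<Rightarrow> real \<Rightarrow> (real ^ 'd \<Rightarrow> real) \<Rightarrow> int ^ 'd \<Rightarrow> 'd \<Rightarrow> real" where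
  "jump p0 h v k i = trace_plus p0 h v k i - trace_minus p0 h v k i"

definition minmod :: "real \<Rightarrow> real \<Rightarrow> real" where
  "minmod s1 s2 =
     (if s1 > 0 \<and> s2 > 0 then min s1 s2 else if s1 < 0 \<and> s2 < 0 then max s1 s2 else 0)"

definition grad_h :: "real ^ 'd \<Rightarrow> real \<Rightarrow> (real ^ 'd \<Rightarrow> real) \<Rightarrow> int ^ 'd \<Rightarrow> real ^ 'd" where
  "grad_h p0 h r k = (\<chi> i. minmod (jump p0 h r (k - axis i 1) i / h) (jump p0 h r k i / h))"

definition recon :: "real ^ 'd \<Rightarrow> real \<Rightarrow> (real ^ 'd \<Rightarrow> real) \<Rightarrow> real ^ 'd \<Rightarrow> real" where
  "recon p0 h r x = (let k = cell_of p0 h x in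
     r (center p0 h k) + (x - center p0 h k) \<bullet> grad_h p0 h r k)"

definition div_h :: "real ^ 'd \<Rightarrow> real \<Rightarrow> (real ^ 'd \<Rightarrow> real) \<Rightarrow> real ^ 'd \<Rightarrow> real" where
  "div_h p0 h r x = (\<Sum>j\<in>UNIV. grad_h p0 h r (cell_of p0 h x) $ j)"


section \<open>The stabilized GRP method\<close>

definition flux_GRP ::
  "real ^ 'd \<Rightarrow> real \<Rightarrow> real \<Rightarrow> (real ^ 'd \<Rightarrow> real) \<Rightarrow> int ^ 'd \<Rightarrow> 'd \<Rightarrow> real" where
  "flux_GRP p0 h dt r k i = (let
     v = recon p0 h r;
     vm = trace_minus p0 h v k i;
     vp = trace_plus p0 h v k i;
     case1 = (jump p0 h v k i < 0 \<and> avg p0 h v k i > 0);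
     case2 = (jump p0 h v k i < 0 \<and> avg p0 h v k i \<le> 0);
     case3 = (0 < vm \<and> vm \<le> vp);
     case5 = (vm \<le> vp \<and> vp < 0)
   in if case1 \<or> case3 then 1 / 2 * \<bar>vm\<bar>\<^sup>2 * (1 - dt * trace_minus p0 h (div_h p0 h r) k i)
      else if case2 \<or> case5 then 1 / 2 * \<bar>vp\<bar>\<^sup>2 * (1 - dt * trace_plus p0 h (div_h p0 h r) k i)
      else 0)"

definition flux_GRP_New ::
  "real ^ 'd \<Rightarrow> real \<Rightarrow> real \<Rightarrow> real \<Rightarrow> (real ^ 'd \<Rightarrow> real) \<Rightarrow> int ^ 'd \<Rightarrow> 'd \<Rightarrow> real" where
  "flux_GRP_New p0 h dt C1 r k i =
     (if jump p0 h r k i \<ge> 0 then flux_GRP p0 h dt r k i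
      else flux_GRP p0 h dt r k i + (1 / 24 + C1) * (jump p0 h r k i)\<^sup>2)"

text \<open>
  The integral over the skeleton of a quantity that is constant on each face; a face has measure
  \<open>h\<^sup>d\<^sup>-\<^sup>1\<close> and is the upper face in its direction of exactly one cell.
\<close>

definition face_integral :: "real ^ 'd \<Rightarrow> real \<Rightarrow> (int ^ 'd \<Rightarrow> 'd \<Rightarrow> real) \<Rightarrow> real" where
  "face_integral l h g = (\<Sum>i\<in>UNIV. \<Sum>k\<in>mesh_cells l h. h ^ (CARD('d) - 1) * g k i)"

definition uniform_mesh :: "real ^ 'd \<Rightarrow> real \<Rightarrow> bool" where
  "uniform_mesh l h \<longleftrightarrow> 0 < h \<and> (\<forall>i. \<exists>M::nat. l $ i = real M * h)"

definition stabilized_GRP_solution ::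
  "real \<Rightarrow> real ^ 'd \<Rightarrow> real \<Rightarrow> real ^ 'd \<Rightarrow> real \<Rightarrow> nat \<Rightarrow> (real ^ 'd \<Rightarrow> real)
     \<Rightarrow> (real \<times> (real ^ 'd) \<Rightarrow> real) \<Rightarrow> bool" where
  "stabilized_GRP_solution T l C1 p0 h N u0 u \<longleftrightarrow> (let dt = T / real N in
     uniform_mesh l h \<and>
     (\<forall>t\<in>{0..T}. (\<lambda>x. u (t, x)) \<in> Qh l p0 h) \<and>
     (\<forall>m<N. \<forall>t\<in>{real m * dt..<real (Suc m) * dt}. \<forall>x. u (t, x) = u (real m * dt, x)) \<and>
     (\<forall>x. u (0, x) = proj_Q p0 h u0 x) \<and>
     (\<forall>m<N. \<forall>\<phi>\<in>Qh l p0 h. let t = real m * dt in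
        (LINT x:torus l|lebesgue. \<phi> x * ((u (t + dt, x) - u (t, x)) / dt))
        - face_integral l h
            (\<lambda>k i. flux_GRP_New p0 h dt C1 (\<lambda>x. u (t, x)) k i * jump p0 h \<phi> k i) = 0))"

end

theory Submission
  imports Defs
begin

text \<open>
  Both parts rest on one relative entropy argument.  Multiplying the scheme by \<open>u\<^sub>h\<close> gives an energy
  inequality: the stabilized face flux dissipates a multiple of \<open>\<bar>[[u\<^sub>h]]\<bar>\<^sup>3\<close> at
  every face, which together with \<open>\<Delta>t = O(h\<^sup>\<alpha>)\<close>, \<open>\<alpha> > 4/3\<close>, absorbs the errors of the explicit time
  step and of the time correction in the GRP flux.  Testing the scheme with the nodal values of a function
  \<open>V\<close> that solves the Burgers equation up to a uniformly small residual and has bounded first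
  derivatives, one controls \<open>\<Sum>\<^sub>K h\<^sup>d (u\<^sub>K - V(x\<^sub>K))\<^sup>2 / 2\<close> by a discrete Gronwall argument.  A \<open>C\<^sup>1\<close> solution
  can be taken as \<open>V\<close> itself.  A Lipschitz weak solution \<open>U\<close> is mollified; the commutator of
  mollification and squaring is small because the kernel derivative acts on \<open>(U - V)\<^sup>2\<close>, whose difference quotients
  are bounded by the Lipschitz constant times the oscillation of \<open>U\<close>.
\<close>

section \<open>The energy balance of a single face\<close>

text \<open>The Gronwall constant depends on the comparison function only through one bound for its
  values and first derivatives. Mollification keeps these below the sup and Lipschitz bounds of the
  strong solution, whatever its radius. Only the modulus in the Taylor bounds deteriorates as the
  residual shrinks; the residual is fixed first and the mesh refined afterwards, so this does no
  harm. The threshold 4/3 is a matter of scaling. With \<open>lam = dt / h\<close>, explicit time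
  stepping and the time correction cost \<open>lam\<close> times squared jumps. Absorbing this into
  the cubed jumps leaves \<open>lam ^ 3\<close>, and dividing by \<open>h\<close> to pass to unit
  time gives \<open>lam ^ 3 / h\<close>, of order \<open>h powr (3 * \<alpha> - 4)\<close>. The
  mollifier looks ahead in time in order to work at time 0. Comparison functions are therefore
  available on \<open>{0..T'}\<close> with \<open>T' < T\<close> only, and the remaining slab is
  small by the uniform bound on the solutions. The same bound turns the quadratic error estimate
  into convergence for every finite exponent.\<close>

text \<open>The value \<open>w\<close> is the one of the GRP flux without its time correction.\<close>

lemma riemann_value_bounds:
  fixes rK rL vm vp :: real
  assumes pos: "rK \<le> rL \<Longrightarrow> rK \<le> vm \<and> vm \<le> (rK + rL) / 2 \<and> (rK + rL) / 2 \<le> vp \<and> vp \<le> rL"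
    and neg: "rL \<le> rK \<Longrightarrow> rL \<le> vp \<and> vp \<le> (rK + rL) / 2 \<and> (rK + rL) / 2 \<le> vm \<and> vm \<le> rK"
  defines "w \<equiv> (if vp - vm < 0 \<and> (vp + vm) / 2 > 0 \<or> 0 < vm \<and> vm \<le> vp then vm
           else if vp - vm < 0 \<and> (vp + vm) / 2 \<le> 0 \<or> vm \<le> vp \<and> vp < 0 then vp else 0)"
  shows "min rK rL \<le> w" "w \<le> max rK rL"
    "rK \<le> rL \<Longrightarrow> w\<^sup>2 \<le> ((rK + rL) / 2)\<^sup>2" "rL \<le> rK \<Longrightarrow> ((rK + rL) / 2)\<^sup>2 \<le> w\<^sup>2"
proof -
  show "min rK rL \<le> w" using pos neg unfolding w_def by (cases "rK \<le> rL") auto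
  show "w \<le> max rK rL" using pos neg unfolding w_def by (cases "rK \<le> rL") auto
  \<comment> \<open>At a rising jump \<open>vm\<close> lies below the mean and \<open>vp\<close>
    above it, and upwinding selects a value between 0 and the mean.\<close>
  show "w\<^sup>2 \<le> ((rK + rL) / 2)\<^sup>2" if "rK \<le> rL"
    using pos[OF that] unfolding w_def abs_le_square_iff[symmetric] by auto
  \<comment> \<open>At a falling jump \<open>vp\<close> lies below the mean and \<open>vm\<close>
    above it, and the sign of \<open>vp + vm\<close> selects the trace of larger modulus.\<close>
  show "((rK + rL) / 2)\<^sup>2 \<le> w\<^sup>2" if "rL \<le> rK"
    using neg[OF that] unfolding w_def abs_le_square_iff[symmetric] by auto
qed

text \<open>Origin of the constant 1/24: the mean of the flux over the segment from
  \<open>rK\<close> to \<open>rL\<close> is the flux at the midpoint plus half the variance, which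
  is one twelfth of the squared jump.\<close>

lemma face_entropy_identity:
  fixes rK rL :: real
  shows "(rL ^ 3 - rK ^ 3) / 6 = (rL - rK) * (((rK + rL) / 2)\<^sup>2 / 2 + (rL - rK)\<^sup>2 / 24)"
  by (simp add: power2_eq_square power3_eq_cube field_simps)

text \<open>By \<open>face_entropy_identity\<close> an entropy conservative face flux is the flux of
  the mean plus 1/24 of the squared jump. At a rising jump the flux stays below that of the mean, so
  the missing 1/24 dissipates and \<open>C1 \<le> 1 / 24\<close> lets it cover \<open>C1\<close>. At
  a falling jump the stabilization supplies the 1/24 and \<open>C1\<close> on top. \<open>E\<close>
  bounds the time correction.\<close>

lemma face_flux_bounds:
  fixes rK rL w D dt C1 ub E :: real
  assumes w: "min rK rL \<le> w" "w \<le> max rK rL"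
    and wpos: "rK \<le> rL \<Longrightarrow> w\<^sup>2 \<le> ((rK + rL) / 2)\<^sup>2"
    and wneg: "rL \<le> rK \<Longrightarrow> ((rK + rL) / 2)\<^sup>2 \<le> w\<^sup>2"
    and C1: "0 < C1" "C1 \<le> 1 / 24"
    and ub: "\<bar>rK\<bar> \<le> ub" "\<bar>rL\<bar> \<le> ub" and D: "\<bar>dt * D\<bar> \<le> E"
  defines "f \<equiv> w\<^sup>2 / 2 * (1 - dt * D) + (if rL - rK \<ge> 0 then 0 else (1 / 24 + C1) * (rL - rK)\<^sup>2)"
  shows "f * (rL - rK) \<le> (rL ^ 3 - rK ^ 3) / 6 - C1 * \<bar>rL - rK\<bar> ^ 3 + ub\<^sup>2 * E * \<bar>rL - rK\<bar>"
    and "\<bar>f - rK\<^sup>2 / 2\<bar> \<le> 2 * ub * \<bar>rL - rK\<bar> + ub\<^sup>2 * E"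
proof -
  let ?J = "rL - rK" and ?a = "(rK + rL) / 2"
  have E: "0 \<le> E" using D by linarith
  have wub: "\<bar>w\<bar> \<le> ub" using w ub by auto
  have ub0: "0 \<le> ub" using ub by linarith
  have w2: "w\<^sup>2 \<le> ub\<^sup>2" using wub by (metis abs_ge_zero power2_abs power_mono)
  have corr: "\<bar>w\<^sup>2 / 2 * (dt * D)\<bar> \<le> ub\<^sup>2 * E"
  proof -
    have "\<bar>w\<^sup>2 / 2 * (dt * D)\<bar> = w\<^sup>2 / 2 * \<bar>dt * D\<bar>" by (simp add: abs_mult)
    also have "\<dots> \<le> ub\<^sup>2 * E" using w2 D E zero_le_power2[of w] by (intro mult_mono) linarith+
    finally show ?thesis .
  qed
  have main: "(w\<^sup>2 / 2 + (if ?J \<ge> 0 then 0 else (1 / 24 + C1) * ?J\<^sup>2)) * ?J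
      \<le> (rL ^ 3 - rK ^ 3) / 6 - C1 * \<bar>?J\<bar> ^ 3"
  proof (cases "?J \<ge> 0")
    case True
    have "w\<^sup>2 / 2 * ?J \<le> ?a\<^sup>2 / 2 * ?J" using wpos True by (intro mult_right_mono) auto
    also have "\<dots> = (rL ^ 3 - rK ^ 3) / 6 - ?J ^ 3 / 24"
      unfolding face_entropy_identity by (simp add: power2_eq_square power3_eq_cube field_simps)
    also have "\<dots> \<le> (rL ^ 3 - rK ^ 3) / 6 - C1 * ?J ^ 3"
      using mult_right_mono[OF C1(2), of "?J ^ 3"] True by auto
    finally show ?thesis using True by simp
  next
    case False
    have "(w\<^sup>2 / 2 + (1 / 24 + C1) * ?J\<^sup>2) * ?J \<le> (?a\<^sup>2 / 2 + (1 / 24 + C1) * ?J\<^sup>2) * ?J"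
      using wneg False by (intro mult_right_mono_neg) auto
    also have "\<dots> = (rL ^ 3 - rK ^ 3) / 6 + C1 * ?J ^ 3"
      unfolding face_entropy_identity by (simp add: power2_eq_square power3_eq_cube field_simps)
    also have "\<dots> = (rL ^ 3 - rK ^ 3) / 6 - C1 * \<bar>?J\<bar> ^ 3"
      using False by (simp add: power3_eq_cube algebra_simps)
    finally show ?thesis using False by simp
  qed
  have feq: "f = w\<^sup>2 / 2 + (if ?J \<ge> 0 then 0 else (1 / 24 + C1) * ?J\<^sup>2) - w\<^sup>2 / 2 * (dt * D)"
    unfolding f_def by (simp add: right_diff_distrib)
  have "\<bar>w\<^sup>2 / 2 * (dt * D) * ?J\<bar> \<le> ub\<^sup>2 * E * \<bar>?J\<bar>"
    unfolding abs_mult[of _ ?J] by (intro mult_right_mono corr) auto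
  with main show "f * ?J \<le> (rL ^ 3 - rK ^ 3) / 6 - C1 * \<bar>?J\<bar> ^ 3 + ub\<^sup>2 * E * \<bar>?J\<bar>"
    unfolding feq left_diff_distrib by linarith
  have "w\<^sup>2 / 2 - rK\<^sup>2 / 2 = (w - rK) * (w + rK) / 2"
    by (simp add: power2_eq_square field_simps)
  then have "\<bar>w\<^sup>2 / 2 - rK\<^sup>2 / 2\<bar> = \<bar>w - rK\<bar> * \<bar>w + rK\<bar> / 2"
    by (simp only: abs_mult abs_divide abs_numeral)
  also have "\<dots> \<le> \<bar>?J\<bar> * (2 * ub) / 2"
    using w ub wub by (intro divide_right_mono mult_mono) auto
  finally have 1: "\<bar>w\<^sup>2 / 2 - rK\<^sup>2 / 2\<bar> \<le> ub * \<bar>?J\<bar>" by (simp add: mult.commute)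
  have "(1 / 24 + C1) * ?J\<^sup>2 \<le> 1 / 12 * (\<bar>?J\<bar> * \<bar>?J\<bar>)"
    using C1 mult_right_mono[of "1 / 24 + C1" "1 / 12" "?J\<^sup>2"] by (simp add: power2_eq_square)
  also have "\<dots> \<le> 1 / 12 * (\<bar>?J\<bar> * (2 * ub))" using ub by (intro mult_left_mono) auto
  also have "\<dots> \<le> ub * \<bar>?J\<bar>" using ub0 by (auto simp: mult.commute intro: mult_nonneg_nonneg)
  finally have 2: "(1 / 24 + C1) * ?J\<^sup>2 \<le> ub * \<bar>?J\<bar>" .
  have 3: "0 \<le> (1 / 24 + C1) * ?J\<^sup>2" using C1 by auto
  show "\<bar>f - rK\<^sup>2 / 2\<bar> \<le> 2 * ub * \<bar>?J\<bar> + ub\<^sup>2 * E"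
    using 1 2 3 corr ub0 unfolding feq by (auto split: if_splits simp: abs_le_iff)
qed

section \<open>One step of an abstract scheme\<close>

text \<open>Either \<open>K \<le> c * A\<close>, and the cube dominates, or \<open>A\<close> is
  below \<open>K / c\<close>. The cubic remainder in \<open>K\<close> later becomes
  \<open>lam ^ 3 / h\<close>.\<close>

lemma absorb_square:
  fixes A c K :: real assumes "0 \<le> A" "0 < c" "0 \<le> K"
  shows "K * A\<^sup>2 \<le> c * A ^ 3 + K ^ 3 / c\<^sup>2"
proof (cases "K \<le> c * A")
  case True
  have "K * A\<^sup>2 \<le> c * A * A\<^sup>2" using True by (intro mult_right_mono) auto
  also have "\<dots> = c * A ^ 3" by (simp add: power2_eq_square power3_eq_cube)
  finally show ?thesis using assms by (simp add: add_increasing2)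
next
  case False
  then have "A \<le> K / c" using assms by (simp add: field_simps)
  then have "K * A\<^sup>2 \<le> K * (K / c)\<^sup>2" using assms by (intro mult_left_mono power_mono) auto
  also have "\<dots> = K ^ 3 / c\<^sup>2" by (simp add: power2_eq_square power3_eq_cube)
  finally show ?thesis using assms by (simp add: add_increasing)
qed

text \<open>The same dichotomy, now at \<open>A = sqrt (K / c)\<close>. For \<open>K\<close> of
  order \<open>h\<close> the remainder is of order \<open>h * sqrt h\<close>.\<close>

lemma absorb_linear:
  fixes A c K :: real assumes "0 \<le> A" "0 < c" "0 \<le> K"
  shows "K * A \<le> c * A ^ 3 + K * sqrt (K / c)"
proof (cases "K \<le> c * A\<^sup>2")
  case True
  have "K * A \<le> c * A\<^sup>2 * A" using True assms by (intro mult_right_mono) auto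
  also have "\<dots> = c * A ^ 3" by (simp add: power2_eq_square power3_eq_cube)
  finally show ?thesis using assms by (simp add: add_increasing2)
next
  case False
  then have "A\<^sup>2 \<le> K / c" using assms by (simp add: field_simps)
  then have "A \<le> sqrt (K / c)" by (simp add: real_le_rsqrt)
  then have "K * A \<le> K * sqrt (K / c)" using assms by (intro mult_left_mono) auto
  then show ?thesis using assms by (simp add: add_increasing)
qed

text \<open>Comparison with the largest summand suffices; this is where the factor
  \<open>d ^ 3\<close> in \<open>dissipation_const\<close> comes from.\<close>

lemma sum_cube_le:
  fixes f :: "'i::finite \<Rightarrow> real" assumes "\<And>i. 0 \<le> f i"
  shows "(\<Sum>i\<in>UNIV. f i) ^ 3 \<le> real CARD('i) ^ 3 * (\<Sum>i\<in>UNIV. f i ^ 3)"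
proof -
  obtain j where j: "\<And>i. f i \<le> f j"
  proof -
    have "Max (range f) \<in> range f" by (rule Max_in) auto
    then obtain j where "Max (range f) = f j" by (rule rangeE)
    then show ?thesis using that[of j] Max_ge[of "range f"] by (metis finite finite_imageI rangeI)
  qed
  have "(\<Sum>i\<in>UNIV. f i) \<le> (\<Sum>i\<in>(UNIV::'i set). f j)" by (intro sum_mono j)
  then have "(\<Sum>i\<in>UNIV. f i) \<le> real CARD('i) * f j" by simp
  then have "(\<Sum>i\<in>UNIV. f i) ^ 3 \<le> (real CARD('i) * f j) ^ 3"
    by (intro power_mono sum_nonneg assms)
  also have "\<dots> \<le> real CARD('i) ^ 3 * (\<Sum>i\<in>UNIV. f i ^ 3)"
    unfolding power_mult_distrib
    by (intro mult_left_mono member_le_sum[of j UNIV "\<lambda>i. f i ^ 3"]) (auto simp: assms)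
  finally show ?thesis .
qed

section \<open>Summation by parts and the energy estimate on a periodic grid\<close>

locale periodic_grid =
  fixes S :: "'k set" and nx :: "'i::finite \<Rightarrow> 'k \<Rightarrow> 'k"
  assumes fin: "finite S" and bij: "\<And>i. bij_betw (nx i) S S"
begin

lemma sum_nx: "(\<Sum>k\<in>S. g (nx i k)) = (\<Sum>k\<in>S. g k)"
  by (rule sum.reindex_bij_betw[OF bij])

lemma nx_in: "k \<in> S \<Longrightarrow> nx i k \<in> S"
  using bij[of i] by (auto simp: bij_betw_def)

text \<open>Summation by parts on a torus: the bijections \<open>nx i\<close> leave no boundary
  terms.\<close>

lemma sum_sum_nx: "(\<Sum>k\<in>S. \<Sum>i\<in>UNIV. g i (nx i k)) = (\<Sum>k\<in>S. \<Sum>i\<in>UNIV. g i k)"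
  by (subst (1 2) sum.swap) (intro sum.cong refl sum_nx)

end

text \<open>One time step seen on the cells. \<open>w\<close> is the increment of \<open>r\<close>,
  and \<open>scheme_w\<close>, \<open>scheme_r\<close> are the scheme tested with \<open>w\<close>
  and with \<open>r\<close>. \<open>A k\<close> collects the jumps at the upper faces of
  \<open>k\<close>; divided by \<open>h\<close> it bounds the discrete divergence, hence the time
  correction in \<open>dissip\<close> and \<open>consist\<close>.\<close>

locale grid_flux = periodic_grid S nx for S :: "'k set" and nx :: "'i::finite \<Rightarrow> 'k \<Rightarrow> 'k" +
  fixes r w :: "'k \<Rightarrow> real" and f :: "'k \<Rightarrow> 'i \<Rightarrow> real" and A :: "'k \<Rightarrow> real" and d lam ub C1 :: real
  defines "d \<equiv> real CARD('i)" and "A \<equiv> \<lambda>k. \<Sum>i\<in>UNIV. \<bar>r (nx i k) - r k\<bar>"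
  assumes lam: "0 < lam" "lam \<le> 1" and C1: "0 < C1" and ub: "0 \<le> ub"
    and r_bound: "\<And>k. k \<in> S \<Longrightarrow> \<bar>r k\<bar> \<le> ub"
    and scheme_w: "(\<Sum>k\<in>S. w k * w k) = lam * (\<Sum>k\<in>S. \<Sum>i\<in>UNIV. f k i * (w (nx i k) - w k))"
    and scheme_r: "(\<Sum>k\<in>S. r k * w k) = lam * (\<Sum>k\<in>S. \<Sum>i\<in>UNIV. f k i * (r (nx i k) - r k))"
    and dissip: "\<And>k i. k \<in> S \<Longrightarrow> f k i * (r (nx i k) - r k) \<le> (r (nx i k) ^ 3 - r k ^ 3) / 6
        - C1 * \<bar>r (nx i k) - r k\<bar> ^ 3 + ub\<^sup>2 * (lam * (A k + A (nx i k))) * \<bar>r (nx i k) - r k\<bar>"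
    and consist: "\<And>k i. k \<in> S \<Longrightarrow> \<bar>f k i - (r k)\<^sup>2 / 2\<bar>
        \<le> 2 * ub * \<bar>r (nx i k) - r k\<bar> + ub\<^sup>2 * (lam * (A k + A (nx i k)))"
begin

lemma dpos: "0 < d" by (simp add: d_def)
abbreviation B :: real where "B \<equiv> 3 * ub + ub\<^sup>2"

lemma A_nonneg: "0 \<le> A k" unfolding A_def by (intro sum_nonneg) auto

lemma jump_le_A: "\<bar>r (nx i k) - r k\<bar> \<le> A k"
  unfolding A_def by (rule member_le_sum) auto

lemma consist': "k \<in> S \<Longrightarrow> \<bar>f k i - (r k)\<^sup>2 / 2\<bar> \<le> (2 * ub + ub\<^sup>2) * (A k + A (nx i k))"
proof -
  assume k: "k \<in> S"
  have "2 * ub * \<bar>r (nx i k) - r k\<bar> \<le> 2 * ub * (A k + A (nx i k))"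
    using jump_le_A[of i k] A_nonneg[of "nx i k"] ub by (intro mult_left_mono) auto
  moreover have "ub\<^sup>2 * (lam * (A k + A (nx i k))) \<le> ub\<^sup>2 * (1 * (A k + A (nx i k)))"
    using lam A_nonneg by (intro mult_left_mono mult_right_mono add_nonneg_nonneg) auto
  ultimately show ?thesis using consist[OF k, of i] by (simp add: algebra_simps)
qed

text \<open>Testing with the increment: the consistent part of the flux is summed by parts, so that
  every term is a jump of \<open>r\<close> times a value of \<open>w\<close>. Young's inequality
  then returns half of the left-hand side.\<close>

lemma increment_bound: "(\<Sum>k\<in>S. (w k)\<^sup>2) \<le> 16 * (d * B * lam)\<^sup>2 * (\<Sum>k\<in>S. (A k)\<^sup>2)"
proof -
  let ?A2 = "\<lambda>k i. (A k + A (nx i k))" and ?W2 = "\<lambda>k i. (\<bar>w k\<bar> + \<bar>w (nx i k)\<bar>)"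
  have parts: "(\<Sum>k\<in>S. \<Sum>i\<in>UNIV. (r k)\<^sup>2 / 2 * (w (nx i k) - w k))
      = (\<Sum>k\<in>S. \<Sum>i\<in>UNIV. ((r k)\<^sup>2 - (r (nx i k))\<^sup>2) / 2 * w (nx i k))"
  proof -
    have "(\<Sum>k\<in>S. \<Sum>i\<in>UNIV. (r (nx i k))\<^sup>2 / 2 * w (nx i k)) = (\<Sum>k\<in>S. \<Sum>i\<in>(UNIV::'i set). (r k)\<^sup>2 / 2 * w k)"
      by (rule sum_sum_nx[of "\<lambda>i k. (r k)\<^sup>2 / 2 * w k"])
    then show ?thesis
      by (simp add: right_diff_distrib left_diff_distrib diff_divide_distrib sum_subtractf)
  qed
  have "(\<Sum>k\<in>S. \<Sum>i\<in>UNIV. f k i * (w (nx i k) - w k))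
      = (\<Sum>k\<in>S. \<Sum>i\<in>UNIV. (f k i - (r k)\<^sup>2 / 2) * (w (nx i k) - w k) + ((r k)\<^sup>2 - (r (nx i k))\<^sup>2) / 2 * w (nx i k))"
    unfolding sum.distrib parts[symmetric] unfolding sum.distrib[symmetric]
    by (intro sum.cong refl) (simp add: algebra_simps)
  also have "\<dots> \<le> (\<Sum>k\<in>S. \<Sum>i\<in>UNIV. B * ?A2 k i * ?W2 k i)"
  proof (intro sum_mono)
    fix k i assume k: "k \<in> S"
    have "(f k i - (r k)\<^sup>2 / 2) * (w (nx i k) - w k) \<le> \<bar>f k i - (r k)\<^sup>2 / 2\<bar> * \<bar>w (nx i k) - w k\<bar>"
      unfolding abs_mult[symmetric] by (rule abs_ge_self)
    also have "\<dots> \<le> ((2 * ub + ub\<^sup>2) * ?A2 k i) * ?W2 k i"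
      using consist'[OF k, of i] ub A_nonneg by (intro mult_mono) (auto intro!: mult_nonneg_nonneg add_nonneg_nonneg)
    finally have 1: "(f k i - (r k)\<^sup>2 / 2) * (w (nx i k) - w k) \<le> (2 * ub + ub\<^sup>2) * ?A2 k i * ?W2 k i" .
    have "\<bar>((r k)\<^sup>2 - (r (nx i k))\<^sup>2) / 2\<bar> = \<bar>r (nx i k) - r k\<bar> * \<bar>r (nx i k) + r k\<bar> / 2"
      unfolding abs_mult[symmetric] by (simp add: power2_eq_square algebra_simps)
    also have "\<dots> \<le> \<bar>r (nx i k) - r k\<bar> * (2 * ub) / 2"
      using r_bound[OF k] r_bound[OF nx_in[OF k], of i] by (intro divide_right_mono mult_left_mono) auto
    also have "\<dots> \<le> ub * ?A2 k i"
      using mult_left_mono[OF jump_le_A[of i k] ub] mult_nonneg_nonneg[OF ub A_nonneg[of "nx i k"]]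
      by (simp add: algebra_simps)
    finally have "\<bar>((r k)\<^sup>2 - (r (nx i k))\<^sup>2) / 2\<bar> * \<bar>w (nx i k)\<bar> \<le> ub * ?A2 k i * ?W2 k i"
      using ub A_nonneg by (intro mult_mono) auto
    then have le: "((r k)\<^sup>2 - (r (nx i k))\<^sup>2) / 2 * w (nx i k) \<le> ub * ?A2 k i * ?W2 k i"
      using abs_ge_self[of "((r k)\<^sup>2 - (r (nx i k))\<^sup>2) / 2 * w (nx i k)"]
      unfolding abs_mult by linarith
    show "(f k i - (r k)\<^sup>2 / 2) * (w (nx i k) - w k) + ((r k)\<^sup>2 - (r (nx i k))\<^sup>2) / 2 * w (nx i k)
        \<le> B * ?A2 k i * ?W2 k i"
    proof -
      have "B * ?A2 k i * ?W2 k i = (2 * ub + ub\<^sup>2) * ?A2 k i * ?W2 k i + ub * ?A2 k i * ?W2 k i"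
        by (simp add: algebra_simps)
      then show ?thesis using 1 le by linarith
    qed
  qed
  finally have "(\<Sum>k\<in>S. (w k)\<^sup>2) \<le> lam * (\<Sum>k\<in>S. \<Sum>i\<in>UNIV. B * ?A2 k i * ?W2 k i)"
    using scheme_w lam by (simp add: power2_eq_square)
  also have "\<dots> = (\<Sum>k\<in>S. \<Sum>i\<in>UNIV. (lam * B * ?A2 k i) * ?W2 k i)"
    by (simp add: sum_distrib_left mult.assoc)
  also have "\<dots> \<le> (\<Sum>k\<in>S. \<Sum>i\<in>UNIV. 4 * d * (lam * B)\<^sup>2 * ((A k)\<^sup>2 + (A (nx i k))\<^sup>2)
      + 1 / (4 * d) * ((w k)\<^sup>2 + (w (nx i k))\<^sup>2))"
  proof (intro sum_mono)
    fix k i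
    \<comment> \<open>The weights leave \<open>1 / (4 * d)\<close> in front of each pair of
      neighbours; over \<open>d\<close> directions and both ends of each pair this adds up to one
      half.\<close>
    have young: "x * y \<le> 2 * d * x\<^sup>2 + 1 / (8 * d) * y\<^sup>2" for x y :: real
    proof -
      have "0 \<le> (4 * d * x - y)\<^sup>2 / (8 * d)" using dpos by auto
      then show ?thesis using dpos by (simp add: power2_eq_square field_simps)
    qed
    have sq: "(x + y)\<^sup>2 \<le> 2 * (x\<^sup>2 + y\<^sup>2)" for x y :: real
      using sum_squares_bound[of x y] by (simp add: power2_sum)
    have "lam * B * ?A2 k i * ?W2 k i \<le> 2 * d * (lam * B * ?A2 k i)\<^sup>2 + 1 / (8 * d) * (?W2 k i)\<^sup>2"
      by (rule young)
    also have "\<dots> \<le> 2 * d * ((lam * B)\<^sup>2 * (2 * ((A k)\<^sup>2 + (A (nx i k))\<^sup>2))) + 1 / (8 * d) * (2 * (\<bar>w k\<bar>\<^sup>2 + \<bar>w (nx i k)\<bar>\<^sup>2))"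
      unfolding power_mult_distrib[of "lam * B" "?A2 k i"] by (intro add_mono mult_left_mono sq) (use dpos in auto)
    also have "\<dots> = 4 * d * (lam * B)\<^sup>2 * ((A k)\<^sup>2 + (A (nx i k))\<^sup>2) + 1 / (4 * d) * ((w k)\<^sup>2 + (w (nx i k))\<^sup>2)"
      using dpos by (simp add: field_simps)
    finally show "lam * B * ?A2 k i * ?W2 k i \<le> 4 * d * (lam * B)\<^sup>2 * ((A k)\<^sup>2 + (A (nx i k))\<^sup>2)
      + 1 / (4 * d) * ((w k)\<^sup>2 + (w (nx i k))\<^sup>2)" .
  qed
  also have "\<dots> = 4 * d * (lam * B)\<^sup>2 * (2 * d * (\<Sum>k\<in>S. (A k)\<^sup>2)) + 1 / (4 * d) * (2 * d * (\<Sum>k\<in>S. (w k)\<^sup>2))"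
    unfolding sum.distrib sum_distrib_left[symmetric]
      sum_sum_nx[of "\<lambda>i k. (A k)\<^sup>2"] sum_sum_nx[of "\<lambda>i k. (w k)\<^sup>2"]
    by (simp add: sum_distrib_left algebra_simps d_def)
  also have "\<dots> = 8 * (d * B * lam)\<^sup>2 * (\<Sum>k\<in>S. (A k)\<^sup>2) + (\<Sum>k\<in>S. (w k)\<^sup>2) / 2"
    using dpos by (simp add: power2_eq_square field_simps)
  finally show ?thesis by simp
qed

text \<open>Testing with the solution: the differences of \<open>r ^ 3 / 6\<close> cancel around the
  torus and the cubed jumps remain as dissipation. The squared jumps come from the time correction
  and from half the sum of \<open>(w k)\<^sup>2\<close>, the price of explicit time
  stepping.\<close>

lemma energy_bound:
  "(\<Sum>k\<in>S. ((r k + w k)\<^sup>2 - (r k)\<^sup>2) / 2)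
     \<le> lam * (\<Sum>k\<in>S. (ub\<^sup>2 * (2 + d) + 8 * (d * B)\<^sup>2) * lam * (A k)\<^sup>2 - C1 / d ^ 3 * A k ^ 3)"
proof -
  have "(\<Sum>k\<in>S. \<Sum>i\<in>UNIV. f k i * (r (nx i k) - r k))
      \<le> (\<Sum>k\<in>S. \<Sum>i\<in>UNIV. (r (nx i k) ^ 3 / 6 - r k ^ 3 / 6) - C1 * \<bar>r (nx i k) - r k\<bar> ^ 3
          + ub\<^sup>2 * lam * (A k * \<bar>r (nx i k) - r k\<bar> + ((A (nx i k))\<^sup>2 + (A k * \<bar>r (nx i k) - r k\<bar>)) / 2))"
  proof (intro sum_mono)
    fix k i assume k: "k \<in> S"
    let ?J = "\<bar>r (nx i k) - r k\<bar>"
    \<comment> \<open>The neighbour's factor is separated as a square, which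
      \<open>sum_sum_nx\<close> moves back to the cell \<open>k\<close> in the sum.\<close>
    have "A (nx i k) * ?J \<le> ((A (nx i k))\<^sup>2 + ?J * ?J) / 2"
      using sum_squares_bound[of "A (nx i k)" ?J] by (simp add: power2_eq_square)
    also have "\<dots> \<le> ((A (nx i k))\<^sup>2 + A k * ?J) / 2"
      using jump_le_A[of i k] by (intro divide_right_mono add_left_mono mult_right_mono) auto
    finally have le: "A (nx i k) * ?J \<le> ((A (nx i k))\<^sup>2 + A k * ?J) / 2" .
    have le: "ub\<^sup>2 * lam * (A (nx i k) * ?J) \<le> ub\<^sup>2 * lam * (((A (nx i k))\<^sup>2 + A k * ?J) / 2)"
      using lam le by (intro mult_left_mono) auto
    show "f k i * (r (nx i k) - r k) \<le> (r (nx i k) ^ 3 / 6 - r k ^ 3 / 6) - C1 * ?J ^ 3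
          + ub\<^sup>2 * lam * (A k * ?J + ((A (nx i k))\<^sup>2 + (A k * ?J)) / 2)"
    proof -
      have "ub\<^sup>2 * (lam * (A k + A (nx i k))) * ?J = ub\<^sup>2 * lam * (A k * ?J) + ub\<^sup>2 * lam * (A (nx i k) * ?J)"
        by (simp add: algebra_simps)
      then show ?thesis
        using dissip[OF k, of i] le unfolding distrib_left[of "ub\<^sup>2 * lam"] diff_divide_distrib by linarith
    qed
  qed
  also have "\<dots> = (\<Sum>k\<in>S. ub\<^sup>2 * lam * ((A k)\<^sup>2 + (d * (A k)\<^sup>2 + (A k)\<^sup>2) / 2))
      - C1 * (\<Sum>k\<in>S. \<Sum>i\<in>UNIV. \<bar>r (nx i k) - r k\<bar> ^ 3)"
  proof -
    have AA: "(\<Sum>i\<in>UNIV. A k * \<bar>r (nx i k) - r k\<bar>) = (A k)\<^sup>2" for k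
      unfolding sum_distrib_left[symmetric] by (simp add: A_def power2_eq_square)
    show ?thesis
      unfolding sum.distrib sum_subtractf distrib_left add_divide_distrib sum_divide_distrib[symmetric]
        sum_distrib_left[symmetric]
        sum_sum_nx[of "\<lambda>i k. (A k)\<^sup>2"] sum_sum_nx[of "\<lambda>i k. r k ^ 3"]
      by (simp add: AA[unfolded sum_distrib_left[symmetric]] sum_distrib_left[symmetric]
          sum_divide_distrib[symmetric] d_def)
  qed
  also have "\<dots> \<le> (\<Sum>k\<in>S. ub\<^sup>2 * lam * ((2 + d) * (A k)\<^sup>2)) - C1 * (\<Sum>k\<in>S. A k ^ 3 / d ^ 3)"
  proof (intro diff_mono sum_mono mult_left_mono)
    show "(A k)\<^sup>2 + (d * (A k)\<^sup>2 + (A k)\<^sup>2) / 2 \<le> (2 + d) * (A k)\<^sup>2" for k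
    proof -
      have "0 \<le> (A k)\<^sup>2" "0 \<le> d * (A k)\<^sup>2" using dpos by auto
      then show ?thesis unfolding distrib_right add_divide_distrib by linarith
    qed
    show "A k ^ 3 / d ^ 3 \<le> (\<Sum>i\<in>UNIV. \<bar>r (nx i k) - r k\<bar> ^ 3)" for k
      using sum_cube_le[of "\<lambda>i. \<bar>r (nx i k) - r k\<bar>"] dpos by (simp add: A_def d_def field_simps)
  qed (use lam C1 in auto)
  finally have 1: "(\<Sum>k\<in>S. r k * w k) \<le> lam * \<dots>"
    unfolding scheme_r using lam by (intro mult_left_mono) auto
  have "(\<Sum>k\<in>S. ((r k + w k)\<^sup>2 - (r k)\<^sup>2) / 2) = (\<Sum>k\<in>S. r k * w k) + (\<Sum>k\<in>S. (w k)\<^sup>2) / 2"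
    unfolding sum_divide_distrib sum.distrib[symmetric]
    by (intro sum.cong refl) (simp add: power2_eq_square algebra_simps)
  also have "\<dots> \<le> lam * ((\<Sum>k\<in>S. ub\<^sup>2 * lam * ((2 + d) * (A k)\<^sup>2)) - C1 * (\<Sum>k\<in>S. A k ^ 3 / d ^ 3))
      + 8 * (d * B * lam)\<^sup>2 * (\<Sum>k\<in>S. (A k)\<^sup>2)"
    using 1 increment_bound by linarith
  also have "\<dots> = lam * (\<Sum>k\<in>S. (ub\<^sup>2 * (2 + d) + 8 * (d * B)\<^sup>2) * lam * (A k)\<^sup>2 - C1 / d ^ 3 * A k ^ 3)"
    unfolding sum_subtractf sum_distrib_left[symmetric] sum_divide_distrib[symmetric]
    by (simp add: power2_eq_square algebra_simps)
  finally show ?thesis .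
qed

lemma A_bound: assumes "k \<in> S" shows "A k \<le> 2 * d * ub"
proof -
  have "A k \<le> (\<Sum>i\<in>(UNIV::'i set). 2 * ub)"
    unfolding A_def
  proof (rule sum_mono)
    show "\<bar>r (nx i k) - r k\<bar> \<le> 2 * ub" for i
      using r_bound[OF assms] r_bound[OF nx_in[OF assms], of i] by linarith
  qed
  then show ?thesis by (simp add: d_def)
qed

lemma flux_abs_bound: assumes "k \<in> S" shows "\<bar>f k i\<bar> \<le> ub\<^sup>2 / 2 + (2 * ub + ub\<^sup>2) * (4 * d * ub)"
proof -
  have "(2 * ub + ub\<^sup>2) * (A k + A (nx i k)) \<le> (2 * ub + ub\<^sup>2) * (4 * d * ub)"
    using A_bound[OF assms] A_bound[OF nx_in[OF assms], of i] ub by (intro mult_left_mono) auto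
  moreover have "(r k)\<^sup>2 \<le> ub\<^sup>2" using r_bound[OF assms] ub by (simp add: abs_le_square_iff[symmetric])
  ultimately show ?thesis using consist'[OF assms, of i] zero_le_power2[of "r k"] by linarith
qed

end

section \<open>Relative entropy over one time step\<close>

definition flux_const :: "real \<Rightarrow> real \<Rightarrow> real" where
  "flux_const d ub = ub\<^sup>2 / 2 + (2 * ub + ub\<^sup>2) * (4 * d * ub)"

definition energy_const :: "real \<Rightarrow> real \<Rightarrow> real" where
  "energy_const d ub = ub\<^sup>2 * (2 + d) + 8 * (d * (3 * ub + ub\<^sup>2))\<^sup>2"

definition consistency_const :: "real \<Rightarrow> real \<Rightarrow> real \<Rightarrow> real" where
  "consistency_const d M ub = 2 * d * (2 * ub + ub\<^sup>2) * (M + 1)"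

text \<open>Half of the cubic coefficient in \<open>energy_bound\<close>: the quadratic and the
  linear error in the jumps absorb one half each.\<close>

definition dissipation_const :: "real \<Rightarrow> real \<Rightarrow> real" where
  "dissipation_const d C1 = C1 / d ^ 3 / 2"

text \<open>The five groups are, in this order, the coefficients of \<open>\<delta>\<close>,
  \<open>\<eta>\<close>, \<open>lam\<close>, \<open>lam ^ 3 / h\<close> and \<open>sqrt h\<close> in
  the one-step estimate; adding them gives one constant that dominates each.\<close>

definition step_const :: "real \<Rightarrow> real \<Rightarrow> real \<Rightarrow> real \<Rightarrow> real" where
  "step_const d M ub C1 = (ub + M) + (d * ub\<^sup>2 / 2 + ub + M + d * M\<^sup>2 / 2)
       + (2 * d * flux_const d ub * (M + 1) + (M + 1)\<^sup>2 / 2)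
       + energy_const d ub ^ 3 / (dissipation_const d C1)\<^sup>2
       + (consistency_const d M ub * sqrt (consistency_const d M ub / dissipation_const d C1) + d * (M + 1) ^ 3)"

text \<open>Discrete chain rule for the cube: the remainder is
  \<open>g\<^sup>2 * (v + g / 3)\<close>, of second order in \<open>h\<close>.\<close>

lemma cube_increment:
  fixes v g M :: real assumes "\<bar>v\<bar> \<le> M" "\<bar>g\<bar> \<le> (M + 1) * h" "0 < h" "h \<le> 1" "0 \<le> M"
  shows "\<bar>v\<^sup>2 * g - ((v + g) ^ 3 - v ^ 3) / 3\<bar> \<le> 2 * (M + 1) ^ 3 * h\<^sup>2"
proof -
  have "\<bar>g\<bar>\<^sup>2 \<le> ((M + 1) * h)\<^sup>2" using assms by (intro power_mono) auto
  then have g2: "g\<^sup>2 \<le> (M + 1)\<^sup>2 * h\<^sup>2" by (simp add: power_mult_distrib)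
  have g1: "\<bar>g\<bar> \<le> (M + 1) * 1" using assms by (intro order_trans[OF assms(2)] mult_left_mono) auto
  have "v\<^sup>2 * g - ((v + g) ^ 3 - v ^ 3) / 3 = - (g\<^sup>2 * (v + g / 3))"
    by (simp add: power2_eq_square power3_eq_cube field_simps)
  then have "\<bar>v\<^sup>2 * g - ((v + g) ^ 3 - v ^ 3) / 3\<bar> = g\<^sup>2 * \<bar>v + g / 3\<bar>"
    by (simp add: abs_mult)
  also have "\<dots> \<le> ((M + 1)\<^sup>2 * h\<^sup>2) * (2 * (M + 1))"
    using g1 g2 assms by (intro mult_mono) auto
  finally show ?thesis by (simp add: power2_eq_square power3_eq_cube algebra_simps)
qed

text \<open>\<open>V0\<close> and \<open>V1\<close> stand for the nodal values of the comparison
  function at both ends of the step, \<open>Vt\<close> and \<open>X i\<close> for its derivatives at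
  the first end, \<open>\<eta>\<close> for the relative Taylor error and \<open>\<delta>\<close> for
  the residual. \<open>scheme_V\<close> uses the new values because expanding the new relative
  entropy produces \<open>V1 k * w k\<close>.\<close>

locale relative_entropy_step = grid_flux S nx r w f A d lam ub C1
  for S :: "'k set" and nx :: "'i::finite \<Rightarrow> 'k \<Rightarrow> 'k" and r w f A d lam ub C1 +
  fixes V0 V1 Vt :: "'k \<Rightarrow> real" and X :: "'i \<Rightarrow> 'k \<Rightarrow> real" and dt h M \<delta> \<eta> :: real
  assumes lam_eq: "lam = dt / h" and dt: "0 < dt" and h: "0 < h" "h \<le> 1"
    and M: "0 \<le> M" and \<delta>: "0 \<le> \<delta>" and \<eta>: "0 \<le> \<eta>" "\<eta> \<le> 1"
    and V0: "\<And>k. k \<in> S \<Longrightarrow> \<bar>V0 k\<bar> \<le> M" and Vt: "\<And>k. k \<in> S \<Longrightarrow> \<bar>Vt k\<bar> \<le> M"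
    and X: "\<And>k i. k \<in> S \<Longrightarrow> \<bar>X i k\<bar> \<le> M"
    and residual: "\<And>k. k \<in> S \<Longrightarrow> \<bar>Vt k + V0 k * (\<Sum>i\<in>UNIV. X i k)\<bar> \<le> \<delta>"
    and V1: "\<And>k. k \<in> S \<Longrightarrow> \<bar>V1 k - V0 k - dt * Vt k\<bar> \<le> \<eta> * dt"
    and V0_nx: "\<And>k i. k \<in> S \<Longrightarrow> \<bar>V0 (nx i k) - V0 k - h * X i k\<bar> \<le> \<eta> * h"
    and scheme_V: "(\<Sum>k\<in>S. V1 k * w k) = lam * (\<Sum>k\<in>S. \<Sum>i\<in>UNIV. f k i * (V1 (nx i k) - V1 k))"
begin

abbreviation "n \<equiv> real (card S)"
abbreviation "F \<equiv> flux_const d ub"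
abbreviation "KE \<equiv> energy_const d ub"
abbreviation "KA \<equiv> consistency_const d M ub"
abbreviation "cc \<equiv> dissipation_const d C1"
abbreviation D where "D k \<equiv> (\<Sum>i\<in>UNIV. X i k)"

lemma dt_eq: "dt = lam * h" using lam_eq h by simp

lemma dt_le: "dt \<le> lam" using lam h unfolding dt_eq by (simp add: mult_left_le)

lemma space_inc: "k \<in> S \<Longrightarrow> \<bar>V0 (nx i k) - V0 k\<bar> \<le> (M + 1) * h"
proof -
  assume k: "k \<in> S"
  have "\<bar>h * X i k\<bar> \<le> M * h" using X[OF k, of i] h by (simp add: abs_mult mult.commute)
  moreover have "\<eta> * h \<le> 1 * h" using \<eta> h by (intro mult_right_mono) auto
  ultimately show ?thesis using V0_nx[OF k, of i] unfolding distrib_right by linarith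
qed

lemma time_inc: "k \<in> S \<Longrightarrow> \<bar>V1 k - V0 k\<bar> \<le> (M + 1) * dt"
proof -
  assume k: "k \<in> S"
  have "\<bar>dt * Vt k\<bar> \<le> M * dt" using Vt[OF k] dt by (simp add: abs_mult mult.commute)
  moreover have "\<eta> * dt \<le> 1 * dt" using \<eta> dt by (intro mult_right_mono) auto
  ultimately show ?thesis using V1[OF k] unfolding distrib_right by linarith
qed

lemma F_nonneg: "0 \<le> F" unfolding flux_const_def using ub dpos by (auto intro!: add_nonneg_nonneg mult_nonneg_nonneg)

text \<open>The flux against increments of \<open>V1\<close> is reduced to
  \<open>(r k)\<^sup>2 / 2\<close> against \<open>h * X i k\<close>. Replacing the flux costs
  \<open>KA * h * A k\<close>, replacing increments by derivatives costs \<open>\<eta>\<close>, and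
  going from \<open>V1\<close> back to \<open>V0\<close> costs \<open>lam\<close>.\<close>

lemma cross_term:
  "- (\<Sum>k\<in>S. V1 k * w k) \<le> - dt * (\<Sum>k\<in>S. (r k)\<^sup>2 / 2 * D k) + lam * (\<Sum>k\<in>S. KA * h * A k)
     + dt * n * (d * ub\<^sup>2 / 2 * \<eta> + 2 * d * F * (M + 1) * lam)"
proof -
  have pt: "- (f k i * (V1 (nx i k) - V1 k)) \<le> - (h * ((r k)\<^sup>2 / 2 * X i k))
      + (2 * ub + ub\<^sup>2) * (M + 1) * h * (A k + A (nx i k)) + (ub\<^sup>2 / 2 * \<eta> * h + 2 * F * (M + 1) * dt)"
    if k: "k \<in> S" for k i
  proof -
    have 1: "\<bar>(f k i - (r k)\<^sup>2 / 2) * (V0 (nx i k) - V0 k)\<bar> \<le> (2 * ub + ub\<^sup>2) * (A k + A (nx i k)) * ((M + 1) * h)"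
      unfolding abs_mult using consist'[OF k, of i] space_inc[OF k, of i] ub A_nonneg
      by (intro mult_mono) (auto intro!: add_nonneg_nonneg mult_nonneg_nonneg)
    have r2: "(r k)\<^sup>2 \<le> ub\<^sup>2" using r_bound[OF k] ub by (simp add: abs_le_square_iff[symmetric])
    have 2: "\<bar>(r k)\<^sup>2 / 2 * (V0 (nx i k) - V0 k - h * X i k)\<bar> \<le> ub\<^sup>2 / 2 * (\<eta> * h)"
      unfolding abs_mult using V0_nx[OF k, of i] r2 by (intro mult_mono) auto
    have 3: "\<bar>f k i * ((V1 (nx i k) - V0 (nx i k)) - (V1 k - V0 k))\<bar> \<le> F * (2 * (M + 1) * dt)"
    proof -
      have "\<bar>(V1 (nx i k) - V0 (nx i k)) - (V1 k - V0 k)\<bar> \<le> (M + 1) * dt + (M + 1) * dt"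
        using time_inc[OF k] time_inc[OF nx_in[OF k], of i] by linarith
      then show ?thesis
        unfolding abs_mult using flux_abs_bound[OF k, of i] F_nonneg
        by (intro mult_mono) (auto simp: flux_const_def algebra_simps)
    qed
    have "f k i * (V1 (nx i k) - V1 k) = (f k i - (r k)\<^sup>2 / 2) * (V0 (nx i k) - V0 k)
       + (r k)\<^sup>2 / 2 * (V0 (nx i k) - V0 k - h * X i k) + f k i * ((V1 (nx i k) - V0 (nx i k)) - (V1 k - V0 k))
       + h * ((r k)\<^sup>2 / 2 * X i k)" by (simp add: algebra_simps diff_divide_distrib)
    moreover have "(2 * ub + ub\<^sup>2) * (A k + A (nx i k)) * ((M + 1) * h) = (2 * ub + ub\<^sup>2) * (M + 1) * h * (A k + A (nx i k))"
      "ub\<^sup>2 / 2 * (\<eta> * h) = ub\<^sup>2 / 2 * \<eta> * h" "F * (2 * (M + 1) * dt) = 2 * F * (M + 1) * dt"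
      by simp_all
    ultimately show ?thesis using 1 2 3 by linarith
  qed
  have "- (\<Sum>k\<in>S. V1 k * w k) = lam * (\<Sum>k\<in>S. \<Sum>i\<in>UNIV. - (f k i * (V1 (nx i k) - V1 k)))"
    unfolding scheme_V by (simp add: sum_negf)
  also have "\<dots> \<le> lam * (\<Sum>k\<in>S. \<Sum>i\<in>UNIV. - (h * ((r k)\<^sup>2 / 2 * X i k))
      + (2 * ub + ub\<^sup>2) * (M + 1) * h * (A k + A (nx i k)) + (ub\<^sup>2 / 2 * \<eta> * h + 2 * F * (M + 1) * dt))"
    using pt lam by (intro mult_left_mono sum_mono) auto
  also have "\<dots> = lam * (- (h * (\<Sum>k\<in>S. (r k)\<^sup>2 / 2 * D k))
      + (2 * ub + ub\<^sup>2) * (M + 1) * h * (2 * d * (\<Sum>k\<in>S. A k)) + n * d * (ub\<^sup>2 / 2 * \<eta> * h + 2 * F * (M + 1) * dt))"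
    unfolding sum.distrib sum_distrib_left[symmetric] sum_negf sum_sum_nx[of "\<lambda>i k. A k"]
    by (simp add: sum_distrib_left[symmetric] sum_distrib_right[symmetric] d_def algebra_simps)
  also have "\<dots> = - dt * (\<Sum>k\<in>S. (r k)\<^sup>2 / 2 * D k) + lam * (\<Sum>k\<in>S. KA * h * A k)
     + dt * n * (d * ub\<^sup>2 / 2 * \<eta> + 2 * d * F * (M + 1) * lam)"
    unfolding sum_distrib_left[symmetric] dt_eq consistency_const_def by (simp add: algebra_simps)
  finally show ?thesis .
qed

text \<open>In the continuum the integrand is the sum of the partial derivatives of one third of the
  cube, whose integral over the torus is zero. \<open>cube_increment\<close> and summation over the
  grid give the discrete version.\<close>

lemma cubic_flux_sum: "\<bar>\<Sum>k\<in>S. (V0 k)\<^sup>2 * D k\<bar> \<le> n * d * (2 * (M + 1) ^ 3 * h + M\<^sup>2 * \<eta>)"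
proof -
  have pt: "\<bar>h * ((V0 k)\<^sup>2 * X i k) - (V0 (nx i k) ^ 3 / 3 - V0 k ^ 3 / 3)\<bar> \<le> h * (2 * (M + 1) ^ 3 * h + M\<^sup>2 * \<eta>)"
    if k: "k \<in> S" for k i
  proof -
    define g where "g = V0 (nx i k) - V0 k"
    have gV: "V0 (nx i k) = V0 k + g" unfolding g_def by simp
    have 1: "\<bar>(V0 k)\<^sup>2 * g - ((V0 k + g) ^ 3 - V0 k ^ 3) / 3\<bar> \<le> 2 * (M + 1) ^ 3 * h\<^sup>2"
      using V0[OF k] space_inc[OF k, of i] h M unfolding g_def by (intro cube_increment) auto
    have "(V0 k)\<^sup>2 \<le> M\<^sup>2" using V0[OF k] M by (simp add: abs_le_square_iff[symmetric])
    then have "\<bar>(V0 k)\<^sup>2 * (g - h * X i k)\<bar> \<le> M\<^sup>2 * (\<eta> * h)"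
      unfolding abs_mult using V0_nx[OF k, of i] unfolding g_def by (intro mult_mono) auto
    moreover have "h * ((V0 k)\<^sup>2 * X i k) = (V0 k)\<^sup>2 * g - (V0 k)\<^sup>2 * (g - h * X i k)"
      by (simp add: algebra_simps)
    moreover have "h * (2 * (M + 1) ^ 3 * h + M\<^sup>2 * \<eta>) = 2 * (M + 1) ^ 3 * h\<^sup>2 + M\<^sup>2 * (\<eta> * h)"
      by (simp add: power2_eq_square algebra_simps)
    ultimately show ?thesis using 1 unfolding gV diff_divide_distrib by linarith
  qed
  have "h * (\<Sum>k\<in>S. (V0 k)\<^sup>2 * D k) = (\<Sum>k\<in>S. \<Sum>i\<in>UNIV. h * ((V0 k)\<^sup>2 * X i k) - (V0 (nx i k) ^ 3 / 3 - V0 k ^ 3 / 3))"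
    unfolding sum_subtractf sum_sum_nx[of "\<lambda>i k. V0 k ^ 3 / 3"] by (simp add: sum_distrib_left)
  from arg_cong[OF this, of abs] have "h * \<bar>\<Sum>k\<in>S. (V0 k)\<^sup>2 * D k\<bar> = \<bar>\<Sum>k\<in>S. \<Sum>i\<in>UNIV. h * ((V0 k)\<^sup>2 * X i k) - (V0 (nx i k) ^ 3 / 3 - V0 k ^ 3 / 3)\<bar>"
    by (simp only: abs_mult abs_of_pos[OF h(1)])
  also have "\<dots> \<le> (\<Sum>k\<in>S. \<Sum>i\<in>(UNIV::'i set). h * (2 * (M + 1) ^ 3 * h + M\<^sup>2 * \<eta>))"
    using pt by (intro order_trans[OF sum_abs] sum_mono) auto
  also have "\<dots> = h * (n * d * (2 * (M + 1) ^ 3 * h + M\<^sup>2 * \<eta>))" by (simp add: d_def)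
  finally show ?thesis using h by simp
qed

text \<open>Relative entropy expansion with \<open>V1 - V0\<close> replaced by
  \<open>- dt * V0 * D\<close>. Writing \<open>(r - V) * V\<close> as
  \<open>r\<^sup>2 / 2 - V\<^sup>2 / 2 - (r - V)\<^sup>2 / 2\<close> yields a term that cancels
  against \<open>cross_term\<close>, one for \<open>cubic_flux_sum\<close>, and a quadratic one for
  Gronwall.\<close>

lemma pointwise_split:
  assumes k: "k \<in> S"
  shows "(r k + w k - V1 k)\<^sup>2 / 2 - (r k - V0 k)\<^sup>2 / 2
    \<le> ((r k + w k)\<^sup>2 - (r k)\<^sup>2) / 2 - V1 k * w k
       + dt * ((r k)\<^sup>2 / 2 * D k) - dt * ((V0 k)\<^sup>2 * D k) / 2 + d * M * dt * ((r k - V0 k)\<^sup>2 / 2)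
       + dt * ((ub + M) * \<delta> + (ub + M) * \<eta> + (M + 1)\<^sup>2 / 2 * lam)"
proof -
  have id: "(r k + w k - V1 k)\<^sup>2 / 2 - (r k - V0 k)\<^sup>2 / 2
     = ((r k + w k)\<^sup>2 - (r k)\<^sup>2) / 2 - V1 k * w k + (V0 k - r k) * (V1 k - V0 k) + (V1 k - V0 k)\<^sup>2 / 2"
    by (simp add: power2_eq_square field_simps)
  have b: "\<bar>V0 k - r k\<bar> \<le> ub + M" using V0[OF k] r_bound[OF k] by linarith
  have "\<bar>V1 k - V0 k + dt * (V0 k * D k)\<bar> \<le> \<bar>V1 k - V0 k - dt * Vt k\<bar> + \<bar>dt * (Vt k + V0 k * D k)\<bar>"
    unfolding distrib_left by linarith
  also have "\<dots> \<le> \<eta> * dt + dt * \<delta>"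
    using V1[OF k] residual[OF k] dt unfolding abs_mult by (intro add_mono mult_mono) auto
  finally have "\<bar>(V0 k - r k) * (V1 k - V0 k + dt * (V0 k * D k))\<bar> \<le> (ub + M) * (\<eta> * dt + dt * \<delta>)"
    unfolding abs_mult using b by (intro mult_mono) auto
  then have 1: "(V0 k - r k) * (V1 k - V0 k) \<le> - ((V0 k - r k) * (dt * (V0 k * D k))) + (ub + M) * (\<eta> * dt + dt * \<delta>)"
    unfolding distrib_left[of "V0 k - r k"] by linarith
  have "\<bar>V1 k - V0 k\<bar>\<^sup>2 \<le> ((M + 1) * dt)\<^sup>2" using time_inc[OF k] by (intro power_mono) auto
  also have "\<dots> = (M + 1)\<^sup>2 * (dt * dt)" by (simp add: power2_eq_square)
  also have "\<dots> \<le> (M + 1)\<^sup>2 * (dt * lam)" using dt dt_le by (intro mult_left_mono) auto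
  finally have 2: "(V1 k - V0 k)\<^sup>2 / 2 \<le> (M + 1)\<^sup>2 / 2 * (dt * lam)" by simp
  have "\<bar>D k\<bar> \<le> (\<Sum>i\<in>(UNIV::'i set). M)" by (intro order_trans[OF sum_abs] sum_mono X k)
  then have Dk: "\<bar>D k\<bar> \<le> d * M" by (simp add: d_def)
  have "- (dt * ((r k - V0 k)\<^sup>2 / 2) * D k) \<le> dt * ((r k - V0 k)\<^sup>2 / 2) * (d * M)"
    unfolding mult_minus_right[symmetric] using Dk dt by (intro mult_left_mono) auto
  moreover have "- ((V0 k - r k) * (dt * (V0 k * D k))) = dt * ((r k)\<^sup>2 / 2 * D k) - dt * ((V0 k)\<^sup>2 * D k) / 2
      - dt * ((r k - V0 k)\<^sup>2 / 2) * D k" by (simp add: power2_eq_square field_simps)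
  moreover have "dt * ((ub + M) * \<delta> + (ub + M) * \<eta> + (M + 1)\<^sup>2 / 2 * lam)
     = (ub + M) * (\<eta> * dt + dt * \<delta>) + (M + 1)\<^sup>2 / 2 * (dt * lam)" by (simp add: algebra_simps)
  moreover have "dt * ((r k - V0 k)\<^sup>2 / 2) * (d * M) = d * M * dt * ((r k - V0 k)\<^sup>2 / 2)" by simp
  ultimately show ?thesis using 1 2 unfolding id by linarith
qed

text \<open>Summed over the cells, the terms with \<open>(r k)\<^sup>2 / 2 * D k\<close> cancel
  between \<open>pointwise_split\<close> and \<open>cross_term\<close>. The error terms that still
  contain \<open>A k\<close> are absorbed by the dissipation of \<open>energy_bound\<close>.\<close>

lemma relative_entropy_step:
  "(\<Sum>k\<in>S. (r k + w k - V1 k)\<^sup>2 / 2) \<le> (1 + d * M * dt) * (\<Sum>k\<in>S. (r k - V0 k)\<^sup>2 / 2)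
     + dt * n * (step_const d M ub C1 * (\<delta> + \<eta> + lam + lam ^ 3 / h + sqrt h))"
proof -
  have cc: "0 < cc" unfolding dissipation_const_def using C1 dpos by simp
  have KE: "0 \<le> KE" unfolding energy_const_def using dpos by (auto intro!: add_nonneg_nonneg mult_nonneg_nonneg)
  have KA: "0 \<le> KA" unfolding consistency_const_def using dpos ub M by (auto intro!: add_nonneg_nonneg mult_nonneg_nonneg)
  let ?R = "\<Sum>k\<in>S. (r k - V0 k)\<^sup>2 / 2" and ?T = "(ub + M) * \<delta> + (ub + M) * \<eta> + (M + 1)\<^sup>2 / 2 * lam"
  have "(\<Sum>k\<in>S. (r k + w k - V1 k)\<^sup>2 / 2) - ?R = (\<Sum>k\<in>S. (r k + w k - V1 k)\<^sup>2 / 2 - (r k - V0 k)\<^sup>2 / 2)"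
    by (simp add: sum_subtractf)
  also have "\<dots> \<le> (\<Sum>k\<in>S. ((r k + w k)\<^sup>2 - (r k)\<^sup>2) / 2 - V1 k * w k
       + dt * ((r k)\<^sup>2 / 2 * D k) - dt * ((V0 k)\<^sup>2 * D k) / 2 + d * M * dt * ((r k - V0 k)\<^sup>2 / 2) + dt * ?T)"
    by (intro sum_mono pointwise_split)
  also have "\<dots> = (\<Sum>k\<in>S. ((r k + w k)\<^sup>2 - (r k)\<^sup>2) / 2) - (\<Sum>k\<in>S. V1 k * w k)
       + dt * (\<Sum>k\<in>S. (r k)\<^sup>2 / 2 * D k) - dt * (\<Sum>k\<in>S. (V0 k)\<^sup>2 * D k) / 2 + d * M * dt * ?R + dt * n * ?T"
    unfolding sum_subtractf sum.distrib
    by (simp only: sum_distrib_left[symmetric] sum_divide_distrib[symmetric] sum_constant of_nat_id mult.assoc mult.left_commute[of n])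
  also have "\<dots> \<le> lam * (\<Sum>k\<in>S. KE * lam * (A k)\<^sup>2 - C1 / d ^ 3 * A k ^ 3) + lam * (\<Sum>k\<in>S. KA * h * A k)
     + dt * n * (d * ub\<^sup>2 / 2 * \<eta> + 2 * d * F * (M + 1) * lam)
     + dt * (n * d * (2 * (M + 1) ^ 3 * h + M\<^sup>2 * \<eta>)) / 2 + d * M * dt * ?R + dt * n * ?T"
  proof -
    have "- (dt * (\<Sum>k\<in>S. (V0 k)\<^sup>2 * D k)) \<le> dt * (n * d * (2 * (M + 1) ^ 3 * h + M\<^sup>2 * \<eta>))"
      unfolding mult_minus_right[symmetric] using cubic_flux_sum dt by (intro mult_left_mono) auto
    with cross_term energy_bound[folded energy_const_def] show ?thesis by simp
  qed
  also have "lam * (\<Sum>k\<in>S. KE * lam * (A k)\<^sup>2 - C1 / d ^ 3 * A k ^ 3) + lam * (\<Sum>k\<in>S. KA * h * A k)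
     = lam * (\<Sum>k\<in>S. KE * lam * (A k)\<^sup>2 - C1 / d ^ 3 * A k ^ 3 + KA * h * A k)"
    by (simp add: sum.distrib distrib_left)
  also have "\<dots> \<le> lam * (\<Sum>k\<in>S. (KE * lam) ^ 3 / cc\<^sup>2 + KA * h * sqrt (KA * h / cc))"
  proof (intro mult_left_mono sum_mono)
    fix k
    have "KE * lam * (A k)\<^sup>2 \<le> cc * A k ^ 3 + (KE * lam) ^ 3 / cc\<^sup>2"
      using KE lam cc A_nonneg by (intro absorb_square) auto
    moreover have "KA * h * A k \<le> cc * A k ^ 3 + KA * h * sqrt (KA * h / cc)"
      using KA h cc A_nonneg by (intro absorb_linear) auto
    moreover have "C1 / d ^ 3 * A k ^ 3 = cc * A k ^ 3 + cc * A k ^ 3" by (simp add: dissipation_const_def)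
    ultimately show "KE * lam * (A k)\<^sup>2 - C1 / d ^ 3 * A k ^ 3 + KA * h * A k
      \<le> (KE * lam) ^ 3 / cc\<^sup>2 + KA * h * sqrt (KA * h / cc)" by linarith
  qed (use lam in auto)
  \<comment> \<open>Since \<open>dt = lam * h\<close>, the product \<open>lam * lam ^ 3\<close>
    becomes \<open>dt * (lam ^ 3 / h)\<close>, the term that asks for an exponent above 4/3.\<close>
  also have "\<dots> = dt * n * (KE ^ 3 / cc\<^sup>2 * (lam ^ 3 / h) + KA * sqrt (KA / cc) * sqrt h)"
  proof -
    have "sqrt (KA * h / cc) = sqrt (KA / cc) * sqrt h" by (simp add: real_sqrt_mult[symmetric])
    moreover have "h * (lam ^ 3 / h) = lam ^ 3" using h by simp
    ultimately show ?thesis using h unfolding dt_eq by (simp add: power_mult_distrib distrib_left mult_ac)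
  qed
  finally have 1: "(\<Sum>k\<in>S. (r k + w k - V1 k)\<^sup>2 / 2) \<le> (1 + d * M * dt) * ?R + dt * n *
     ((KE ^ 3 / cc\<^sup>2 * (lam ^ 3 / h) + KA * sqrt (KA / cc) * sqrt h)
      + (d * ub\<^sup>2 / 2 * \<eta> + 2 * d * F * (M + 1) * lam) + (d * (2 * (M + 1) ^ 3 * h + M\<^sup>2 * \<eta>)) / 2 + ?T)"
    by (simp add: algebra_simps add_divide_distrib)
  \<comment> \<open>The consistency error of order \<open>h\<close> is merged with the weaker
    \<open>sqrt h\<close> left by \<open>absorb_linear\<close>.\<close>
  have hs: "h \<le> sqrt h"
    using h by (metis le_add_same_cancel1 mult_left_le less_imp_le power2_eq_square real_le_rsqrt)
  let ?a = "ub + M" and ?b = "d * ub\<^sup>2 / 2 + ub + M + d * M\<^sup>2 / 2" and ?c = "2 * d * F * (M + 1) + (M + 1)\<^sup>2 / 2"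
    and ?e = "KE ^ 3 / cc\<^sup>2" and ?g = "KA * sqrt (KA / cc) + d * (M + 1) ^ 3"
  have sc: "step_const d M ub C1 = ?a + ?b + ?c + ?e + ?g" by (simp add: step_const_def)
  have nn: "0 \<le> ?a" "0 \<le> ?b" "0 \<le> ?c" "0 \<le> ?e" "0 \<le> ?g"
    using ub M dpos F_nonneg KE KA cc by (auto intro!: add_nonneg_nonneg mult_nonneg_nonneg divide_nonneg_nonneg)
  have "d * (M + 1) ^ 3 * h \<le> d * (M + 1) ^ 3 * sqrt h" using hs dpos M by (intro mult_left_mono) auto
  then have "(KE ^ 3 / cc\<^sup>2 * (lam ^ 3 / h) + KA * sqrt (KA / cc) * sqrt h)
      + (d * ub\<^sup>2 / 2 * \<eta> + 2 * d * F * (M + 1) * lam) + (d * (2 * (M + 1) ^ 3 * h + M\<^sup>2 * \<eta>)) / 2 + ?T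
     \<le> ?a * \<delta> + ?b * \<eta> + ?c * lam + ?e * (lam ^ 3 / h) + ?g * sqrt h"
    by (simp add: algebra_simps add_divide_distrib)
  also have "\<dots> \<le> step_const d M ub C1 * \<delta> + step_const d M ub C1 * \<eta> + step_const d M ub C1 * lam
       + step_const d M ub C1 * (lam ^ 3 / h) + step_const d M ub C1 * sqrt h"
  proof -
    have "?a \<le> step_const d M ub C1" "?b \<le> step_const d M ub C1" "?c \<le> step_const d M ub C1"
      "?e \<le> step_const d M ub C1" "?g \<le> step_const d M ub C1" unfolding sc using nn by linarith+
    then show ?thesis using \<delta> \<eta> lam h by (intro add_mono mult_right_mono) auto
  qed
  also have "\<dots> = step_const d M ub C1 * (\<delta> + \<eta> + lam + lam ^ 3 / h + sqrt h)"
    by (simp add: distrib_left)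
  finally have "dt * n * ((KE ^ 3 / cc\<^sup>2 * (lam ^ 3 / h) + KA * sqrt (KA / cc) * sqrt h)
      + (d * ub\<^sup>2 / 2 * \<eta> + 2 * d * F * (M + 1) * lam) + (d * (2 * (M + 1) ^ 3 * h + M\<^sup>2 * \<eta>)) / 2 + ?T)
     \<le> dt * n * (step_const d M ub C1 * (\<delta> + \<eta> + lam + lam ^ 3 / h + sqrt h))"
    using dt by (intro mult_left_mono) auto
  with 1 show ?thesis by linarith
qed

end

lemma discrete_gronwall:
  fixes R :: "nat \<Rightarrow> real"
  assumes step: "\<And>m. m < N \<Longrightarrow> R (Suc m) \<le> (1 + a * dt) * R m + dt * b"
    and "0 \<le> a" "0 \<le> dt" "0 \<le> b" "0 \<le> R 0" "m \<le> N"
  shows "R m \<le> exp (a * (real m * dt)) * (R 0 + real m * dt * b)"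
  using assms(6)
proof (induction m)
  case 0 then show ?case using assms by simp
next
  case (Suc m)
  let ?E = "exp (a * (real m * dt))"
  have "R (Suc m) \<le> (1 + a * dt) * R m + dt * b" using Suc.prems by (intro step) auto
  also have "\<dots> \<le> exp (a * dt) * (?E * (R 0 + real m * dt * b)) + exp (a * dt) * ?E * (dt * b)"
  proof (intro add_mono)
    have "(1 + a * dt) * R m \<le> (1 + a * dt) * (?E * (R 0 + real m * dt * b))"
      using Suc assms by (intro mult_left_mono) auto
    also have "\<dots> \<le> exp (a * dt) * (?E * (R 0 + real m * dt * b))"
      using assms by (intro mult_right_mono exp_ge_add_one_self) auto
    finally show "(1 + a * dt) * R m \<le> \<dots>" .
    have "1 \<le> exp (a * dt + a * (real m * dt))" using assms by auto
    then have "1 * (dt * b) \<le> exp (a * dt) * ?E * (dt * b)"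
      unfolding exp_add using assms by (intro mult_right_mono) auto
    then show "dt * b \<le> exp (a * dt) * ?E * (dt * b)" by simp
  qed
  also have "\<dots> = exp (a * (real (Suc m) * dt)) * (R 0 + real (Suc m) * dt * b)"
    by (simp add: exp_add[symmetric] algebra_simps)
  finally show ?case .
qed

section \<open>Lattices and fundamental domains\<close>

text \<open>Every point of \<open>A\<close> is carried into \<open>B\<close> by exactly one lattice
  vector, so a sum over \<open>\<Lambda>\<close> of indicators can be inserted; sum and integral are
  exchanged and each summand is translated. Values in \<open>ennreal\<close> make the exchange
  unconditional, and a general \<open>\<Lambda>\<close> serves space as well as space-time.\<close>

lemma nn_integral_fundamental_domain:
  fixes A B \<Lambda> :: "'a::euclidean_space set" and g :: "'a \<Rightarrow> ennreal"
  assumes [measurable]: "A \<in> sets borel" "B \<in> sets borel" "g \<in> borel_measurable borel"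
    and "countable \<Lambda>"
    and per: "\<And>x \<nu>. \<nu> \<in> \<Lambda> \<Longrightarrow> g (x + \<nu>) = g x"
    and AB: "\<And>x. x \<in> A \<Longrightarrow> \<exists>!\<nu>. \<nu> \<in> \<Lambda> \<and> x + \<nu> \<in> B"
    and BA: "\<And>y. y \<in> B \<Longrightarrow> \<exists>!\<nu>. \<nu> \<in> \<Lambda> \<and> y - \<nu> \<in> A"
  shows "(\<integral>\<^sup>+x\<in>A. g x \<partial>lborel) = (\<integral>\<^sup>+x\<in>B. g x \<partial>lborel)"
proof -
  have one: "(\<integral>\<^sup>+\<nu>. c * of_bool (P \<nu>) \<partial>count_space \<Lambda>) = c"
    if ex1: "\<exists>!\<nu>. \<nu> \<in> \<Lambda> \<and> P \<nu>" for P and c :: ennreal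
  proof -
    from ex1 obtain \<nu> where \<nu>: "\<nu> \<in> \<Lambda>" "P \<nu>" and u: "\<And>\<mu>. \<mu> \<in> \<Lambda> \<Longrightarrow> P \<mu> \<Longrightarrow> \<mu> = \<nu>" by blast
    have "(\<integral>\<^sup>+\<mu>. c * of_bool (P \<mu>) \<partial>count_space \<Lambda>) = (\<integral>\<^sup>+\<mu>. c * indicator {\<nu>} \<mu> \<partial>count_space \<Lambda>)"
    proof (rule nn_integral_cong)
      fix \<mu> assume "\<mu> \<in> space (count_space \<Lambda>)"
      then have "P \<mu> \<longleftrightarrow> \<mu> = \<nu>" using \<nu> u[of \<mu>] by auto
      then show "c * of_bool (P \<mu>) = c * indicator {\<nu>} \<mu>" by (simp add: indicator_def)
    qed
    also have "\<dots> = c" using \<nu>(1) by (subst nn_integral_cmult_indicator) auto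
    finally show ?thesis .
  qed
  have "(\<integral>\<^sup>+x\<in>A. g x \<partial>lborel) = (\<integral>\<^sup>+x. (\<integral>\<^sup>+\<nu>. g x * indicator A x * of_bool (x + \<nu> \<in> B) \<partial>count_space \<Lambda>) \<partial>lborel)"
  proof (rule nn_integral_cong)
    fix x show "g x * indicator A x = (\<integral>\<^sup>+\<nu>. g x * indicator A x * of_bool (x + \<nu> \<in> B) \<partial>count_space \<Lambda>)"
    proof (cases "x \<in> A")
      case True then show ?thesis using one[OF AB[OF True]] by simp
    qed simp
  qed
  also have "\<dots> = (\<integral>\<^sup>+x. (\<integral>\<^sup>+\<nu>. g x * indicator A x * indicator B (x + \<nu>) \<partial>count_space \<Lambda>) \<partial>lborel)"
    by (simp add: indicator_def[of B])
  also have "\<dots> = (\<integral>\<^sup>+\<nu>. (\<integral>\<^sup>+x. g x * indicator A x * indicator B (x + \<nu>) \<partial>lborel) \<partial>count_space \<Lambda>)"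
    by (rule nn_integral_count_space_nn_integral[OF assms(4)]) measurable
  also have "\<dots> = (\<integral>\<^sup>+\<nu>. (\<integral>\<^sup>+y. g y * indicator B y * indicator A (y - \<nu>) \<partial>lborel) \<partial>count_space \<Lambda>)"
  proof (rule nn_integral_cong)
    fix \<nu> assume "\<nu> \<in> space (count_space \<Lambda>)"
    then have \<nu>: "\<nu> \<in> \<Lambda>" by simp
    have "(\<integral>\<^sup>+y. g y * indicator B y * indicator A (y - \<nu>) \<partial>lborel)
        = (\<integral>\<^sup>+y. g y * indicator B y * indicator A (y - \<nu>) \<partial>distr lborel borel ((+) \<nu>))"
      by (simp add: lborel_distr_plus)
    also have "\<dots> = (\<integral>\<^sup>+x. g (\<nu> + x) * indicator B (\<nu> + x) * indicator A (\<nu> + x - \<nu>) \<partial>lborel)"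
      by (rule nn_integral_distr) measurable
    also have "\<dots> = (\<integral>\<^sup>+x. g x * indicator A x * indicator B (x + \<nu>) \<partial>lborel)"
      using per[OF \<nu>] by (simp add: add.commute mult_ac)
    finally show "(\<integral>\<^sup>+x. g x * indicator A x * indicator B (x + \<nu>) \<partial>lborel)
        = (\<integral>\<^sup>+y. g y * indicator B y * indicator A (y - \<nu>) \<partial>lborel)" by (rule sym)
  qed
  also have "\<dots> = (\<integral>\<^sup>+y. (\<integral>\<^sup>+\<nu>. g y * indicator B y * indicator A (y - \<nu>) \<partial>count_space \<Lambda>) \<partial>lborel)"
    by (rule nn_integral_count_space_nn_integral[OF assms(4), symmetric]) measurable
  also have "\<dots> = (\<integral>\<^sup>+y. (\<integral>\<^sup>+\<nu>. g y * indicator B y * of_bool (y - \<nu> \<in> A) \<partial>count_space \<Lambda>) \<partial>lborel)"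
    by (simp add: indicator_def[of A])
  also have "\<dots> = (\<integral>\<^sup>+y\<in>B. g y \<partial>lborel)"
  proof (rule nn_integral_cong)
    fix y show "(\<integral>\<^sup>+\<nu>. g y * indicator B y * of_bool (y - \<nu> \<in> A) \<partial>count_space \<Lambda>) = g y * indicator B y"
    proof (cases "y \<in> B")
      case True then show ?thesis using one[OF BA[OF True]] by simp
    qed simp
  qed
  finally show ?thesis .
qed

section \<open>The lattice of periods and translation invariance of integrals\<close>

definition lattice :: "real ^ 'd \<Rightarrow> (real ^ 'd) set" where
  "lattice l = range (\<lambda>z :: int ^ 'd. \<chi> i. of_int (z $ i) * l $ i)"

lemma countable_lattice: "countable (lattice l)"
  unfolding lattice_def by (rule countable_image) simp

lemma uminus_in_lattice: assumes "\<nu> \<in> lattice l" shows "- \<nu> \<in> lattice l"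
proof -
  obtain z where "\<nu> = (\<chi> i. of_int (z $ i) * l $ i)" using assms unfolding lattice_def by auto
  then have "- \<nu> = (\<chi> i. of_int ((- z) $ i) * l $ i)" by (simp add: vec_eq_iff)
  then show ?thesis unfolding lattice_def by (rule range_eqI)
qed

lemma periodic_int:
  assumes "periodic l r" shows "r (x + axis i (of_int z * l $ i)) = r x"
proof -
  have pos: "r (x + axis i (of_nat m * l $ i)) = r x" for m x
  proof (induction m)
    case 0 then show ?case by (simp add: axis_eq_0_iff[THEN iffD2] zero_vec_def[symmetric])
  next
    case (Suc m)
    have "x + axis i (of_nat (Suc m) * l $ i) = (x + axis i (of_nat m * l $ i)) + axis i (l $ i)"
      by (simp add: vec_eq_iff axis_def algebra_simps)
    then show ?case using Suc assms by (metis periodic_def)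
  qed
  show ?thesis
  proof (cases z rule: int_cases2)
    case (nonneg m) then show ?thesis using pos by simp
  next
    case (nonpos m)
    have e: "(x + axis i (of_int z * l $ i)) + axis i (of_nat m * l $ i) = x"
      using nonpos by (simp add: vec_eq_iff axis_def)
    show ?thesis using pos[of "x + axis i (of_int z * l $ i)" m] unfolding e ..
  qed
qed

lemma periodic_lattice:
  fixes l :: "real ^ 'd"
  assumes "periodic l r" "\<nu> \<in> lattice l" shows "r (x + \<nu>) = r x"
proof -
  obtain z where z: "\<nu> = (\<chi> i. of_int (z $ i) * l $ i)" using assms(2) unfolding lattice_def by auto
  have "r (x + (\<Sum>i\<in>I. axis i (of_int (z $ i) * l $ i))) = r x" if "finite I" for I :: "'d set"
    using that
  proof (induction I)
    case (insert i I)
    then show ?case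
      using periodic_int[OF assms(1), of "x + (\<Sum>i\<in>I. axis i (of_int (z $ i) * l $ i))" i "z $ i"]
      by (simp add: add_ac)
  qed simp
  moreover have "(\<Sum>i\<in>UNIV. axis i (of_int (z $ i) * l $ i)) = \<nu>"
    unfolding z by (simp add: vec_eq_iff axis_def)
  ultimately show ?thesis by (metis finite)
qed

definition halfopen_box :: "real ^ 'd \<Rightarrow> real ^ 'd \<Rightarrow> (real ^ 'd) set" where
  "halfopen_box p l = {x. \<forall>i. p $ i \<le> x $ i \<and> x $ i < p $ i + l $ i}"

lemma torus_eq: "torus l = halfopen_box 0 l" by (simp add: torus_def halfopen_box_def)

lemma halfopen_box_measurable [measurable]: "halfopen_box p l \<in> sets borel"
proof -
  have "halfopen_box p l = (\<Inter>i. {x. p $ i \<le> x $ i} \<inter> {x. x $ i < p $ i + l $ i})"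
    by (auto simp: halfopen_box_def)
  also have "\<dots> \<in> sets borel"
    by (intro sets.finite_INT sets.Int) (auto intro!: borel_closed closed_Collect_le borel_open open_Collect_less continuous_intros)
  finally show ?thesis .
qed

lemma torus_measurable [measurable]: "torus l \<in> sets borel"
  by (simp add: torus_eq halfopen_box_measurable)

lemma lattice_unique:
  assumes l: "\<And>i. 0 < l $ i"
  shows "\<exists>!\<nu>. \<nu> \<in> lattice l \<and> x + \<nu> \<in> halfopen_box p l"
proof (intro ex_ex1I conjI)
  let ?z = "\<chi> i. - \<lfloor>(x $ i - p $ i) / l $ i\<rfloor>"
  have "x + (\<chi> i. of_int (?z $ i) * l $ i) \<in> halfopen_box p l"
    unfolding halfopen_box_def
  proof (intro CollectI allI conjI)
    fix i
    show "p $ i \<le> (x + (\<chi> i. of_int (?z $ i) * l $ i)) $ i"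
      using floor_divide_lower[OF l[of i], of "x $ i - p $ i"] by simp
    show "(x + (\<chi> i. of_int (?z $ i) * l $ i)) $ i < p $ i + l $ i"
      using floor_divide_upper[OF l[of i], of "x $ i - p $ i"] by (simp add: algebra_simps)
  qed
  then show "\<exists>\<nu>. \<nu> \<in> lattice l \<and> x + \<nu> \<in> halfopen_box p l" unfolding lattice_def by blast
next
  fix \<nu> \<mu> assume a: "\<nu> \<in> lattice l \<and> x + \<nu> \<in> halfopen_box p l" "\<mu> \<in> lattice l \<and> x + \<mu> \<in> halfopen_box p l"
  then obtain z w where zw: "\<nu> = (\<chi> i. of_int (z $ i) * l $ i)" "\<mu> = (\<chi> i. of_int (w $ i) * l $ i)"
    unfolding lattice_def by auto
  have "z $ i = w $ i" for i
  proof -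
    have b: "p $ i \<le> x $ i + of_int (z $ i) * l $ i" "x $ i + of_int (z $ i) * l $ i < p $ i + l $ i"
      "p $ i \<le> x $ i + of_int (w $ i) * l $ i" "x $ i + of_int (w $ i) * l $ i < p $ i + l $ i"
      using a unfolding zw halfopen_box_def by auto
    have "(of_int (z $ i) - of_int (w $ i)) * l $ i < 1 * l $ i"
      "(of_int (w $ i) - of_int (z $ i)) * l $ i < 1 * l $ i" using b by (simp_all add: algebra_simps)
    then have "of_int (z $ i) - of_int (w $ i) < (1::real)" "of_int (w $ i) - of_int (z $ i) < (1::real)"
      unfolding mult_less_cancel_right_pos[OF l[of i]] by auto
    then show ?thesis by linarith
  qed
  then show "\<nu> = \<mu>" unfolding zw by simp
qed

lemma lattice_unique_minus:
  assumes l: "\<And>i. 0 < l $ i"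
  shows "\<exists>!\<nu>. \<nu> \<in> lattice l \<and> x - \<nu> \<in> halfopen_box p l"
proof -
  obtain \<nu> where \<nu>: "\<nu> \<in> lattice l" "x + \<nu> \<in> halfopen_box p l"
    and u: "\<And>\<mu>. \<mu> \<in> lattice l \<Longrightarrow> x + \<mu> \<in> halfopen_box p l \<Longrightarrow> \<mu> = \<nu>"
    using lattice_unique[OF l, of x p] by blast
  show ?thesis
  proof (rule ex1I[of _ "- \<nu>"])
    show "- \<nu> \<in> lattice l \<and> x - - \<nu> \<in> halfopen_box p l" using \<nu> uminus_in_lattice by auto
    show "\<mu> = - \<nu>" if "\<mu> \<in> lattice l \<and> x - \<mu> \<in> halfopen_box p l" for \<mu>
      using that u[of "- \<mu>"] uminus_in_lattice[of \<mu> l] by auto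
  qed
qed

lemma nn_integral_halfopen_box_periodic:
  fixes g :: "real ^ 'd \<Rightarrow> ennreal"
  assumes l: "\<And>i. 0 < l $ i" and g: "g \<in> borel_measurable borel"
    and per: "\<And>x \<nu>. \<nu> \<in> lattice l \<Longrightarrow> g (x + \<nu>) = g x"
  shows "(\<integral>\<^sup>+x\<in>halfopen_box p l. g x \<partial>lborel) = (\<integral>\<^sup>+x\<in>torus l. g x \<partial>lborel)"
  unfolding torus_eq
  by (rule nn_integral_fundamental_domain[OF _ _ g countable_lattice per
        lattice_unique[OF l] lattice_unique_minus[OF l]]) auto

text \<open>The translated strip lies over the box with corner \<open>snd v\<close>, another
  fundamental domain. Time is not periodic, so the group is
  \<open>{0} \<times> lattice l\<close>.\<close>

lemma nn_integral_strip_shift: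
  fixes g :: "real \<times> (real ^ 'd) \<Rightarrow> ennreal"
  assumes l: "\<And>i. 0 < l $ i" and [measurable]: "g \<in> borel_measurable borel"
    and per: "\<And>t x \<nu>. \<nu> \<in> lattice l \<Longrightarrow> g (t, x + \<nu>) = g (t, x)"
  shows "(\<integral>\<^sup>+z\<in>UNIV \<times> torus l. g (z + v) \<partial>lborel) = (\<integral>\<^sup>+z\<in>UNIV \<times> torus l. g z \<partial>lborel)"
proof -
  have meas [measurable]: "UNIV \<times> halfopen_box p l \<in> sets (borel :: (real \<times> (real ^ 'd)) measure)" for p l
    unfolding borel_prod[symmetric] by (intro pair_measureI) auto
  have "(\<integral>\<^sup>+z\<in>UNIV \<times> torus l. g (z + v) \<partial>lborel) = (\<integral>\<^sup>+z. g (v + z) * indicator (UNIV \<times> halfopen_box (snd v) l) (v + z) \<partial>lborel)"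
  proof (rule nn_integral_cong)
    fix z
    have "z \<in> UNIV \<times> torus l \<longleftrightarrow> v + z \<in> UNIV \<times> halfopen_box (snd v) l"
      by (cases z, cases v) (simp add: torus_eq halfopen_box_def)
    then show "g (z + v) * indicator (UNIV \<times> torus l) z = g (v + z) * indicator (UNIV \<times> halfopen_box (snd v) l) (v + z)"
      by (simp add: indicator_def add.commute)
  qed
  also have "\<dots> = (\<integral>\<^sup>+z\<in>UNIV \<times> halfopen_box (snd v) l. g z \<partial>distr lborel borel ((+) v))"
    by (subst nn_integral_distr) auto
  also have "\<dots> = (\<integral>\<^sup>+z\<in>UNIV \<times> halfopen_box (snd v) l. g z \<partial>lborel)" by (simp add: lborel_distr_plus)
  also have "\<dots> = (\<integral>\<^sup>+z\<in>UNIV \<times> torus l. g z \<partial>lborel)"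
    unfolding torus_eq
  proof (rule nn_integral_fundamental_domain[where \<Lambda> = "{0} \<times> lattice l"])
    show "countable ({0} \<times> lattice l)" by (intro countable_SIGMA countable_lattice) auto
    show "g (x + \<nu>) = g x" if "\<nu> \<in> {0} \<times> lattice l" for x \<nu>
      using per[of "snd \<nu>" "fst x" "snd x"] that by (cases x) auto
    have *: "(\<exists>!\<nu>::real \<times> (real ^ 'd). \<nu> \<in> {0} \<times> lattice l \<and> P (snd \<nu>)) = (\<exists>!\<nu>. \<nu> \<in> lattice l \<and> P \<nu>)" for P
      by (auto simp: Ex1_def)
    show "\<exists>!\<nu>. \<nu> \<in> {0} \<times> lattice l \<and> x + \<nu> \<in> UNIV \<times> halfopen_box 0 l" for x :: "real \<times> (real ^ 'd)"
      using lattice_unique[OF l, of "snd x" 0] by (cases x) (auto simp: Ex1_def)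
    show "\<exists>!\<nu>. \<nu> \<in> {0} \<times> lattice l \<and> x - \<nu> \<in> UNIV \<times> halfopen_box (snd v) l" for x :: "real \<times> (real ^ 'd)"
      using lattice_unique_minus[OF l, of "snd x" "snd v"] by (cases x) (auto simp: Ex1_def)
  qed auto
  finally show ?thesis .
qed

lemma integral_strip_shift:
  fixes g :: "real \<times> (real ^ 'd) \<Rightarrow> real"
  assumes l: "\<And>i. 0 < l $ i" and g: "g \<in> borel_measurable borel"
    and per: "\<And>t x \<nu>. \<nu> \<in> lattice l \<Longrightarrow> g (t, x + \<nu>) = g (t, x)"
    and int: "set_integrable lborel (UNIV \<times> torus l) g"
  shows "set_integrable lborel (UNIV \<times> torus l) (\<lambda>z. g (z + v))"
    and "(LINT z:UNIV \<times> torus l|lborel. g (z + v)) = (LINT z:UNIV \<times> torus l|lborel. g z)"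
proof -
  let ?S = "UNIV \<times> torus l"
  have S [measurable]: "?S \<in> sets (borel :: (real \<times> (real ^ 'd)) measure)"
    unfolding borel_prod[symmetric] by (intro pair_measureI) auto
  have gm [measurable]: "g \<in> borel_measurable borel" by (rule g)
  have ind: "ennreal (indicator ?S z *\<^sub>R y) = ennreal y * indicator ?S z" for z y
    by (auto simp: indicator_def)
  have ind': "ennreal (- (indicator ?S z *\<^sub>R y)) = ennreal (- y) * indicator ?S z" for z y
    by (auto simp: indicator_def)
  have indn: "ennreal (norm (indicator ?S z *\<^sub>R y)) = ennreal \<bar>y\<bar> * indicator ?S z" for z y
    by (auto simp: indicator_def)
  \<comment> \<open>With \<open>\<phi>\<close> the absolute value, the identity and the negation,
    this gives integrability and both parts of the signed integral.\<close>
  have e: "(\<integral>\<^sup>+z\<in>?S. ennreal (\<phi> (g (z + v))) \<partial>lborel) = (\<integral>\<^sup>+z\<in>?S. ennreal (\<phi> (g z)) \<partial>lborel)"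
    if "\<phi> \<in> borel_measurable borel" for \<phi> :: "real \<Rightarrow> real"
    using that by (intro nn_integral_strip_shift l) (auto simp: per)
  show *: "set_integrable lborel ?S (\<lambda>z. g (z + v))"
    using int e[of abs] unfolding set_integrable_def integrable_iff_bounded indn by simp
  show "(LINT z:?S|lborel. g (z + v)) = (LINT z:?S|lborel. g z)"
    unfolding set_lebesgue_integral_def
    using * int e[of "\<lambda>x. x"] e[of "\<lambda>x. - x"]
    by (simp add: real_lebesgue_integral_def set_integrable_def ind ind' del: real_scaleR_def)
qed

section \<open>Traces on faces and the GRP flux\<close>

lemma cell_of_eq_iff: assumes "0 < h" shows "cell_of p0 h x = k \<longleftrightarrow> x \<in> cell p0 h k"
proof -
  have "\<lfloor>(x $ i - p0 $ i) / h\<rfloor> = k $ i \<longleftrightarrow>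
      p0 $ i + h * of_int (k $ i) \<le> x $ i \<and> x $ i < p0 $ i + h * (of_int (k $ i) + 1)" for i
    using assms by (simp add: floor_eq_iff field_simps)
  then show ?thesis by (simp add: cell_of_def cell_def vec_eq_iff)
qed

lemma cell_measurable [measurable]: "cell p0 h k \<in> sets borel"
proof -
  have "cell p0 h k = halfopen_box (\<chi> i. p0 $ i + h * of_int (k $ i)) (\<chi> i. h)"
    by (auto simp: cell_def halfopen_box_def algebra_simps)
  then show ?thesis by simp
qed

lemma center_in_cell: "0 < h \<Longrightarrow> center p0 h k \<in> cell p0 h k"
  by (auto simp: center_def cell_def)

lemma emeasure_cell: assumes "0 < h" shows "emeasure lborel (cell p0 h (k :: int ^ 'd)) = ennreal (h ^ CARD('d))"
proof -
  let ?a = "\<chi> i. p0 $ i + h * of_int (k $ i)" and ?b = "\<chi> i. p0 $ i + h * (of_int (k $ i) + 1)"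
  have ab: "?a \<bullet> b \<le> ?b \<bullet> b" if "b \<in> Basis" for b
    using that assms by (auto simp: Basis_vec_def inner_axis)
  have prod: "prod ((\<bullet>) (?b - ?a)) Basis = h ^ CARD('d)"
  proof -
    have "(?b - ?a) \<bullet> b = h" if "b \<in> Basis" for b
      using that by (auto simp: Basis_vec_def inner_axis algebra_simps)
    then have "prod ((\<bullet>) (?b - ?a)) Basis = (\<Prod>b\<in>(Basis :: (real ^ 'd) set). h)" by (intro prod.cong) auto
    then show ?thesis by simp
  qed
  have "box ?a ?b \<subseteq> cell p0 h k" "cell p0 h k \<subseteq> cbox ?a ?b"
    by (auto simp: cell_def mem_box_cart) (meson less_imp_le)+
  then have "emeasure lborel (box ?a ?b) \<le> emeasure lborel (cell p0 h k)"
    "emeasure lborel (cell p0 h k) \<le> emeasure lborel (cbox ?a ?b)" by (intro emeasure_mono; simp)+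
  then show ?thesis
    using emeasure_lborel_box[OF ab] emeasure_lborel_cbox[OF ab] unfolding prod by auto
qed

lemma axis_int_nth: "axis i (c::int) $ j = (if j = i then c else 0)" by (auto simp: axis_def)

lemma axis_real_nth: "axis i (c::real) $ j = (if j = i then c else 0)" by (auto simp: axis_def)

lemma center_add_axis: "center p0 h (k + axis i 1) = center p0 h k + h *\<^sub>R axis i 1"
  by (auto simp: center_def vec_eq_iff axis_int_nth axis_real_nth algebra_simps)

lemma Lim_at_right_eq:
  fixes f :: "real \<Rightarrow> real"
  assumes "0 < e" "\<And>\<delta>. 0 < \<delta> \<Longrightarrow> \<delta> < e \<Longrightarrow> f \<delta> = g \<delta>" "(g \<longlongrightarrow> L) (at_right 0)"
  shows "Lim (at_right 0) f = L"
proof (rule tendsto_Lim)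
  have "\<forall>\<^sub>F \<delta> in at_right 0. g \<delta> = f \<delta>"
    using assms by (intro eventually_at_rightI[of 0 e]) auto
  then show "(f \<longlongrightarrow> L) (at_right 0)" using assms(3) by (rule Lim_transform_eventually[rotated])
qed simp

lemma face_plus_in_cell:
  assumes "0 < \<delta>" "\<delta> < h"
  shows "face_center p0 h k i + \<delta> *\<^sub>R axis i 1 \<in> cell p0 h (k + axis i 1)"
  using assms by (auto simp: cell_def face_center_def center_def axis_int_nth axis_real_nth algebra_simps)

lemma face_minus_in_cell:
  assumes "0 < \<delta>" "\<delta> < h"
  shows "face_center p0 h k i - \<delta> *\<^sub>R axis i 1 \<in> cell p0 h k"
  using assms by (auto simp: cell_def face_center_def center_def axis_int_nth axis_real_nth algebra_simps)

text \<open>The limit only sees the cell beyond the face, whose centre is half a cell away.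
  \<open>g = 0\<close> covers \<open>Qh\<close> functions and the discrete divergence,
  \<open>g = grad_h\<close> the reconstruction.\<close>

lemma trace_plus_cellwise:
  assumes "0 < h" "\<And>x. x \<in> cell p0 h (k + axis i 1) \<Longrightarrow> v x = c + (x - center p0 h (k + axis i 1)) \<bullet> g"
  shows "trace_plus p0 h v k i = c - h / 2 * g $ i"
  unfolding trace_plus_def
proof (rule Lim_at_right_eq)
  show "v (face_center p0 h k i + \<delta> *\<^sub>R axis i 1) = c + (\<delta> - h / 2) * g $ i" if "0 < \<delta>" "\<delta> < h" for \<delta>
  proof -
    have "face_center p0 h k i + \<delta> *\<^sub>R axis i 1 - center p0 h (k + axis i 1) = (\<delta> - h / 2) *\<^sub>R axis i 1"
      unfolding face_center_def center_add_axis by (simp add: vec_eq_iff field_simps)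
    then show ?thesis
      using assms(2)[OF face_plus_in_cell[OF that, of p0 k i]] by (simp add: inner_axis' )
  qed
  show "((\<lambda>\<delta>. c + (\<delta> - h / 2) * g $ i) \<longlongrightarrow> c - h / 2 * g $ i) (at_right 0)"
    by (auto intro!: tendsto_eq_intros)
qed (use assms in auto)

lemma trace_minus_cellwise:
  assumes "0 < h" "\<And>x. x \<in> cell p0 h k \<Longrightarrow> v x = c + (x - center p0 h k) \<bullet> g"
  shows "trace_minus p0 h v k i = c + h / 2 * g $ i"
  unfolding trace_minus_def
proof (rule Lim_at_right_eq)
  show "v (face_center p0 h k i - \<delta> *\<^sub>R axis i 1) = c + (h / 2 - \<delta>) * g $ i" if "0 < \<delta>" "\<delta> < h" for \<delta>
  proof -
    have "face_center p0 h k i - \<delta> *\<^sub>R axis i 1 - center p0 h k = (h / 2 - \<delta>) *\<^sub>R axis i 1"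
      unfolding face_center_def by (simp add: vec_eq_iff field_simps)
    then show ?thesis
      using assms(2)[OF face_minus_in_cell[OF that, of p0 k i]] by (simp add: inner_axis')
  qed
  show "((\<lambda>\<delta>. c + (h / 2 - \<delta>) * g $ i) \<longlongrightarrow> c + h / 2 * g $ i) (at_right 0)"
    by (auto intro!: tendsto_eq_intros)
qed (use assms in auto)

lemma Qh_const: "r \<in> Qh l p0 h \<Longrightarrow> x \<in> cell p0 h k \<Longrightarrow> r x = r (center p0 h k)"
  by (auto simp: Qh_def)

lemma jump_Qh:
  assumes "0 < h" "r \<in> Qh l p0 h"
  shows "jump p0 h r k i = r (center p0 h (k + axis i 1)) - r (center p0 h k)"
  unfolding jump_def
  using trace_plus_cellwise[OF assms(1), of p0 k i r "r (center p0 h (k + axis i 1))" 0]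
    trace_minus_cellwise[OF assms(1), of p0 k r "r (center p0 h k)" 0 i] Qh_const[OF assms(2)]
  by simp

lemma recon_cell:
  assumes "0 < h" "x \<in> cell p0 h k"
  shows "recon p0 h r x = r (center p0 h k) + (x - center p0 h k) \<bullet> grad_h p0 h r k"
  using assms cell_of_eq_iff[of h p0 x k] by (simp add: recon_def Let_def)

lemma div_h_cell:
  assumes "0 < h" "x \<in> cell p0 h k" shows "div_h p0 h r x = (\<Sum>j\<in>UNIV. grad_h p0 h r k $ j)"
  using assms cell_of_eq_iff[of h p0 x k] by (simp add: div_h_def)

lemma trace_minus_div:
  fixes p0 :: "real ^ 'd"
  assumes "0 < h" shows "trace_minus p0 h (div_h p0 h r) k i = (\<Sum>j\<in>UNIV. grad_h p0 h r k $ j)"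
proof -
  have "trace_minus p0 h (div_h p0 h r) k i = (\<Sum>j\<in>UNIV. grad_h p0 h r k $ j) + h / 2 * (0 :: real ^ 'd) $ i"
    by (rule trace_minus_cellwise) (use assms in \<open>simp_all add: div_h_cell\<close>)
  then show ?thesis by simp
qed

lemma trace_plus_div:
  fixes p0 :: "real ^ 'd"
  assumes "0 < h" shows "trace_plus p0 h (div_h p0 h r) k i = (\<Sum>j\<in>UNIV. grad_h p0 h r (k + axis i 1) $ j)"
proof -
  have "trace_plus p0 h (div_h p0 h r) k i = (\<Sum>j\<in>UNIV. grad_h p0 h r (k + axis i 1) $ j) - h / 2 * (0 :: real ^ 'd) $ i"
    by (rule trace_plus_cellwise) (use assms in \<open>simp_all add: div_h_cell\<close>)
  then show ?thesis by simp
qed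

text \<open>The limited slope lies between 0 and each neighbouring difference quotient. Over half a
  cell the reconstruction thus moves from the cell value at most to the mean across the face, which
  is what \<open>riemann_value_bounds\<close> asks for.\<close>

lemma minmod_between:
  "0 \<le> s2 \<Longrightarrow> 0 \<le> minmod s1 s2 \<and> minmod s1 s2 \<le> s2" "s2 \<le> 0 \<Longrightarrow> s2 \<le> minmod s1 s2 \<and> minmod s1 s2 \<le> 0"
  "0 \<le> s1 \<Longrightarrow> 0 \<le> minmod s1 s2 \<and> minmod s1 s2 \<le> s1" "s1 \<le> 0 \<Longrightarrow> s1 \<le> minmod s1 s2 \<and> minmod s1 s2 \<le> 0"
  by (auto simp: minmod_def)

text \<open>Of the two slopes compared by minmod, the one at the upper face is kept, so that the
  divergence on a cell is controlled by the jumps at its upper faces alone.\<close>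

lemma abs_grad_h_le:
  assumes "0 < h" shows "\<bar>grad_h p0 h r k $ j\<bar> \<le> \<bar>jump p0 h r k j\<bar> / h"
  using minmod_between(1,2)[of "jump p0 h r k j / h" "jump p0 h r (k - axis j 1) j / h"] assms
  by (auto simp: grad_h_def abs_le_iff abs_if field_simps)

text \<open>Brings the scheme's flux into the form of \<open>face_flux_bounds\<close>, with the
  factor \<open>E = dt / h * (A k + A (k + axis i 1))\<close> for the time correction.\<close>

lemma flux_GRP_New_bounds:
  fixes r :: "real ^ 'd \<Rightarrow> real"
  assumes h: "0 < h" and r: "r \<in> Qh l p0 h" and ub: "\<And>x. \<bar>r x\<bar> \<le> ub" and dt: "0 < dt"
    and C1: "0 < C1" "C1 \<le> 1 / 24"
  defines "a \<equiv> \<lambda>k. r (center p0 h k)"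
  defines "A \<equiv> \<lambda>k. \<Sum>j\<in>UNIV. \<bar>a (k + axis j 1) - a k\<bar>"
  defines "f \<equiv> flux_GRP_New p0 h dt C1 r"
  shows "f k i * (a (k + axis i 1) - a k) \<le> (a (k + axis i 1) ^ 3 - a k ^ 3) / 6
        - C1 * \<bar>a (k + axis i 1) - a k\<bar> ^ 3 + ub\<^sup>2 * (dt / h * (A k + A (k + axis i 1))) * \<bar>a (k + axis i 1) - a k\<bar>"
    and "\<bar>f k i - (a k)\<^sup>2 / 2\<bar> \<le> 2 * ub * \<bar>a (k + axis i 1) - a k\<bar> + ub\<^sup>2 * (dt / h * (A k + A (k + axis i 1)))"
proof -
  let ?v = "recon p0 h r" and ?k' = "k + axis i 1"
  let ?vm = "trace_minus p0 h ?v k i" and ?vp = "trace_plus p0 h ?v k i"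
  let ?Dm = "trace_minus p0 h (div_h p0 h r) k i" and ?Dp = "trace_plus p0 h (div_h p0 h r) k i"
  have J: "jump p0 h r k j = a (k + axis j 1) - a k" for k j unfolding a_def by (rule jump_Qh[OF h r])
  have vm: "?vm = a k + h / 2 * grad_h p0 h r k $ i"
    unfolding a_def by (rule trace_minus_cellwise[OF h recon_cell[OF h]])
  have vp: "?vp = a ?k' - h / 2 * grad_h p0 h r ?k' $ i"
    unfolding a_def by (rule trace_plus_cellwise[OF h recon_cell[OF h]])
  have gm: "grad_h p0 h r k $ i = minmod (jump p0 h r (k - axis i 1) i / h) ((a ?k' - a k) / h)"
    by (simp add: grad_h_def J[symmetric])
  have gp: "grad_h p0 h r ?k' $ i = minmod ((a ?k' - a k) / h) (jump p0 h r ?k' i / h)"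
    by (simp add: grad_h_def J[symmetric])
  have posJ: "a k \<le> ?vm \<and> ?vm \<le> (a k + a ?k') / 2 \<and> (a k + a ?k') / 2 \<le> ?vp \<and> ?vp \<le> a ?k'" if "a k \<le> a ?k'"
    using that h minmod_between(1)[of "(a ?k' - a k) / h" "jump p0 h r (k - axis i 1) i / h"]
      minmod_between(3)[of "(a ?k' - a k) / h" "jump p0 h r ?k' i / h"]
    unfolding vm vp gm gp by (simp add: field_simps)
  have negJ: "a ?k' \<le> ?vp \<and> ?vp \<le> (a k + a ?k') / 2 \<and> (a k + a ?k') / 2 \<le> ?vm \<and> ?vm \<le> a k" if "a ?k' \<le> a k"
  proof -
    have "(a ?k' - a k) / h \<le> 0" using that h by (simp add: divide_nonpos_pos)
    then show ?thesis
      using that h minmod_between(2)[of "(a ?k' - a k) / h" "jump p0 h r (k - axis i 1) i / h"]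
        minmod_between(4)[of "(a ?k' - a k) / h" "jump p0 h r ?k' i / h"]
      unfolding vm vp gm gp by (simp add: field_simps mult_le_0_iff)
  qed
  define w where "w = (if ?vp - ?vm < 0 \<and> (?vp + ?vm) / 2 > 0 \<or> 0 < ?vm \<and> ?vm \<le> ?vp then ?vm
           else if ?vp - ?vm < 0 \<and> (?vp + ?vm) / 2 \<le> 0 \<or> ?vm \<le> ?vp \<and> ?vp < 0 then ?vp else 0)"
  \<comment> \<open>The divergence is taken from the side that supplies \<open>w\<close>; in Case 4
    the value \<open>w = 0\<close> makes the product vanish for either choice.\<close>
  define D where "D = (if ?vp - ?vm < 0 \<and> (?vp + ?vm) / 2 > 0 \<or> 0 < ?vm \<and> ?vm \<le> ?vp then ?Dm else ?Dp)"
  have f: "f k i = w\<^sup>2 / 2 * (1 - dt * D) + (if a ?k' - a k \<ge> 0 then 0 else (1 / 24 + C1) * (a ?k' - a k)\<^sup>2)"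
    unfolding f_def flux_GRP_New_def flux_GRP_def Let_def w_def D_def J avg_def jump_def[of p0 h ?v] by auto
  note wb = riemann_value_bounds[OF posJ negJ, folded w_def]
  have div: "\<bar>\<Sum>j\<in>UNIV. grad_h p0 h r k $ j\<bar> \<le> A k / h" for k
  proof -
    have "\<bar>\<Sum>j\<in>UNIV. grad_h p0 h r k $ j\<bar> \<le> (\<Sum>j\<in>UNIV. \<bar>jump p0 h r k j\<bar> / h)"
      by (intro order_trans[OF sum_abs] sum_mono abs_grad_h_le[OF h])
    then show ?thesis unfolding A_def J by (simp add: sum_divide_distrib)
  qed
  have A0: "0 \<le> A k" for k unfolding A_def by (intro sum_nonneg) auto
  \<comment> \<open>The side supplying \<open>D\<close> depends on the case, so the bounds of both
    cells are added.\<close>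
  have "\<bar>D\<bar> \<le> A k / h + A ?k' / h"
    using div[of k] div[of ?k'] A0[of k] A0[of ?k'] h unfolding D_def trace_minus_div[OF h] trace_plus_div[OF h]
    by (auto simp: divide_nonneg_pos intro: add_increasing add_increasing2)
  then have "\<bar>dt * D\<bar> \<le> dt * (A k / h + A ?k' / h)" using dt by (simp add: abs_mult)
  then have D: "\<bar>dt * D\<bar> \<le> dt / h * (A k + A ?k')" by (simp add: add_divide_distrib distrib_left)
  have ubs: "\<bar>a k\<bar> \<le> ub" "\<bar>a ?k'\<bar> \<le> ub" unfolding a_def by (rule ub)+
  show "f k i * (a ?k' - a k) \<le> (a ?k' ^ 3 - a k ^ 3) / 6
        - C1 * \<bar>a ?k' - a k\<bar> ^ 3 + ub\<^sup>2 * (dt / h * (A k + A ?k')) * \<bar>a ?k' - a k\<bar>"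
    unfolding f by (rule face_flux_bounds(1)[OF wb C1 ubs D])
  show "\<bar>f k i - (a k)\<^sup>2 / 2\<bar> \<le> 2 * ub * \<bar>a ?k' - a k\<bar> + ub\<^sup>2 * (dt / h * (A k + A ?k'))"
    unfolding f by (rule face_flux_bounds(2)[OF wb C1 ubs D])
qed

section \<open>The periodic mesh of the torus\<close>

definition next_cell :: "real ^ 'd \<Rightarrow> real \<Rightarrow> 'd \<Rightarrow> int ^ 'd \<Rightarrow> int ^ 'd" where
  "next_cell l h i k = (\<chi> j. if j = i then (if h * of_int (k $ i + 1) < l $ i then k $ i + 1 else 0) else k $ j)"

lemma mesh_cells_eq:
  assumes "0 < h" "\<And>i. l $ i = real (M i) * h"
  shows "mesh_cells l h = {k. \<forall>i. 0 \<le> k $ i \<and> k $ i < int (M i)}"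
proof -
  have "h * of_int z < real (M i) * h \<longleftrightarrow> z < int (M i)" for z i
    using assms(1) of_int_less_iff[where 'a=real, of z "int (M i)"] by (simp add: mult.commute)
  then show ?thesis by (simp add: mesh_cells_def assms(2))
qed

lemma finite_vec_box:
  fixes M :: "'d::finite \<Rightarrow> nat"
  shows "finite {k :: int ^ 'd. \<forall>i. 0 \<le> k $ i \<and> k $ i < int (M i)}"
proof -
  have "finite (\<Pi>\<^sub>E i\<in>UNIV. {0..<int (M i)})" by (intro finite_PiE) auto
  then have "finite (vec_lambda ` (\<Pi>\<^sub>E i\<in>UNIV. {0..<int (M i)}))" by (rule finite_imageI)
  moreover have "{k :: int ^ 'd. \<forall>i. 0 \<le> k $ i \<and> k $ i < int (M i)} \<subseteq> vec_lambda ` (\<Pi>\<^sub>E i\<in>UNIV. {0..<int (M i)})"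
  proof
    fix k :: "int ^ 'd" assume "k \<in> {k. \<forall>i. 0 \<le> k $ i \<and> k $ i < int (M i)}"
    then show "k \<in> vec_lambda ` (\<Pi>\<^sub>E i\<in>UNIV. {0..<int (M i)})"
      by (intro image_eqI[of _ _ "\<lambda>i. k $ i"]) auto
  qed
  ultimately show ?thesis by (rule finite_subset[rotated])
qed

locale mesh =
  fixes l p0 :: "real ^ 'd" and h :: real and M :: "'d \<Rightarrow> nat"
  assumes l: "\<And>i. 0 < l $ i" and h: "0 < h" and lM: "\<And>i. l $ i = real (M i) * h"
begin

abbreviation "S \<equiv> mesh_cells l h"

lemma M_pos: "0 < M i"
  using l[of i] lM[of i] by (cases "M i") auto

lemma S_eq: "S = {k. \<forall>i. 0 \<le> k $ i \<and> k $ i < int (M i)}"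
  by (rule mesh_cells_eq[OF h lM])

lemma finite_S: "finite S"
  unfolding S_eq by (rule finite_vec_box)

lemma next_cell_eq:
  "next_cell l h i k = (\<chi> j. if j = i then (if k $ i + 1 < int (M i) then k $ i + 1 else 0) else k $ j)"
proof -
  have "h * of_int (k $ i + 1) < real (M i) * h \<longleftrightarrow> of_int (k $ i + 1) < (of_int (int (M i)) :: real)"
    using h by (simp add: mult.commute[of h])
  also have "\<dots> \<longleftrightarrow> k $ i + 1 < int (M i)" by (rule of_int_less_iff)
  finally show ?thesis unfolding next_cell_def lM by (simp cong: if_cong)
qed

lemma next_cell_in: "k \<in> S \<Longrightarrow> next_cell l h i k \<in> S"
  using M_pos by (auto simp: S_eq next_cell_eq)

lemma next_cell_inj: "inj_on (next_cell l h i) S"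
proof (rule inj_onI)
  fix k k' assume k: "k \<in> S" "k' \<in> S" and e: "next_cell l h i k = next_cell l h i k'"
  have *: "(if k $ i + 1 < int (M i) then k $ i + 1 else 0) = (if k' $ i + 1 < int (M i) then k' $ i + 1 else 0)"
    using arg_cong[OF e, of "\<lambda>v. v $ i"] by (simp add: next_cell_eq)
  have b: "0 \<le> k $ i" "k $ i < int (M i)" "0 \<le> k' $ i" "k' $ i < int (M i)" using k by (auto simp: S_eq)
  have "k $ i = k' $ i" using * b by (auto split: if_splits)
  moreover have "k $ j = k' $ j" if "j \<noteq> i" for j
    using arg_cong[OF e, of "\<lambda>v. v $ j"] that by (simp add: next_cell_eq)
  ultimately show "k = k'" unfolding vec_eq_iff by metis
qed

sublocale periodic_grid S "next_cell l h"
proof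
  show "bij_betw (next_cell l h i) S S" for i
    using endo_inj_surj[OF finite_S _ next_cell_inj] next_cell_in next_cell_inj
    unfolding bij_betw_def by blast
qed (rule finite_S)

text \<open>Beyond the last cell the index wraps to 0, a translation by one period. The free offset
  \<open>v\<close> shows that the same lattice vector serves the neighbours of that cell, which
  enter the divergence on its side of the face.\<close>

lemma center_next_cell:
  assumes "k \<in> S"
  shows "\<exists>\<nu>\<in>lattice l. \<forall>v. center p0 h (k + axis i 1 + v) = center p0 h (next_cell l h i k + v) + \<nu>"
proof -
  define z :: "int ^ 'd" where "z = (if k $ i + 1 < int (M i) then 0 else axis i 1)"
  have ki: "k $ i < int (M i)" using assms by (auto simp: S_eq)
  have "center p0 h (k + axis i 1 + v) = center p0 h (next_cell l h i k + v) + (\<chi> j. of_int (z $ j) * l $ j)" for v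
  proof (cases "k $ i + 1 < int (M i)")
    case True
    then show ?thesis by (auto simp: z_def vec_eq_iff center_def next_cell_eq axis_int_nth)
  next
    case False
    then have "k $ i + 1 = int (M i)" using ki by simp
    then have "(of_int (k $ i) :: real) + 1 = real (M i)" by (metis of_int_1 of_int_add of_int_of_nat_eq)
    then have "h * of_int (k $ i) + h = l $ i" unfolding lM[of i] by (metis distrib_left mult.commute mult.right_neutral)
    then show ?thesis using False
      by (auto simp: z_def vec_eq_iff center_def next_cell_eq axis_int_nth distrib_left)
  qed
  then show ?thesis unfolding lattice_def by blast
qed

lemma periodic_next_cell:
  assumes "k \<in> S" "periodic l r"
  shows "r (center p0 h (k + axis i 1 + v)) = r (center p0 h (next_cell l h i k + v))"
  using center_next_cell[OF assms(1), of i] periodic_lattice[OF assms(2)] by auto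

lemma periodic_next_cell0:
  assumes "k \<in> S" "periodic l r"
  shows "r (center p0 h (k + axis i 1)) = r (center p0 h (next_cell l h i k))"
  using periodic_next_cell[OF assms, of i 0] by simp

text \<open>The mesh is based at an arbitrary \<open>p0\<close>, so its cells tile a box with that
  corner; for periodic integrands this box can be exchanged for \<open>torus l\<close>.\<close>

lemma box_eq_cells: "halfopen_box p0 l = (\<Union>k\<in>S. cell p0 h k)"
proof (intro set_eqI iffI)
  fix x assume x: "x \<in> halfopen_box p0 l"
  let ?k = "cell_of p0 h x"
  have xk: "x \<in> cell p0 h ?k" using cell_of_eq_iff[OF h, of p0 x ?k] by simp
  have "0 \<le> ?k $ i \<and> ?k $ i < int (M i)" for i
  proof
    have b: "p0 $ i \<le> x $ i" "x $ i < p0 $ i + real (M i) * h" using x unfolding halfopen_box_def lM by auto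
    show "0 \<le> ?k $ i" using b h by (simp add: cell_of_def)
    have "(x $ i - p0 $ i) / h < real (M i)" using b h by (simp add: field_simps)
    then show "?k $ i < int (M i)" by (simp add: cell_of_def floor_less_iff)
  qed
  then show "x \<in> (\<Union>k\<in>S. cell p0 h k)" using xk unfolding S_eq by blast
next
  fix x assume "x \<in> (\<Union>k\<in>S. cell p0 h k)"
  then obtain k where k: "k \<in> S" "x \<in> cell p0 h k" by auto
  have "p0 $ i \<le> x $ i \<and> x $ i < p0 $ i + real (M i) * h" for i
  proof -
    have b: "0 \<le> k $ i" "k $ i + 1 \<le> int (M i)" using k(1) by (auto simp: S_eq dest: zless_imp_add1_zle)
    have "0 \<le> h * of_int (k $ i)" using b h by simp
    moreover have "h * (of_int (k $ i) + 1) \<le> h * real (M i)"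
    proof (intro mult_left_mono)
      have "of_int (k $ i + 1) \<le> (of_int (int (M i)) :: real)" using b(2) by (simp only: of_int_le_iff)
      then show "of_int (k $ i) + 1 \<le> real (M i)" by simp
    qed (use h in auto)
    moreover have "p0 $ i + h * of_int (k $ i) \<le> x $ i" "x $ i < p0 $ i + h * (of_int (k $ i) + 1)"
      using k(2) unfolding cell_def by auto
    ultimately show ?thesis by (simp add: mult.commute)
  qed
  then show "x \<in> halfopen_box p0 l" unfolding halfopen_box_def lM by auto
qed

lemma disjoint_cells: "disjoint_family_on (cell p0 h) K"
  by (auto simp: disjoint_family_on_def cell_of_eq_iff[OF h, symmetric])

lemma nn_integral_torus_cells:
  fixes g :: "real ^ 'd \<Rightarrow> ennreal"
  assumes g: "g \<in> borel_measurable borel" and per: "\<And>x \<nu>. \<nu> \<in> lattice l \<Longrightarrow> g (x + \<nu>) = g x"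
  shows "(\<integral>\<^sup>+x\<in>torus l. g x \<partial>lborel) = (\<Sum>k\<in>S. \<integral>\<^sup>+x\<in>cell p0 h k. g x \<partial>lborel)"
proof -
  have [measurable]: "g \<in> borel_measurable borel" by (rule g)
  have "(\<integral>\<^sup>+x\<in>torus l. g x \<partial>lborel) = (\<integral>\<^sup>+x\<in>(\<Union>k\<in>S. cell p0 h k). g x \<partial>lborel)"
    unfolding box_eq_cells[symmetric] by (rule nn_integral_halfopen_box_periodic[OF l g per, symmetric])
  also have "\<dots> = (\<integral>\<^sup>+x. (\<Sum>k\<in>S. g x * indicator (cell p0 h k) x) \<partial>lborel)"
    by (simp add: indicator_UN_disjoint[OF finite_S disjoint_cells] sum_distrib_left)
  also have "\<dots> = (\<Sum>k\<in>S. \<integral>\<^sup>+x\<in>cell p0 h k. g x \<partial>lborel)"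
    by (rule nn_integral_sum) measurable
  finally show ?thesis .
qed

lemma Qh_borel: assumes "r \<in> Qh l p0 h" shows "r \<in> borel_measurable borel"
proof -
  have e: "{x. r x \<in> B} = (\<Union>k\<in>{k. r (center p0 h k) \<in> B}. cell p0 h k)" for B
  proof (intro set_eqI iffI)
    fix x assume "x \<in> {x. r x \<in> B}"
    then have x: "r x \<in> B" by simp
    have xk: "x \<in> cell p0 h (cell_of p0 h x)" using cell_of_eq_iff[OF h, of p0 x] by blast
    show "x \<in> (\<Union>k\<in>{k. r (center p0 h k) \<in> B}. cell p0 h k)"
      using x Qh_const[OF assms xk] xk by auto
  qed (use Qh_const[OF assms] in auto)
  have "{x \<in> space borel. r x \<in> B} \<in> sets borel" for B
    unfolding space_borel by (simp add: e del: UN_simps)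
  then show ?thesis by (intro measurableI) (auto simp: vimage_def)
qed

lemma Qh_comp2: "r \<in> Qh l p0 h \<Longrightarrow> s \<in> Qh l p0 h \<Longrightarrow> (\<lambda>x. F (r x) (s x)) \<in> Qh l p0 h"
  by (auto simp: Qh_def periodic_def)

lemma nn_integral_Qh:
  assumes "r \<in> Qh l p0 h"
  shows "(\<integral>\<^sup>+x\<in>torus l. ennreal (r x) \<partial>lborel) = (\<Sum>k\<in>S. ennreal (r (center p0 h k)) * ennreal (h ^ CARD('d)))"
proof -
  have [measurable]: "r \<in> borel_measurable borel" by (rule Qh_borel[OF assms])
  have "periodic l r" using assms by (simp add: Qh_def)
  then have "(\<integral>\<^sup>+x\<in>torus l. ennreal (r x) \<partial>lborel) = (\<Sum>k\<in>S. \<integral>\<^sup>+x\<in>cell p0 h k. ennreal (r x) \<partial>lborel)"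
    by (intro nn_integral_torus_cells) (simp_all add: periodic_lattice)
  also have "\<dots> = (\<Sum>k\<in>S. \<integral>\<^sup>+x. ennreal (r (center p0 h k)) * indicator (cell p0 h k) x \<partial>lborel)"
    using Qh_const[OF assms] by (intro sum.cong nn_integral_cong) (auto simp: indicator_def)
  also have "\<dots> = (\<Sum>k\<in>S. ennreal (r (center p0 h k)) * ennreal (h ^ CARD('d)))"
    by (intro sum.cong refl) (simp add: nn_integral_cmult_indicator emeasure_cell[OF h])
  finally show ?thesis .
qed

text \<open>The \<open>max\<close> is the truncation of negative reals by \<open>ennreal\<close>.
  Applied to \<open>r\<close> and to its negative, the formula gives the signed integral.\<close>

lemma nn_integral_Qh_real:
  assumes "r \<in> Qh l p0 h"
  shows "(\<integral>\<^sup>+x\<in>torus l. ennreal (r x) \<partial>lborel) = ennreal (h ^ CARD('d) * (\<Sum>k\<in>S. max 0 (r (center p0 h k))))"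
proof -
  have "ennreal (r (center p0 h k)) * ennreal (h ^ CARD('d)) = ennreal (h ^ CARD('d) * max 0 (r (center p0 h k)))" for k
  proof (cases "0 \<le> r (center p0 h k)")
    case True
    then show ?thesis using h by (simp add: ennreal_mult'[symmetric] mult.commute)
  next
    case False
    then show ?thesis by (simp add: ennreal_neg)
  qed
  then show ?thesis
    unfolding nn_integral_Qh[OF assms] sum_distrib_left using h by (simp add: sum_ennreal)
qed

lemma integral_Qh:
  assumes r: "r \<in> Qh l p0 h"
  shows "set_integrable lborel (torus l) r"
    and "(LINT x:torus l|lborel. r x) = h ^ CARD('d) * (\<Sum>k\<in>S. r (center p0 h k))"
proof -
  have [measurable]: "r \<in> borel_measurable borel" by (rule Qh_borel[OF r])
  have neg: "(\<lambda>x. - r x) \<in> Qh l p0 h" and ab: "(\<lambda>x. \<bar>r x\<bar>) \<in> Qh l p0 h"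
    using Qh_comp2[OF r r, of "\<lambda>a b. - a"] Qh_comp2[OF r r, of "\<lambda>a b. \<bar>a\<bar>"] by auto
  have ind: "ennreal (indicator (torus l) z *\<^sub>R y) = ennreal y * indicator (torus l) z" for z y
    by (auto simp: indicator_def)
  have ind': "ennreal (- (indicator (torus l) z *\<^sub>R y)) = ennreal (- y) * indicator (torus l) z" for z y
    by (auto simp: indicator_def)
  have indn: "ennreal (norm (indicator (torus l) z *\<^sub>R y)) = ennreal \<bar>y\<bar> * indicator (torus l) z" for z y
    by (auto simp: indicator_def)
  show int: "set_integrable lborel (torus l) r"
    unfolding set_integrable_def integrable_iff_bounded indn nn_integral_Qh_real[OF ab] by simp
  have "(LINT x:torus l|lborel. r x) = h ^ CARD('d) * (\<Sum>k\<in>S. max 0 (r (center p0 h k)))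
     - h ^ CARD('d) * (\<Sum>k\<in>S. max 0 (- r (center p0 h k)))"
    using int unfolding set_lebesgue_integral_def set_integrable_def
    by (subst real_lebesgue_integral_def)
      (simp_all add: ind ind' nn_integral_Qh_real[OF r] nn_integral_Qh_real[OF neg] sum_nonneg h less_imp_le del: real_scaleR_def)
  also have "\<dots> = h ^ CARD('d) * (\<Sum>k\<in>S. r (center p0 h k))"
    unfolding right_diff_distrib[symmetric] sum_subtractf[symmetric]
    by (intro arg_cong2[where f="(*)"] sum.cong) auto
  finally show "(LINT x:torus l|lborel. r x) = h ^ CARD('d) * (\<Sum>k\<in>S. r (center p0 h k))" .
qed

lemma integral_Qh_lebesgue:
  assumes r: "r \<in> Qh l p0 h"
  shows "(LINT x:torus l|lebesgue. r x) = h ^ CARD('d) * (\<Sum>k\<in>S. r (center p0 h k))"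
proof -
  have [measurable]: "r \<in> borel_measurable borel" by (rule Qh_borel[OF r])
  have "(\<lambda>x. indicator (torus l) x *\<^sub>R r x) \<in> borel_measurable lborel" by measurable
  then show ?thesis
    using integral_Qh(2)[OF r] unfolding set_lebesgue_integral_def by (simp add: integral_completion)
qed

lemma card_S: "h ^ CARD('d) * real (card S) = (\<Prod>i\<in>UNIV. l $ i)"
proof -
  have "card S = (\<Prod>i\<in>UNIV. M i)"
  proof -
    have "bij_betw (\<lambda>f. (\<chi> i. f i)) (\<Pi>\<^sub>E i\<in>UNIV. {0..<int (M i)}) S"
      unfolding S_eq
      by (rule bij_betw_byWitness[where f'="\<lambda>k i. k $ i"]) (auto simp: PiE_def Pi_def extensional_def)
    then have "card S = card (\<Pi>\<^sub>E i\<in>(UNIV::'d set). {0..<int (M i)})" by (simp add: bij_betw_same_card)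
    then show ?thesis by (simp add: card_PiE)
  qed
  then show ?thesis by (simp add: lM prod.distrib mult.commute)
qed

end

section \<open>The relative entropy of the scheme\<close>

text \<open>Differentiability enters only through the uniform Taylor bounds, with the time increments one-sided.\<close>

definition approx_solution :: "real \<Rightarrow> real ^ 'd \<Rightarrow> real \<Rightarrow> real \<Rightarrow> (real \<times> (real ^ 'd) \<Rightarrow> real) \<Rightarrow> bool" where
  "approx_solution T l M \<delta> V \<longleftrightarrow> (\<forall>t\<in>{0..T}. periodic l (\<lambda>x. V (t, x))) \<and>
     (\<exists>Vt X. (\<forall>t\<in>{0..T}. \<forall>x. \<bar>V (t, x)\<bar> \<le> M \<and> \<bar>Vt (t, x)\<bar> \<le> M \<and> (\<forall>i. \<bar>X i (t, x)\<bar> \<le> M) \<and>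
         \<bar>Vt (t, x) + V (t, x) * (\<Sum>i\<in>UNIV. X i (t, x))\<bar> \<le> \<delta>) \<and>
       (\<forall>\<eta>>0. \<exists>\<rho>>0. \<forall>s t x. 0 < s \<and> s < \<rho> \<and> t \<in> {0..T} \<longrightarrow>
         (t + s \<le> T \<longrightarrow> \<bar>V (t + s, x) - V (t, x) - s * Vt (t, x)\<bar> \<le> \<eta> * s) \<and>
         (\<forall>i. \<bar>V (t, x + s *\<^sub>R axis i 1) - V (t, x) - s * X i (t, x)\<bar> \<le> \<eta> * s)))"

context mesh begin

lemma center_cell_of_shift:
  "center p0 h (cell_of p0 h (x + axis i (l $ i))) = center p0 h (cell_of p0 h x) + axis i (l $ i)"
proof -
  have "(x $ i + l $ i - p0 $ i) / h = (x $ i - p0 $ i) / h + of_int (int (M i))"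
    using h by (simp add: lM field_simps)
  then have "\<lfloor>(x $ i + l $ i - p0 $ i) / h\<rfloor> = \<lfloor>(x $ i - p0 $ i) / h\<rfloor> + int (M i)"
    by (simp only: floor_add_int[symmetric])
  then show ?thesis
    by (auto simp: vec_eq_iff center_def cell_of_def axis_real_nth lM algebra_simps)
qed

lemma center_cell_of_cell: "x \<in> cell p0 h k \<Longrightarrow> center p0 h (cell_of p0 h x) = center p0 h k"
  using cell_of_eq_iff[OF h] by metis

text \<open>Sampling at cell centres turns the comparison function into a discrete test
  function.\<close>

lemma sample_Qh:
  assumes "periodic l v" shows "(\<lambda>x. v (center p0 h (cell_of p0 h x))) \<in> Qh l p0 h"
  using assms
  by (auto simp: Qh_def periodic_def center_cell_of_shift center_cell_of_cell
      center_cell_of_cell[OF center_in_cell[OF h]])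

text \<open>The volume integral carries \<open>h ^ CARD('d)\<close> and the face integral one power
  less, which leaves the ratio \<open>dt / h\<close>. Each face is attached to the cell below it,
  and periodicity replaces its upper cell by \<open>next_cell\<close>.\<close>

lemma scheme_summed:
  fixes u :: "real \<times> (real ^ 'd) \<Rightarrow> real"
  assumes sol: "stabilized_GRP_solution T l C1 p0 h N u0 u" and m: "m < N" and "0 < T"
    and \<phi>: "\<phi> \<in> Qh l p0 h"
  defines "dt \<equiv> T / real N"
  shows "(\<Sum>k\<in>S. \<phi> (center p0 h k) * (u (real (Suc m) * dt, center p0 h k) - u (real m * dt, center p0 h k)))
     = dt / h * (\<Sum>k\<in>S. \<Sum>i\<in>UNIV. flux_GRP_New p0 h dt C1 (\<lambda>x. u (real m * dt, x)) k i *
         (\<phi> (center p0 h (next_cell l h i k)) - \<phi> (center p0 h k)))"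
proof -
  let ?t = "real m * dt" and ?f = "\<lambda>k i. flux_GRP_New p0 h dt C1 (\<lambda>x. u (real m * dt, x)) k i"
  have N: "0 < N" using m by simp
  have dt: "0 < dt" unfolding dt_def using N \<open>0 < T\<close> by simp
  have NdT: "real N * dt = T" unfolding dt_def using N by simp
  have "?t \<le> real N * dt" "real (Suc m) * dt \<le> real N * dt" using m dt by (intro mult_right_mono; simp)+
  then have tin: "?t \<in> {0..T}" "real (Suc m) * dt \<in> {0..T}" using dt unfolding NdT by auto
  have t1: "real (Suc m) * dt = ?t + dt" by (simp add: algebra_simps)
  have Q: "(\<lambda>x. u (?t, x)) \<in> Qh l p0 h" "(\<lambda>x. u (?t + dt, x)) \<in> Qh l p0 h"
    using sol tin unfolding stabilized_GRP_solution_def Let_def t1 by auto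
  have eq: "(LINT x:torus l|lebesgue. \<phi> x * ((u (?t + dt, x) - u (?t, x)) / dt))
        = face_integral l h (\<lambda>k i. ?f k i * jump p0 h \<phi> k i)"
    using sol m \<phi> unfolding stabilized_GRP_solution_def Let_def dt_def by auto
  have per: "periodic l \<phi>" using \<phi> by (simp add: Qh_def)
  have Q2: "(\<lambda>x. \<phi> x * ((u (?t + dt, x) - u (?t, x)) / dt)) \<in> Qh l p0 h"
    using Qh_comp2[OF \<phi> Qh_comp2[OF Q(2) Q(1), of "\<lambda>a b. (a - b) / dt"], of "(*)"] by simp
  have "(LINT x:torus l|lebesgue. \<phi> x * ((u (?t + dt, x) - u (?t, x)) / dt))
      = h ^ CARD('d) * (\<Sum>k\<in>S. \<phi> (center p0 h k) * ((u (?t + dt, center p0 h k) - u (?t, center p0 h k)) / dt))"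
    by (rule integral_Qh_lebesgue[OF Q2])
  moreover have "face_integral l h (\<lambda>k i. ?f k i * jump p0 h \<phi> k i)
      = h ^ (CARD('d) - 1) * (\<Sum>k\<in>S. \<Sum>i\<in>UNIV. ?f k i * (\<phi> (center p0 h (next_cell l h i k)) - \<phi> (center p0 h k)))"
    unfolding face_integral_def sum_distrib_left
    by (subst sum.swap) (intro sum.cong refl, simp add: jump_Qh[OF h \<phi>] periodic_next_cell0[OF _ per])
  ultimately have e: "h ^ CARD('d) * (\<Sum>k\<in>S. \<phi> (center p0 h k) * ((u (?t + dt, center p0 h k) - u (?t, center p0 h k)) / dt))
     = h ^ (CARD('d) - 1) * (\<Sum>k\<in>S. \<Sum>i\<in>UNIV. ?f k i * (\<phi> (center p0 h (next_cell l h i k)) - \<phi> (center p0 h k)))"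
    using eq by simp
  have "h ^ CARD('d) = h ^ (CARD('d) - 1) * h"
    by (metis Suc_pred' mult.commute power_Suc zero_less_card_finite)
  with e have e1: "h * (\<Sum>k\<in>S. \<phi> (center p0 h k) * ((u (?t + dt, center p0 h k) - u (?t, center p0 h k)) / dt))
     = (\<Sum>k\<in>S. \<Sum>i\<in>UNIV. ?f k i * (\<phi> (center p0 h (next_cell l h i k)) - \<phi> (center p0 h k)))"
    using h by simp
  have e2: "(\<Sum>k\<in>S. \<phi> (center p0 h k) * ((u (?t + dt, center p0 h k) - u (?t, center p0 h k)) / dt))
      = (\<Sum>k\<in>S. \<phi> (center p0 h k) * (u (?t + dt, center p0 h k) - u (?t, center p0 h k))) / dt"
    by (simp add: sum_divide_distrib)
  have gen: "P = dt / h * F" if "h * (P / dt) = F" for P F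
    using that h dt by (simp add: field_simps)
  show ?thesis unfolding t1 by (rule gen) (use e1 e2 in simp)
qed

text \<open>Gronwall over the time levels up to \<open>T'\<close>. The weight
  \<open>h ^ CARD('d)\<close> turns the number of cells in the one-step estimate into the volume of
  the torus.\<close>

lemma relative_entropy_bound:
  fixes u V :: "real \<times> (real ^ 'd) \<Rightarrow> real"
  assumes sol: "stabilized_GRP_solution T l C1 p0 h N u0 u" and T: "0 < T" and N: "0 < N"
    and C1: "0 < C1" "C1 \<le> 1 / 24" and hle: "h \<le> 1"
    and ub: "\<And>t x. 0 \<le> t \<Longrightarrow> t < T \<Longrightarrow> \<bar>u (t, x)\<bar> \<le> ub"
    and T': "0 < T'" "T' < T"
    and per: "\<And>t. t \<in> {0..T'} \<Longrightarrow> periodic l (\<lambda>x. V (t, x))"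
    and bnd: "\<And>t x. t \<in> {0..T'} \<Longrightarrow> \<bar>V (t, x)\<bar> \<le> MV \<and> \<bar>Vt (t, x)\<bar> \<le> MV \<and> (\<forall>i. \<bar>X i (t, x)\<bar> \<le> MV) \<and>
         \<bar>Vt (t, x) + V (t, x) * (\<Sum>i\<in>UNIV. X i (t, x))\<bar> \<le> \<delta>"
    and \<eta>: "0 < \<eta>" "\<eta> \<le> 1"
    and mod: "\<And>s t x. 0 < s \<Longrightarrow> s < \<rho> \<Longrightarrow> t \<in> {0..T'} \<Longrightarrow>
         (t + s \<le> T' \<longrightarrow> \<bar>V (t + s, x) - V (t, x) - s * Vt (t, x)\<bar> \<le> \<eta> * s) \<and>
         (\<forall>i. \<bar>V (t, x + s *\<^sub>R axis i 1) - V (t, x) - s * X i (t, x)\<bar> \<le> \<eta> * s)"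
  defines "dt \<equiv> T / real N"
  assumes small: "dt < \<rho>" "h < \<rho>" "dt / h \<le> 1" and m: "real m * dt \<le> T'"
  defines "R \<equiv> \<lambda>m. h ^ CARD('d) * (\<Sum>k\<in>S. (u (real m * dt, center p0 h k) - V (real m * dt, center p0 h k))\<^sup>2 / 2)"
  shows "R m \<le> exp (real CARD('d) * MV * T) * (R 0 + T * ((\<Prod>i\<in>UNIV. l $ i) *
      (step_const (real CARD('d)) MV ub C1 * (\<delta> + \<eta> + dt / h + (dt / h) ^ 3 / h + sqrt h))))"
proof -
  let ?c = "center p0 h" and ?d = "real CARD('d)"
  let ?E = "step_const ?d MV ub C1 * (\<delta> + \<eta> + dt / h + (dt / h) ^ 3 / h + sqrt h)"
  have dt: "0 < dt" unfolding dt_def using N T by simp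
  have NdT: "real N * dt = T" unfolding dt_def using N by simp
  have MV: "0 \<le> MV" and \<delta>: "0 \<le> \<delta>" and ub0: "0 \<le> ub"
    using bnd[of 0 undefined] T' ub[of 0 undefined] T by force+
  have step: "R (Suc j) \<le> (1 + ?d * MV * dt) * R j + dt * ((\<Prod>i\<in>UNIV. l $ i) * ?E)" if j: "j < m" for j
  proof -
    let ?t = "real j * dt" and ?t1 = "real (Suc j) * dt"
    have "?t1 \<le> real m * dt" using j dt by (intro mult_right_mono) auto
    with m have t1: "?t1 \<le> T'" by simp
    have tt: "?t1 = ?t + dt" by (simp add: algebra_simps)
    have t: "?t \<in> {0..T'}" "?t1 \<in> {0..T'}" "?t + dt \<le> T'" using t1 tt dt by auto
    have jN: "j < N"
    proof (rule ccontr)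
      assume "\<not> j < N"
      then have "real N * dt \<le> ?t" using dt by (intro mult_right_mono) auto
      then show False using NdT t T' by auto
    qed
    define a where "a = (\<lambda>k. u (?t, ?c k))"
    define w where "w = (\<lambda>k. u (?t1, ?c k) - u (?t, ?c k))"
    define f where "f = flux_GRP_New p0 h dt C1 (\<lambda>x. u (?t, x))"
    define A where "A = (\<lambda>k. \<Sum>i\<in>UNIV. \<bar>a (next_cell l h i k) - a k\<bar>)"
    have tT: "?t \<in> {0..T}" "?t1 \<in> {0..T}" "?t < T" using t T' by auto
    have Q: "(\<lambda>x. u (?t, x)) \<in> Qh l p0 h" "(\<lambda>x. u (?t1, x)) \<in> Qh l p0 h"
      using sol tT unfolding stabilized_GRP_solution_def Let_def by auto
    have perU: "periodic l (\<lambda>x. u (?t, x))" using Q(1) by (simp add: Qh_def)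
    have Qw: "(\<lambda>x. u (?t1, x) - u (?t, x)) \<in> Qh l p0 h" using Qh_comp2[OF Q(2) Q(1), of "(-)"] .
    note scheme = scheme_summed[OF sol jN T, folded dt_def, folded f_def]
    have bndu: "\<And>x. \<bar>u (?t, x)\<bar> \<le> ub" using ub tT by auto
    note fb = flux_GRP_New_bounds[OF h Q(1) bndu dt C1, folded f_def]
    \<comment> \<open>The flux bounds refer to shifted indices, the abstract grid to wrapped ones;
      \<open>ann\<close> does the translation for second neighbours.\<close>
    have an: "u (?t, ?c (k + axis i 1)) = a (next_cell l h i k)" if "k \<in> S" for k i
      unfolding a_def using periodic_next_cell0[OF that perU] .
    have ann: "u (?t, ?c (k + axis i 1 + axis j 1)) = a (next_cell l h j (next_cell l h i k))" if "k \<in> S" for k i j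
      using periodic_next_cell[OF that perU] an[OF next_cell_in[OF that]] by simp
    let ?A = "\<lambda>k. \<Sum>i\<in>UNIV. \<bar>a (next_cell l h i k) - a k\<bar>"
    have A1: "(\<Sum>j\<in>UNIV. \<bar>u (?t, ?c (k + axis j 1)) - u (?t, ?c k)\<bar>) = A k" if "k \<in> S" for k
      unfolding A_def by (simp add: an[OF that]) (simp add: a_def)
    have A2: "(\<Sum>j\<in>UNIV. \<bar>u (?t, ?c (k + axis i 1 + axis j 1)) - u (?t, ?c (k + axis i 1))\<bar>) = A (next_cell l h i k)"
      if "k \<in> S" for k i
      unfolding A_def by (simp add: an[OF that] ann[OF that])
    interpret relative_entropy_step S "next_cell l h" a w f A "?d" "dt / h" ub C1
      "\<lambda>k. V (?t, ?c k)" "\<lambda>k. V (?t1, ?c k)" "\<lambda>k. Vt (?t, ?c k)" "\<lambda>i k. X i (?t, ?c k)" dt h MV \<delta> \<eta>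
    proof unfold_locales
      show "A \<equiv> \<lambda>k. \<Sum>i\<in>UNIV. \<bar>a (next_cell l h i k) - a k\<bar>" by (rule eq_reflection) (rule A_def)
      show "0 < dt / h" using dt h by simp
      show "\<bar>a k\<bar> \<le> ub" for k unfolding a_def by (rule bndu)
      show "(\<Sum>k\<in>S. w k * w k) = dt / h * (\<Sum>k\<in>S. \<Sum>i\<in>UNIV. f k i * (w (next_cell l h i k) - w k))"
        using scheme[OF Qw] unfolding w_def .
      show "(\<Sum>k\<in>S. a k * w k) = dt / h * (\<Sum>k\<in>S. \<Sum>i\<in>UNIV. f k i * (a (next_cell l h i k) - a k))"
        using scheme[OF Q(1)] unfolding w_def a_def .
      show "f k i * (a (next_cell l h i k) - a k) \<le> (a (next_cell l h i k) ^ 3 - a k ^ 3) / 6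
        - C1 * \<bar>a (next_cell l h i k) - a k\<bar> ^ 3
        + ub\<^sup>2 * (dt / h * (?A k + ?A (next_cell l h i k))) * \<bar>a (next_cell l h i k) - a k\<bar>" if "k \<in> S" for k i
        using fb(1)[of k i, unfolded A1[OF that] A2[OF that], unfolded an[OF that]] by (simp add: a_def A_def)
      show "\<bar>f k i - (a k)\<^sup>2 / 2\<bar>
        \<le> 2 * ub * \<bar>a (next_cell l h i k) - a k\<bar> + ub\<^sup>2 * (dt / h * (?A k + ?A (next_cell l h i k)))" if "k \<in> S" for k i
        using fb(2)[of k i, unfolded A1[OF that] A2[OF that], unfolded an[OF that]] by (simp add: a_def A_def)
      show "\<bar>V (?t1, ?c k) - V (?t, ?c k) - dt * Vt (?t, ?c k)\<bar> \<le> \<eta> * dt" for k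
        using mod[OF dt small(1) t(1)] t(3) unfolding tt by auto
      show "\<bar>V (?t, ?c (next_cell l h i k)) - V (?t, ?c k) - h * X i (?t, ?c k)\<bar> \<le> \<eta> * h" if "k \<in> S" for k i
        using mod[OF h small(2) t(1), THEN conjunct2, rule_format, of "?c k" i]
          periodic_next_cell0[OF that per[OF t(1)], of i]
        unfolding center_add_axis by simp
      show "(\<Sum>k\<in>S. V (?t1, ?c k) * w k) = dt / h * (\<Sum>k\<in>S. \<Sum>i\<in>UNIV. f k i * (V (?t1, ?c (next_cell l h i k)) - V (?t1, ?c k)))"
        using scheme[OF sample_Qh[OF per[OF t(2)]]] unfolding w_def
        by (simp add: center_cell_of_cell[OF center_in_cell[OF h]])
    qed (use bnd[OF t(1)] dt h hle MV \<delta> \<eta> ub0 C1 small in auto)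
    have eq: "a k + w k - V (?t1, ?c k) = u (?t1, ?c k) - V (?t1, ?c k)" for k unfolding a_def w_def by simp
    have hd: "0 \<le> h ^ CARD('d)" using h by simp
    have "R (Suc j) \<le> h ^ CARD('d) * ((1 + ?d * MV * dt) * (\<Sum>k\<in>S. (a k - V (?t, ?c k))\<^sup>2 / 2) + dt * real (card S) * ?E)"
      unfolding R_def using mult_left_mono[OF relative_entropy_step hd] unfolding eq .
    also have "\<dots> = (1 + ?d * MV * dt) * R j + dt * (h ^ CARD('d) * real (card S) * ?E)"
      unfolding R_def a_def by (simp add: algebra_simps)
    finally show ?thesis unfolding card_S .
  qed
  have R0: "0 \<le> R 0" unfolding R_def using h by (intro mult_nonneg_nonneg sum_nonneg) auto
  have nn: "0 \<le> (\<Prod>i\<in>UNIV. l $ i) * ?E"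
  proof (intro mult_nonneg_nonneg prod_nonneg)
    show "0 \<le> step_const ?d MV ub C1"
      unfolding step_const_def flux_const_def energy_const_def consistency_const_def dissipation_const_def
      using MV ub0 C1 by (auto intro!: add_nonneg_nonneg mult_nonneg_nonneg divide_nonneg_nonneg)
    show "0 \<le> \<delta> + \<eta> + dt / h + (dt / h) ^ 3 / h + sqrt h" using \<delta> \<eta> dt h by (auto intro!: add_nonneg_nonneg)
  qed (use l less_imp_le in auto)
  have "R m \<le> exp (?d * MV * (real m * dt)) * (R 0 + real m * dt * ((\<Prod>i\<in>UNIV. l $ i) * ?E))"
    by (rule discrete_gronwall[where N=m]) (use step R0 nn dt MV in auto)
  also have "\<dots> \<le> exp (?d * MV * T) * (R 0 + T * ((\<Prod>i\<in>UNIV. l $ i) * ?E))"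
  proof -
    have "exp (a * s) * (R 0 + s * W) \<le> exp (a * T) * (R 0 + T * W)" if "0 \<le> s" "s \<le> T" "0 \<le> a" "0 \<le> W" for a s W
      \<comment> \<open>Both factors increase in the elapsed time, so \<open>real m * dt\<close> may
        be enlarged to \<open>T\<close>.\<close>
      using that R0 by (intro mult_mono add_left_mono mult_right_mono) (auto intro!: mult_left_mono)
    then show ?thesis using m T' MV dt nn by auto
  qed
  finally show ?thesis .
qed

end

section \<open>The initial error and the error on a time slice\<close>

lemma cell_diameter:
  fixes x y :: "real ^ 'd"
  assumes "0 < h" "x \<in> cell p0 h k" "y \<in> cell p0 h k"
  shows "dist x y \<le> real CARD('d) * h"
proof -
  have "dist x y \<le> (\<Sum>i\<in>UNIV. \<bar>(x - y) $ i\<bar>)" unfolding dist_norm by (rule norm_le_l1_cart)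
  also have "\<dots> \<le> (\<Sum>i\<in>(UNIV::'d set). h)"
  proof (rule sum_mono)
    fix i
    have "p0 $ i + h * of_int (k $ i) \<le> x $ i \<and> x $ i < p0 $ i + h * (of_int (k $ i) + 1)"
      "p0 $ i + h * of_int (k $ i) \<le> y $ i \<and> y $ i < p0 $ i + h * (of_int (k $ i) + 1)"
      using assms unfolding cell_def by auto
    then show "\<bar>(x - y) $ i\<bar> \<le> h" by (auto simp: distrib_left abs_le_iff)
  qed
  finally show ?thesis by simp
qed

context mesh begin

text \<open>\<open>u0\<close> is known only up to a null set, hence its cell average is computed
  from the continuous representative \<open>v\<close>.\<close>

lemma proj_Q_approx:
  fixes u0 v :: "real ^ 'd \<Rightarrow> real"
  assumes ae: "AE x in lebesgue. v x = u0 x" and v: "continuous_on UNIV v"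
    and close: "\<And>x. x \<in> cell p0 h k \<Longrightarrow> \<bar>v x - c\<bar> \<le> \<epsilon>"
  shows "\<bar>proj_Q p0 h u0 (center p0 h k) - c\<bar> \<le> \<epsilon>"
proof -
  let ?C = "cell p0 h k"
  have ck: "cell_of p0 h (center p0 h k) = k" using cell_of_eq_iff[OF h] center_in_cell[OF h] by blast
  have [measurable]: "v \<in> borel_measurable borel" by (rule borel_measurable_continuous_onI[OF v])
  have v': "v \<in> borel_measurable lebesgue" by (simp add: measurable_completion)
  have u0: "u0 \<in> borel_measurable lebesgue" by (rule borel_measurable_AE[OF v' ae])
  have hd: "0 < h ^ CARD('d)" using h by simp
  have eC: "emeasure lborel ?C = ennreal (h ^ CARD('d))" by (rule emeasure_cell[OF h])
  have "(LINT y:?C|lebesgue. u0 y) = (LINT y:?C|lebesgue. v y)"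
    unfolding set_lebesgue_integral_def using ae u0 v'
    by (intro integral_cong_AE) (auto intro!: borel_measurable_times borel_measurable_indicator)
  also have "\<dots> = (LINT y:?C|lborel. v y)"
    unfolding set_lebesgue_integral_def by (rule integral_completion) measurable
  finally have e: "(LINT y:?C|lebesgue. u0 y) = (LINT y:?C|lborel. v y)" .
  have bound: "\<bar>v y\<bar> \<le> \<bar>c\<bar> + \<epsilon>" if "y \<in> ?C" for y using close[OF that] by linarith
  have int: "set_integrable lborel ?C v"
  proof -
    have "integrable lborel (\<lambda>y. (\<bar>c\<bar> + \<epsilon>) * indicator ?C y)"
      using eC by (intro integrable_mult_right integrable_real_indicator) (auto simp: h)
    then show ?thesis
      unfolding set_integrable_def
    proof (rule Bochner_Integration.integrable_bound)
      show "AE y in lborel. norm (indicator ?C y *\<^sub>R v y) \<le> norm ((\<bar>c\<bar> + \<epsilon>) * indicator ?C y)"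
        using bound by (intro AE_I2) (force simp: indicator_def)
    qed measurable
  qed
  have ic: "set_integrable lborel ?C (\<lambda>y. c)" for c :: real
    unfolding set_integrable_def using eC by (intro integrable_scaleR_left integrable_real_indicator) auto
  have const: "(LINT y:?C|lborel. (a::real)) = a * h ^ CARD('d)" for a
    unfolding set_lebesgue_integral_def using eC hd by (simp add: measure_def)
  have "(LINT y:?C|lborel. v y) \<le> (LINT y:?C|lborel. c + \<epsilon>)" "(LINT y:?C|lborel. c - \<epsilon>) \<le> (LINT y:?C|lborel. v y)"
    using close by (intro set_integral_mono int ic; force simp: abs_le_iff)+
  moreover have "\<bar>I / H - c\<bar> \<le> \<epsilon>" if "I \<le> (c + \<epsilon>) * H" "(c - \<epsilon>) * H \<le> I" "0 < H" for I H
  proof -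
    have "c - \<epsilon> \<le> I / H" "I / H \<le> c + \<epsilon>"
      using that by (simp_all add: pos_le_divide_eq pos_divide_le_eq)
    then show ?thesis by linarith
  qed
  ultimately have "\<bar>(LINT y:?C|lborel. v y) / h ^ CARD('d) - c\<bar> \<le> \<epsilon>"
    unfolding const using hd by blast
  then show ?thesis unfolding proj_Q_def ck e by simp
qed

end

text \<open>Small values are charged to \<open>\<mu>\<close>. Otherwise \<open>a\<^sup>2\<close> is
  at least \<open>\<mu> powr (2 / p)\<close>, so the bound \<open>A powr p\<close> may be multiplied
  by a quotient that is at least 1. This treats exponents below and above 2 alike.\<close>

lemma power_interpolation:
  fixes a A p \<mu> :: real
  assumes "1 \<le> p" "\<bar>a\<bar> \<le> A" "0 < \<mu>"
  shows "\<bar>a\<bar> powr p \<le> \<mu> + A powr p / (\<mu> powr (2 / p)) * a\<^sup>2"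
proof (cases "\<bar>a\<bar> powr p \<le> \<mu>")
  case True then show ?thesis by (simp add: add_increasing2)
next
  case False
  then have "\<mu> powr (1 / p) \<le> (\<bar>a\<bar> powr p) powr (1 / p)" using assms by (intro powr_mono2) auto
  then have "\<mu> powr (1 / p) \<le> \<bar>a\<bar>" using assms by (simp add: powr_powr)
  then have "(\<mu> powr (1 / p)) powr 2 \<le> \<bar>a\<bar> powr 2" by (intro powr_mono2) auto
  then have "\<mu> powr (2 / p) \<le> a\<^sup>2" by (simp add: powr_powr)
  then have "1 \<le> a\<^sup>2 / \<mu> powr (2 / p)" using assms by (simp add: field_simps)
  then have "A powr p * 1 \<le> A powr p * (a\<^sup>2 / \<mu> powr (2 / p))" by (intro mult_left_mono) auto
  moreover have "\<bar>a\<bar> powr p \<le> A powr p" using assms by (intro powr_mono2) auto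
  ultimately show ?thesis using assms by simp
qed

lemma emeasure_torus:
  assumes "\<And>i. 0 < l $ i" shows "emeasure lborel (torus (l :: real ^ 'd)) = ennreal (\<Prod>i\<in>UNIV. l $ i)"
proof -
  have ab: "0 \<bullet> b \<le> l \<bullet> b" if "b \<in> Basis" for b :: "real ^ 'd"
    using that less_imp_le[OF assms] by (auto simp: Basis_vec_def inner_axis)
  have prod: "prod ((\<bullet>) (l - 0)) Basis = (\<Prod>i\<in>UNIV. l $ i)"
  proof -
    have "Basis = (\<lambda>i. axis i 1 :: real ^ 'd) ` UNIV" by (auto simp: Basis_vec_def)
    then have "prod ((\<bullet>) (l - 0)) Basis = prod ((\<bullet>) (l - 0)) ((\<lambda>i. axis i 1 :: real ^ 'd) ` UNIV)" by (rule arg_cong)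
    also have "\<dots> = (\<Prod>i\<in>UNIV. l $ i)"
      by (subst prod.reindex) (auto simp: inj_def axis_eq_axis inner_axis)
    finally show ?thesis .
  qed
  have "box 0 l \<subseteq> torus l" "torus l \<subseteq> cbox 0 l"
    by (auto simp: torus_def mem_box_cart) (meson less_imp_le)+
  then have "emeasure lborel (box 0 l) \<le> emeasure lborel (torus l)"
    "emeasure lborel (torus l) \<le> emeasure lborel (cbox 0 l)" by (intro emeasure_mono; simp)+
  then show ?thesis
    using emeasure_lborel_box[OF ab] emeasure_lborel_cbox[OF ab] unfolding prod by auto
qed

context mesh begin

text \<open>On each cell the error is split at the nodal value of \<open>V\<close>. The factor 4
  comes from the square of a sum and from the one half in the relative entropy.\<close>

lemma slice_bound:
  fixes u U :: "real ^ 'd \<Rightarrow> real" and V :: "real ^ 'd \<Rightarrow> real"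
  assumes Q: "u \<in> Qh l p0 h" and Ucont: "continuous_on UNIV U" and Uper: "periodic l U"
    and A: "\<And>x. \<bar>u x - U x\<bar> \<le> A" and p: "1 \<le> p" and \<mu>: "0 < \<mu>"
    and close: "\<And>k x. x \<in> cell p0 h k \<Longrightarrow> \<bar>U x - V (center p0 h k)\<bar> \<le> \<epsilon>"
    and R: "h ^ CARD('d) * (\<Sum>k\<in>S. (u (center p0 h k) - V (center p0 h k))\<^sup>2 / 2) \<le> R"
  shows "(\<integral>\<^sup>+x\<in>torus l. ennreal (\<bar>u x - U x\<bar> powr p) \<partial>lborel)
     \<le> ennreal (\<mu> * (\<Prod>i\<in>UNIV. l $ i) + A powr p / (\<mu> powr (2 / p)) * (4 * R + 2 * \<epsilon>\<^sup>2 * (\<Prod>i\<in>UNIV. l $ i)))"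
proof -
  let ?c = "center p0 h" and ?K = "A powr p / (\<mu> powr (2 / p))"
  have [measurable]: "u \<in> borel_measurable borel" by (rule Qh_borel[OF Q])
  have [measurable]: "U \<in> borel_measurable borel" by (rule borel_measurable_continuous_onI[OF Ucont])
  have up: "periodic l u" using Q by (simp add: Qh_def)
  have K: "0 \<le> ?K" by simp
  let ?b = "\<lambda>k. \<mu> + ?K * (2 * (u (?c k) - V (?c k))\<^sup>2 + 2 * \<epsilon>\<^sup>2)"
  have pt: "\<bar>u x - U x\<bar> powr p \<le> ?b k" if x: "x \<in> cell p0 h k" for x k
  proof -
    have "\<bar>U x - V (?c k)\<bar>\<^sup>2 \<le> \<epsilon>\<^sup>2" using close[OF x] by (intro power_mono) auto
    moreover have "(u x - U x)\<^sup>2 \<le> 2 * (u (?c k) - V (?c k))\<^sup>2 + 2 * (U x - V (?c k))\<^sup>2"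
    proof -
      have "0 \<le> ((u (?c k) - V (?c k)) + (U x - V (?c k)))\<^sup>2" by simp
      then show ?thesis using Qh_const[OF Q x] by (simp add: power2_eq_square algebra_simps)
    qed
    ultimately have "(u x - U x)\<^sup>2 \<le> 2 * (u (?c k) - V (?c k))\<^sup>2 + 2 * \<epsilon>\<^sup>2" by simp
    then have "?K * (u x - U x)\<^sup>2 \<le> ?K * (2 * (u (?c k) - V (?c k))\<^sup>2 + 2 * \<epsilon>\<^sup>2)"
      by (intro mult_left_mono K)
    then show ?thesis using power_interpolation[OF p A \<mu>, of x] by linarith
  qed
  have b0: "0 \<le> ?b k" for k using \<mu> by (intro add_nonneg_nonneg mult_nonneg_nonneg) auto
  have "(\<integral>\<^sup>+x\<in>torus l. ennreal (\<bar>u x - U x\<bar> powr p) \<partial>lborel)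
      = (\<Sum>k\<in>S. \<integral>\<^sup>+x\<in>cell p0 h k. ennreal (\<bar>u x - U x\<bar> powr p) \<partial>lborel)"
    by (rule nn_integral_torus_cells) (simp_all add: periodic_lattice[OF up] periodic_lattice[OF Uper])
  also have "\<dots> \<le> (\<Sum>k\<in>S. \<integral>\<^sup>+x. ennreal (?b k) * indicator (cell p0 h k) x \<partial>lborel)"
    using pt by (intro sum_mono nn_integral_mono) (auto simp: indicator_def intro!: ennreal_leI)
  also have "\<dots> = (\<Sum>k\<in>S. ennreal (h ^ CARD('d) * ?b k))"
  proof (intro sum.cong refl)
    fix k
    have "(\<integral>\<^sup>+x. ennreal (?b k) * indicator (cell p0 h k) x \<partial>lborel) = ennreal (?b k) * ennreal (h ^ CARD('d))"
      by (subst nn_integral_cmult_indicator) (simp_all add: emeasure_cell[OF h])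
    also have "\<dots> = ennreal (?b k * h ^ CARD('d))" using b0[of k] h by (intro ennreal_mult[symmetric]) auto
    finally show "(\<integral>\<^sup>+x. ennreal (?b k) * indicator (cell p0 h k) x \<partial>lborel) = ennreal (h ^ CARD('d) * ?b k)"
      by (simp only: mult.commute)
  qed
  also have "\<dots> = ennreal (\<Sum>k\<in>S. h ^ CARD('d) * ?b k)"
    using b0 h by (intro sum_ennreal mult_nonneg_nonneg) auto
  also have "\<dots> \<le> ennreal (\<mu> * (\<Prod>i\<in>UNIV. l $ i) + ?K * (4 * R + 2 * \<epsilon>\<^sup>2 * (\<Prod>i\<in>UNIV. l $ i)))"
  proof (intro ennreal_leI)
    have "(\<Sum>k\<in>S. h ^ CARD('d) * ?b k) = \<mu> * (h ^ CARD('d) * real (card S))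
       + ?K * (4 * (h ^ CARD('d) * (\<Sum>k\<in>S. (u (?c k) - V (?c k))\<^sup>2 / 2)) + 2 * \<epsilon>\<^sup>2 * (h ^ CARD('d) * real (card S)))"
      by (simp add: sum_distrib_left sum.distrib algebra_simps)
    also have "\<dots> \<le> \<mu> * (\<Prod>i\<in>UNIV. l $ i) + ?K * (4 * R + 2 * \<epsilon>\<^sup>2 * (\<Prod>i\<in>UNIV. l $ i))"
      unfolding card_S by (intro add_left_mono mult_left_mono add_right_mono R K) simp
    finally show "(\<Sum>k\<in>S. h ^ CARD('d) * ?b k) \<le> \<dots>" .
  qed
  finally show ?thesis .
qed

end

section \<open>From the relative entropy to convergence\<close>

lemma continuous_slice:
  assumes "continuous_on (I \<times> UNIV) U" "t \<in> I" shows "continuous_on UNIV (\<lambda>x. U (t, x))"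
  by (rule continuous_on_compose2[OF assms(1)]) (use assms(2) in \<open>auto intro!: continuous_intros\<close>)

lemma lattice_reduction:
  assumes "\<And>i. 0 < l $ i" shows "\<exists>\<nu>\<in>lattice l. x + \<nu> \<in> torus l"
  using lattice_unique[OF assms, of x 0] unfolding torus_eq by blast

text \<open>Both points are moved by the lattice vector that brings the first into the torus. The
  margin of 1 around the compact box keeps the second one inside, as the distance is below
  1.\<close>

lemma periodic_uniformly_continuous:
  fixes U :: "real \<times> (real ^ 'd) \<Rightarrow> real"
  assumes l: "\<And>i. 0 < l $ i" and cont: "continuous_on ({a..b} \<times> UNIV) U"
    and per: "\<And>t. t \<in> {a..b} \<Longrightarrow> periodic l (\<lambda>x. U (t, x))" and \<epsilon>: "0 < \<epsilon>"
  shows "\<exists>\<rho>>0. \<forall>t\<in>{a..b}. \<forall>s\<in>{a..b}. \<forall>x y. \<bar>t - s\<bar> < \<rho> \<longrightarrow> dist x y < \<rho> \<longrightarrow> \<bar>U (t, x) - U (s, y)\<bar> < \<epsilon>"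
proof -
  let ?K = "{a..b} \<times> cbox (\<chi> i. - 1) (\<chi> i. l $ i + 1) :: (real \<times> (real ^ 'd)) set"
  have "compact ?K" by (intro compact_Times compact_Icc compact_cbox)
  moreover have "continuous_on ?K U" by (rule continuous_on_subset[OF cont]) auto
  ultimately have "uniformly_continuous_on ?K U" by (rule compact_uniformly_continuous[rotated])
  then obtain \<rho> where \<rho>: "0 < \<rho>" and u: "\<And>z w. z \<in> ?K \<Longrightarrow> w \<in> ?K \<Longrightarrow> dist w z < \<rho> \<Longrightarrow> dist (U w) (U z) < \<epsilon>"
    using \<epsilon> unfolding uniformly_continuous_on_def by metis
  let ?r = "min 1 (\<rho> / 2)"
  have "\<bar>U (t, x) - U (s, y)\<bar> < \<epsilon>"
    if t: "t \<in> {a..b}" "s \<in> {a..b}" and d: "\<bar>t - s\<bar> < ?r" "dist x y < ?r" for t s x y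
  proof -
    obtain \<nu> where \<nu>: "\<nu> \<in> lattice l" "x + \<nu> \<in> torus l" using lattice_reduction[OF l] by blast
    have "- 1 \<le> x $ i + \<nu> $ i \<and> x $ i + \<nu> $ i \<le> l $ i + 1 \<and> - 1 \<le> y $ i + \<nu> $ i \<and> y $ i + \<nu> $ i \<le> l $ i + 1" for i
    proof -
      have "\<bar>(x - y) $ i\<bar> < 1" using component_le_norm_cart[of "x - y" i] d by (simp add: dist_norm)
      moreover have "0 \<le> x $ i + \<nu> $ i" "x $ i + \<nu> $ i < l $ i" using \<nu>(2) unfolding torus_def by auto
      ultimately show ?thesis unfolding vector_minus_component by linarith
    qed
    then have K: "(t, x + \<nu>) \<in> ?K" "(s, y + \<nu>) \<in> ?K" using t by (auto simp: mem_box_cart)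
    have "dist (t, x + \<nu>) (s, y + \<nu>) \<le> dist t s + dist (x + \<nu>) (y + \<nu>)"
      unfolding dist_Pair_Pair by (intro order_trans[OF sqrt_add_le_add_sqrt]) auto
    also have "\<dots> < \<rho>" using d by (simp add: dist_real_def)
    finally have "dist (U (t, x + \<nu>)) (U (s, y + \<nu>)) < \<epsilon>" by (intro u K)
    then show ?thesis
      using periodic_lattice[OF per[OF t(1)] \<nu>(1)] periodic_lattice[OF per[OF t(2)] \<nu>(1)]
      by (simp add: dist_real_def)
  qed
  then show ?thesis using \<rho> by (intro exI[of _ ?r]) auto
qed

lemma periodic_bounded:
  fixes U :: "real \<times> (real ^ 'd) \<Rightarrow> real"
  assumes l: "\<And>i. 0 < l $ i" and cont: "continuous_on ({a..b} \<times> UNIV) U"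
    and per: "\<And>t. t \<in> {a..b} \<Longrightarrow> periodic l (\<lambda>x. U (t, x))"
  obtains B where "0 \<le> B" "\<And>t x. t \<in> {a..b} \<Longrightarrow> \<bar>U (t, x)\<bar> \<le> B"
proof -
  let ?K = "{a..b} \<times> cbox 0 l :: (real \<times> (real ^ 'd)) set"
  have "compact ?K" by (intro compact_Times compact_Icc compact_cbox)
  moreover have "continuous_on ?K U" by (rule continuous_on_subset[OF cont]) auto
  ultimately have "bounded (U ` ?K)" by (intro compact_imp_bounded compact_continuous_image)
  then obtain B where B: "\<And>z. z \<in> ?K \<Longrightarrow> \<bar>U z\<bar> \<le> B" unfolding bounded_iff by auto
  have "\<bar>U (t, x)\<bar> \<le> \<bar>B\<bar>" if t: "t \<in> {a..b}" for t x
  proof -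
    obtain \<nu> where \<nu>: "\<nu> \<in> lattice l" "x + \<nu> \<in> torus l" using lattice_reduction[OF l] by blast
    then have "(t, x + \<nu>) \<in> ?K" using t by (auto simp: torus_def mem_box_cart less_imp_le)
    from B[OF this] show ?thesis using periodic_lattice[OF per[OF t] \<nu>(1)] by simp
  qed
  then show thesis using that[of "\<bar>B\<bar>"] by auto
qed

section \<open>The space-time error\<close>

lemma cylinder_measurable [measurable]: "cylinder T l \<in> sets borel"
  unfolding cylinder_def borel_prod[symmetric] by (intro pair_measureI) auto

context mesh begin

lemma solution_piecewise:
  assumes sol: "stabilized_GRP_solution T l C1 p0 h N u0 u" and T: "0 < T" and N: "0 < N"
  defines "dt \<equiv> T / real N"
  assumes t: "0 \<le> t" "t < T"
  obtains m where "m < N" "real m * dt \<le> t" "t < real (Suc m) * dt" "\<And>x. u (t, x) = u (real m * dt, x)"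
proof -
  have dt: "0 < dt" unfolding dt_def using N T by simp
  have NdT: "real N * dt = T" unfolding dt_def using N by simp
  define m where "m = nat \<lfloor>t / dt\<rfloor>"
  have fl: "real_of_int \<lfloor>t / dt\<rfloor> * dt \<le> t" "t < (real_of_int \<lfloor>t / dt\<rfloor> + 1) * dt"
    using floor_divide_lower[OF dt, of t] floor_divide_upper[OF dt, of t] .
  have rm: "real m = real_of_int \<lfloor>t / dt\<rfloor>" unfolding m_def using t dt by simp
  have m: "real m * dt \<le> t" "t < real (Suc m) * dt" using fl unfolding rm[symmetric] by (auto simp: algebra_simps)
  have "m < N"
  proof (rule ccontr)
    assume "\<not> m < N"
    then have "real N * dt \<le> real m * dt" using dt by (intro mult_right_mono) auto
    then show False using m t NdT by simp
  qed
  moreover from this have "u (t, x) = u (real m * dt, x)" for x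
  proof -
    have "\<forall>m<N. \<forall>t\<in>{real m * (T / real N)..<real (Suc m) * (T / real N)}. \<forall>x. u (t, x) = u (real m * (T / real N), x)"
      using sol unfolding stabilized_GRP_solution_def Let_def by blast
    from this[rule_format, OF \<open>m < N\<close>, of t x] show ?thesis using m unfolding dt_def by simp
  qed
  ultimately show thesis using m by (intro that[of m])
qed

lemma solution_slice_Qh:
  assumes "stabilized_GRP_solution T l C1 p0 h N u0 u" "t \<in> {0..T}"
  shows "(\<lambda>x. u (t, x)) \<in> Qh l p0 h"
  using assms unfolding stabilized_GRP_solution_def Let_def by auto

text \<open>The numerical solution is a finite sum over time slabs. The equality is claimed on the
  cylinder only, since its values at other times are unconstrained.\<close>

lemma solution_measurable:
  assumes sol: "stabilized_GRP_solution T l C1 p0 h N u0 u" and T: "0 < T" and N: "0 < N"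
  shows "\<exists>u'\<in>borel_measurable borel. \<forall>z\<in>cylinder T l. u z = u' z"
proof
  let ?dt = "T / real N"
  let ?I = "\<lambda>m. {real m * ?dt..<real (Suc m) * ?dt}"
  let ?u = "\<lambda>z. \<Sum>m<N. indicator (?I m) (fst z) * u (real m * ?dt, snd z)"
  have dt: "0 < ?dt" using N T by simp
  have [measurable]: "(\<lambda>x. u (real m * ?dt, x)) \<in> borel_measurable borel" if "m < N" for m
  proof (rule Qh_borel[OF solution_slice_Qh[OF sol]])
    have "real m * ?dt \<le> real N * ?dt" using that dt by (intro mult_right_mono) auto
    then show "real m * ?dt \<in> {0..T}" using N T by auto
  qed
  show "?u \<in> borel_measurable borel"
    unfolding borel_prod[symmetric] by measurable
  show "\<forall>z\<in>cylinder T l. u z = ?u z"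
  proof
    fix z assume "z \<in> cylinder T l"
    then obtain t x where z: "z = (t, x)" "0 < t" "t < T" by (auto simp: cylinder_def)
    obtain m where m: "m < N" "real m * ?dt \<le> t" "t < real (Suc m) * ?dt" "\<And>x. u (t, x) = u (real m * ?dt, x)"
      using solution_piecewise[OF sol T N, of t] z by auto
    have "indicator (?I j) t = (of_bool (j = m) :: real)" for j
    proof -
      have "t \<in> ?I j \<longleftrightarrow> j = m"
      proof
        assume a: "t \<in> ?I j"
        have "real j * ?dt < real (Suc m) * ?dt" "real m * ?dt < real (Suc j) * ?dt" using a m by auto
        then have "real j < real (Suc m)" "real m < real (Suc j)" using dt by (simp_all only: mult_less_cancel_right_pos)
        then show "j = m" by simp
      qed (use m in auto)
      then show ?thesis by (simp add: indicator_def)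
    qed
    then have "?u z = (\<Sum>j<N. of_bool (j = m) * u (real j * ?dt, x))" unfolding z by simp
    also have "\<dots> = (\<Sum>j<N. if j = m then u (real j * ?dt, x) else 0)" by (intro sum.cong) auto
    also have "\<dots> = u (real m * ?dt, x)" using m(1) by simp
    finally show "u z = ?u z" using m(4) z by simp
  qed
qed

text \<open>Integration in time of slice estimates. Up to \<open>T'\<close> they come from
  \<open>slice_bound\<close>; after \<open>T'\<close> there is no comparison function, and the
  uniform bound \<open>A\<close> pays for the short remaining slab.\<close>

lemma error_bound:
  fixes u U :: "real \<times> (real ^ 'd) \<Rightarrow> real"
  assumes sol: "stabilized_GRP_solution T l C1 p0 h N u0 u" and T: "0 < T" and N: "0 < N"
    and Ucont: "continuous_on ({0..T} \<times> UNIV) U" and Uper: "\<And>t. t \<in> {0..T} \<Longrightarrow> periodic l (\<lambda>x. U (t, x))"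
    and A: "\<And>t x. 0 \<le> t \<Longrightarrow> t < T \<Longrightarrow> \<bar>u (t, x) - U (t, x)\<bar> \<le> A" and p: "1 \<le> p" and \<mu>: "0 < \<mu>"
    and T': "0 < T'" "T' < T"
  defines "dt \<equiv> T / real N"
  assumes close: "\<And>m t k x. real m * dt \<le> t \<Longrightarrow> t < real (Suc m) * dt \<Longrightarrow> t \<le> T' \<Longrightarrow> x \<in> cell p0 h k \<Longrightarrow>
        \<bar>U (t, x) - V (real m * dt, center p0 h k)\<bar> \<le> \<epsilon>"
    and R: "\<And>m. real m * dt \<le> T' \<Longrightarrow>
        h ^ CARD('d) * (\<Sum>k\<in>S. (u (real m * dt, center p0 h k) - V (real m * dt, center p0 h k))\<^sup>2 / 2) \<le> R"
    and R0: "0 \<le> R"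
  defines "vol \<equiv> \<Prod>i\<in>UNIV. l $ i"
  shows "(\<integral>\<^sup>+z\<in>cylinder T l. ennreal (\<bar>u z - U z\<bar> powr p) \<partial>lborel)
     \<le> ennreal (T * (\<mu> * vol + A powr p / (\<mu> powr (2 / p)) * (4 * R + 2 * \<epsilon>\<^sup>2 * vol)) + (T - T') * (A powr p * vol))"
proof -
  let ?b1 = "\<mu> * vol + A powr p / (\<mu> powr (2 / p)) * (4 * R + 2 * \<epsilon>\<^sup>2 * vol)" and ?b2 = "A powr p * vol"
  have vol: "0 \<le> vol" unfolding vol_def using l less_imp_le by (intro prod_nonneg) auto
  have b1: "0 \<le> ?b1" using \<mu> vol R0 by (intro add_nonneg_nonneg mult_nonneg_nonneg) auto
  have b2: "0 \<le> ?b2" using vol by simp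
  obtain u' where u' [measurable]: "u' \<in> borel_measurable borel" and uu': "\<And>z. z \<in> cylinder T l \<Longrightarrow> u z = u' z"
    using solution_measurable[OF sol T N] by auto
  \<comment> \<open>\<open>U\<close> is continuous on the closed slab only; extension by zero makes
    it Borel on the whole space.\<close>
  let ?U = "\<lambda>z. indicator ({0..T} \<times> UNIV) z *\<^sub>R U z"
  have [measurable]: "?U \<in> borel_measurable borel"
    by (rule borel_measurable_continuous_on_indicator[OF _ Ucont]) (unfold borel_prod[symmetric], intro pair_measureI, auto)
  define g where "g = (\<lambda>z. ennreal (\<bar>u' z - ?U z\<bar> powr p) * indicator (cylinder T l) z)"
  have gm: "g \<in> borel_measurable borel" unfolding g_def by measurable
  have geq: "g z = ennreal (\<bar>u z - U z\<bar> powr p) * indicator (cylinder T l) z" for z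
    using uu' unfolding g_def by (auto simp: indicator_def cylinder_def)
  have "(\<integral>\<^sup>+z\<in>cylinder T l. ennreal (\<bar>u z - U z\<bar> powr p) \<partial>lborel) = (\<integral>\<^sup>+z. g z \<partial>(lborel \<Otimes>\<^sub>M lborel))"
    unfolding lborel_prod by (simp add: geq)
  also have "\<dots> = (\<integral>\<^sup>+t. \<integral>\<^sup>+x. g (t, x) \<partial>lborel \<partial>lborel)"
    using gm by (intro lborel.nn_integral_fst[symmetric]) (simp add: lborel_prod)
  also have "\<dots> \<le> (\<integral>\<^sup>+t. ennreal ?b1 * indicator {0..T} t + ennreal ?b2 * indicator {T'..T} t \<partial>lborel)"
  proof (rule nn_integral_mono)
    fix t :: real
    have inner: "(\<integral>\<^sup>+x. g (t, x) \<partial>lborel) = (\<integral>\<^sup>+x\<in>torus l. ennreal (\<bar>u (t, x) - U (t, x)\<bar> powr p) \<partial>lborel)" if "0 < t" "t < T"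
      using that by (intro nn_integral_cong) (auto simp: geq cylinder_def indicator_def)
    show "(\<integral>\<^sup>+x. g (t, x) \<partial>lborel) \<le> ennreal ?b1 * indicator {0..T} t + ennreal ?b2 * indicator {T'..T} t"
    proof (cases "0 < t \<and> t < T")
      case False
      then have "g (t, x) = 0" for x by (auto simp: geq cylinder_def)
      then show ?thesis by simp
    next
      case t: True
      show ?thesis
      proof (cases "t \<le> T'")
        case True
        obtain m where m: "m < N" "real m * dt \<le> t" "t < real (Suc m) * dt" "\<And>x. u (t, x) = u (real m * dt, x)"
          using solution_piecewise[OF sol T N, of t] t unfolding dt_def by auto
        have "(\<integral>\<^sup>+x\<in>torus l. ennreal (\<bar>u (t, x) - U (t, x)\<bar> powr p) \<partial>lborel) \<le> ennreal ?b1"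
          unfolding vol_def
        proof (rule slice_bound[where V = "\<lambda>x. V (real m * dt, x)"])
          show "(\<lambda>x. u (t, x)) \<in> Qh l p0 h" using t by (intro solution_slice_Qh[OF sol]) auto
          show "continuous_on UNIV (\<lambda>x. U (t, x))" using t by (intro continuous_slice[OF Ucont]) auto
          show "h ^ CARD('d) * (\<Sum>k\<in>S. (u (t, center p0 h k) - V (real m * dt, center p0 h k))\<^sup>2 / 2) \<le> R"
            unfolding m(4) using R[of m] m True by auto
        qed (use t A Uper p \<mu> close[OF m(2,3) True] in auto)
        then show ?thesis using inner t by (auto intro: add_increasing2)
      next
        case False
        have "(\<integral>\<^sup>+x\<in>torus l. ennreal (\<bar>u (t, x) - U (t, x)\<bar> powr p) \<partial>lborel) \<le> (\<integral>\<^sup>+x. ennreal (A powr p) * indicator (torus l) x \<partial>lborel)"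
          using A t p by (intro nn_integral_mono) (auto simp: indicator_def intro!: ennreal_leI powr_mono2)
        also have "\<dots> = ennreal ?b2"
          using vol by (subst nn_integral_cmult_indicator) (auto simp: emeasure_torus[OF l] vol_def ennreal_mult)
        finally show ?thesis using inner t False by (auto intro: add_increasing)
      qed
    qed
  qed
  also have "\<dots> = ennreal ?b1 * ennreal T + ennreal ?b2 * ennreal (T - T')"
    using T T' by (subst nn_integral_add) (auto simp: nn_integral_cmult_indicator)
  also have "\<dots> = ennreal (T * ?b1 + (T - T') * ?b2)"
    using b1 b2 T T' by (simp add: ennreal_mult'[symmetric] ennreal_plus[symmetric] mult.commute del: ennreal_plus)
  finally show ?thesis .
qed

end

lemma set_integrable_of_nn_bound:
  fixes f :: "'a::euclidean_space \<Rightarrow> real"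
  assumes D: "D \<in> sets borel" and f': "f' \<in> borel_measurable borel" "\<And>z. z \<in> D \<Longrightarrow> f z = f' z"
    and nonneg: "\<And>z. 0 \<le> f z" and b: "(\<integral>\<^sup>+z\<in>D. ennreal (f z) \<partial>lborel) \<le> ennreal b" "0 \<le> b"
  shows "set_integrable lebesgue D f" and "(LINT z:D|lebesgue. f z) \<le> b"
proof -
  have eq: "indicator D z *\<^sub>R f z = indicator D z *\<^sub>R f' z" for z using f'(2) by (simp add: indicator_def)
  have m: "(\<lambda>z. indicator D z *\<^sub>R f z) \<in> borel_measurable lborel"
    unfolding eq using D f'(1) by simp
  have e: "ennreal (indicator D z *\<^sub>R f z) = ennreal (f z) * indicator D z" for z by (simp add: indicator_def)
  have nn: "(\<integral>\<^sup>+z. ennreal (indicator D z *\<^sub>R f z) \<partial>lborel) \<le> ennreal b" using b unfolding e by simp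
  have "integrable lborel (\<lambda>z. indicator D z *\<^sub>R f z)"
    using nn nonneg by (intro integrableI_nonneg m) (auto intro: le_less_trans)
  then show "set_integrable lebesgue D f"
    unfolding set_integrable_def by (rule integrable_completion[THEN iffD2, rotated]) (rule m)
  have "(LINT z:D|lebesgue. f z) = (LINT z|lborel. indicator D z *\<^sub>R f z)"
    unfolding set_lebesgue_integral_def by (rule integral_completion[OF m])
  also have "\<dots> \<le> b"
    using nn nonneg b(2) by (subst integral_eq_nn_integral[OF m]) (auto intro: enn2real_leI)
  finally show "(LINT z:D|lebesgue. f z) \<le> b" .
qed

lemma emeasure_cylinder_le:
  assumes T: "0 < T" and l: "\<And>i. 0 < l $ i"
  shows "\<exists>B. emeasure lborel (cylinder T (l :: real ^ 'd)) \<le> ennreal B \<and> 0 \<le> B"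
proof -
  have "cylinder T l \<subseteq> cbox (0, 0) (T, l)"
    by (auto simp: cylinder_def torus_def mem_box_cart less_imp_le cbox_Pair_eq)
  then have "emeasure lborel (cylinder T l) \<le> emeasure lborel (cbox (0, 0) (T, l))" by (intro emeasure_mono) auto
  also have "\<dots> < \<infinity>" by (rule emeasure_lborel_cbox_finite)
  finally have "emeasure lborel (cylinder T l) = ennreal (enn2real (emeasure lborel (cylinder T l)))" by simp
  then show ?thesis by (intro exI[of _ "enn2real (emeasure lborel (cylinder T l))"]) auto
qed

context mesh begin

lemma error_measurable:
  fixes u U :: "real \<times> (real ^ 'd) \<Rightarrow> real"
  assumes sol: "stabilized_GRP_solution T l C1 p0 h N u0 u" and T: "0 < T" and N: "0 < N"
    and Ucont: "continuous_on ({0..T} \<times> UNIV) U"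
  shows "\<exists>f'\<in>borel_measurable borel. \<forall>z\<in>cylinder T l. \<bar>u z - U z\<bar> powr p = f' z"
proof -
  obtain u' where u' [measurable]: "u' \<in> borel_measurable borel" and uu': "\<And>z. z \<in> cylinder T l \<Longrightarrow> u z = u' z"
    using solution_measurable[OF sol T N] by auto
  let ?U = "\<lambda>z. indicator ({0..T} \<times> UNIV) z *\<^sub>R U z"
  have [measurable]: "?U \<in> borel_measurable borel"
    by (rule borel_measurable_continuous_on_indicator[OF _ Ucont]) (unfold borel_prod[symmetric], intro pair_measureI, auto)
  have "(\<lambda>z. \<bar>u' z - ?U z\<bar> powr p) \<in> borel_measurable borel" by measurable
  moreover have "\<bar>u z - U z\<bar> powr p = \<bar>u' z - ?U z\<bar> powr p" if "z \<in> cylinder T l" for z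
    using that uu' by (auto simp: cylinder_def)
  ultimately show ?thesis by (intro bexI[of _ "\<lambda>z. \<bar>u' z - ?U z\<bar> powr p"] ballI)
qed

lemma error_integrable:
  fixes u U :: "real \<times> (real ^ 'd) \<Rightarrow> real"
  assumes sol: "stabilized_GRP_solution T l C1 p0 h N u0 u" and T: "0 < T" and N: "0 < N"
    and Ucont: "continuous_on ({0..T} \<times> UNIV) U" and p: "0 < p"
    and A: "\<And>t x. 0 \<le> t \<Longrightarrow> t < T \<Longrightarrow> \<bar>u (t, x) - U (t, x)\<bar> \<le> A"
  shows "set_integrable lebesgue (cylinder T l) (\<lambda>z. \<bar>u z - U z\<bar> powr p)"
proof -
  obtain f' where f': "f' \<in> borel_measurable borel" "\<And>z. z \<in> cylinder T l \<Longrightarrow> \<bar>u z - U z\<bar> powr p = f' z"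
    using error_measurable[OF sol T N Ucont, of p] by blast
  obtain B where B: "emeasure lborel (cylinder T l) \<le> ennreal B" "0 \<le> B" using emeasure_cylinder_le[OF T l] by blast
  have "(\<integral>\<^sup>+z\<in>cylinder T l. ennreal (\<bar>u z - U z\<bar> powr p) \<partial>lborel)
      \<le> (\<integral>\<^sup>+z. ennreal (A powr p) * indicator (cylinder T l) z \<partial>lborel)"
    using A p by (intro nn_integral_mono) (auto simp: indicator_def cylinder_def intro!: ennreal_leI powr_mono2)
  also have "\<dots> = ennreal (A powr p) * emeasure lborel (cylinder T l)"
    by (rule nn_integral_cmult_indicator) simp
  also have "\<dots> \<le> ennreal (A powr p * B)" using B by (simp add: ennreal_mult mult_left_mono)
  finally show ?thesis
    using B by (intro set_integrable_of_nn_bound(1)[OF cylinder_measurable f'(1) f'(2), where b = "A powr p * B"]) auto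
qed

end

text \<open>The second quantity is at most a constant times \<open>h\<close> to the power
  \<open>3 * (\<alpha> - 1) - 1\<close>, which is positive exactly for
  \<open>\<alpha> > 4 / 3\<close>.\<close>

lemma mesh_ratio_limits:
  fixes h dt :: "nat \<Rightarrow> real"
  assumes h: "h \<longlonglongrightarrow> 0" and pos: "\<And>n. 0 < dt n \<and> 0 < h n" and \<alpha>: "4 / 3 < \<alpha>"
    and le: "\<And>n. dt n \<le> C2 * h n powr \<alpha>"
  shows "(\<lambda>n. dt n / h n) \<longlonglongrightarrow> 0" "(\<lambda>n. (dt n / h n) ^ 3 / h n) \<longlonglongrightarrow> 0" "dt \<longlonglongrightarrow> 0"
proof -
  have nn: "0 \<le> dt n" "0 \<le> h n" for n using pos[of n] by auto
  have lim: "(\<lambda>n. C * h n powr b) \<longlonglongrightarrow> 0" if "0 < b" for b C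
    using tendsto_mult_left[OF tendsto_zero_powrI[OF h tendsto_const _ that], of C] pos
    by (simp add: less_imp_le)
  have C2: "0 \<le> C2"
  proof -
    have "0 < C2 * h 0 powr \<alpha>" using pos[of 0] le[of 0] by linarith
    then show ?thesis by (simp add: zero_less_mult_iff)
  qed
  have b1: "dt n / h n \<le> C2 * h n powr (\<alpha> - 1)" for n
  proof -
    have "h n powr (\<alpha> - 1) = h n powr \<alpha> / h n" using pos[of n] by (simp add: powr_diff)
    then show ?thesis using le[of n] pos[of n] by (simp add: divide_right_mono)
  qed
  show 1: "(\<lambda>n. dt n / h n) \<longlonglongrightarrow> 0"
    by (rule tendsto_sandwich[OF _ _ tendsto_const lim]) (use b1 nn \<alpha> in \<open>auto intro!: always_eventually divide_nonneg_nonneg\<close>)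
  have b2: "(dt n / h n) ^ 3 / h n \<le> C2 ^ 3 * h n powr (3 * (\<alpha> - 1) - 1)" for n
  proof -
    have "(dt n / h n) ^ 3 \<le> (C2 * h n powr (\<alpha> - 1)) ^ 3" using b1[of n] pos[of n] by (intro power_mono) auto
    also have "\<dots> = C2 ^ 3 * h n powr (3 * (\<alpha> - 1))"
      using pos[of n] by (simp add: power_mult_distrib powr_realpow[symmetric] powr_powr mult.commute)
    finally have "(dt n / h n) ^ 3 / h n \<le> C2 ^ 3 * h n powr (3 * (\<alpha> - 1)) / h n"
      using pos[of n] by (intro divide_right_mono) auto
    also have "\<dots> = C2 ^ 3 * (h n powr (3 * (\<alpha> - 1)) / h n powr 1)" using pos[of n] by simp
    also have "\<dots> = C2 ^ 3 * h n powr (3 * (\<alpha> - 1) - 1)" by (simp only: powr_diff)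
    finally show ?thesis .
  qed
  show "(\<lambda>n. (dt n / h n) ^ 3 / h n) \<longlonglongrightarrow> 0"
    by (rule tendsto_sandwich[OF _ _ tendsto_const lim]) (use b2 nn \<alpha> in \<open>auto intro!: always_eventually divide_nonneg_nonneg\<close>)
  have "(\<lambda>n. dt n / h n * h n) \<longlonglongrightarrow> 0 * 0" by (rule tendsto_mult[OF 1 h])
  moreover have "dt n / h n * h n = dt n" for n using pos[of n] by simp
  ultimately show "dt \<longlonglongrightarrow> 0" by simp
qed

lemma approx_solutionE:
  assumes "approx_solution T l M \<delta> V"
  obtains Vt X where "\<And>t. t \<in> {0..T} \<Longrightarrow> periodic l (\<lambda>x. V (t, x))"
    and "\<And>t x. t \<in> {0..T} \<Longrightarrow> \<bar>V (t, x)\<bar> \<le> M \<and> \<bar>Vt (t, x)\<bar> \<le> M \<and> (\<forall>i. \<bar>X i (t, x)\<bar> \<le> M) \<and>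
         \<bar>Vt (t, x) + V (t, x) * (\<Sum>i\<in>UNIV. X i (t, x))\<bar> \<le> \<delta>"
    and "\<And>\<eta>. 0 < \<eta> \<Longrightarrow> \<exists>\<rho>>0. \<forall>s t x. 0 < s \<and> s < \<rho> \<and> t \<in> {0..T} \<longrightarrow>
         (t + s \<le> T \<longrightarrow> \<bar>V (t + s, x) - V (t, x) - s * Vt (t, x)\<bar> \<le> \<eta> * s) \<and>
         (\<forall>i. \<bar>V (t, x + s *\<^sub>R axis i 1) - V (t, x) - s * X i (t, x)\<bar> \<le> \<eta> * s)"
proof -
  obtain Vt X where V1: "\<forall>t\<in>{0..T}. \<forall>x. \<bar>V (t, x)\<bar> \<le> M \<and> \<bar>Vt (t, x)\<bar> \<le> M \<and> (\<forall>i. \<bar>X i (t, x)\<bar> \<le> M) \<and>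
         \<bar>Vt (t, x) + V (t, x) * (\<Sum>i\<in>UNIV. X i (t, x))\<bar> \<le> \<delta>"
    and V2: "\<forall>\<eta>>0. \<exists>\<rho>>0. \<forall>s t x. 0 < s \<and> s < \<rho> \<and> t \<in> {0..T} \<longrightarrow>
         (t + s \<le> T \<longrightarrow> \<bar>V (t + s, x) - V (t, x) - s * Vt (t, x)\<bar> \<le> \<eta> * s) \<and>
         (\<forall>i. \<bar>V (t, x + s *\<^sub>R axis i 1) - V (t, x) - s * X i (t, x)\<bar> \<le> \<eta> * s)"
    using assms unfolding approx_solution_def by (elim conjE exE) (rule that)
  have V0: "\<forall>t\<in>{0..T}. periodic l (\<lambda>x. V (t, x))"
    using assms unfolding approx_solution_def by (elim conjE)
  show thesis
    by (rule that[OF bspec[OF V0] spec[OF bspec[OF V1]] mp[OF spec[OF V2]]])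
qed

text \<open>The bound \<open>M\<close> is common to all \<open>T'\<close> and
  \<open>\<delta>\<close>. All constants of the relative entropy estimate are therefore fixed before
  the comparison function is chosen, and that choice precedes the mesh size.\<close>

theorem scheme_converges:
  fixes l :: "real ^ 'd" and U :: "real \<times> (real ^ 'd) \<Rightarrow> real"
  assumes T: "0 < T" and l: "\<And>i. 0 < l $ i"
    and C1: "0 < C1" "C1 \<le> 1 / 24"
    and h0: "h \<longlonglongrightarrow> 0" and N: "\<And>n. 0 < N n" and dt: "\<And>n. dt n = T / real (N n)"
    and sol: "\<And>n. stabilized_GRP_solution T l C1 (org n) (h n) (N n) u0 (uh n)"
    and bound: "\<And>n t x. 0 \<le> t \<Longrightarrow> t < T \<Longrightarrow> \<bar>uh n (t, x)\<bar> \<le> ubar"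
    and steps: "\<And>n. 0 < dt n \<and> dt n \<le> 1 \<and> 0 < h n \<and> h n \<le> 1"
    and \<alpha>: "4 / 3 < \<alpha>" "\<And>n. dt n \<le> C2 * h n powr \<alpha>"
    and Ucont: "continuous_on ({0..T} \<times> UNIV) U" and Uper: "\<And>t. t \<in> {0..T} \<Longrightarrow> periodic l (\<lambda>x. U (t, x))"
    and ae: "AE x in lebesgue. U (0, x) = u0 x"
    and approx: "\<And>T' \<delta>. 0 < T' \<Longrightarrow> T' < T \<Longrightarrow> 0 < \<delta> \<Longrightarrow>
        \<exists>V. approx_solution T' l M \<delta> V \<and> (\<forall>t\<in>{0..T'}. \<forall>x. \<bar>V (t, x) - U (t, x)\<bar> \<le> \<delta>)"
    and p: "1 \<le> p"
  shows "Lp_converges (cylinder T l) p uh U"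
proof -
  obtain MU where MU: "0 \<le> MU" "\<And>t x. t \<in> {0..T} \<Longrightarrow> \<bar>U (t, x)\<bar> \<le> MU"
    using periodic_bounded[OF l Ucont Uper] by blast
  define A where "A = ubar + MU"
  have A: "\<bar>uh n (t, x) - U (t, x)\<bar> \<le> A" if "0 \<le> t" "t < T" for n t x
    using bound[OF that, of n x] MU(2)[of t x] that unfolding A_def by simp
  have mesh: "\<exists>k. mesh l (h n) k" for n
  proof -
    have "\<forall>i. \<exists>k::nat. l $ i = real k * h n"
      using sol[of n] unfolding stabilized_GRP_solution_def Let_def uniform_mesh_def by auto
    then obtain k where "\<And>i. l $ i = real (k i) * h n" by metis
    then show ?thesis using steps[of n] l by (intro exI[of _ k]) (auto simp: mesh_def)
  qed
  have int: "set_integrable lebesgue (cylinder T l) (\<lambda>z. \<bar>uh n z - U z\<bar> powr p)" for n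
  proof -
    obtain k where "mesh l (h n) k" using mesh by blast
    then interpret mesh l "org n" "h n" k .
    show ?thesis using p A by (intro error_integrable[OF sol T N Ucont, where A=A]) auto
  qed
  let ?I = "\<lambda>n. LINT z:cylinder T l|lebesgue. \<bar>uh n z - U z\<bar> powr p"
  have I0: "0 \<le> ?I n" for n unfolding set_lebesgue_integral_def by (rule integral_nonneg_AE) auto
  define vol where "vol = (\<Prod>i\<in>UNIV. l $ i)"
  have vol: "0 < vol" unfolding vol_def using l by (intro prod_pos) auto
  define d where "d = real CARD('d)"
  have d: "0 < d" unfolding d_def by simp
  have ub0: "0 \<le> ubar" using bound[of 0 0 undefined] T by fastforce
  have small: "eventually (\<lambda>n. ?I n \<le> e) sequentially" if e: "0 < e" for e
  proof -
    define C where "C = A powr p"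
    \<comment> \<open>The last slab contributes at most \<open>e / 3\<close>. The maximum with
      \<open>T / 2\<close> keeps \<open>T'\<close> positive, and the \<open>+ 1\<close> guards
      against a zero denominator.\<close>
    define T' where "T' = max (T / 2) (T - e / (3 * (C * vol + 1)))"
    have Cv: "0 \<le> C * vol" using vol unfolding C_def by simp
    have T': "0 < T'" "T' < T" unfolding T'_def using T e Cv by auto
    have part3: "(T - T') * (C * vol) \<le> e / 3"
    proof -
      have "(T - T') * (C * vol) \<le> e / (3 * (C * vol + 1)) * (C * vol)"
        unfolding T'_def using Cv by (intro mult_right_mono) auto
      also have "\<dots> \<le> e / (3 * (C * vol + 1)) * (C * vol + 1)" using Cv e by (intro mult_left_mono) auto
      also have "\<dots> = e / 3" using Cv by (simp add: field_simps)
      finally show ?thesis .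
    qed
    \<comment> \<open>Makes the interpolation error over the whole cylinder equal to
      \<open>e / 3\<close>.\<close>
    define \<mu> where "\<mu> = e / (3 * T * vol)"
    have \<mu>: "0 < \<mu>" unfolding \<mu>_def using e T vol by simp
    have part1: "T * (\<mu> * vol) = e / 3" unfolding \<mu>_def using T vol by simp
    define K where "K = A powr p / (\<mu> powr (2 / p))"
    have K: "0 \<le> K" unfolding K_def by simp
    \<comment> \<open>Any comparison function will do here; it only shows that \<open>M\<close> is
      nonnegative.\<close>
    obtain V1 where "approx_solution T' l M 1 V1" using approx[OF T', of 1] by auto
    then have M: "0 \<le> M"
    proof (rule approx_solutionE)
      fix Vt X assume "\<And>t x. t \<in> {0..T'} \<Longrightarrow> \<bar>V1 (t, x)\<bar> \<le> M \<and> \<bar>Vt (t, x)\<bar> \<le> M \<and> (\<forall>i. \<bar>X i (t, x)\<bar> \<le> M) \<and>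
         \<bar>Vt (t, x) + V1 (t, x) * (\<Sum>i\<in>UNIV. X i (t, x))\<bar> \<le> 1"
      from this[of 0 0] T' have "\<bar>V1 (0, 0)\<bar> \<le> M" by simp
      then show "0 \<le> M" by linarith
    qed
    define SC where "SC = step_const d M ubar C1"
    have SC: "0 \<le> SC"
      unfolding SC_def step_const_def flux_const_def energy_const_def consistency_const_def dissipation_const_def
      using M ub0 C1 d by (auto intro!: add_nonneg_nonneg mult_nonneg_nonneg divide_nonneg_nonneg)
    \<comment> \<open>\<open>Z * \<theta>\<close> will bound the relative entropy: the initial part
      contributes \<open>2 * vol\<close>, and the 5 counts residual, Taylor error,
      \<open>dt / h\<close>, its cube over \<open>h\<close>, and \<open>sqrt h\<close>, each below
      \<open>\<theta>\<close>.\<close>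
    define Z where "Z = exp (d * M * T) * (2 * vol + T * (vol * (SC * 5)))"
    have Z: "0 \<le> Z" unfolding Z_def using vol T SC by simp
    \<comment> \<open>\<open>H * \<theta>\<close> collects the relative entropy and the distance to
      \<open>V\<close>; the 8 is \<open>2 * (2 * \<theta>)\<^sup>2\<close> after bounding the square
      of \<open>\<theta>\<close> by \<open>\<theta>\<close>.\<close>
    define H where "H = T * K * (4 * Z + 8 * vol)"
    have H: "0 \<le> H" unfolding H_def using T K Z vol by simp
    define \<theta> where "\<theta> = min 1 (e / (3 * (H + 1)))"
    have \<theta>: "0 < \<theta>" "\<theta> \<le> 1" unfolding \<theta>_def using e H by auto
    have \<theta>2: "\<theta>\<^sup>2 \<le> \<theta>" using \<theta> by (simp add: power2_eq_square mult_left_le)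
    have part2: "H * \<theta> \<le> e / 3"
    proof -
      have "H * \<theta> \<le> (H + 1) * (e / (3 * (H + 1)))" unfolding \<theta>_def using H e by (intro mult_mono) auto
      also have "\<dots> = e / 3" using H by (simp add: field_simps)
      finally show ?thesis .
    qed
    obtain V where V: "approx_solution T' l M \<theta> V" and VU: "\<And>t x. t \<in> {0..T'} \<Longrightarrow> \<bar>V (t, x) - U (t, x)\<bar> \<le> \<theta>"
      using approx[OF T' \<theta>(1)] by blast
    obtain Vt X where Vper: "\<And>t. t \<in> {0..T'} \<Longrightarrow> periodic l (\<lambda>x. V (t, x))"
      and Vb: "\<And>t x. t \<in> {0..T'} \<Longrightarrow> \<bar>V (t, x)\<bar> \<le> M \<and> \<bar>Vt (t, x)\<bar> \<le> M \<and> (\<forall>i. \<bar>X i (t, x)\<bar> \<le> M) \<and>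
         \<bar>Vt (t, x) + V (t, x) * (\<Sum>i\<in>UNIV. X i (t, x))\<bar> \<le> \<theta>"
      and Vm: "\<And>\<eta>. 0 < \<eta> \<Longrightarrow> \<exists>\<rho>>0. \<forall>s t x. 0 < s \<and> s < \<rho> \<and> t \<in> {0..T'} \<longrightarrow>
         (t + s \<le> T' \<longrightarrow> \<bar>V (t + s, x) - V (t, x) - s * Vt (t, x)\<bar> \<le> \<eta> * s) \<and>
         (\<forall>i. \<bar>V (t, x + s *\<^sub>R axis i 1) - V (t, x) - s * X i (t, x)\<bar> \<le> \<eta> * s)"
      by (rule approx_solutionE[OF V]) (rule that)
    obtain \<rho> where \<rho>: "0 < \<rho>" and mod: "\<And>s t x. 0 < s \<Longrightarrow> s < \<rho> \<Longrightarrow> t \<in> {0..T'} \<Longrightarrow>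
         (t + s \<le> T' \<longrightarrow> \<bar>V (t + s, x) - V (t, x) - s * Vt (t, x)\<bar> \<le> \<theta> * s) \<and>
         (\<forall>i. \<bar>V (t, x + s *\<^sub>R axis i 1) - V (t, x) - s * X i (t, x)\<bar> \<le> \<theta> * s)"
    proof -
      from Vm[OF \<theta>(1)] obtain \<rho> where "0 < \<rho>" and m: "\<forall>s t x. 0 < s \<and> s < \<rho> \<and> t \<in> {0..T'} \<longrightarrow>
         (t + s \<le> T' \<longrightarrow> \<bar>V (t + s, x) - V (t, x) - s * Vt (t, x)\<bar> \<le> \<theta> * s) \<and>
         (\<forall>i. \<bar>V (t, x + s *\<^sub>R axis i 1) - V (t, x) - s * X i (t, x)\<bar> \<le> \<theta> * s)" by (elim exE conjE)
      show thesis by (rule that[OF \<open>0 < \<rho>\<close>]) (use m in simp)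
    qed
    obtain \<rho>' where \<rho>': "0 < \<rho>'" and uc: "\<And>t s x y. t \<in> {0..T} \<Longrightarrow> s \<in> {0..T} \<Longrightarrow> \<bar>t - s\<bar> < \<rho>' \<Longrightarrow> dist x y < \<rho>' \<Longrightarrow>
        \<bar>U (t, x) - U (s, y)\<bar> < \<theta>"
      using periodic_uniformly_continuous[OF l Ucont Uper \<theta>(1)] by metis
    have pos: "\<And>n. 0 < dt n \<and> 0 < h n" using steps by auto
    note lims = mesh_ratio_limits[OF h0 pos \<alpha>]
    have "(\<lambda>n. sqrt (h n)) \<longlonglongrightarrow> 0" using tendsto_real_sqrt[OF h0] by simp
    then have "\<forall>\<^sub>F n in sequentially. sqrt (h n) < \<theta>" by (rule order_tendstoD(2)) (rule \<theta>)
    moreover have "\<forall>\<^sub>F n in sequentially. dt n / h n < \<theta>" by (rule order_tendstoD(2)[OF lims(1) \<theta>(1)])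
    moreover have "\<forall>\<^sub>F n in sequentially. (dt n / h n) ^ 3 / h n < \<theta>" by (rule order_tendstoD(2)[OF lims(2) \<theta>(1)])
    moreover have "\<forall>\<^sub>F n in sequentially. dt n < min \<rho> \<rho>'" using \<rho> \<rho>' by (intro order_tendstoD(2)[OF lims(3)]) auto
    moreover have "\<forall>\<^sub>F n in sequentially. h n < min \<rho> (\<rho>' / d)" using \<rho> \<rho>' d by (intro order_tendstoD(2)[OF h0]) auto
    ultimately show ?thesis
    proof eventually_elim
      case (elim n)
      obtain k where "mesh l (h n) k" using mesh by blast
      then interpret mesh l "org n" "h n" k .
      have dh: "d * h n < \<rho>'" using elim(5) d by (simp add: field_simps)
      \<comment> \<open>One \<open>\<theta>\<close> for the modulus of continuity of
        \<open>U\<close> within a space-time cell, one for the distance from \<open>U\<close> to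
        \<open>V\<close> at the node.\<close>
      have close: "\<bar>U (t, x) - V (real m * dt n, center (org n) (h n) j)\<bar> \<le> 2 * \<theta>"
        if m: "real m * dt n \<le> t" "t < real (Suc m) * dt n" "t \<le> T'" and x: "x \<in> cell (org n) (h n) j" for m t j x
      proof -
        have "0 \<le> real m * dt n" using steps[of n] by simp
        then have mt: "real m * dt n \<in> {0..T'}" "t \<in> {0..T}" "real m * dt n \<in> {0..T}" using m T' by auto
        have "\<bar>t - real m * dt n\<bar> < \<rho>'" using m elim(4) by (auto simp: algebra_simps)
        moreover have "dist x (center (org n) (h n) j) < \<rho>'"
          using cell_diameter[OF h x center_in_cell[OF h]] dh unfolding d_def by simp
        ultimately have "\<bar>U (t, x) - U (real m * dt n, center (org n) (h n) j)\<bar> < \<theta>" using mt by (intro uc) auto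
        then show ?thesis using VU[OF mt(1), of "center (org n) (h n) j"] by linarith
      qed
      have lam1: "dt n / h n \<le> 1" using elim(2) \<theta> by linarith
      define R where "R = (\<lambda>m. h n ^ CARD('d) * (\<Sum>j\<in>S. (uh n (real m * dt n, center (org n) (h n) j) - V (real m * dt n, center (org n) (h n) j))\<^sup>2 / 2))"
      \<comment> \<open>The initial relative entropy is half of
        \<open>(2 * \<theta>)\<^sup>2\<close> on each cell, from \<open>close\<close> at time 0
        averaged by the projection.\<close>
      have R0: "R 0 \<le> 2 * vol * \<theta>"
      proof -
        have "\<bar>uh n (0, center (org n) (h n) j) - V (0, center (org n) (h n) j)\<bar> \<le> 2 * \<theta>" for j
        proof -
          have "uh n (0, center (org n) (h n) j) = proj_Q (org n) (h n) u0 (center (org n) (h n) j)"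
            using sol[of n] unfolding stabilized_GRP_solution_def Let_def by auto
          then show ?thesis
            using close[of 0 0] T' steps[of n] T
            by (auto intro!: proj_Q_approx[OF ae] continuous_slice[OF Ucont])
        qed
        then have "\<bar>uh n (0, center (org n) (h n) j) - V (0, center (org n) (h n) j)\<bar>\<^sup>2 \<le> (2 * \<theta>)\<^sup>2" for j
          by (intro power_mono) auto
        then have "(uh n (0, center (org n) (h n) j) - V (0, center (org n) (h n) j))\<^sup>2 \<le> (2 * \<theta>)\<^sup>2" for j
          unfolding power2_abs .
        then have "(\<Sum>j\<in>S. (uh n (0, center (org n) (h n) j) - V (0, center (org n) (h n) j))\<^sup>2 / 2) \<le> (\<Sum>j\<in>S. 2 * \<theta>\<^sup>2)"
          by (intro sum_mono) (simp add: power_mult_distrib)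
        then have "R 0 \<le> h n ^ CARD('d) * (\<Sum>j\<in>S. 2 * \<theta>\<^sup>2)" unfolding R_def using h by (auto intro!: mult_left_mono)
        also have "\<dots> = 2 * vol * \<theta>\<^sup>2" using card_S unfolding vol_def by (simp add: mult_ac)
        also have "\<dots> \<le> 2 * vol * \<theta>" using \<theta>2 vol by (intro mult_left_mono) auto
        finally show ?thesis .
      qed
      have Rm: "R m \<le> Z * \<theta>" if m: "real m * dt n \<le> T'" for m
      proof -
        have "R m \<le> exp (real CARD('d) * M * T) * (R 0 + T * ((\<Prod>i\<in>UNIV. l $ i) *
          (step_const (real CARD('d)) M ubar C1 * (\<theta> + \<theta> + dt n / h n + (dt n / h n) ^ 3 / h n + sqrt (h n)))))"
          unfolding R_def dt
          by (rule relative_entropy_bound[where \<rho> = \<rho>, OF sol T N C1 _ bound T' Vper Vb \<theta> mod])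
            (use elim m steps[of n] \<theta> lam1 in \<open>auto simp: dt[symmetric]\<close>)
        also have "\<dots> \<le> exp (d * M * T) * (2 * vol * \<theta> + T * (vol * (SC * (5 * \<theta>))))"
          unfolding d_def[symmetric] vol_def[symmetric] SC_def[symmetric]
          using R0 elim T vol SC by (intro mult_left_mono add_mono) auto
        also have "\<dots> = Z * \<theta>" unfolding Z_def by (simp add: algebra_simps)
        finally show ?thesis .
      qed
      obtain f' where f': "f' \<in> borel_measurable borel" "\<And>z. z \<in> cylinder T l \<Longrightarrow> \<bar>uh n z - U z\<bar> powr p = f' z"
        using error_measurable[OF sol T N Ucont, of p] by blast
      let ?b = "T * (\<mu> * vol + K * (4 * (Z * \<theta>) + 2 * (2 * \<theta>)\<^sup>2 * vol)) + (T - T') * (C * vol)"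
      have nn: "(\<integral>\<^sup>+z\<in>cylinder T l. ennreal (\<bar>uh n z - U z\<bar> powr p) \<partial>lborel) \<le> ennreal ?b"
        unfolding K_def C_def vol_def
        by (rule error_bound[OF sol T N Ucont Uper A p \<mu> T', where V = V])
          (use close Rm Z \<theta> in \<open>auto simp: dt[symmetric] R_def\<close>)
      have b: "?b \<le> e"
      proof -
        have "K * (4 * (Z * \<theta>) + 2 * (2 * \<theta>)\<^sup>2 * vol) \<le> K * (4 * (Z * \<theta>) + 8 * \<theta> * vol)"
          using \<theta>2 K vol by (intro mult_left_mono add_left_mono mult_right_mono) (auto simp: power_mult_distrib)
        then have "T * (K * (4 * (Z * \<theta>) + 2 * (2 * \<theta>)\<^sup>2 * vol)) \<le> T * (K * (4 * (Z * \<theta>) + 8 * \<theta> * vol))"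
          by (rule mult_left_mono) (use T in simp)
        also have "\<dots> = H * \<theta>" unfolding H_def by (simp add: algebra_simps)
        finally show ?thesis using part1 part2 part3 by (simp add: distrib_left)
      qed
      have b0: "0 \<le> ?b" using T vol \<mu> K Z \<theta> T' by (intro add_nonneg_nonneg mult_nonneg_nonneg) (auto simp: C_def)
      have "?I n \<le> ?b"
        by (rule set_integrable_of_nn_bound(2)[OF cylinder_measurable f'(1) f'(2) _ nn b0]) auto
      with b show "?I n \<le> e" by linarith
    qed
  qed
  have "?I \<longlonglongrightarrow> 0"
  proof (rule tendstoI)
    fix e :: real assume "0 < e"
    then have "\<forall>\<^sub>F n in sequentially. ?I n \<le> e / 2" by (intro small) auto
    then show "\<forall>\<^sub>F n in sequentially. dist (?I n) 0 < e"
      by eventually_elim (use I0 \<open>0 < e\<close> in \<open>auto simp: abs_of_nonneg\<close>)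
  qed
  then have "(\<lambda>n. ?I n powr (1 / p)) \<longlonglongrightarrow> 0"
    using p I0 by (intro tendsto_zero_powrI[OF _ tendsto_const]) auto
  then show ?thesis unfolding Lp_converges_def using int by blast
qed

section \<open>Smooth functions\<close>

lemma frechet_derivative_eq: "(v has_derivative v') (at z) \<Longrightarrow> frechet_derivative v (at z) = v'"
  by (rule frechet_derivative_at[symmetric])

lemma Ck_Suc_D: "Ck (Suc k) v \<Longrightarrow> Ck k v"
proof (induction k arbitrary: v)
  case 0
  then show ?case
    by (auto simp: continuous_on_eq_continuous_at intro: differentiable_imp_continuous_within)
next
  case (Suc k)
  then show ?case by (simp del: Ck.simps(1))
qed

lemma Ck_imp_continuous: "Ck k v \<Longrightarrow> continuous_on UNIV v"
  by (induction k) (auto dest: Ck_Suc_D simp del: Ck.simps(2))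

lemma Ck_const: "Ck k (\<lambda>z. c)"
proof (induction k arbitrary: c)
  case (Suc k)
  then show ?case by simp
qed simp

lemma Ck_add: "Ck k v \<Longrightarrow> Ck k w \<Longrightarrow> Ck k (\<lambda>z. v z + w z)"
proof (induction k arbitrary: v w)
  case 0 then show ?case by (auto intro: continuous_intros)
next
  case (Suc k)
  have d: "v differentiable (at z)" "w differentiable (at z)" for z using Suc.prems by auto
  have "frechet_derivative (\<lambda>z. v z + w z) (at z) e = frechet_derivative v (at z) e + frechet_derivative w (at z) e" for z e
    by (subst frechet_derivative_eq[OF has_derivative_add[OF
          frechet_derivative_works[THEN iffD1, OF d(1)] frechet_derivative_works[THEN iffD1, OF d(2)]]]) simp
  then show ?case using Suc d by (auto intro: differentiable_add)
qed

lemma Ck_mult: "Ck k v \<Longrightarrow> Ck k w \<Longrightarrow> Ck k (\<lambda>z. v z * w z)"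
proof (induction k arbitrary: v w)
  case 0 then show ?case by (auto intro: continuous_intros)
next
  case (Suc k)
  have d: "v differentiable (at z)" "w differentiable (at z)" for z using Suc.prems by auto
  have eq: "frechet_derivative (\<lambda>z. v z * w z) (at z) e = v z * frechet_derivative w (at z) e + frechet_derivative v (at z) e * w z" for z e
    by (subst frechet_derivative_eq[OF has_derivative_mult[OF
          frechet_derivative_works[THEN iffD1, OF d(1)] frechet_derivative_works[THEN iffD1, OF d(2)]]]) simp
  have "Ck k (\<lambda>z. v z * frechet_derivative w (at z) e + frechet_derivative v (at z) e * w z)" if "e \<in> Basis" for e
    using that Suc.prems Ck_Suc_D[OF Suc.prems(1)] Ck_Suc_D[OF Suc.prems(2)]
    by (intro Ck_add Suc.IH) auto
  then show ?case using d by (auto simp: eq intro: differentiable_mult)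
qed

lemma Ck_prod: "(\<And>i. i \<in> I \<Longrightarrow> Ck k (v i)) \<Longrightarrow> Ck k (\<lambda>z. \<Prod>i\<in>I. v i z)"
  by (induction I rule: infinite_finite_induct) (auto intro: Ck_const Ck_mult)

lemma Ck_affine: "Ck k (\<lambda>z. z \<bullet> a + c)"
proof (cases k)
  case 0 then show ?thesis by (simp add: continuous_on_add continuous_on_inner continuous_on_id continuous_on_const)
next
  case (Suc j)
  have "((\<lambda>z. z \<bullet> a + c) has_derivative (\<lambda>e. e \<bullet> a)) (at z)" for z
    by (auto intro!: derivative_eq_intros)
  from frechet_derivative_eq[OF this] this show ?thesis
    unfolding Suc by (auto simp: differentiable_def intro: Ck_const)
qed

text \<open>\<open>G n\<close> plays the n-th derivative of \<open>G 0\<close>. With the whole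
  sequence in the hypothesis, the chain rule stays inside the induction and merely raises the
  index.\<close>

lemma Ck_compose:
  fixes G :: "nat \<Rightarrow> real \<Rightarrow> real"
  assumes G: "\<And>n x. (G n has_real_derivative G (Suc n) x) (at x)"
  shows "Ck k v \<Longrightarrow> Ck k (\<lambda>z. G n (v z))"
proof (induction k arbitrary: n v)
  case 0
  have "continuous_on UNIV (G n)"
    by (simp add: continuous_on_eq_continuous_at DERIV_isCont[OF G])
  with 0 show ?case by (auto intro: continuous_on_compose2)
next
  case (Suc k)
  have d: "(v has_derivative frechet_derivative v (at z)) (at z)" for z
    using Suc.prems frechet_derivative_works by auto
  have D: "((\<lambda>z. G n (v z)) has_derivative (\<lambda>e. G (Suc n) (v z) * frechet_derivative v (at z) e)) (at z)" for z
    using has_derivative_compose[OF d G[unfolded has_field_derivative_def]] by simp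
  have "Ck k (\<lambda>z. G (Suc n) (v z) * frechet_derivative v (at z) e)" if "e \<in> Basis" for e
    using that Suc.prems by (intro Ck_mult Suc.IH Ck_Suc_D[OF Suc.prems]) auto
  then show ?case using D by (auto simp: frechet_derivative_eq[OF D] differentiable_def)
qed

lemma smoothI: "(\<And>k. Ck k v) \<Longrightarrow> smooth v" by (simp add: smooth_def)

lemma smooth_mult: "smooth v \<Longrightarrow> smooth w \<Longrightarrow> smooth (\<lambda>z. v z * w z)"
  by (simp add: smooth_def Ck_mult)

lemma smooth_prod: "(\<And>i. i \<in> I \<Longrightarrow> smooth (v i)) \<Longrightarrow> smooth (\<lambda>z. \<Prod>i\<in>I. v i z)"
  by (simp add: smooth_def Ck_prod)

lemma smooth_continuous: "smooth v \<Longrightarrow> continuous_on UNIV v"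
  using Ck_imp_continuous by (auto simp: smooth_def)

lemma smooth_has_derivative:
  assumes "smooth v" shows "(v has_derivative frechet_derivative v (at z)) (at z)"
proof -
  have "Ck (Suc 0) v" using assms unfolding smooth_def by blast
  then show ?thesis using frechet_derivative_works by auto
qed

lemma smooth_partial:
  assumes "smooth v" "e \<in> Basis" shows "smooth (\<lambda>z. frechet_derivative v (at z) e)"
proof (rule smoothI)
  fix k
  have "Ck (Suc k) v" using assms unfolding smooth_def by blast
  then show "Ck k (\<lambda>z. frechet_derivative v (at z) e)" using assms by simp
qed

lemma smooth_cos: assumes "smooth v" shows "smooth (\<lambda>z. cos (v z))"
proof -
  \<comment> \<open>Each derivative of the cosine is a shift by a quarter period, which gives the
    sequence for \<open>Ck_compose\<close>.\<close>
  have "((\<lambda>x. cos (x + real n * (pi / 2))) has_real_derivative cos (x + real (Suc n) * (pi / 2))) (at x)" for n x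
  proof -
    have "x + real (Suc n) * (pi / 2) = (x + real n * (pi / 2)) + pi / 2" by (simp add: algebra_simps)
    then have "cos (x + real (Suc n) * (pi / 2)) = - sin (x + real n * (pi / 2))"
      by (simp only: cos_add) simp
    then show ?thesis by (auto intro!: derivative_eq_intros)
  qed
  then have "Ck k (\<lambda>z. cos (v z + real 0 * (pi / 2)))" for k
    using assms unfolding smooth_def by (intro Ck_compose[where G = "\<lambda>n x. cos (x + real n * (pi / 2))"]) auto
  then show ?thesis by (intro smoothI) simp
qed

text \<open>\<open>bump_deriv p\<close> with \<open>p = 1\<close> is the standard smooth function that vanishes exactly on the
  negative half-line; the class of all \<open>bump_deriv p\<close> is closed under differentiation.\<close>

definition bump_deriv :: "real poly \<Rightarrow> real \<Rightarrow> real" where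
  "bump_deriv p t = (if 0 < t then poly p (1 / t) * exp (- (1 / t)) else 0)"

lemma poly_div_exp_0: "((\<lambda>x. poly p x / exp x) \<longlongrightarrow> 0) (at_top :: real filter)"
proof -
  have "((\<lambda>x. \<Sum>i\<le>degree p. coeff p i * (x ^ i / exp x)) \<longlongrightarrow> (\<Sum>i\<le>degree p. coeff p i * 0)) (at_top :: real filter)"
    by (intro tendsto_sum tendsto_mult tendsto_const tendsto_power_div_exp_0)
  then show ?thesis by (simp add: poly_altdef sum_divide_distrib)
qed

lemma bump_deriv_tendsto_0: "(bump_deriv p \<longlongrightarrow> 0) (at_right 0)"
proof -
  have "((\<lambda>t. poly p (inverse t) / exp (inverse t)) \<longlongrightarrow> 0) (at_right (0::real))"
    by (rule filterlim_compose[OF poly_div_exp_0 filterlim_inverse_at_top_right])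
  moreover have "\<forall>\<^sub>F t in at_right 0. poly p (inverse t) / exp (inverse t) = bump_deriv p t"
    by (intro eventually_at_rightI[of 0 1]) (auto simp: bump_deriv_def exp_minus field_simps)
  ultimately show ?thesis by (rule Lim_transform_eventually)
qed

text \<open>With \<open>x = 1 / t\<close>, the derivative of \<open>p(x) * exp(-x)\<close> in
  \<open>t\<close> is \<open>x^2 * (p(x) - p'(x)) * exp(-x)\<close>; the polynomial
  \<open>[:0, 0, 1:]\<close> is the factor \<open>x^2\<close>.\<close>

lemma bump_deriv_has_derivative:
  "(bump_deriv p has_real_derivative bump_deriv ([:0, 0, 1:] * (p - pderiv p)) t) (at t)"
proof -
  consider "t < 0" | "t = 0" | "0 < t" by linarith
  then show ?thesis
  proof cases
    case 1
    have "(bump_deriv p has_real_derivative 0) (at t)"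
      by (rule has_field_derivative_transform_within_open[of "\<lambda>t. 0" 0 t "{..<0}"])
        (use 1 in \<open>auto simp: bump_deriv_def\<close>)
    then show ?thesis using 1 by (simp add: bump_deriv_def)
  next
    case 2
    \<comment> \<open>The difference quotient at 0 from the right is again of the class, with
      polynomial \<open>x * p(x)\<close>, and so tends to 0.\<close>
    have "((\<lambda>s. bump_deriv p s / s) \<longlongrightarrow> 0) (at_right 0)"
    proof (rule Lim_transform_eventually[OF bump_deriv_tendsto_0])
      show "\<forall>\<^sub>F s in at_right 0. bump_deriv ([:0, 1:] * p) s = bump_deriv p s / s"
        by (intro eventually_at_rightI[of 0 1]) (auto simp: bump_deriv_def)
    qed
    moreover have "((\<lambda>s. bump_deriv p s / s) \<longlongrightarrow> 0) (at_left 0)"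
    proof (rule Lim_transform_eventually[OF tendsto_const])
      show "\<forall>\<^sub>F s in at_left 0. 0 = bump_deriv p s / s"
        by (intro eventually_at_leftI[of "-1"]) (auto simp: bump_deriv_def)
    qed
    ultimately have "((\<lambda>s. bump_deriv p s / s) \<longlongrightarrow> 0) (at 0)" by (rule filterlim_split_at[rotated])
    then show ?thesis using 2 by (simp add: has_field_derivative_iff bump_deriv_def)
  next
    case 3
    let ?f = "\<lambda>t. poly p (1 / t) * exp (- (1 / t))"
    have "(?f has_real_derivative bump_deriv ([:0, 0, 1:] * (p - pderiv p)) t) (at t)"
      using 3 by (auto intro!: derivative_eq_intros poly_DERIV[THEN DERIV_chain2]
          simp: bump_deriv_def power2_eq_square field_simps)
    then show ?thesis
      by (rule has_field_derivative_transform_within_open[of _ _ t "{0<..}"])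
        (use 3 in \<open>auto simp: bump_deriv_def\<close>)
  qed
qed

definition bump :: "real \<Rightarrow> real" where "bump t = (if 0 < t then exp (- (1 / t)) else 0)"

lemma bump_nonneg: "0 \<le> bump t" by (simp add: bump_def)

lemma bump_le_1: "bump t \<le> 1" by (simp add: bump_def)

lemma bump_pos_iff: "0 < bump t \<longleftrightarrow> 0 < t" by (simp add: bump_def)

lemma bump_eq_0_iff: "bump t = 0 \<longleftrightarrow> t \<le> 0" by (auto simp: bump_def)

lemma smooth_bump: assumes "smooth v" shows "smooth (\<lambda>z. bump (v z))"
proof -
  \<comment> \<open>The polynomials of the successive derivatives, starting from the constant
    1.\<close>
  define P where "P = rec_nat [:1:] (\<lambda>_ p. [:0, 0, 1:] * (p - pderiv p :: real poly))"
  have "(bump_deriv (P n) has_real_derivative bump_deriv (P (Suc n)) x) (at x)" for n x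
    unfolding P_def using bump_deriv_has_derivative by simp
  then have "Ck k (\<lambda>z. bump_deriv (P 0) (v z))" for k
    using assms unfolding smooth_def by (intro Ck_compose[where G = "\<lambda>n. bump_deriv (P n)"]) auto
  then have "smooth (\<lambda>z. bump_deriv (P 0) (v z))" by (rule smoothI)
  moreover have "bump_deriv (P 0) = bump" by (auto simp: P_def bump_deriv_def bump_def)
  ultimately show ?thesis by simp
qed

section \<open>Integration by parts on the cylinder\<close>

lemma axis_dir_bounds:
  fixes e :: "real \<times> (real ^ 'd)" assumes "e \<in> Basis" shows "\<bar>fst e\<bar> \<le> 1" "norm (snd e) \<le> 1"
  using assms by (auto simp: Basis_prod_def)

text \<open>Mean value inequality along the segment with the uniform modulus of the partial
  derivative. Derivatives within the closed slab suffice, so the end times are included.\<close>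

lemma periodic_uniform_taylor:
  fixes g g' :: "real \<times> (real ^ 'd) \<Rightarrow> real"
  assumes l: "\<And>i. 0 < l $ i" and e: "e \<in> Basis"
    and D: "\<And>z. fst z \<in> {a..b} \<Longrightarrow> (g has_derivative D z) (at z within ({a..b} \<times> UNIV))"
    and g': "\<And>z. fst z \<in> {a..b} \<Longrightarrow> g' z = D z e"
    and cont: "continuous_on ({a..b} \<times> UNIV) g'"
    and per: "\<And>t. t \<in> {a..b} \<Longrightarrow> periodic l (\<lambda>x. g' (t, x))" and \<eta>: "0 < \<eta>"
  shows "\<exists>\<rho>>0. \<forall>z s. 0 < s \<and> s < \<rho> \<and> fst z \<in> {a..b} \<and> fst (z + s *\<^sub>R e) \<in> {a..b} \<longrightarrow>
     \<bar>g (z + s *\<^sub>R e) - g z - s * g' z\<bar> \<le> \<eta> * s"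
proof -
  obtain \<rho> where \<rho>: "0 < \<rho>" and uc: "\<And>t s x y. t \<in> {a..b} \<Longrightarrow> s \<in> {a..b} \<Longrightarrow> \<bar>t - s\<bar> < \<rho> \<Longrightarrow> dist x y < \<rho> \<Longrightarrow>
      \<bar>g' (t, x) - g' (s, y)\<bar> < \<eta>"
    using periodic_uniformly_continuous[OF l cont per \<eta>] by metis
  have "\<bar>g (z + s *\<^sub>R e) - g z - s * g' z\<bar> \<le> \<eta> * s"
    if s: "0 < s" "s < \<rho>" and z: "fst z \<in> {a..b}" "fst (z + s *\<^sub>R e) \<in> {a..b}" for z s
  proof -
    \<comment> \<open>A basis vector advances time by 0 or 1, so the times along the segment lie
      between those of its end points.\<close>
    have inI: "fst (z + \<sigma> *\<^sub>R e) \<in> {a..b}" if "\<sigma> \<in> {0..s}" for \<sigma>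
    proof -
      have "fst e = 0 \<or> fst e = 1" using e by (auto simp: Basis_prod_def)
      then show ?thesis using z that s by auto
    qed
    have der: "((\<lambda>\<sigma>. g (z + \<sigma> *\<^sub>R e) - \<sigma> * g' z) has_field_derivative g' (z + \<sigma> *\<^sub>R e) - g' z) (at \<sigma> within {0..s})"
      if \<sigma>: "\<sigma> \<in> {0..s}" for \<sigma>
    proof -
      have 1: "((\<lambda>\<sigma>. z + \<sigma> *\<^sub>R e) has_derivative (\<lambda>t. t *\<^sub>R e)) (at \<sigma> within {0..s})"
        by (auto intro!: derivative_eq_intros)
      have sub: "(\<lambda>\<sigma>. z + \<sigma> *\<^sub>R e) ` {0..s} \<subseteq> {a..b} \<times> UNIV"
      proof
        fix w assume "w \<in> (\<lambda>\<sigma>. z + \<sigma> *\<^sub>R e) ` {0..s}"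
        then obtain \<sigma> where "w = z + \<sigma> *\<^sub>R e" "\<sigma> \<in> {0..s}" by (rule imageE)
        then show "w \<in> {a..b} \<times> UNIV" using inI[of \<sigma>] by (auto simp: mem_Times_iff)
      qed
      have 2: "((\<lambda>\<sigma>. g (z + \<sigma> *\<^sub>R e)) has_derivative (\<lambda>t. D (z + \<sigma> *\<^sub>R e) (t *\<^sub>R e))) (at \<sigma> within {0..s})"
        by (rule has_derivative_in_compose[OF 1 has_derivative_subset[OF D[OF inI[OF \<sigma>]] sub]])
      have lin: "linear (D (z + \<sigma> *\<^sub>R e))" using D[OF inI[OF \<sigma>]] by (rule has_derivative_linear)
      have "((\<lambda>\<sigma>. g (z + \<sigma> *\<^sub>R e)) has_field_derivative g' (z + \<sigma> *\<^sub>R e)) (at \<sigma> within {0..s})"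
        using 2 unfolding has_field_derivative_def g'[OF inI[OF \<sigma>]]
        by (simp add: linear_cmul[OF lin] mult.commute[of _ "D (z + \<sigma> *\<^sub>R e) e"])
      then show ?thesis by (auto intro!: derivative_eq_intros)
    qed
    have bnd: "norm (g' (z + \<sigma> *\<^sub>R e) - g' z) \<le> \<eta>" if "\<sigma> \<in> {0..s}" for \<sigma>
    proof -
      have "\<bar>\<sigma> * fst e\<bar> \<le> \<sigma> * 1" "norm (\<sigma> *\<^sub>R snd e) \<le> \<sigma> * 1"
        using that axis_dir_bounds[OF e] unfolding abs_mult norm_scaleR
        by (auto intro!: mult_left_mono simp del: mult_1_right)
      then have "\<bar>fst (z + \<sigma> *\<^sub>R e) - fst z\<bar> < \<rho>" "dist (snd (z + \<sigma> *\<^sub>R e)) (snd z) < \<rho>"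
        using that s by (auto simp: dist_norm)
      from uc[OF inI[OF that] z(1) this] show ?thesis unfolding prod.collapse real_norm_def by (rule less_imp_le)
    qed
    have "norm ((g (z + s *\<^sub>R e) - s * g' z) - (g (z + 0 *\<^sub>R e) - 0 * g' z)) \<le> \<eta> * norm (s - 0)"
      by (rule field_differentiable_bound[OF _ der bnd]) (use s in auto)
    then show ?thesis using s by simp
  qed
  then show ?thesis using \<rho> by blast
qed

text \<open>The slab is enlarged by 1 on each side. A step shorter than 1 that leaves it starts and
  ends where the function vanishes.\<close>

lemma compact_uniform_taylor:
  fixes g g' :: "real \<times> (real ^ 'd) \<Rightarrow> real"
  assumes l: "\<And>i. 0 < l $ i" and e: "e \<in> Basis"
    and D: "\<And>z. (g has_derivative D z) (at z)" and g': "\<And>z. g' z = D z e"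
    and cont: "continuous_on UNIV g'" and per: "\<And>t. periodic l (\<lambda>x. g' (t, x))"
    and zero: "\<And>z. fst z \<notin> {a..b} \<Longrightarrow> g z = 0 \<and> g' z = 0" and \<eta>: "0 < \<eta>"
  shows "\<exists>\<rho>>0. \<forall>z s. 0 < s \<and> s < \<rho> \<longrightarrow> \<bar>g (z + s *\<^sub>R e) - g z - s * g' z\<bar> \<le> \<eta> * s"
proof -
  have "\<exists>\<rho>>0. \<forall>z s. 0 < s \<and> s < \<rho> \<and> fst z \<in> {a - 1..b + 1} \<and> fst (z + s *\<^sub>R e) \<in> {a - 1..b + 1} \<longrightarrow>
     \<bar>g (z + s *\<^sub>R e) - g z - s * g' z\<bar> \<le> \<eta> * s"
    by (rule periodic_uniform_taylor[OF l e has_derivative_at_withinI[OF D] g' continuous_on_subset[OF cont] per \<eta>]) auto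
  then obtain \<rho> where \<rho>: "0 < \<rho>" and tay: "\<And>z s. 0 < s \<and> s < \<rho> \<and> fst z \<in> {a - 1..b + 1} \<and> fst (z + s *\<^sub>R e) \<in> {a - 1..b + 1} \<longrightarrow>
     \<bar>g (z + s *\<^sub>R e) - g z - s * g' z\<bar> \<le> \<eta> * s" by blast
  have "\<bar>g (z + s *\<^sub>R e) - g z - s * g' z\<bar> \<le> \<eta> * s" if s: "0 < s" "s < min \<rho> 1" for z s
  proof (cases "fst z \<in> {a - 1..b + 1} \<and> fst (z + s *\<^sub>R e) \<in> {a - 1..b + 1}")
    case True then show ?thesis using tay s by auto
  next
    case False
    have "fst e = 0 \<or> fst e = 1" using e by (auto simp: Basis_prod_def)
    then have "fst z \<notin> {a..b} \<and> fst (z + s *\<^sub>R e) \<notin> {a..b}" using False s by auto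
    then show ?thesis using zero \<eta> s by simp
  qed
  then show ?thesis using \<rho> by (intro exI[of _ "min \<rho> 1"]) auto
qed

section \<open>Integrals over the full time strip\<close>

abbreviation strip :: "real ^ 'd \<Rightarrow> (real \<times> (real ^ 'd)) set" where "strip l \<equiv> UNIV \<times> torus l"

lemma strip_measurable [measurable]: "strip l \<in> sets borel"
  unfolding borel_prod[symmetric] by (intro pair_measureI) auto

lemma strip_box_emeasure:
  assumes l: "\<And>i. 0 < l $ i" and ab: "a \<le> b"
  shows "emeasure lborel ({a..b} \<times> torus l) = ennreal ((b - a) * (\<Prod>i\<in>UNIV. l $ i))"
proof -
  have "emeasure lborel ({a..b} \<times> torus l) = emeasure (lborel \<Otimes>\<^sub>M lborel) ({a..b} \<times> torus l)"
    by (simp add: lborel_prod)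
  also have "\<dots> = emeasure lborel {a..b} * emeasure lborel (torus l)"
    by (rule lborel.emeasure_pair_measure_Times) auto
  finally show ?thesis using ab by (simp add: emeasure_torus[OF l] ennreal_mult'[symmetric])
qed

lemma strip_integrable:
  fixes g :: "real \<times> (real ^ 'd) \<Rightarrow> real"
  assumes l: "\<And>i. 0 < l $ i" and g: "g \<in> borel_measurable borel" and bnd: "\<And>z. \<bar>g z\<bar> \<le> B"
    and zero: "\<And>z. fst z \<notin> {a..b} \<Longrightarrow> g z = 0" and ab: "a \<le> b"
  shows "set_integrable lborel (strip l) g"
    and "\<bar>LINT z:strip l|lborel. g z\<bar> \<le> B * ((b - a) * (\<Prod>i\<in>UNIV. l $ i))"
proof -
  let ?R = "{a..b} \<times> torus l"
  have R [measurable]: "?R \<in> sets borel" unfolding borel_prod[symmetric] by (intro pair_measureI) auto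
  have fin: "integrable lborel (\<lambda>z. B * indicator ?R z)"
    by (intro integrable_mult_right integrable_real_indicator) (auto simp: strip_box_emeasure[OF l ab])
  have le: "norm (indicator (strip l) z *\<^sub>R g z) \<le> B * indicator ?R z" for z
    using bnd[of z] zero[of z] by (cases z) (auto simp: indicator_def)
  have B: "0 \<le> B" using bnd[of undefined] by linarith
  have m: "(\<lambda>z. indicator (strip l) z *\<^sub>R g z) \<in> borel_measurable lborel" using g by simp
  show "set_integrable lborel (strip l) g"
    unfolding set_integrable_def
    by (rule Bochner_Integration.integrable_bound[OF fin m]) (use le B in \<open>auto intro!: AE_I2 order_trans[OF le]\<close>)
  have "\<bar>LINT z:strip l|lborel. g z\<bar> \<le> (LINT z|lborel. B * indicator ?R z)"
    unfolding set_lebesgue_integral_def real_norm_def[symmetric]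
    using fin le \<open>set_integrable lborel (strip l) g\<close> unfolding set_integrable_def
    by (intro order_trans[OF integral_norm_bound] integral_mono) auto
  also have "\<dots> = B * ((b - a) * (\<Prod>i\<in>UNIV. l $ i))"
  proof -
    have "0 \<le> (b - a) * (\<Prod>i\<in>UNIV. l $ i)"
      using ab less_imp_le[OF l] by (intro mult_nonneg_nonneg prod_nonneg) auto
    then show ?thesis using strip_box_emeasure[OF l ab] by (simp add: measure_def)
  qed
  finally show "\<bar>LINT z:strip l|lborel. g z\<bar> \<le> B * ((b - a) * (\<Prod>i\<in>UNIV. l $ i))" .
qed

lemma strip_compact_bounded:
  fixes g :: "real \<times> (real ^ 'd) \<Rightarrow> real"
  assumes l: "\<And>i. 0 < l $ i" and cont: "continuous_on UNIV g" and per: "\<And>t. periodic l (\<lambda>x. g (t, x))"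
    and zero: "\<And>z. fst z \<notin> {a..b} \<Longrightarrow> g z = 0"
  obtains B where "0 \<le> B" "\<And>z. \<bar>g z\<bar> \<le> B"
proof -
  obtain B where B: "0 \<le> B" "\<And>t x. t \<in> {a..b} \<Longrightarrow> \<bar>g (t, x)\<bar> \<le> B"
    using periodic_bounded[OF l continuous_on_subset[OF cont], of a b] per by auto
  have "\<bar>g z\<bar> \<le> B" for z using B zero[of z] by (cases z; cases "fst z \<in> {a..b}") auto
  with B show thesis using that by blast
qed

text \<open>A difference quotient integrates to zero by translation invariance, and it approximates
  the derivative uniformly on a set of finite measure. This treats time and space directions at once
  and avoids iterated integrals.\<close>

lemma strip_divergence_zero:
  fixes g g' :: "real \<times> (real ^ 'd) \<Rightarrow> real"
  assumes l: "\<And>i. 0 < l $ i" and e: "e \<in> Basis" and ab: "a \<le> b"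
    and D: "\<And>z. (g has_derivative D z) (at z)" and g': "\<And>z. g' z = D z e"
    and cont: "continuous_on UNIV g'" and per: "\<And>t. periodic l (\<lambda>x. g (t, x))" "\<And>t. periodic l (\<lambda>x. g' (t, x))"
    and zero: "\<And>z. fst z \<notin> {a..b} \<Longrightarrow> g z = 0 \<and> g' z = 0"
  shows "(LINT z:strip l|lborel. g' z) = 0"
proof -
  have cg: "continuous_on UNIV g" using D by (auto simp: continuous_on_eq_continuous_at intro: has_derivative_continuous)
  have [measurable]: "g \<in> borel_measurable borel" "g' \<in> borel_measurable borel"
    using cg cont by (auto intro: borel_measurable_continuous_onI)
  obtain Bg where Bg: "\<And>z. \<bar>g z\<bar> \<le> Bg" using strip_compact_bounded[OF l cg per(1)] zero by metis
  obtain Bg' where Bg': "\<And>z. \<bar>g' z\<bar> \<le> Bg'" using strip_compact_bounded[OF l cont per(2)] zero by metis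
  have ig: "set_integrable lborel (strip l) g" and ig': "set_integrable lborel (strip l) g'"
    using strip_integrable(1)[OF l _ Bg _ ab] strip_integrable(1)[OF l _ Bg' _ ab] zero by auto
  let ?W = "(b + 1 - (a - 1)) * (\<Prod>i\<in>UNIV. l $ i)"
  have W: "0 < ?W" using ab l by (intro mult_pos_pos prod_pos) auto
  have le: "\<bar>LINT z:strip l|lborel. g' z\<bar> \<le> \<eta> * ?W" if \<eta>: "0 < \<eta>" for \<eta>
  proof -
    obtain \<rho> where \<rho>: "0 < \<rho>" and tay: "\<And>z s. 0 < s \<and> s < \<rho> \<Longrightarrow> \<bar>g (z + s *\<^sub>R e) - g z - s * g' z\<bar> \<le> \<eta> * s"
      using compact_uniform_taylor[OF l e D g' cont per(2) zero \<eta>] by blast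
    define s where "s = min (\<rho> / 2) 1"
    have s: "0 < s" "s < \<rho>" "s \<le> 1" unfolding s_def using \<rho> by auto
    have perg: "g (t, x + \<nu>) = g (t, x)" if "\<nu> \<in> lattice l" for t x \<nu>
      using periodic_lattice[OF per(1) that] .
    have sh: "set_integrable lborel (strip l) (\<lambda>z. g (z + s *\<^sub>R e))"
      "(LINT z:strip l|lborel. g (z + s *\<^sub>R e)) = (LINT z:strip l|lborel. g z)"
      by (rule integral_strip_shift[OF l _ perg ig]; simp)+
    have "(LINT z:strip l|lborel. g (z + s *\<^sub>R e) - g z - s * g' z) = - (s * (LINT z:strip l|lborel. g' z))"
      using sh ig ig' by (simp add: set_integral_diff)
    moreover have "\<bar>LINT z:strip l|lborel. g (z + s *\<^sub>R e) - g z - s * g' z\<bar> \<le> (\<eta> * s) * ?W"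
    proof (rule strip_integrable(2)[OF l])
      show "(\<lambda>z. g (z + s *\<^sub>R e) - g z - s * g' z) \<in> borel_measurable borel" by measurable
      show "\<bar>g (z + s *\<^sub>R e) - g z - s * g' z\<bar> \<le> \<eta> * s" for z using tay s by auto
      show "g (z + s *\<^sub>R e) - g z - s * g' z = 0" if "fst z \<notin> {a - 1..b + 1}" for z
      proof -
        have "fst e = 0 \<or> fst e = 1" using e by (auto simp: Basis_prod_def)
        then have "fst z \<notin> {a..b} \<and> fst (z + s *\<^sub>R e) \<notin> {a..b}" using that s by auto
        then show ?thesis using zero by simp
      qed
    qed (use ab in auto)
    ultimately have "s * \<bar>LINT z:strip l|lborel. g' z\<bar> \<le> s * (\<eta> * ?W)"
      using s by (simp add: abs_mult mult_ac)
    then show ?thesis using s by simp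
  qed
  have "\<bar>LINT z:strip l|lborel. g' z\<bar> \<le> 0 + \<epsilon>" if "0 < \<epsilon>" for \<epsilon>
  proof -
    have "\<epsilon> / ?W * ?W = \<epsilon>" using W by (metis less_irrefl nonzero_eq_divide_eq)
    then show ?thesis using le[OF divide_pos_pos[OF that W]] by linarith
  qed
  then have "\<bar>LINT z:strip l|lborel. g' z\<bar> \<le> 0" by (rule field_le_epsilon)
  then show ?thesis by simp
qed

lemma cylinder_integral_strip:
  fixes g :: "real \<times> (real ^ 'd) \<Rightarrow> real"
  assumes "g \<in> borel_measurable borel" and ab: "0 < a" "b < T" and zero: "\<And>z. fst z \<notin> {a..b} \<Longrightarrow> g z = 0"
  shows "(LINT z:cylinder T l|lebesgue. g z) = (LINT z:strip l|lborel. g z)"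
proof -
  have "indicator (cylinder T l) z *\<^sub>R g z = indicator (strip l) z *\<^sub>R g z" for z
    using zero[of z] ab by (cases z; cases "fst z \<in> {a..b}") (auto simp: indicator_def cylinder_def)
  then have "(\<lambda>z. indicator (cylinder T l) z *\<^sub>R g z) = (\<lambda>z. indicator (strip l) z *\<^sub>R g z)" by (rule ext)
  moreover have "(\<lambda>z. indicator (strip l) z *\<^sub>R g z) \<in> borel_measurable lborel" using assms(1) by simp
  ultimately show ?thesis unfolding set_lebesgue_integral_def by (simp only: integral_completion)
qed

section \<open>Test functions and integration by parts\<close>

abbreviation partial :: "'a::euclidean_space \<Rightarrow> ('a \<Rightarrow> real) \<Rightarrow> 'a \<Rightarrow> real" where
  "partial e v z \<equiv> frechet_derivative v (at z) e"

lemma frechet_derivative_shift: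
  fixes v :: "'a::euclidean_space \<Rightarrow> real"
  assumes "smooth v"
  shows "((\<lambda>z. v (z + c)) has_derivative frechet_derivative v (at (z + c))) (at z)"
    and "partial e (\<lambda>z. v (z + c)) z = partial e v (z + c)"
proof -
  have "((\<lambda>z. z + c) has_derivative (\<lambda>x. x)) (at z)" by (auto intro!: derivative_eq_intros)
  from has_derivative_compose[OF this smooth_has_derivative[OF assms]]
  show 1: "((\<lambda>z. v (z + c)) has_derivative frechet_derivative v (at (z + c))) (at z)" .
  show "partial e (\<lambda>z. v (z + c)) z = partial e v (z + c)" by (simp add: frechet_derivative_eq[OF 1])
qed

lemma partial_periodic:
  fixes v :: "real \<times> (real ^ 'd) \<Rightarrow> real"
  assumes v: "smooth v" and per: "\<And>t. periodic l (\<lambda>x. v (t, x))"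
  shows "periodic l (\<lambda>x. partial e v (t, x))"
  unfolding periodic_def
proof (intro allI)
  fix x i
  have "(\<lambda>z. v (z + (0, axis i (l $ i)))) = v" using per by (auto simp: periodic_def)
  then show "partial e v (t, x + axis i (l $ i)) = partial e v (t, x)"
    using frechet_derivative_shift(2)[OF v, where e = e and c = "(0, axis i (l $ i))" and z = "(t, x)"] by simp
qed

lemma partial_zero_outside:
  fixes v :: "real \<times> (real ^ 'd) \<Rightarrow> real"
  assumes zero: "\<And>z. fst z \<notin> {a..b} \<Longrightarrow> v z = 0" and z: "fst z \<notin> {a..b}"
  shows "(v has_derivative (\<lambda>_. 0)) (at z)" "partial e v z = 0"
proof -
  have "open (- ({a..b} \<times> UNIV) :: (real \<times> (real ^ 'd)) set)" by (intro open_Compl closed_Times) auto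
  then show 1: "(v has_derivative (\<lambda>_. 0)) (at z)"
    by (rule has_derivative_transform_within_open[OF has_derivative_const[of 0 "at z"]])
      (use z zero in \<open>auto simp: mem_Times_iff\<close>)
  show "partial e v z = 0" by (simp add: frechet_derivative_eq[OF 1])
qed

lemma cylinder_testsD:
  assumes "\<psi> \<in> cylinder_tests T l" "0 < T"
  obtains a b where "smooth \<psi>" "\<And>t. periodic l (\<lambda>x. \<psi> (t, x))" "0 < a" "b < T" "a \<le> b" "\<And>z. fst z \<notin> {a..b} \<Longrightarrow> \<psi> z = 0"
proof -
  from assms(1) obtain a b where ab: "0 < a" "b < T" and z: "\<And>t x. t \<notin> {a..b} \<Longrightarrow> \<psi> (t, x) = 0"
    and s: "smooth \<psi>" "\<And>t. periodic l (\<lambda>x. \<psi> (t, x))"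
    unfolding cylinder_tests_def by blast
  \<comment> \<open>The definition of test functions admits an empty time interval; it is widened
    inside \<open>(0, T)\<close> to an ordered one.\<close>
  define a' where "a' = min a (T / 2)"
  have "0 < a'" "b \<le> max a' b" "max a' b < T" "a' \<le> max a' b" using ab assms(2) by (auto simp: a'_def)
  moreover have "\<psi> z = 0" if "fst z \<notin> {a'..max a' b}" for z
  proof -
    have "fst z \<notin> {a..b}" using that unfolding a'_def by (auto simp: min_def max_def split: if_splits)
    then show ?thesis using z[of "fst z" "snd z"] by simp
  qed
  ultimately show thesis using that s by blast
qed

text \<open>\<open>v\<close> is only known for times in \<open>(0, T)\<close>. The product vanishes
  on the open complement of the support slab, and the two open sets cover space-time.\<close>

lemma test_product_continuous:
  fixes v \<psi> :: "real \<times> (real ^ 'd) \<Rightarrow> real"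
  assumes v: "continuous_on ({0<..<T} \<times> UNIV) v" and \<psi>: "continuous_on UNIV \<psi>"
    and zero: "\<And>z. fst z \<notin> {a..b} \<Longrightarrow> \<psi> z = 0" and ab: "0 < a" "b < T"
  shows "continuous_on UNIV (\<lambda>z. v z * \<psi> z)"
proof -
  let ?A = "{0<..<T} \<times> UNIV :: (real \<times> (real ^ 'd)) set" and ?B = "- ({a..b} \<times> UNIV) :: (real \<times> (real ^ 'd)) set"
  have oA: "open ?A" by (intro open_Times) auto
  have oB: "open ?B" by (intro open_Compl closed_Times) auto
  have "continuous_on ?A (\<lambda>z. v z * \<psi> z)" by (intro continuous_on_mult v continuous_on_subset[OF \<psi>]) auto
  moreover have "continuous_on ?B (\<lambda>z. v z * \<psi> z)"
    by (rule continuous_on_eq[OF continuous_on_const[of _ 0]]) (use zero in \<open>auto simp: mem_Times_iff\<close>)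
  ultimately have "continuous_on (?A \<union> ?B) (\<lambda>z. v z * \<psi> z)" by (rule continuous_on_open_Un[OF oA oB])
  moreover have "?A \<union> ?B = UNIV" using ab by (auto simp: mem_Times_iff)
  ultimately show ?thesis by simp
qed

lemma test_product_periodic:
  fixes v \<psi> :: "real \<times> (real ^ 'd) \<Rightarrow> real"
  assumes v: "\<And>t. t \<in> {0<..<T} \<Longrightarrow> periodic l (\<lambda>x. v (t, x))" and \<psi>: "\<And>t. periodic l (\<lambda>x. \<psi> (t, x))"
    and zero: "\<And>z. fst z \<notin> {a..b} \<Longrightarrow> \<psi> z = 0" and ab: "0 < a" "b < T"
  shows "periodic l (\<lambda>x. v (t, x) * \<psi> (t, x))"
proof (cases "t \<in> {0<..<T}")
  case True then show ?thesis using v \<psi> by (simp add: periodic_def)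
next
  case False
  then have "t \<notin> {a..b}" using ab by auto
  then have "\<psi> (t, x) = 0" for x using zero[of "(t, x)"] by simp
  then show ?thesis by (simp add: periodic_def)
qed

text \<open>\<open>strip_divergence_zero\<close> applied to the product of \<open>v\<close> and
  \<open>\<psi>\<close>, which vanishes near the ends of the time interval.\<close>

lemma integration_by_parts:
  fixes v :: "real \<times> (real ^ 'd) \<Rightarrow> real"
  assumes l: "\<And>i. 0 < l $ i" and T: "0 < T" and e: "e \<in> Basis" and \<psi>: "\<psi> \<in> cylinder_tests T l"
    and D: "\<And>z. fst z \<in> {0<..<T} \<Longrightarrow> (v has_derivative D z) (at z)"
    and cont: "continuous_on ({0<..<T} \<times> UNIV) (\<lambda>z. D z e)"
    and per: "\<And>t. t \<in> {0<..<T} \<Longrightarrow> periodic l (\<lambda>x. v (t, x))" "\<And>t. t \<in> {0<..<T} \<Longrightarrow> periodic l (\<lambda>x. D (t, x) e)"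
  shows "(LINT z:cylinder T l|lebesgue. v z * partial e \<psi> z) = - (LINT z:cylinder T l|lebesgue. D z e * \<psi> z)"
proof -
  obtain a b where s: "smooth \<psi>" and \<psi>per: "\<And>t. periodic l (\<lambda>x. \<psi> (t, x))" and ab: "0 < a" "b < T" "a \<le> b"
    and zero: "\<And>z. fst z \<notin> {a..b} \<Longrightarrow> \<psi> z = 0"
    using cylinder_testsD[OF \<psi> T] by metis
  have zero': "partial x \<psi> z = 0" if "fst z \<notin> {a..b}" for x z
    by (rule partial_zero_outside(2)[OF _ that]) (rule zero)
  have cv: "continuous_on ({0<..<T} \<times> UNIV) v"
    unfolding continuous_on_eq_continuous_within
  proof
    fix z assume "z \<in> {0<..<T} \<times> (UNIV :: (real ^ 'd) set)"
    then have "fst z \<in> {0<..<T}" by (simp add: mem_Times_iff)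
    from has_derivative_continuous[OF D[OF this]] show "continuous (at z within {0<..<T} \<times> UNIV) v"
      by (rule continuous_at_imp_continuous_at_within)
  qed
  have c1: "continuous_on UNIV (\<lambda>z. v z * partial e \<psi> z)"
    by (rule test_product_continuous[OF cv smooth_continuous[OF smooth_partial[OF s e]] zero' ab(1,2)])
  have c2: "continuous_on UNIV (\<lambda>z. D z e * \<psi> z)"
    by (rule test_product_continuous[OF cont smooth_continuous[OF s] zero ab(1,2)])
  have p1: "periodic l (\<lambda>x. v (t, x) * partial e \<psi> (t, x))" for t
    by (rule test_product_periodic[OF per(1) partial_periodic[OF s \<psi>per] zero' ab(1,2)])
  have p2: "periodic l (\<lambda>x. D (t, x) e * \<psi> (t, x))" for t
    by (rule test_product_periodic[where v = "\<lambda>z. D z e", OF per(2) \<psi>per zero ab(1,2)])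
  have p3: "periodic l (\<lambda>x. v (t, x) * \<psi> (t, x))" for t
    by (rule test_product_periodic[OF per(1) \<psi>per zero ab(1,2)])
  obtain B1 where B1: "\<And>z. \<bar>v z * partial e \<psi> z\<bar> \<le> B1"
  proof (rule strip_compact_bounded[OF l c1 p1, of a b])
    show "v z * partial e \<psi> z = 0" if out: "fst z \<notin> {a..b}" for z
      by (simp add: zero'[OF out])
  qed (rule that)
  obtain B2 where B2: "\<And>z. \<bar>D z e * \<psi> z\<bar> \<le> B2"
  proof (rule strip_compact_bounded[OF l c2 p2, of a b])
    show "D z e * \<psi> z = 0" if "fst z \<notin> {a..b}" for z by (simp add: zero[OF that])
  qed (rule that)
  have m: "(\<lambda>z. v z * partial e \<psi> z) \<in> borel_measurable borel" "(\<lambda>z. D z e * \<psi> z) \<in> borel_measurable borel"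
    using c1 c2 by (auto intro: borel_measurable_continuous_onI)
  have i1: "set_integrable lborel (strip l) (\<lambda>z. v z * partial e \<psi> z)"
    by (rule strip_integrable(1)[OF l m(1) B1 _ ab(3)]) (simp add: zero')
  have i2: "set_integrable lborel (strip l) (\<lambda>z. D z e * \<psi> z)"
    by (rule strip_integrable(1)[OF l m(2) B2 _ ab(3)]) (simp add: zero)
  define g' where "g' = (\<lambda>z. v z * partial e \<psi> z + D z e * \<psi> z)"
  \<comment> \<open>Outside the support slab \<open>D\<close> carries no information, so the
    derivative of the product is set to zero there.\<close>
  define D' where "D' = (\<lambda>z x. if fst z \<in> {a..b} then v z * partial x \<psi> z + D z x * \<psi> z else 0)"
  have "(LINT z:strip l|lborel. g' z) = 0"
  proof (rule strip_divergence_zero[OF l e ab(3), where g = "\<lambda>z. v z * \<psi> z" and D = D'])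
    show "((\<lambda>z. v z * \<psi> z) has_derivative D' z) (at z)" for z
    proof (cases "fst z \<in> {a..b}")
      case True
      then have "fst z \<in> {0<..<T}" using ab by auto
      from has_derivative_mult[OF D[OF this] smooth_has_derivative[OF s, of z]] True show ?thesis
        by (simp add: D'_def)
    next
      case False
      have "((\<lambda>z. v z * \<psi> z) has_derivative (\<lambda>_. 0)) (at z)"
        by (rule partial_zero_outside(1)[OF _ False]) (simp add: zero)
      moreover have "D' z = (\<lambda>_. 0)" using False unfolding D'_def by auto
      ultimately show ?thesis by simp
    qed
    show "g' z = D' z e" for z by (simp add: g'_def D'_def zero zero')
    show "continuous_on UNIV g'" unfolding g'_def by (intro continuous_on_add c1 c2)
    show "periodic l (\<lambda>x. g' (t, x))" for t using p1[of t] p2[of t] by (simp add: g'_def periodic_def)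
    show "v z * \<psi> z = 0 \<and> g' z = 0" if "fst z \<notin> {a..b}" for z using that by (simp add: g'_def zero zero')
  qed (rule p3)
  then have "(LINT z:strip l|lborel. v z * partial e \<psi> z) + (LINT z:strip l|lborel. D z e * \<psi> z) = 0"
    unfolding g'_def using i1 i2 by (simp add: set_integral_add)
  moreover have "(LINT z:cylinder T l|lebesgue. v z * partial e \<psi> z) = (LINT z:strip l|lborel. v z * partial e \<psi> z)"
    by (rule cylinder_integral_strip[OF m(1) ab(1,2)]) (simp add: zero')
  moreover have "(LINT z:cylinder T l|lebesgue. D z e * \<psi> z) = (LINT z:strip l|lborel. D z e * \<psi> z)"
    by (rule cylinder_integral_strip[OF m(2) ab(1,2)]) (simp add: zero)
  ultimately show ?thesis by simp
qed

text \<open>The cosines make the kernel periodic in space without a sum over translates. For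
  \<open>r \<le> l $ i / 2\<close> it lives, modulo the lattice, where time and every coordinate are
  below \<open>r\<close> in modulus. It is not normalised; \<open>kernel_mass\<close> is divided out
  later.\<close>

definition bump_kernel :: "real ^ 'd \<Rightarrow> real \<Rightarrow> real \<times> (real ^ 'd) \<Rightarrow> real" where
  "bump_kernel l r z = bump (r\<^sup>2 - (fst z)\<^sup>2) * (\<Prod>i\<in>UNIV. bump (cos (2 * pi / l $ i * snd z $ i) - cos (2 * pi / l $ i * r)))"

lemma kernel_nonneg: "0 \<le> bump_kernel l r z"
  unfolding bump_kernel_def by (intro mult_nonneg_nonneg prod_nonneg) (auto simp: bump_nonneg)

lemma smooth_add: "smooth v \<Longrightarrow> smooth w \<Longrightarrow> smooth (\<lambda>z. v z + w z)"
  by (simp add: smooth_def Ck_add)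

lemma smooth_const: "smooth (\<lambda>z. c)" by (simp add: smooth_def Ck_const)

lemma smooth_affine: "smooth (\<lambda>z. z \<bullet> a + c)" by (simp add: smooth_def Ck_affine)

lemma smooth_kernel:
  fixes l :: "real ^ 'd" shows "smooth (bump_kernel l r)"
proof -
  have t: "smooth (\<lambda>z :: real \<times> (real ^ 'd). r\<^sup>2 - (fst z)\<^sup>2)"
  proof -
    have "smooth (\<lambda>z :: real \<times> (real ^ 'd). (z \<bullet> (- 1, 0) + 0) * (z \<bullet> (1, 0) + 0) + r\<^sup>2)"
      by (intro smooth_add smooth_mult smooth_affine smooth_const)
    then show ?thesis by (simp add: inner_prod_def power2_eq_square)
  qed
  have x: "smooth (\<lambda>z :: real \<times> (real ^ 'd). cos (2 * pi / l $ i * snd z $ i) - cos (2 * pi / l $ i * r))" for i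
  proof -
    have "smooth (\<lambda>z :: real \<times> (real ^ 'd). cos (z \<bullet> (0, axis i (2 * pi / l $ i)) + 0) + (- cos (2 * pi / l $ i * r)))"
      by (intro smooth_add smooth_cos smooth_affine smooth_const)
    then show ?thesis by (simp add: inner_prod_def inner_axis mult.commute)
  qed
  show ?thesis unfolding bump_kernel_def by (intro smooth_mult smooth_prod smooth_bump t x)
qed

lemma periodic_kernel:
  assumes l: "\<And>i. 0 < l $ i" shows "periodic l (\<lambda>x. bump_kernel l r (t, x))"
  unfolding periodic_def
proof (intro allI)
  fix x i
  have "cos (2 * pi / l $ j * (x + axis i (l $ i)) $ j) = cos (2 * pi / l $ j * x $ j)" for j
  proof (cases "j = i")
    case True
    then have "2 * pi / l $ j * (x + axis i (l $ i)) $ j = 2 * pi / l $ j * x $ j + 2 * pi"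
      using l[of j] by (simp add: axis_def distrib_left)
    then show ?thesis by (simp only: cos_periodic)
  qed (simp add: axis_def)
  then show "bump_kernel l r (t, x + axis i (l $ i)) = bump_kernel l r (t, x)" unfolding bump_kernel_def by simp
qed

lemma kernel_zero_time: assumes "0 < r" "r \<le> \<bar>fst z\<bar>" shows "bump_kernel l r z = 0"
proof -
  have "r\<^sup>2 \<le> \<bar>fst z\<bar>\<^sup>2" using assms by (intro power_mono) auto
  then show ?thesis by (simp add: bump_kernel_def bump_def)
qed

text \<open>Moving \<open>y\<close> by the nearest multiple of \<open>L\<close> brings the phase
  into \<open>[-pi, pi]\<close>, where the cosine decreases in the absolute value;
  \<open>r \<le> L / 2\<close> puts the phase of \<open>r\<close> in the same range.\<close>

lemma cos_near_period:
  assumes L: "0 < L" and r: "0 < r" "r \<le> L / 2" and c: "cos (2 * pi / L * r) < cos (2 * pi / L * y)"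
  shows "\<exists>n::int. \<bar>y + of_int n * L\<bar> < r"
proof -
  let ?n = "- round (y / L)"
  let ?y = "y + of_int ?n * L"
  have "\<bar>of_int (round (y / L)) - y / L\<bar> \<le> 1 / 2" by (rule of_int_round_abs_le)
  then have "\<bar>?y / L\<bar> \<le> 1 / 2" using L by (simp add: field_simps abs_minus_commute)
  then have "2 * pi * \<bar>?y / L\<bar> \<le> 2 * pi * (1 / 2)" by (intro mult_left_mono) auto
  moreover have "\<bar>2 * pi / L * ?y\<bar> = 2 * pi * \<bar>?y / L\<bar>" by (simp add: abs_mult)
  ultimately have b: "\<bar>2 * pi / L * ?y\<bar> \<le> pi" by linarith
  have "2 * pi / L * ?y = 2 * pi / L * y + 2 * pi * of_int ?n" using L by (simp add: field_simps)
  then have "cos (2 * pi / L * ?y) = cos (2 * pi / L * y)"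
    by (simp add: cos_add cos_int_2pin sin_int_2pin del: of_int_minus)
  then have "cos (2 * pi / L * r) < cos \<bar>2 * pi / L * ?y\<bar>" using c cos_abs_real[of "2 * pi / L * ?y"] by linarith
  moreover have "2 * pi / L * r \<le> pi" using r L by (simp add: field_simps)
  ultimately have "\<bar>2 * pi / L * ?y\<bar> < 2 * pi / L * r"
    using b r L cos_mono_less_eq[of "2 * pi / L * r" "\<bar>2 * pi / L * ?y\<bar>"] by simp
  then have "2 * pi / L * \<bar>?y\<bar> < 2 * pi / L * r" using L by (simp add: abs_mult)
  moreover have "0 < 2 * pi / L" using L by simp
  ultimately have "\<bar>?y\<bar> < r" by (simp only: mult_less_cancel_left_pos)
  then show ?thesis by blast
qed

lemma kernel_support:
  fixes l :: "real ^ 'd"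
  assumes l: "\<And>i. 0 < l $ i" and r: "0 < r" "\<And>i. r \<le> l $ i / 2" and z: "bump_kernel l r z \<noteq> 0"
  shows "\<bar>fst z\<bar> < r" "\<exists>\<nu>\<in>lattice l. norm (snd z + \<nu>) \<le> real CARD('d) * r"
proof -
  show "\<bar>fst z\<bar> < r" using kernel_zero_time[OF r(1)] z by (meson not_less)
  have "cos (2 * pi / l $ i * r) < cos (2 * pi / l $ i * snd z $ i)" for i
    using z unfolding bump_kernel_def by (auto simp: bump_eq_0_iff not_le)
  then have "\<forall>i. \<exists>n::int. \<bar>snd z $ i + of_int n * l $ i\<bar> < r" using cos_near_period[OF l r(1) r(2)] by blast
  then obtain n where n: "\<And>i. \<bar>snd z $ i + of_int (n i) * l $ i\<bar> < r" by metis
  let ?\<nu> = "\<chi> i. of_int ((\<chi> i. n i) $ i) * l $ i"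
  have "norm (snd z + ?\<nu>) \<le> (\<Sum>i\<in>UNIV. \<bar>(snd z + ?\<nu>) $ i\<bar>)" by (rule norm_le_l1_cart)
  also have "\<dots> \<le> (\<Sum>i\<in>(UNIV::'d set). r)" using n by (intro sum_mono) (simp add: less_imp_le)
  finally have "norm (snd z + ?\<nu>) \<le> real CARD('d) * r" by simp
  moreover have "?\<nu> \<in> lattice l" unfolding lattice_def by (rule rangeI)
  ultimately show "\<exists>\<nu>\<in>lattice l. norm (snd z + \<nu>) \<le> real CARD('d) * r" by blast
qed

section \<open>Mollification\<close>

text \<open>Integrands whose integral over the cylinder equals the one over the whole strip.\<close>

definition admissible :: "real \<Rightarrow> real ^ 'd \<Rightarrow> (real \<times> (real ^ 'd) \<Rightarrow> real) \<Rightarrow> bool" where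
  "admissible T l k \<longleftrightarrow> continuous_on UNIV k \<and> (\<forall>t. periodic l (\<lambda>x. k (t, x))) \<and>
     (\<exists>a b. 0 < a \<and> a \<le> b \<and> b < T \<and> (\<forall>z. fst z \<notin> {a..b} \<longrightarrow> k z = 0))"

abbreviation strip_integral :: "real ^ 'd \<Rightarrow> (real \<times> (real ^ 'd) \<Rightarrow> real) \<Rightarrow> real" where
  "strip_integral l k \<equiv> (LINT z:strip l|lborel. k z)"

lemma admissible_borel: "admissible T l k \<Longrightarrow> k \<in> borel_measurable borel"
  by (simp add: admissible_def borel_measurable_continuous_onI)

lemma admissible_integrable:
  assumes l: "\<And>i. 0 < l $ i" and k: "admissible T l k"
  shows "set_integrable lborel (strip l) k"
proof -
  obtain a b where ab: "a \<le> b" and zero: "\<And>z. fst z \<notin> {a..b} \<Longrightarrow> k z = 0"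
    using k unfolding admissible_def by auto
  have c: "continuous_on UNIV k" and p: "\<And>t. periodic l (\<lambda>x. k (t, x))" using k unfolding admissible_def by auto
  obtain B where "\<And>z. \<bar>k z\<bar> \<le> B"
  proof (rule strip_compact_bounded[OF l c p, of a b])
    show "k z = 0" if "fst z \<notin> {a..b}" for z by (rule zero[OF that])
  qed (rule that)
  then show ?thesis by (intro strip_integrable(1)[OF l admissible_borel[OF k] _ zero ab])
qed

lemma admissible_cylinder_integral:
  assumes k: "admissible T l k"
  shows "(LINT z:cylinder T l|lebesgue. k z) = strip_integral l k"
proof -
  obtain a b where "0 < a" "b < T" and "\<And>z. fst z \<notin> {a..b} \<Longrightarrow> k z = 0"
    using k unfolding admissible_def by auto
  then show ?thesis by (intro cylinder_integral_strip[OF admissible_borel[OF k]])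
qed

lemma admissible_combine:
  assumes k: "admissible T l k" and m: "admissible T l m"
    and F: "continuous_on UNIV (\<lambda>(x, y). F x y)" "F 0 0 = 0"
  shows "admissible T l (\<lambda>z. F (k z) (m z))"
proof -
  obtain a b where ab: "0 < a" "a \<le> b" "b < T" "\<And>z. fst z \<notin> {a..b} \<Longrightarrow> k z = 0"
    using k unfolding admissible_def by auto
  obtain a' b' where ab': "0 < a'" "a' \<le> b'" "b' < T" "\<And>z. fst z \<notin> {a'..b'} \<Longrightarrow> m z = 0"
    using m unfolding admissible_def by auto
  have "continuous_on UNIV (\<lambda>z. (k z, m z))"
    using k m unfolding admissible_def by (intro continuous_on_Pair) auto
  from continuous_on_compose2[OF F(1) this] have "continuous_on UNIV (\<lambda>z. F (k z) (m z))" by simp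
  moreover have "periodic l (\<lambda>x. F (k (t, x)) (m (t, x)))" for t
    using k m unfolding admissible_def periodic_def by auto
  moreover have "F (k z) (m z) = 0" if "fst z \<notin> {min a a'..max b b'}" for z
  proof -
    have "fst z \<notin> {a..b}" "fst z \<notin> {a'..b'}" using that by auto
    then show ?thesis using ab(4) ab'(4) F(2) by simp
  qed
  ultimately show ?thesis unfolding admissible_def using ab ab'
    by (intro conjI allI exI[of _ "min a a'"] exI[of _ "max b b'"]) auto
qed

lemma admissible_add: "admissible T l k \<Longrightarrow> admissible T l m \<Longrightarrow> admissible T l (\<lambda>z. k z + m z)"
  by (rule admissible_combine[where F = "(+)"]) (auto simp: case_prod_unfold intro!: continuous_intros)

lemma admissible_diff: "admissible T l k \<Longrightarrow> admissible T l m \<Longrightarrow> admissible T l (\<lambda>z. k z - m z)"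
  by (rule admissible_combine[where F = "(-)"]) (auto simp: case_prod_unfold intro!: continuous_intros)

lemma admissible_cmult: "admissible T l k \<Longrightarrow> admissible T l (\<lambda>z. c * k z)"
  by (rule admissible_combine[where F = "\<lambda>x y. c * x" and m = k]) (auto simp: case_prod_unfold intro!: continuous_intros)

lemma admissible_mult:
  assumes k: "admissible T l k" and f: "continuous_on ({0<..<T} \<times> UNIV) f"
    and per: "\<And>t. t \<in> {0<..<T} \<Longrightarrow> periodic l (\<lambda>x. f (t, x))"
  shows "admissible T l (\<lambda>z. f z * k z)"
proof -
  obtain a b where ab: "0 < a" "a \<le> b" "b < T" "\<And>z. fst z \<notin> {a..b} \<Longrightarrow> k z = 0"
    using k unfolding admissible_def by auto
  have c: "continuous_on UNIV k" and p: "\<And>t. periodic l (\<lambda>x. k (t, x))" using k unfolding admissible_def by auto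
  have "continuous_on UNIV (\<lambda>z. f z * k z)" by (rule test_product_continuous[OF f c ab(4,1,3)])
  moreover have "periodic l (\<lambda>x. f (t, x) * k (t, x))" for t by (rule test_product_periodic[OF per p ab(4,1,3)])
  moreover have "f z * k z = 0" if "fst z \<notin> {a..b}" for z using ab(4)[OF that] by simp
  ultimately show ?thesis unfolding admissible_def using ab by blast
qed

lemma admissible_sum:
  assumes "finite I" "I \<noteq> {}" "\<And>i. i \<in> I \<Longrightarrow> admissible T l (k i)"
  shows "admissible T l (\<lambda>z. \<Sum>i\<in>I. k i z)"
  using assms by (induction I rule: finite_ne_induct) (auto intro: admissible_add)

lemma strip_integral_add:
  assumes "\<And>i. 0 < l $ i" "admissible T l k" "admissible T l m"
  shows "strip_integral l (\<lambda>z. k z + m z) = strip_integral l k + strip_integral l m"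
  by (rule set_integral_add(2)[OF admissible_integrable[OF assms(1,2)] admissible_integrable[OF assms(1,3)]])

lemma strip_integral_diff:
  assumes "\<And>i. 0 < l $ i" "admissible T l k" "admissible T l m"
  shows "strip_integral l (\<lambda>z. k z - m z) = strip_integral l k - strip_integral l m"
  by (rule set_integral_diff(2)[OF admissible_integrable[OF assms(1,2)] admissible_integrable[OF assms(1,3)]])

lemma strip_integral_cmult: "strip_integral l (\<lambda>z. c * k z) = c * strip_integral l k"
  unfolding set_lebesgue_integral_def by (simp add: mult.left_commute)

lemma strip_integral_sum:
  assumes "\<And>i. 0 < l $ i" "finite I" "I \<noteq> {}" "\<And>i. i \<in> I \<Longrightarrow> admissible T l (k i)"
  shows "strip_integral l (\<lambda>z. \<Sum>i\<in>I. k i z) = (\<Sum>i\<in>I. strip_integral l (k i))"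
  using assms(2-4)
proof (induction I rule: finite_ne_induct)
  case (insert x F)
  then show ?case
    using strip_integral_add[OF assms(1), of T "k x" "\<lambda>z. \<Sum>i\<in>F. k i z"] admissible_sum[of F T l k] by simp
qed simp

lemma strip_integral_abs_le:
  assumes l: "\<And>i. 0 < l $ i" and k: "admissible T l k" "admissible T l m" and le: "\<And>z. \<bar>k z\<bar> \<le> m z"
  shows "\<bar>strip_integral l k\<bar> \<le> strip_integral l m"
  unfolding set_lebesgue_integral_def real_norm_def[symmetric]
  using admissible_integrable[OF l k(1)] admissible_integrable[OF l k(2)] le unfolding set_integrable_def
  by (intro order_trans[OF integral_norm_bound] integral_mono) (auto simp: indicator_def)

lemma strip_integral_shift:
  assumes l: "\<And>i. 0 < l $ i" and k: "admissible T l k"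
  shows "strip_integral l (\<lambda>z. k (z + v)) = strip_integral l k"
proof (rule integral_strip_shift(2)[OF l admissible_borel[OF k]])
  show "k (t, x + \<nu>) = k (t, x)" if "\<nu> \<in> lattice l" for t x \<nu>
    using periodic_lattice[of l "\<lambda>x. k (t, x)", OF _ that] k unfolding admissible_def by auto
qed (use admissible_integrable[OF l k] in auto)

section \<open>Kernels as test functions\<close>

lemma smooth_shift:
  assumes "smooth v" shows "smooth (\<lambda>z. v (z + c))"
proof (rule smoothI)
  fix k show "Ck k (\<lambda>z. v (z + c))"
    using assms
  proof (induction k arbitrary: v)
    case 0
    have "continuous_on UNIV (\<lambda>z. v (z + c))"
      by (rule continuous_on_compose2[OF smooth_continuous[OF 0]]) (auto intro: continuous_intros)
    then show ?case by simp
  next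
    case (Suc k)
    have "(\<lambda>z. v (z + c)) differentiable at z" for z
      using frechet_derivative_shift(1)[OF Suc.prems] by (auto simp: differentiable_def)
    moreover have "Ck k (\<lambda>z. partial e (\<lambda>z. v (z + c)) z)" if "e \<in> Basis" for e
      unfolding frechet_derivative_shift(2)[OF Suc.prems] by (rule Suc.IH[OF smooth_partial[OF Suc.prems that]])
    ultimately show ?case by simp
  qed
qed

lemma kernel_minus: "bump_kernel l r (- z) = bump_kernel l r z"
  by (simp add: bump_kernel_def)

lemma partial_kernel_minus: "partial e (bump_kernel l r) (- z) = - partial e (bump_kernel l r) z"
proof -
  have "((\<lambda>z. bump_kernel l r (- z)) has_derivative (\<lambda>x. frechet_derivative (bump_kernel l r) (at (- z)) (- x))) (at z)"
    by (rule has_derivative_compose[OF _ smooth_has_derivative[OF smooth_kernel]]) (auto intro!: derivative_eq_intros)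
  then have "frechet_derivative (bump_kernel l r) (at z) = (\<lambda>x. frechet_derivative (bump_kernel l r) (at (- z)) (- x))"
    unfolding kernel_minus by (rule frechet_derivative_eq)
  moreover have "linear (frechet_derivative (bump_kernel l r) (at (- z)))"
    using smooth_has_derivative[OF smooth_kernel] has_derivative_linear by blast
  ultimately show ?thesis by (simp add: linear_neg)
qed

definition kernel_at :: "real ^ 'd \<Rightarrow> real \<Rightarrow> real \<times> (real ^ 'd) \<Rightarrow> real \<times> (real ^ 'd) \<Rightarrow> real" where
  "kernel_at l r c w = bump_kernel l r (c - w)"

text \<open>The derivative with respect to the centre \<open>c\<close>. The one with respect to the
  integration variable \<open>w\<close> has the opposite sign.\<close>

definition kernel_d :: "real \<times> (real ^ 'd) \<Rightarrow> real ^ 'd \<Rightarrow> real \<Rightarrow> real \<times> (real ^ 'd) \<Rightarrow> real \<times> (real ^ 'd) \<Rightarrow> real" where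
  "kernel_d e l r c w = partial e (bump_kernel l r) (c - w)"

lemma kernel_at_shift: "kernel_at l r c = (\<lambda>w. bump_kernel l r (w + - c))"
proof
  fix w show "kernel_at l r c w = bump_kernel l r (w + - c)"
    using kernel_minus[of l r "w - c"] by (simp add: kernel_at_def)
qed

lemma smooth_kernel_at: "smooth (kernel_at l r c)"
  unfolding kernel_at_shift by (rule smooth_shift[OF smooth_kernel])

lemma partial_kernel_at:
  fixes l :: "real ^ 'd" shows "partial e (kernel_at l r c) w = - kernel_d e l r c w"
  unfolding kernel_at_shift frechet_derivative_shift(2)[OF smooth_kernel] kernel_d_def
  using partial_kernel_minus[where e = e and l = l and r = r and z = "w - c"] by simp

lemma kernel_d_eq: "kernel_d e l r c w = - partial e (kernel_at l r c) w"
  by (simp add: partial_kernel_at)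

lemma periodic_kernel_at: assumes "\<And>i. 0 < l $ i" shows "periodic l (\<lambda>x. kernel_at l r c (t, x))"
proof -
  have "kernel_at l r c (t, x) = bump_kernel l r (t - fst c, x - snd c)" for x
    unfolding kernel_at_shift by (cases c) simp
  moreover have "x + axis i (l $ i) - snd c = (x - snd c) + axis i (l $ i)" for x i by simp
  ultimately show ?thesis using periodic_kernel[OF assms, of r "t - fst c"]
    by (simp only: periodic_def) blast
qed

lemma kernel_at_zero: "0 < r \<Longrightarrow> fst w \<notin> {fst c - r..fst c + r} \<Longrightarrow> kernel_at l r c w = 0"
  unfolding kernel_at_def by (rule kernel_zero_time) (auto simp: abs_if)

lemma kernel_at_test:
  assumes l: "\<And>i. 0 < l $ i" and r: "0 < r" "r < fst c" "fst c + r < T"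
  shows "kernel_at l r c \<in> cylinder_tests T l"
  unfolding cylinder_tests_def
proof (intro CollectI conjI allI)
  have z: "\<forall>t x. t \<notin> {fst c - r..fst c + r} \<longrightarrow> kernel_at l r c (t, x) = 0"
    by (intro allI impI kernel_at_zero[OF r(1)]) simp
  show "\<exists>a b. 0 < a \<and> b < T \<and> (\<forall>t x. t \<notin> {a..b} \<longrightarrow> kernel_at l r c (t, x) = 0)"
    by (rule exI[of _ "fst c - r"], rule exI[of _ "fst c + r"]) (use r z in simp)
qed (rule smooth_kernel_at, rule periodic_kernel_at[OF l])

lemma admissible_test:
  assumes "\<psi> \<in> cylinder_tests T l" "0 < T"
  shows "admissible T l \<psi>" and "e \<in> Basis \<Longrightarrow> admissible T l (partial e \<psi>)"
proof -
  obtain a b where s: "smooth \<psi>" and per: "\<And>t. periodic l (\<lambda>x. \<psi> (t, x))" and ab: "0 < a" "b < T" "a \<le> b"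
    and zero: "\<And>z. fst z \<notin> {a..b} \<Longrightarrow> \<psi> z = 0" using cylinder_testsD[OF assms] by metis
  show "admissible T l \<psi>"
    unfolding admissible_def using smooth_continuous[OF s] per ab zero by blast
  have zero': "partial e \<psi> z = 0" if "fst z \<notin> {a..b}" for z
    by (rule partial_zero_outside(2)[OF _ that]) (rule zero)
  show "admissible T l (partial e \<psi>)" if "e \<in> Basis"
    unfolding admissible_def
    using smooth_continuous[OF smooth_partial[OF s that]] partial_periodic[OF s per] ab zero' by blast
qed

lemma admissible_kernel:
  assumes l: "\<And>i. 0 < l $ i" and r: "0 < r" "r < fst c" "fst c + r < T"
  shows "admissible T l (kernel_at l r c)" "e \<in> Basis \<Longrightarrow> admissible T l (kernel_d e l r c)"
proof -
  have T: "0 < T" using r by linarith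
  note t = kernel_at_test[OF l r]
  show "admissible T l (kernel_at l r c)" by (rule admissible_test(1)[OF t T])
  assume e: "e \<in> Basis"
  have "kernel_d e l r c = (\<lambda>w. (- 1) * partial e (kernel_at l r c) w)" by (simp add: fun_eq_iff kernel_d_eq)
  then show "admissible T l (kernel_d e l r c)" using admissible_cmult[OF admissible_test(2)[OF t T e], of "- 1"] by simp
qed

definition kernel_mass :: "real ^ 'd \<Rightarrow> real \<Rightarrow> real" where
  "kernel_mass l r = strip_integral l (bump_kernel l r)"

lemma kernel_mass_at:
  assumes l: "\<And>i. 0 < l $ i" and r: "0 < r" "r < fst c" "fst c + r < T"
  shows "strip_integral l (kernel_at l r c) = kernel_mass l r"
  using strip_integral_shift[OF l admissible_kernel(1)[OF l r], of c]
  unfolding kernel_mass_def kernel_at_shift by simp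

text \<open>The kernel is positive on the box with time in \<open>(-r, r)\<close> and coordinates in
  \<open>(0, r)\<close>, which lies in the strip and has positive volume.\<close>

lemma kernel_mass_pos:
  fixes l :: "real ^ 'd"
  assumes l: "\<And>i. 0 < l $ i" and r: "0 < r" "\<And>i. r \<le> l $ i / 2"
  shows "0 < kernel_mass l r"
proof -
  let ?k = "\<lambda>z. indicator (strip l) z *\<^sub>R bump_kernel l r z" and ?W = "box (- r, 0) (r, \<chi> i. r) :: (real \<times> (real ^ 'd)) set"
  have c: "kernel_at l r v (z + v) = bump_kernel l r z" for v z by (simp add: kernel_at_shift)
  \<comment> \<open>\<open>admissible\<close> wants positive times, so the kernel is first centred
    at time \<open>2 * r\<close> and then shifted back.\<close>
  have "admissible (4 * r) l (kernel_at l r (2 * r, 0))" using r by (intro admissible_kernel(1)[OF l]) auto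
  then have "set_integrable lborel (strip l) (\<lambda>z. kernel_at l r (2 * r, 0) (z + (2 * r, 0)))"
    by (intro integral_strip_shift(1)[OF l admissible_borel] admissible_integrable[OF l])
      (auto intro: periodic_lattice[OF periodic_kernel_at[OF l]])
  then have int: "integrable lborel ?k" unfolding c set_integrable_def by simp
  have pos: "0 < bump_kernel l r z \<and> z \<in> strip l" if "z \<in> ?W" for z
  proof -
    obtain t x where z: "z = (t, x)" by (cases z)
    have t: "\<bar>t\<bar> < r" and x: "\<And>i. 0 < x $ i \<and> x $ i < r"
    proof -
      have b: "(- r, 0) \<bullet> b < z \<bullet> b \<and> z \<bullet> b < (r, \<chi> i. r) \<bullet> b" if "b \<in> Basis" for b
        using \<open>z \<in> ?W\<close> that unfolding mem_box by blast
      show "\<bar>t\<bar> < r" using b[of "(1, 0)"] unfolding z by (auto simp: Basis_prod_def)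
      show "0 < x $ i \<and> x $ i < r" for i
        using b[of "(0, axis i 1)"] unfolding z by (auto simp: Basis_prod_def inner_axis axis_in_Basis_iff)
    qed
    have "\<bar>t\<bar>\<^sup>2 < r\<^sup>2" using t by (intro power_strict_mono) auto
    moreover have "cos (2 * pi / l $ i * r) < cos (2 * pi / l $ i * x $ i)" for i
    proof (rule cos_monotone_0_pi)
      show "2 * pi / l $ i * x $ i < 2 * pi / l $ i * r" using x[of i] l[of i] by (intro mult_strict_left_mono) auto
      have "2 * pi / l $ i * r \<le> 2 * pi / l $ i * (l $ i / 2)" using r(2)[of i] l[of i] by (intro mult_left_mono) auto
      then show "2 * pi / l $ i * r \<le> pi" using l[of i] by simp
    qed (use x[of i] l[of i] in \<open>auto intro!: mult_nonneg_nonneg simp: less_imp_le\<close>)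
    ultimately have "0 < bump_kernel l r z"
      unfolding bump_kernel_def z by (intro mult_pos_pos prod_pos) (auto simp: bump_pos_iff)
    moreover have "x $ i < l $ i" for i using x[of i] r(2)[of i] l[of i] by auto
    then have "z \<in> strip l" unfolding z torus_def using x less_imp_le by auto
    ultimately show ?thesis by simp
  qed
  have nonneg: "0 \<le> ?k z" for z using kernel_nonneg[of l r z] by simp
  have "kernel_mass l r \<noteq> 0"
  proof
    assume "kernel_mass l r = 0"
    then have "AE z in lborel. ?k z = 0"
      using integral_nonneg_eq_0_iff_AE[OF int] nonneg unfolding kernel_mass_def set_lebesgue_integral_def by simp
    then obtain N where N: "{z \<in> space lborel. ?k z \<noteq> 0} \<subseteq> N" "emeasure lborel N = 0" "N \<in> sets lborel"
      by (rule AE_E)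
    have "?W \<subseteq> N" using N(1) pos by (force simp: indicator_def)
    then have "emeasure lborel ?W \<le> emeasure lborel N" by (rule emeasure_mono[OF _ N(3)])
    moreover have "emeasure lborel ?W \<noteq> 0"
    proof -
      let ?a = "(- r, 0) :: real \<times> (real ^ 'd)" and ?b = "(r, \<chi> i. r) :: real \<times> (real ^ 'd)"
      have ab: "?a \<bullet> b \<le> ?b \<bullet> b" "0 < (?b - ?a) \<bullet> b" if "b \<in> Basis" for b
        using that r by (auto simp: Basis_prod_def Basis_vec_def inner_axis)
      have "0 < prod ((\<bullet>) (?b - ?a)) Basis" by (rule prod_pos) (rule ab(2))
      moreover have "emeasure lborel ?W = ennreal (prod ((\<bullet>) (?b - ?a)) Basis)"
        by (rule emeasure_lborel_box) (rule ab(1))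
      ultimately show ?thesis by (simp only: ennreal_eq_0_iff not_le)
    qed
    ultimately show False using N(2) by simp
  qed
  moreover have "0 \<le> kernel_mass l r"
    unfolding kernel_mass_def set_lebesgue_integral_def by (rule integral_nonneg_AE) (use nonneg in auto)
  ultimately show ?thesis by simp
qed

lemma kernel_average:
  assumes l: "\<And>i. 0 < l $ i" and r: "0 < r" "r < fst c" "fst c + r < T"
    and f: "continuous_on ({0<..<T} \<times> UNIV) f" "\<And>t. t \<in> {0<..<T} \<Longrightarrow> periodic l (\<lambda>x. f (t, x))"
    and osc: "\<And>w. kernel_at l r c w \<noteq> 0 \<Longrightarrow> \<bar>f w - v\<bar> \<le> \<epsilon>"
  shows "\<bar>strip_integral l (\<lambda>w. f w * kernel_at l r c w) - v * kernel_mass l r\<bar> \<le> \<epsilon> * kernel_mass l r"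
proof -
  note k = admissible_kernel(1)[OF l r]
  have e: "strip_integral l (\<lambda>w. f w * kernel_at l r c w) - v * kernel_mass l r
      = strip_integral l (\<lambda>w. f w * kernel_at l r c w - v * kernel_at l r c w)"
    unfolding kernel_mass_at[OF l r, symmetric]
    by (subst strip_integral_diff[OF l admissible_mult[OF k f] admissible_cmult[OF k]])
      (assumption, simp only: strip_integral_cmult)
  have "\<bar>strip_integral l (\<lambda>w. f w * kernel_at l r c w - v * kernel_at l r c w)\<bar> \<le> strip_integral l (\<lambda>w. \<epsilon> * kernel_at l r c w)"
  proof (rule strip_integral_abs_le[OF l admissible_diff[OF admissible_mult[OF k f] admissible_cmult[OF k]] admissible_cmult[OF k]])
    fix w
    have k0: "0 \<le> kernel_at l r c w" unfolding kernel_at_def by (rule kernel_nonneg)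
    show "\<bar>f w * kernel_at l r c w - v * kernel_at l r c w\<bar> \<le> \<epsilon> * kernel_at l r c w"
    proof (cases "kernel_at l r c w = 0")
      case False
      then show ?thesis using osc[OF False] k0 by (simp add: left_diff_distrib[symmetric] abs_mult mult_right_mono)
    qed simp
  qed
  then show ?thesis unfolding e strip_integral_cmult by (simp add: kernel_mass_at[OF l r])
qed

text \<open>Integration by parts against the constant function 1.\<close>

lemma kernel_d_integral:
  assumes l: "\<And>i. 0 < l $ i" and r: "0 < r" "r < fst c" "fst c + r < T" and e: "e \<in> Basis"
  shows "strip_integral l (kernel_d e l r c) = 0"
proof -
  have T: "0 < T" using r by linarith
  note t = kernel_at_test[OF l r]
  have "(LINT z:cylinder T l|lebesgue. (1::real) * partial e (kernel_at l r c) z) = - (LINT z:cylinder T l|lebesgue. 0 * kernel_at l r c z)"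
    by (rule integration_by_parts[OF l T e t, where v = "\<lambda>_. 1" and D = "\<lambda>_ _. 0"]) (auto simp: periodic_def)
  then have "strip_integral l (partial e (kernel_at l r c)) = 0"
    using admissible_cylinder_integral[OF admissible_test(2)[OF t T e]] by (simp add: set_lebesgue_integral_def)
  then show ?thesis unfolding kernel_d_eq by (simp add: set_lebesgue_integral_def)
qed

lemma kernel_taylor:
  assumes l: "\<And>i. 0 < l $ i" and r: "0 < r" and e: "e \<in> Basis" and \<eta>: "0 < \<eta>"
  shows "\<exists>\<rho>>0. \<forall>c w s. 0 < s \<and> s < \<rho> \<longrightarrow> \<bar>kernel_at l r (c + s *\<^sub>R e) w - kernel_at l r c w - s * kernel_d e l r c w\<bar> \<le> \<eta> * s"
proof -
  have z: "bump_kernel l r z = 0" if "fst z \<notin> {- r..r}" for z using that r by (intro kernel_zero_time) auto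
  have z': "partial e (bump_kernel l r) z = 0" if "fst z \<notin> {- r..r}" for z
    by (rule partial_zero_outside(2)[OF _ that]) (rule z)
  have "\<exists>\<rho>>0. \<forall>z s. 0 < s \<and> s < \<rho> \<longrightarrow> \<bar>bump_kernel l r (z + s *\<^sub>R e) - bump_kernel l r z - s * partial e (bump_kernel l r) z\<bar> \<le> \<eta> * s"
    by (rule compact_uniform_taylor[OF l e smooth_has_derivative[OF smooth_kernel] refl
          smooth_continuous[OF smooth_partial[OF smooth_kernel e]] partial_periodic[OF smooth_kernel periodic_kernel[OF l]] _ \<eta>])
      (use z z' in blast)
  then obtain \<rho> where "0 < \<rho>" and t: "\<And>z s. 0 < s \<and> s < \<rho> \<Longrightarrow> \<bar>bump_kernel l r (z + s *\<^sub>R e) - bump_kernel l r z - s * partial e (bump_kernel l r) z\<bar> \<le> \<eta> * s"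
    by blast
  have "c + s *\<^sub>R e - w = (c - w) + s *\<^sub>R e" for c w s by simp
  then show ?thesis unfolding kernel_at_def kernel_d_def using \<open>0 < \<rho>\<close> t by (metis (no_types))
qed

lemma kernel_at_nonneg: "0 \<le> kernel_at l r c w"
  unfolding kernel_at_def by (rule kernel_nonneg)

lemma strip_integral_lin3:
  assumes l: "\<And>i. 0 < l $ i" and k: "admissible T l k1" "admissible T l k2" "admissible T l k3"
  shows "strip_integral l (\<lambda>w. k1 w - k2 w - s * k3 w)
    = strip_integral l (\<lambda>w. k1 w) - strip_integral l (\<lambda>w. k2 w) - s * strip_integral l (\<lambda>w. k3 w)"
  unfolding strip_integral_diff[OF l admissible_diff[OF k(1,2)] admissible_cmult[OF k(3)]]
    strip_integral_diff[OF l k(1,2)] strip_integral_cmult by (rule refl)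

section \<open>Mollified weak solutions\<close>

abbreviation e_t :: "real \<times> (real ^ 'd)" where "e_t \<equiv> (1, 0)"
abbreviation e_x :: "'d \<Rightarrow> real \<times> (real ^ 'd)" where "e_x i \<equiv> (0, axis i 1)"

lemma e_Basis: "e_t \<in> Basis" "e_x i \<in> Basis"
  by (auto simp: Basis_prod_def axis_in_Basis_iff)

text \<open>Taylor bounds control short steps only; a long step is cut into equal short
  ones.\<close>

lemma lipschitz_from_small_steps:
  fixes F :: "real \<Rightarrow> real"
  assumes "0 < \<rho>" and step: "\<And>x s. 0 < s \<Longrightarrow> s < \<rho> \<Longrightarrow> \<bar>F (x + s) - F x\<bar> \<le> K * s" and s: "0 < s"
  shows "\<bar>F (x + s) - F x\<bar> \<le> K * s"
proof -
  obtain n :: nat where n: "s / \<rho> < real n" using reals_Archimedean2 by blast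
  have n0: "0 < real n" using n s \<open>0 < \<rho>\<close> by (meson divide_pos_pos less_trans)
  let ?h = "s / real n"
  have h: "0 < ?h" "?h < \<rho>" using n n0 s \<open>0 < \<rho>\<close> by (auto simp: field_simps)
  have "\<bar>F (x + real m * ?h) - F x\<bar> \<le> K * (real m * ?h)" for m
  proof (induction m)
    case (Suc m)
    have "\<bar>F ((x + real m * ?h) + ?h) - F (x + real m * ?h)\<bar> \<le> K * ?h" by (rule step[OF h])
    moreover have e: "x + real (Suc m) * ?h = (x + real m * ?h) + ?h" "K * (real (Suc m) * ?h) = K * (real m * ?h) + K * ?h"
      by (simp_all add: algebra_simps add_divide_distrib)
    ultimately show ?case using Suc unfolding e by linarith
  qed simp
  from this[of n] show ?thesis using n0 by simp
qed

text \<open>The bounded weak gradient enters by duality: \<open>weak_lip\<close> is stated for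
  nonnegative tests, which is the form that applies to the kernel.\<close>

locale weak_burgers =
  fixes l :: "real ^ 'd" and T MG MU :: real and U :: "real \<times> (real ^ 'd) \<Rightarrow> real"
  assumes l: "\<And>i. 0 < l $ i" and T: "0 < T"
    and cont: "continuous_on ({0..T} \<times> UNIV) U"
    and per: "\<And>t. t \<in> {0..T} \<Longrightarrow> periodic l (\<lambda>x. U (t, x))"
    and bounded: "\<And>t x. t \<in> {0..T} \<Longrightarrow> \<bar>U (t, x)\<bar> \<le> MU" and MG: "0 \<le> MG" and MU: "0 \<le> MU"
    and weak: "\<And>\<psi>. \<psi> \<in> cylinder_tests T l \<Longrightarrow>
        (LINT z:cylinder T l|lebesgue. U z * partial e_t \<psi> z + flux (U z) * (\<Sum>i\<in>UNIV. partial (e_x i) \<psi> z)) = 0"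
    and weak_lip: "\<And>e \<psi>. e \<in> Basis \<Longrightarrow> \<psi> \<in> cylinder_tests T l \<Longrightarrow> (\<And>z. 0 \<le> \<psi> z) \<Longrightarrow>
        \<bar>LINT z:cylinder T l|lebesgue. U z * partial e \<psi> z\<bar> \<le> MG * (LINT z:cylinder T l|lebesgue. \<psi> z)"
begin

lemma cont_open: "continuous_on ({0<..<T} \<times> UNIV) U"
  by (rule continuous_on_subset[OF cont]) auto

lemma per_open: "t \<in> {0<..<T} \<Longrightarrow> periodic l (\<lambda>x. U (t, x))"
  by (rule per) auto

lemma admissible_U: "admissible T l k \<Longrightarrow> admissible T l (\<lambda>w. U w * k w)"
  by (rule admissible_mult[OF _ cont_open per_open])

lemma admissible_comp_U:
  assumes "admissible T l k" "continuous_on UNIV F"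
  shows "admissible T l (\<lambda>w. F (U w) * k w)"
proof (rule admissible_mult[OF assms(1)])
  show "continuous_on ({0<..<T} \<times> UNIV) (\<lambda>w. F (U w))"
    by (rule continuous_on_compose2[OF assms(2) cont_open]) auto
  show "periodic l (\<lambda>x. F (U (t, x)))" if "t \<in> {0<..<T}" for t
    using per_open[OF that] by (simp add: periodic_def)
qed

text \<open>The weak equation tested with the kernel. Passing to derivatives in the centre changes
  the sign of the time and the space terms alike.\<close>

lemma conservation:
  assumes r: "0 < r" "r < fst c" "fst c + r < T"
  shows "strip_integral l (\<lambda>w. U w * kernel_d e_t l r c w)
     = - (\<Sum>i\<in>UNIV. strip_integral l (\<lambda>w. (U w)\<^sup>2 / 2 * kernel_d (e_x i) l r c w))"
proof -
  note k = admissible_kernel(2)[OF l r]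
  have aU: "admissible T l (\<lambda>w. U w * kernel_d e_t l r c w)" by (rule admissible_U[OF k[OF e_Basis(1)]])
  have aF: "admissible T l (\<lambda>w. (U w)\<^sup>2 / 2 * kernel_d (e_x i) l r c w)" for i
    by (rule admissible_comp_U[OF k[OF e_Basis(2)], of "\<lambda>u. u\<^sup>2 / 2"]) (auto intro!: continuous_intros)
  have aS: "admissible T l (\<lambda>w. \<Sum>i\<in>UNIV. (U w)\<^sup>2 / 2 * kernel_d (e_x i) l r c w)"
    by (rule admissible_sum[OF _ _ aF]) auto
  have eq: "U z * partial e_t (kernel_at l r c) z + flux (U z) * (\<Sum>i\<in>UNIV. partial (e_x i) (kernel_at l r c) z)
      = (- 1) * (U z * kernel_d e_t l r c z + (\<Sum>i\<in>UNIV. (U z)\<^sup>2 / 2 * kernel_d (e_x i) l r c z))" for z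
    by (simp add: partial_kernel_at flux_def sum_distrib_left sum_negf)
  have "strip_integral l (\<lambda>z. (- 1) * (U z * kernel_d e_t l r c z + (\<Sum>i\<in>UNIV. (U z)\<^sup>2 / 2 * kernel_d (e_x i) l r c z))) = 0"
    using weak[OF kernel_at_test[OF l r]] admissible_cylinder_integral[OF admissible_cmult[OF admissible_add[OF aU aS], of "- 1"]]
    unfolding eq by simp
  then show ?thesis
    unfolding strip_integral_cmult strip_integral_add[OF l aU aS]
    using strip_integral_sum[OF l, of UNIV T "\<lambda>i w. (U w)\<^sup>2 / 2 * kernel_d (e_x i) l r c w"] aF by simp
qed

text \<open>The window of the mollification lies in the future of \<open>z\<close>, so that it stays inside
  the cylinder for \<open>z\<close> at the initial time.\<close>

definition moll :: "real \<Rightarrow> real \<times> (real ^ 'd) \<Rightarrow> real" where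
  "moll r z = strip_integral l (\<lambda>w. U w * kernel_at l r (z + (2 * r, 0)) w) / kernel_mass l r"

definition moll_d :: "real \<times> (real ^ 'd) \<Rightarrow> real \<Rightarrow> real \<times> (real ^ 'd) \<Rightarrow> real" where
  "moll_d e r z = strip_integral l (\<lambda>w. U w * kernel_d e l r (z + (2 * r, 0)) w) / kernel_mass l r"

text \<open>The window has its centre at time \<open>fst z + 2 * r\<close> and time radius
  \<open>r\<close>, so it covers the times from \<open>fst z + r\<close> to
  \<open>fst z + 3 * r\<close>.\<close>

abbreviation valid :: "real \<Rightarrow> real \<times> (real ^ 'd) \<Rightarrow> bool" where
  "valid r z \<equiv> 0 < r \<and> (\<forall>i. r \<le> l $ i / 2) \<and> 0 \<le> fst z \<and> fst z + 3 * r < T"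

lemma validD:
  assumes "valid r z"
  shows "0 < r" "r < fst (z + (2 * r, 0))" "fst (z + (2 * r, 0)) + r < T" "0 < kernel_mass l r" "fst z \<in> {0..T}"
  using assms kernel_mass_pos[OF l, of r] by auto

text \<open>The kernel is a nonnegative test function, so \<open>weak_lip\<close> bounds the
  integral by \<open>MG\<close> times the mass that is divided out. The bound does not depend on
  \<open>r\<close>.\<close>

lemma moll_d_bound: assumes "valid r z" "e \<in> Basis" shows "\<bar>moll_d e r z\<bar> \<le> MG"
proof -
  note v = validD[OF assms(1)]
  let ?c = "z + (2 * r, 0)"
  note t = kernel_at_test[OF l v(1-3)]
  have "admissible T l (\<lambda>w. U w * partial e (kernel_at l r ?c) w)"
    by (rule admissible_U[OF admissible_test(2)[OF t T assms(2)]])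
  from admissible_cylinder_integral[OF this] admissible_cylinder_integral[OF admissible_test(1)[OF t T]]
  have "\<bar>strip_integral l (\<lambda>w. U w * partial e (kernel_at l r ?c) w)\<bar> \<le> MG * kernel_mass l r"
    using weak_lip[OF assms(2) t kernel_at_nonneg] unfolding kernel_mass_at[OF l v(1-3), symmetric] by simp
  moreover have "strip_integral l (\<lambda>w. U w * kernel_d e l r ?c w) = - strip_integral l (\<lambda>w. U w * partial e (kernel_at l r ?c) w)"
    using strip_integral_cmult[of l "- 1" "\<lambda>w. U w * partial e (kernel_at l r ?c) w"] by (simp add: kernel_d_eq)
  ultimately show ?thesis using v(4) by (simp add: moll_d_def pos_divide_le_eq)
qed

lemma moll_taylor:
  assumes r: "0 < r" "\<And>i. r \<le> l $ i / 2" and e: "e \<in> Basis" and \<eta>: "0 < \<eta>"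
  shows "\<exists>\<rho>>0. \<forall>z s. 0 < s \<and> s < \<rho> \<and> valid r z \<and> valid r (z + s *\<^sub>R e) \<longrightarrow>
     \<bar>moll r (z + s *\<^sub>R e) - moll r z - s * moll_d e r z\<bar> \<le> \<eta> * s"
proof -
  let ?W = "(T - 0) * (\<Prod>i\<in>UNIV. l $ i)" and ?m = "kernel_mass l r"
  have W: "0 < ?W" using T l by (intro mult_pos_pos prod_pos) auto
  have m: "0 < ?m" by (rule kernel_mass_pos[OF l r])
  \<comment> \<open>The Taylor error of the kernel is multiplied by \<open>U\<close> and integrated
    over a set of volume \<open>?W\<close>; the \<open>+ 1\<close> avoids division by zero if
    \<open>MU = 0\<close>.\<close>
  define \<eta>' where "\<eta>' = \<eta> * ?m / ((MU + 1) * ?W)"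
  have MU1: "0 < MU + 1" using MU by simp
  have \<eta>': "0 < \<eta>'" unfolding \<eta>'_def by (rule divide_pos_pos[OF mult_pos_pos[OF \<eta> m] mult_pos_pos[OF MU1 W]])
  have key: "MU * \<eta>' * ?W \<le> \<eta> * ?m"
  proof -
    have "MU * \<eta>' * ?W \<le> (MU + 1) * \<eta>' * ?W" using \<eta>' W by (intro mult_right_mono) auto
    also have "\<dots> = ((MU + 1) * ?W) * \<eta>'" by (simp only: mult_ac)
    also have "\<dots> = \<eta> * ?m"
      unfolding \<eta>'_def using mult_pos_pos[OF MU1 W] by (simp only: times_divide_eq_right) (metis less_irrefl nonzero_mult_div_cancel_left)
    finally show ?thesis .
  qed
  obtain \<rho> where \<rho>: "0 < \<rho>" and tay: "\<And>c w s. 0 < s \<and> s < \<rho> \<Longrightarrow>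
      \<bar>kernel_at l r (c + s *\<^sub>R e) w - kernel_at l r c w - s * kernel_d e l r c w\<bar> \<le> \<eta>' * s"
    using kernel_taylor[OF l r(1) e \<eta>'] by blast
  have "\<bar>moll r (z + s *\<^sub>R e) - moll r z - s * moll_d e r z\<bar> \<le> \<eta> * s"
    if s: "0 < s" "s < \<rho>" and z: "valid r z" "valid r (z + s *\<^sub>R e)" for z s
  proof -
    let ?c = "z + (2 * r, 0)"
    have sh: "z + s *\<^sub>R e + (2 * r, 0) = ?c + s *\<^sub>R e" by simp
    note v = validD[OF z(1)] and v' = validD[OF z(2), unfolded sh]
    note k1 = admissible_kernel(1)[OF l v'(1-3)] and k2 = admissible_kernel(1)[OF l v(1-3)] and k3 = admissible_kernel(2)[OF l v(1-3) e]
    let ?q = "\<lambda>w. kernel_at l r (?c + s *\<^sub>R e) w - kernel_at l r ?c w - s * kernel_d e l r ?c w"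
    have q: "admissible T l ?q" by (intro admissible_diff k1 k2 admissible_cmult k3)
    have aU: "admissible T l (\<lambda>w. U w * ?q w)" by (rule admissible_U[OF q])
    have "strip_integral l (\<lambda>w. U w * ?q w)
      = strip_integral l (\<lambda>w. U w * kernel_at l r (?c + s *\<^sub>R e) w - U w * kernel_at l r ?c w - s * (U w * kernel_d e l r ?c w))"
      by (rule arg_cong[where f = "strip_integral l"]) (simp add: fun_eq_iff algebra_simps)
    also have "\<dots> = strip_integral l (\<lambda>w. U w * kernel_at l r (?c + s *\<^sub>R e) w) - strip_integral l (\<lambda>w. U w * kernel_at l r ?c w)
        - s * strip_integral l (\<lambda>w. U w * kernel_d e l r ?c w)"
      by (rule strip_integral_lin3[OF l admissible_U[OF k1] admissible_U[OF k2] admissible_U[OF k3]])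
    finally have lin: "strip_integral l (\<lambda>w. U w * ?q w) = strip_integral l (\<lambda>w. U w * kernel_at l r (?c + s *\<^sub>R e) w)
        - strip_integral l (\<lambda>w. U w * kernel_at l r ?c w) - s * strip_integral l (\<lambda>w. U w * kernel_d e l r ?c w)" .
    have eq: "strip_integral l (\<lambda>w. U w * ?q w) = (moll r (z + s *\<^sub>R e) - moll r z - s * moll_d e r z) * ?m"
    proof -
      have "A - B - s * C = (A / M - B / M - s * (C / M)) * M" if "0 < M" for A B C M :: real
        using that by (simp add: field_simps)
      from this[OF m] show ?thesis unfolding moll_def moll_d_def sh lin by blast
    qed
    have "\<bar>strip_integral l (\<lambda>w. U w * ?q w)\<bar> \<le> (MU * (\<eta>' * s)) * ?W"
    proof (rule strip_integrable(2)[OF l admissible_borel[OF aU]])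
      have out: "U w * ?q w = 0" if "fst w \<notin> {0..T}" for w
        using aU that unfolding admissible_def by (meson atLeastAtMost_iff less_imp_le order_trans)
      show "U w * ?q w = 0" if "fst w \<notin> {0..T}" for w by (rule out[OF that])
      show "\<bar>U w * ?q w\<bar> \<le> MU * (\<eta>' * s)" for w
      proof (cases "fst w \<in> {0..T}")
        case True
        then have "\<bar>U w\<bar> \<le> MU" using bounded[of "fst w" "snd w"] by simp
        then show ?thesis unfolding abs_mult using tay[of s ?c w] s MU by (intro mult_mono) auto
      next
        case False
        show ?thesis unfolding out[OF False] using MU \<eta>' s by simp
      qed
    qed (use T in auto)
    also have "\<dots> = MU * \<eta>' * ?W * s" by (simp only: mult_ac)
    also have "\<dots> \<le> \<eta> * ?m * s" using key s by (intro mult_right_mono) auto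
    finally have "\<bar>moll r (z + s *\<^sub>R e) - moll r z - s * moll_d e r z\<bar> * ?m \<le> \<eta> * s * ?m"
      unfolding eq abs_mult using m by (simp add: mult_ac)
    then show ?thesis using m by simp
  qed
  then show ?thesis using \<rho> by blast
qed

text \<open>Points of the window are less than \<open>3 * r\<close> away in time and, modulo the
  lattice, at most \<open>d * r\<close> in space.\<close>

lemma oscillation:
  assumes \<delta>: "0 < \<delta>"
  shows "\<exists>r0>0. \<forall>r<r0. \<forall>z w. valid r z \<and> kernel_at l r (z + (2 * r, 0)) w \<noteq> 0 \<longrightarrow> \<bar>U w - U z\<bar> \<le> \<delta>"
proof -
  obtain \<rho> where \<rho>: "0 < \<rho>" and uc: "\<And>t s x y. t \<in> {0..T} \<Longrightarrow> s \<in> {0..T} \<Longrightarrow> \<bar>t - s\<bar> < \<rho> \<Longrightarrow> dist x y < \<rho> \<Longrightarrow>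
      \<bar>U (t, x) - U (s, y)\<bar> < \<delta>"
    using periodic_uniformly_continuous[OF l cont per \<delta>] by metis
  let ?d = "real CARD('d)"
  have d: "1 \<le> ?d" using zero_less_card_finite[where 'a = 'd] by linarith
  have "\<bar>U w - U z\<bar> \<le> \<delta>"
    if r: "r < \<rho> / (3 * ?d)" and z: "valid r z" and k: "kernel_at l r (z + (2 * r, 0)) w \<noteq> 0" for r z w
  proof -
    note v = validD[OF z]
    have r': "3 * r * ?d < \<rho>" using r d by (simp add: field_simps)
    have "3 * r * 1 \<le> 3 * r * ?d" "1 * (r * ?d) \<le> 3 * (r * ?d)" using d v(1) by (intro mult_left_mono mult_right_mono; simp)+
    then have r3: "3 * r < \<rho>" "?d * r < \<rho>" using r' by (simp_all add: mult_ac)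
    have "\<bar>fst (z + (2 * r, 0) - w)\<bar> < r" and "\<exists>\<nu>\<in>lattice l. norm (snd (z + (2 * r, 0) - w) + \<nu>) \<le> ?d * r"
      using kernel_support[OF l v(1)] z k unfolding kernel_at_def by blast+
    then obtain \<nu> where t: "\<bar>fst z + 2 * r - fst w\<bar> < r" and \<nu>: "\<nu> \<in> lattice l" "norm (snd z - snd w + \<nu>) \<le> ?d * r" by auto
    have "\<bar>fst w - fst z\<bar> < \<rho>" using t r3 by linarith
    moreover have "dist (snd w) (snd z + \<nu>) < \<rho>"
      using \<nu>(2) r3 by (simp add: dist_norm norm_minus_commute algebra_simps)
    moreover have "fst w \<in> {0..T}" using t z v(1) by (auto simp: abs_less_iff)
    ultimately have "\<bar>U (fst w, snd w) - U (fst z, snd z + \<nu>)\<bar> < \<delta>" using v(5) by (intro uc)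
    then show ?thesis using periodic_lattice[OF per[OF v(5)] \<nu>(1), of "snd z"] by simp
  qed
  then show ?thesis using \<rho> d by (intro exI[of _ "\<rho> / (3 * ?d)"]) auto
qed

text \<open>The reference value \<open>v\<close> is free: \<open>U z\<close> gives closeness to
  \<open>U\<close>, and 0 gives the sup bound for the mollified function.\<close>

lemma moll_close:
  assumes z: "valid r z" and osc: "\<And>w. kernel_at l r (z + (2 * r, 0)) w \<noteq> 0 \<Longrightarrow> \<bar>U w - v\<bar> \<le> \<delta>"
  shows "\<bar>moll r z - v\<bar> \<le> \<delta>"
proof -
  note v = validD[OF z]
  have "\<bar>strip_integral l (\<lambda>w. U w * kernel_at l r (z + (2 * r, 0)) w) - v * kernel_mass l r\<bar> \<le> \<delta> * kernel_mass l r"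
    by (rule kernel_average[OF l v(1-3) cont_open per_open osc])
  moreover have "strip_integral l (\<lambda>w. U w * kernel_at l r (z + (2 * r, 0)) w) = moll r z * kernel_mass l r"
    using v(4) by (simp add: moll_def)
  ultimately have "\<bar>moll r z - v\<bar> * kernel_mass l r \<le> \<delta> * kernel_mass l r"
    using v(4) by (simp add: abs_mult left_diff_distrib[symmetric])
  then show ?thesis using v(4) by simp
qed

lemma moll_exists:
  assumes \<delta>: "0 < \<delta>" and T': "T' < T"
  shows "\<exists>r. (\<forall>t\<in>{0..T'}. \<forall>x. valid r (t, x)) \<and> 0 < r \<and> (\<forall>i. r \<le> l $ i / 2) \<and>
     (\<forall>z w. valid r z \<and> kernel_at l r (z + (2 * r, 0)) w \<noteq> 0 \<longrightarrow> \<bar>U w - U z\<bar> \<le> \<delta>)"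
proof -
  obtain r0 where r0: "0 < r0" and o: "\<And>r z w. r < r0 \<Longrightarrow> valid r z \<and> kernel_at l r (z + (2 * r, 0)) w \<noteq> 0 \<Longrightarrow> \<bar>U w - U z\<bar> \<le> \<delta>"
    using oscillation[OF \<delta>] by blast
  define m where "m = Min (range (\<lambda>i. l $ i / 2))"
  have m: "0 < m" "\<And>i. m \<le> l $ i / 2"
  proof -
    have "m \<in> range (\<lambda>i. l $ i / 2)" unfolding m_def by (rule Min_in) auto
    then show "0 < m" using l by auto
    show "m \<le> l $ i / 2" for i unfolding m_def by (rule Min_le) auto
  qed
  \<comment> \<open>A sixth of the gap makes \<open>T' + 3 * r\<close> at most the midpoint of
    \<open>T'\<close> and \<open>T\<close>, so the window stays below \<open>T\<close>.\<close>
  define r where "r = min (min (r0 / 2) m) ((T - T') / 6)"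
  have r: "0 < r" "r < r0" "r \<le> m" unfolding r_def using r0 m T' by auto
  have r6: "r \<le> (T - T') / 6" unfolding r_def by (rule min.cobounded2)
  have rl: "r \<le> l $ i / 2" for i using r(3) m(2)[of i] by linarith
  have "valid r (t, x)" if "t \<in> {0..T'}" for t x using that r r6 rl T' by auto
  then show ?thesis using r rl o by blast
qed

text \<open>The mollified functions have spatial difference quotients bounded by \<open>MG\<close>
  up to an arbitrarily small Taylor error, whatever \<open>r\<close>, and they approximate
  \<open>U\<close> uniformly on the slice.\<close>

lemma U_lipschitz:
  assumes t: "0 \<le> t" "t < T" and s: "0 < s"
  shows "\<bar>U (t, x + s *\<^sub>R axis i 1) - U (t, x)\<bar> \<le> MG * s"
proof -
  have "\<bar>U (t, x + s *\<^sub>R axis i 1) - U (t, x)\<bar> \<le> MG * s + \<epsilon>" if \<epsilon>: "0 < \<epsilon>" for \<epsilon>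
  proof -
    \<comment> \<open>Two approximation errors of \<open>\<epsilon> / 4\<close>; the other half of
      \<open>\<epsilon>\<close> is the Taylor slack \<open>\<eta> * s\<close>.\<close>
    define \<delta> where "\<delta> = \<epsilon> / 4"
    have \<delta>: "0 < \<delta>" unfolding \<delta>_def using \<epsilon> by simp
    define \<eta> where "\<eta> = \<epsilon> / (2 * s)"
    have \<eta>: "0 < \<eta>" unfolding \<eta>_def using \<epsilon> s by simp
    obtain r where vt: "\<And>x. valid r (t, x)" and r: "0 < r" "\<And>i. r \<le> l $ i / 2"
      and o: "\<And>z w. valid r z \<and> kernel_at l r (z + (2 * r, 0)) w \<noteq> 0 \<Longrightarrow> \<bar>U w - U z\<bar> \<le> \<delta>"
      using moll_exists[OF \<delta> t(2)] t(1) by (metis atLeastAtMost_iff order_refl)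
    have cl: "\<bar>moll r (t, y) - U (t, y)\<bar> \<le> \<delta>" for y
      by (rule moll_close[OF vt]) (use o vt in blast)
    obtain \<rho> where \<rho>: "0 < \<rho>" and tay: "\<And>z s. 0 < s \<and> s < \<rho> \<and> valid r z \<and> valid r (z + s *\<^sub>R e_x i) \<Longrightarrow>
       \<bar>moll r (z + s *\<^sub>R e_x i) - moll r z - s * moll_d (e_x i) r z\<bar> \<le> \<eta> * s"
      using moll_taylor[OF r e_Basis(2) \<eta>, of i] by blast
    let ?F = "\<lambda>\<sigma>. moll r (t, x + \<sigma> *\<^sub>R axis i 1)"
    have "\<bar>?F (0 + s) - ?F 0\<bar> \<le> (MG + \<eta>) * s"
    proof (rule lipschitz_from_small_steps[OF \<rho> _ s])
      fix \<sigma> h :: real assume h: "0 < h" "h < \<rho>"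
      let ?z = "(t, x + \<sigma> *\<^sub>R axis i 1)"
      have e: "?z + h *\<^sub>R e_x i = (t, x + (\<sigma> + h) *\<^sub>R axis i 1)" by (simp add: scaleR_add_left)
      have "\<bar>moll r (t, x + (\<sigma> + h) *\<^sub>R axis i 1) - moll r ?z - h * moll_d (e_x i) r ?z\<bar> \<le> \<eta> * h"
        using tay[of h ?z] h vt unfolding e by blast
      moreover have "\<bar>h * moll_d (e_x i) r ?z\<bar> \<le> h * MG"
        unfolding abs_mult using moll_d_bound[OF vt e_Basis(2)] h by (intro mult_mono) auto
      moreover have "(MG + \<eta>) * h = h * MG + \<eta> * h" by (simp add: algebra_simps)
      ultimately show "\<bar>?F (\<sigma> + h) - ?F \<sigma>\<bar> \<le> (MG + \<eta>) * h" by linarith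
    qed
    moreover have "(MG + \<eta>) * s = MG * s + \<epsilon> / 2" unfolding \<eta>_def using s by (simp add: field_simps)
    ultimately have "\<bar>moll r (t, x + s *\<^sub>R axis i 1) - moll r (t, x)\<bar> \<le> MG * s + \<epsilon> / 2" by simp
    then show ?thesis using cl[of x] cl[of "x + s *\<^sub>R axis i 1"] unfolding \<delta>_def by linarith
  qed
  then show ?thesis by (rule field_le_epsilon)
qed

end

context weak_burgers begin

text \<open>The derivative of the kernel is replaced by a difference quotient with step \<open>s\<close>, which is then
  moved to \<open>(U - v)\<^sup>2\<close> by shifting the integration variable.\<close>

lemma defect_bound:
  assumes z: "valid r z" and \<delta>: "0 < \<delta>"
    and osc: "\<And>w. kernel_at l r (z + (2 * r, 0)) w \<noteq> 0 \<Longrightarrow> \<bar>U w - v\<bar> \<le> 2 * \<delta>"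
  shows "\<bar>strip_integral l (\<lambda>w. (U w - v)\<^sup>2 / 2 * kernel_d (e_x i) l r (z + (2 * r, 0)) w)\<bar>
     \<le> (2 * MG + 1) * \<delta> * kernel_mass l r"
proof -
  let ?c = "z + (2 * r, 0)" and ?g = "\<lambda>w. (U w - v)\<^sup>2 / 2" and ?m = "kernel_mass l r" and ?W = "(T - 0) * (\<Prod>i\<in>UNIV. l $ i)"
  let ?e = "e_x i" and ?Q = "strip_integral l (\<lambda>w. (U w - v)\<^sup>2 / 2 * kernel_d (e_x i) l r (z + (2 * r, 0)) w)"
  note vd = validD[OF z]
  have W: "0 < ?W" using T l by (intro mult_pos_pos prod_pos) auto
  define G0 where "G0 = (MU + \<bar>v\<bar>)\<^sup>2 / 2"
  have G0: "0 \<le> G0" unfolding G0_def by simp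
  have G01: "0 < G0 + 1" using G0 by simp
  have gb: "\<bar>?g w\<bar> \<le> G0" if "fst w \<in> {0..T}" for w
  proof -
    have "\<bar>U w - v\<bar> \<le> MU + \<bar>v\<bar>" using bounded[OF that, of "snd w"] by simp
    then have "\<bar>U w - v\<bar>\<^sup>2 \<le> (MU + \<bar>v\<bar>)\<^sup>2" by (intro power_mono) auto
    then show ?thesis unfolding G0_def by simp
  qed
  \<comment> \<open>Keeps the error of the difference quotient below a quarter of
    \<open>\<delta>\<close> times the kernel mass.\<close>
  define \<eta> where "\<eta> = \<delta> * ?m / (4 * ((G0 + 1) * ?W))"
  have \<eta>: "0 < \<eta>"
    unfolding \<eta>_def using mult_pos_pos[OF \<delta> vd(4)] mult_pos_pos[OF G01 W] by (intro divide_pos_pos) auto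
  have key: "G0 * \<eta> * ?W \<le> \<delta> * ?m / 4"
  proof -
    have "G0 * \<eta> * ?W \<le> (G0 + 1) * \<eta> * ?W" using \<eta> W by (intro mult_right_mono) auto
    also have "\<dots> = ((G0 + 1) * ?W) * \<eta>" by (simp only: mult_ac)
    also have "\<dots> = \<delta> * ?m / 4"
    proof -
      have "x * (y / (4 * x)) = y / 4" if "0 < x" for x y :: real using that by simp
      from this[OF mult_pos_pos[OF G01 W]] show ?thesis unfolding \<eta>_def .
    qed
    finally show ?thesis .
  qed
  obtain \<rho> where \<rho>: "0 < \<rho>" and tay: "\<And>c w s. 0 < s \<and> s < \<rho> \<Longrightarrow>
      \<bar>kernel_at l r (c + s *\<^sub>R ?e) w - kernel_at l r c w - s * kernel_d ?e l r c w\<bar> \<le> \<eta> * s"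
    using kernel_taylor[OF l vd(1) e_Basis(2) \<eta>] by blast
  \<comment> \<open>The second bound makes \<open>MG\<^sup>2 * s \<le> \<delta>\<close>, so that the
    quadratic part of the increment of the square is of order \<open>\<delta>\<close> as
    well.\<close>
  define s where "s = min (\<rho> / 2) (\<delta> / (MG\<^sup>2 + 1))"
  have MG1: "0 < MG\<^sup>2 + 1" by (simp add: add_nonneg_pos)
  have s: "0 < s" "s < \<rho>" unfolding s_def using \<rho> \<delta> MG1 by auto
  have sMG: "MG\<^sup>2 * s \<le> \<delta>"
  proof -
    have "MG\<^sup>2 * s \<le> (MG\<^sup>2 + 1) * (\<delta> / (MG\<^sup>2 + 1))" unfolding s_def using \<delta> MG1 s(1)[unfolded s_def] by (intro mult_mono) auto
    then show ?thesis using MG1 by simp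
  qed
  let ?c' = "?c + s *\<^sub>R ?e"
  have c': "fst ?c' = fst ?c" by simp
  note k' = admissible_kernel(1)[OF l vd(1) vd(2)[folded c'] vd(3)[folded c']]
    and k = admissible_kernel(1)[OF l vd(1-3)] and kd = admissible_kernel(2)[OF l vd(1-3) e_Basis(2)]
  have gcont: "continuous_on UNIV (\<lambda>u. (u - v)\<^sup>2 / 2)" by (intro continuous_intros) auto
  note ag = admissible_comp_U[OF _ gcont]
  let ?q = "\<lambda>w. kernel_at l r ?c' w - kernel_at l r ?c w - s * kernel_d ?e l r ?c w"
  have q: "admissible T l ?q" by (intro admissible_diff k' k admissible_cmult kd)
  have "strip_integral l (\<lambda>w. ?g w * ?q w)
    = strip_integral l (\<lambda>w. ?g w * kernel_at l r ?c' w - ?g w * kernel_at l r ?c w - s * (?g w * kernel_d ?e l r ?c w))"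
    by (rule arg_cong[where f = "strip_integral l"]) (simp add: fun_eq_iff algebra_simps)
  also have "\<dots> = strip_integral l (\<lambda>w. ?g w * kernel_at l r ?c' w) - strip_integral l (\<lambda>w. ?g w * kernel_at l r ?c w) - s * ?Q"
    by (rule strip_integral_lin3[OF l ag[OF k'] ag[OF k] ag[OF kd]])
  finally have split: "s * ?Q = strip_integral l (\<lambda>w. ?g w * kernel_at l r ?c' w) - strip_integral l (\<lambda>w. ?g w * kernel_at l r ?c w)
      - strip_integral l (\<lambda>w. ?g w * ?q w)" by linarith
  have err: "\<bar>strip_integral l (\<lambda>w. ?g w * ?q w)\<bar> \<le> (G0 * (\<eta> * s)) * ?W"
  proof (rule strip_integrable(2)[OF l admissible_borel[OF ag[OF q]]])
    have out: "?g w * ?q w = 0" if "fst w \<notin> {0..T}" for w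
      using ag[OF q] that unfolding admissible_def by (meson atLeastAtMost_iff less_imp_le order_trans)
    show "?g w * ?q w = 0" if "fst w \<notin> {0..T}" for w by (rule out[OF that])
    show "\<bar>?g w * ?q w\<bar> \<le> G0 * (\<eta> * s)" for w
    proof (cases "fst w \<in> {0..T}")
      case True
      show ?thesis unfolding abs_mult[of "?g w"] using tay[of s ?c w] gb[OF True] s G0 by (intro mult_mono) auto
    next
      case False
      show ?thesis unfolding out[OF False] using G0 \<eta> s by simp
    qed
  qed (use T in auto)
  have shift: "strip_integral l (\<lambda>w. ?g w * kernel_at l r ?c' w) = strip_integral l (\<lambda>w. ?g (w + s *\<^sub>R ?e) * kernel_at l r ?c w)"
  proof -
    have "kernel_at l r ?c' (w + s *\<^sub>R ?e) = kernel_at l r ?c w" for w by (simp add: kernel_at_def)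
    then show ?thesis using strip_integral_shift[OF l ag[OF k'], of "s *\<^sub>R ?e"] by simp
  qed
  have sh_cont: "continuous_on ({0<..<T} \<times> UNIV) (\<lambda>w. ?g (w + s *\<^sub>R ?e))"
    by (rule continuous_on_compose2[OF continuous_on_compose2[OF gcont cont_open]]) (auto intro!: continuous_intros)
  have sh_per: "periodic l (\<lambda>x. ?g ((t, x) + s *\<^sub>R ?e))" if "t \<in> {0<..<T}" for t
  proof -
    have "U (t, x + axis j (l $ j) + s *\<^sub>R axis i 1) = U (t, x + s *\<^sub>R axis i 1)" for x j
    proof -
      have "x + axis j (l $ j) + s *\<^sub>R axis i 1 = (x + s *\<^sub>R axis i 1) + axis j (l $ j)" by simp
      then show ?thesis using per_open[OF that] by (simp only: periodic_def)
    qed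
    then show ?thesis by (simp add: periodic_def)
  qed
  have a1: "admissible T l (\<lambda>w. ?g (w + s *\<^sub>R ?e) * kernel_at l r ?c w)"
    by (rule admissible_mult[OF k sh_cont sh_per])
  have diff: "\<bar>strip_integral l (\<lambda>w. ?g (w + s *\<^sub>R ?e) * kernel_at l r ?c w) - strip_integral l (\<lambda>w. ?g w * kernel_at l r ?c w)\<bar>
     \<le> (MG * s * (4 * \<delta> + MG * s) / 2) * ?m"
  proof -
    have "\<bar>strip_integral l (\<lambda>w. ?g (w + s *\<^sub>R ?e) * kernel_at l r ?c w - ?g w * kernel_at l r ?c w)\<bar>
        \<le> strip_integral l (\<lambda>w. (MG * s * (4 * \<delta> + MG * s) / 2) * kernel_at l r ?c w)"
    proof (rule strip_integral_abs_le[OF l admissible_diff[OF a1 ag[OF k]] admissible_cmult[OF k]])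
      fix w
      show "\<bar>?g (w + s *\<^sub>R ?e) * kernel_at l r ?c w - ?g w * kernel_at l r ?c w\<bar> \<le> (MG * s * (4 * \<delta> + MG * s) / 2) * kernel_at l r ?c w"
      proof (cases "kernel_at l r ?c w = 0")
        case False
        have "fst w \<in> {fst ?c - r..fst ?c + r}" using kernel_at_zero[OF vd(1)] False by blast
        then have tw: "0 \<le> fst w" "fst w < T" using vd by auto
        let ?a = "U (w + s *\<^sub>R ?e) - v" and ?b = "U w - v"
        have "\<bar>U (fst w, snd w + s *\<^sub>R axis i 1) - U (fst w, snd w)\<bar> \<le> MG * s" by (rule U_lipschitz[OF tw s(1)])
        moreover have "w + s *\<^sub>R ?e = (fst w, snd w + s *\<^sub>R axis i 1)" by (cases w) simp
        ultimately have ab: "\<bar>?a - ?b\<bar> \<le> MG * s" by simp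
        have b: "\<bar>?b\<bar> \<le> 2 * \<delta>" by (rule osc[OF False])
        have "\<bar>?a + ?b\<bar> \<le> 4 * \<delta> + MG * s" using ab b by linarith
        \<comment> \<open>Difference of squares: the first factor is Lipschitz of order
          \<open>s\<close>, the second is small by the oscillation bound. Dividing by
          \<open>s\<close> leaves order \<open>\<delta>\<close>.\<close>
        then have "\<bar>?a - ?b\<bar> * \<bar>?a + ?b\<bar> \<le> MG * s * (4 * \<delta> + MG * s)" using ab by (intro mult_mono) auto
        moreover have "?g (w + s *\<^sub>R ?e) - ?g w = (?a - ?b) * (?a + ?b) / 2" by (simp add: power2_eq_square field_simps)
        then have "\<bar>?g (w + s *\<^sub>R ?e) - ?g w\<bar> = \<bar>?a - ?b\<bar> * \<bar>?a + ?b\<bar> / 2"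
          by (simp only: abs_mult abs_divide abs_numeral)
        ultimately have "\<bar>?g (w + s *\<^sub>R ?e) - ?g w\<bar> \<le> MG * s * (4 * \<delta> + MG * s) / 2" by linarith
        then show ?thesis
          unfolding left_diff_distrib[symmetric] abs_mult[of _ "kernel_at l r ?c w"] abs_of_nonneg[OF kernel_at_nonneg]
          by (rule mult_right_mono[OF _ kernel_at_nonneg])
      qed simp
    qed
    then show ?thesis
      unfolding strip_integral_cmult kernel_mass_at[OF l vd(1-3)] strip_integral_diff[OF l a1 ag[OF k]] .
  qed
  have "s * \<bar>?Q\<bar> = \<bar>s * ?Q\<bar>" using s by (simp add: abs_mult)
  also have "\<dots> \<le> (MG * s * (4 * \<delta> + MG * s) / 2) * ?m + (G0 * (\<eta> * s)) * ?W"
    using split err diff unfolding shift by linarith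
  also have "\<dots> = s * ((2 * MG * \<delta> + MG\<^sup>2 * s / 2) * ?m + G0 * \<eta> * ?W)"
    by (simp add: algebra_simps power2_eq_square)
  finally have "\<bar>?Q\<bar> \<le> (2 * MG * \<delta> + MG\<^sup>2 * s / 2) * ?m + G0 * \<eta> * ?W" using s(1) by simp
  also have "\<dots> \<le> (2 * MG * \<delta> + \<delta> / 2) * ?m + \<delta> * ?m / 4"
    using key sMG vd(4) MG \<delta> by (intro add_mono mult_right_mono) auto
  also have "\<dots> \<le> (2 * MG + 1) * \<delta> * ?m" using \<delta> vd(4) by (simp add: algebra_simps)
  finally show ?thesis .
qed

text \<open>With \<open>v\<close> frozen at the mollified value, the residual is minus the kernel
  derivative tested against \<open>(U - v)\<^sup>2 / 2\<close>, summed over directions: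
  \<open>conservation\<close> supplies the square, the linear term is the transport part, and the
  constant drops by \<open>kernel_d_integral\<close>.\<close>

lemma moll_residual:
  assumes z: "valid r z" and \<delta>: "0 < \<delta>"
    and osc: "\<And>w. kernel_at l r (z + (2 * r, 0)) w \<noteq> 0 \<Longrightarrow> \<bar>U w - U z\<bar> \<le> \<delta>"
  shows "\<bar>moll_d e_t r z + moll r z * (\<Sum>i\<in>UNIV. moll_d (e_x i) r z)\<bar> \<le> real CARD('d) * ((2 * MG + 1) * \<delta>)"
proof -
  let ?c = "z + (2 * r, 0)" and ?v = "moll r z" and ?m = "kernel_mass l r"
  note vd = validD[OF z]
  have "\<bar>?v - U z\<bar> \<le> \<delta>" by (rule moll_close[OF z osc])
  then have osc2: "\<bar>U w - ?v\<bar> \<le> 2 * \<delta>" if "kernel_at l r ?c w \<noteq> 0" for w using osc[OF that] by linarith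
  let ?I1 = "\<lambda>i. strip_integral l (\<lambda>w. U w * kernel_d (e_x i) l r ?c w)"
    and ?I2 = "\<lambda>i. strip_integral l (\<lambda>w. (U w)\<^sup>2 / 2 * kernel_d (e_x i) l r ?c w)"
    and ?Q = "\<lambda>i. strip_integral l (\<lambda>w. (U w - ?v)\<^sup>2 / 2 * kernel_d (e_x i) l r ?c w)"
  have Q: "?Q i = ?I2 i - ?v * ?I1 i" for i
  proof -
    note kd = admissible_kernel(2)[OF l vd(1-3) e_Basis(2), of i]
    have a2: "admissible T l (\<lambda>w. (U w)\<^sup>2 / 2 * kernel_d (e_x i) l r ?c w)"
      by (rule admissible_comp_U[OF kd, of "\<lambda>u. u\<^sup>2 / 2"]) (auto intro!: continuous_intros)
    have "?Q i = strip_integral l (\<lambda>w. (U w)\<^sup>2 / 2 * kernel_d (e_x i) l r ?c w - (- (?v\<^sup>2 / 2)) * kernel_d (e_x i) l r ?c w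
        - ?v * (U w * kernel_d (e_x i) l r ?c w))"
      by (rule arg_cong[where f = "strip_integral l"]) (simp add: fun_eq_iff power2_eq_square field_simps)
    also have "\<dots> = ?I2 i - (- (?v\<^sup>2 / 2)) * strip_integral l (kernel_d (e_x i) l r ?c) - ?v * ?I1 i"
      unfolding strip_integral_lin3[OF l a2 admissible_cmult[OF kd] admissible_U[OF kd]] strip_integral_cmult by (rule refl)
    finally show ?thesis unfolding kernel_d_integral[OF l vd(1-3) e_Basis(2)] by simp
  qed
  have "moll_d e_t r z + ?v * (\<Sum>i\<in>UNIV. moll_d (e_x i) r z) = - (\<Sum>i\<in>UNIV. ?Q i) / ?m"
    unfolding moll_d_def conservation[OF vd(1-3)] Q
    by (simp add: sum_subtractf sum_divide_distrib sum_distrib_left diff_divide_distrib)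
  then have "\<bar>moll_d e_t r z + ?v * (\<Sum>i\<in>UNIV. moll_d (e_x i) r z)\<bar> = \<bar>\<Sum>i\<in>UNIV. ?Q i\<bar> / ?m"
    using vd(4) by (simp add: abs_divide)
  also have "\<dots> \<le> (\<Sum>i\<in>(UNIV :: 'd set). (2 * MG + 1) * \<delta> * ?m) / ?m"
    using vd(4) by (intro divide_right_mono order_trans[OF sum_abs] sum_mono defect_bound[OF z \<delta> osc2]) auto
  also have "\<dots> = real CARD('d) * ((2 * MG + 1) * \<delta>)" using vd(4) by simp
  finally show ?thesis .
qed

lemma moll_periodic: "periodic l (\<lambda>x. moll r (t, x))"
  unfolding periodic_def
proof (intro allI)
  fix x i
  have "kernel_at l r ((t, x + axis i (l $ i)) + (2 * r, 0)) w = kernel_at l r ((t, x) + (2 * r, 0)) w" for w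
  proof -
    have "(t, x + axis i (l $ i)) + (2 * r, 0) - w = (t + 2 * r - fst w, (x - snd w) + axis i (l $ i))"
      and "(t, x) + (2 * r, 0) - w = (t + 2 * r - fst w, x - snd w)"
      by (simp_all add: prod_eq_iff)
    then show ?thesis
      using periodic_kernel[OF l, of r "t + 2 * r - fst w"] unfolding kernel_at_def by (simp only: periodic_def)
  qed
  then show "moll r (t, x + axis i (l $ i)) = moll r (t, x)" unfolding moll_def by simp
qed

text \<open>The bound \<open>max MU MG\<close> is independent of \<open>\<epsilon>\<close> and
  \<open>T'\<close>, as \<open>scheme_converges\<close> requires.\<close>

theorem approximate_solutions:
  assumes T': "0 < T'" "T' < T" and \<epsilon>: "0 < \<epsilon>"
  shows "\<exists>V. approx_solution T' l (max MU MG) \<epsilon> V \<and> (\<forall>t\<in>{0..T'}. \<forall>x. \<bar>V (t, x) - U (t, x)\<bar> \<le> \<epsilon>)"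
proof -
  let ?d = "real CARD('d)"
  \<comment> \<open>Chosen so that the bound of \<open>moll_residual\<close> equals
    \<open>\<epsilon>\<close>; as the denominator is at least 1, closeness to \<open>U\<close>
    within \<open>\<epsilon>\<close> follows too.\<close>
  define \<delta> where "\<delta> = \<epsilon> / (?d * (2 * MG + 1))"
  have d: "1 \<le> ?d" using zero_less_card_finite[where 'a = 'd] by linarith
  have dM: "1 \<le> ?d * (2 * MG + 1)" using mult_mono[of 1 ?d 1 "2 * MG + 1"] d MG by simp
  have \<delta>: "0 < \<delta>" unfolding \<delta>_def using \<epsilon> dM by simp
  have \<delta>\<epsilon>: "\<delta> \<le> \<epsilon>" "?d * ((2 * MG + 1) * \<delta>) = \<epsilon>"
  proof -
    show "?d * ((2 * MG + 1) * \<delta>) = \<epsilon>" unfolding \<delta>_def using dM d MG by simp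
    then have "(?d * (2 * MG + 1)) * \<delta> = \<epsilon>" by (simp only: mult.assoc)
    moreover have "1 * \<delta> \<le> (?d * (2 * MG + 1)) * \<delta>" using dM \<delta> by (intro mult_right_mono) auto
    ultimately show "\<delta> \<le> \<epsilon>" by simp
  qed
  obtain r where valid: "\<And>t x. t \<in> {0..T'} \<Longrightarrow> valid r (t, x)" and r: "0 < r" "\<And>i. r \<le> l $ i / 2"
    and osc: "\<And>z w. valid r z \<and> kernel_at l r (z + (2 * r, 0)) w \<noteq> 0 \<Longrightarrow> \<bar>U w - U z\<bar> \<le> \<delta>"
    using moll_exists[OF \<delta> T'(2)] by blast
  have close: "\<bar>moll r (t, x) - U (t, x)\<bar> \<le> \<delta>" if "t \<in> {0..T'}" for t x
    by (rule moll_close[OF valid[OF that]]) (use osc valid[OF that] in blast)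
  have bnd: "\<bar>moll r (t, x)\<bar> \<le> MU" if "t \<in> {0..T'}" for t x
  proof -
    have "\<bar>U w - 0\<bar> \<le> MU" if "kernel_at l r ((t, x) + (2 * r, 0)) w \<noteq> 0" for w
    proof -
      note vd = validD[OF valid[OF \<open>t \<in> {0..T'}\<close>, of x]]
      have "fst w \<in> {fst ((t, x) + (2 * r, 0)) - r..fst ((t, x) + (2 * r, 0)) + r}" using kernel_at_zero[OF vd(1)] that by blast
      then have "fst w \<in> {0..T}" using vd(1-3) by auto
      then show ?thesis using bounded[of "fst w" "snd w"] by simp
    qed
    then have "\<bar>moll r (t, x) - 0\<bar> \<le> MU" by (rule moll_close[OF valid[OF that]])
    then show ?thesis by simp
  qed
  have res: "\<bar>moll_d e_t r (t, x) + moll r (t, x) * (\<Sum>i\<in>UNIV. moll_d (e_x i) r (t, x))\<bar> \<le> \<epsilon>" if "t \<in> {0..T'}" for t x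
    using moll_residual[OF valid[OF that] \<delta>, of x] osc valid[OF that] unfolding \<delta>\<epsilon>(2) by blast
  have mt: "\<bar>moll_d e_t r (t, x)\<bar> \<le> MG" and mx: "\<bar>moll_d (e_x i) r (t, x)\<bar> \<le> MG" if "t \<in> {0..T'}" for t x i
    by (rule moll_d_bound[OF valid[OF that] e_Basis(1)], rule moll_d_bound[OF valid[OF that] e_Basis(2)])
  have "approx_solution T' l (max MU MG) \<epsilon> (moll r)"
    unfolding approx_solution_def
  proof (intro conjI ballI exI[of _ "moll_d e_t r"] exI[of _ "\<lambda>i. moll_d (e_x i) r"] moll_periodic allI impI)
    fix \<eta> :: real assume \<eta>: "0 < \<eta>"
    obtain \<rho>t where \<rho>t: "0 < \<rho>t" "\<And>z s. 0 < s \<and> s < \<rho>t \<and> valid r z \<and> valid r (z + s *\<^sub>R e_t) \<Longrightarrow>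
       \<bar>moll r (z + s *\<^sub>R e_t) - moll r z - s * moll_d e_t r z\<bar> \<le> \<eta> * s"
      using moll_taylor[OF r e_Basis(1) \<eta>] by blast
    have "\<forall>i. \<exists>\<rho>>0. \<forall>z s. 0 < s \<and> s < \<rho> \<and> valid r z \<and> valid r (z + s *\<^sub>R e_x i) \<longrightarrow>
       \<bar>moll r (z + s *\<^sub>R e_x i) - moll r z - s * moll_d (e_x i) r z\<bar> \<le> \<eta> * s"
      by (intro allI moll_taylor[OF r e_Basis(2) \<eta>])
    then obtain \<rho>x where \<rho>x: "\<And>i. 0 < \<rho>x i" "\<And>i z s. 0 < s \<and> s < \<rho>x i \<and> valid r z \<and> valid r (z + s *\<^sub>R e_x i) \<Longrightarrow>
       \<bar>moll r (z + s *\<^sub>R e_x i) - moll r z - s * moll_d (e_x i) r z\<bar> \<le> \<eta> * s"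
      by metis
    define \<rho> where "\<rho> = min \<rho>t (Min (range \<rho>x))"
    have "Min (range \<rho>x) \<in> range \<rho>x" by (rule Min_in) auto
    then have \<rho>: "0 < \<rho>" unfolding \<rho>_def using \<rho>t(1) \<rho>x(1) by auto
    have \<rho>le: "\<rho> \<le> \<rho>t" "\<rho> \<le> \<rho>x i" for i
      unfolding \<rho>_def using Min_le[of "range \<rho>x" "\<rho>x i"] by (auto intro: min.coboundedI2)
    show "\<exists>\<rho>>0. \<forall>s t x. 0 < s \<and> s < \<rho> \<and> t \<in> {0..T'} \<longrightarrow>
         (t + s \<le> T' \<longrightarrow> \<bar>moll r (t + s, x) - moll r (t, x) - s * moll_d e_t r (t, x)\<bar> \<le> \<eta> * s) \<and>
         (\<forall>i. \<bar>moll r (t, x + s *\<^sub>R axis i 1) - moll r (t, x) - s * moll_d (e_x i) r (t, x)\<bar> \<le> \<eta> * s)"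
    proof (intro exI[of _ \<rho>] conjI allI impI \<rho>; (elim conjE)?)
      fix s t x assume s: "0 < s" "s < \<rho>" "t \<in> {0..T'}"
      show "\<bar>moll r (t + s, x) - moll r (t, x) - s * moll_d e_t r (t, x)\<bar> \<le> \<eta> * s" if "t + s \<le> T'"
      proof -
        have "valid r (t + s, x)" using s that by (intro valid) auto
        then show ?thesis using \<rho>t(2)[of s "(t, x)"] s \<rho>le valid[OF s(3), of x] by (simp add: less_le_trans)
      qed
      show "\<bar>moll r (t, x + s *\<^sub>R axis i 1) - moll r (t, x) - s * moll_d (e_x i) r (t, x)\<bar> \<le> \<eta> * s" for i
      proof -
        have "s < \<rho>x i" using s(2) \<rho>le(2)[of i] by linarith
        then show ?thesis
          using \<rho>x(2)[of s i "(t, x)"] s(1) valid[OF s(3), of x] valid[OF s(3), of "x + s *\<^sub>R axis i 1"] by simp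
      qed
    qed
  qed (use bnd res mt mx in \<open>auto simp: le_max_iff_disj\<close>)
  then show ?thesis using close \<delta>\<epsilon>(1) by (meson order_trans)
qed

end

section \<open>Strong solutions\<close>

lemma cylinder_lebesgue: "cylinder T l \<in> sets lebesgue"
  using cylinder_measurable by simp

lemma set_integral_lebesgue_on:
  fixes f :: "'a::euclidean_space \<Rightarrow> real"
  assumes "D \<in> sets lebesgue" shows "(LINT z:D|lebesgue. f z) = integral\<^sup>L (lebesgue_on D) f"
  using assms unfolding set_lebesgue_integral_def by (subst integral_restrict_space) auto

lemma finite_measure_cylinder:
  assumes "0 < T" "\<And>i. 0 < l $ i" shows "finite_measure (lebesgue_on (cylinder T l))"
proof
  obtain B where "emeasure lborel (cylinder T l) \<le> ennreal B" using emeasure_cylinder_le[OF assms] by blast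
  then have "emeasure lebesgue (cylinder T l) < \<infinity>" by (simp add: emeasure_completion le_less_trans)
  then show "emeasure (lebesgue_on (cylinder T l)) (space (lebesgue_on (cylinder T l))) \<noteq> \<infinity>"
    by (simp add: emeasure_restrict_space cylinder_lebesgue space_restrict_space)
qed

lemma L_infty_times_integrable:
  fixes v \<psi> :: "'a::euclidean_space \<Rightarrow> real"
  assumes fin: "finite_measure (lebesgue_on D)" and v: "L_infty D v"
    and \<psi>: "\<psi> \<in> borel_measurable borel" "\<And>z. \<bar>\<psi> z\<bar> \<le> B"
  shows "integrable (lebesgue_on D) (\<lambda>z. v z * \<psi> z)"
proof -
  interpret finite_measure "lebesgue_on D" by (rule fin)
  obtain M where M: "AE z in lebesgue_on D. \<bar>v z\<bar> \<le> M" and vm: "v \<in> borel_measurable (lebesgue_on D)"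
    using v unfolding L_infty_def by auto
  have "\<psi> \<in> borel_measurable (lebesgue_on D)"
    using \<psi>(1) by (intro measurable_restrict_space1) (simp add: measurable_completion)
  with vm have m: "(\<lambda>z. v z * \<psi> z) \<in> borel_measurable (lebesgue_on D)" by (rule borel_measurable_times)
  show ?thesis
  proof (rule integrable_const_bound[OF _ m])
    show "AE z in lebesgue_on D. norm (v z * \<psi> z) \<le> \<bar>M\<bar> * B"
      using M
    proof eventually_elim
      case (elim z)
      then show ?case unfolding real_norm_def abs_mult using \<psi>(2)[of z] by (intro mult_mono) auto
    qed
  qed
qed

lemma admissible_bounded:
  fixes l :: "real ^ 'd"
  assumes l: "\<And>i. 0 < l $ i" and k: "admissible T l k"
  obtains B where "\<And>z. \<bar>k z\<bar> \<le> B"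
proof -
  obtain a b where "a \<le> b" and zero: "\<And>z. fst z \<notin> {a..b} \<Longrightarrow> k z = 0" using k unfolding admissible_def by auto
  have c: "continuous_on UNIV k" and p: "\<And>t. periodic l (\<lambda>x. k (t, x))" using k unfolding admissible_def by auto
  show thesis
  proof (rule strip_compact_bounded[OF l c p, of a b])
    show "k z = 0" if "fst z \<notin> {a..b}" for z by (rule zero[OF that])
  qed (rule that)
qed

text \<open>The weak derivatives of \<open>u\<close> and of its flux are moved onto the test
  function, and the almost everywhere equation makes the sum vanish. The essential bounds of the
  gradient give \<open>weak_lip\<close>.\<close>

lemma strong_solution_weak_burgers:
  fixes l :: "real ^ 'd" and u :: "real \<times> (real ^ 'd) \<Rightarrow> real"
  assumes l: "\<And>i. 0 < l $ i" and T: "0 < T" and u: "strong_solution T l u0 u"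
  shows "\<exists>MG MU. weak_burgers l T MG MU u"
proof -
  have W: "W1_infty T l u" using u unfolding strong_solution_def by blast
  have cont: "continuous_on ({0..T} \<times> UNIV) u" and per: "\<And>t. t \<in> {0..T} \<Longrightarrow> periodic l (\<lambda>x. u (t, x))"
    using W unfolding W1_infty_def by auto
  obtain G F where G: "weak_gradient (cylinder_tests T l) (cylinder T l) u G"
    and F: "weak_gradient (cylinder_tests T l) (cylinder T l) (\<lambda>z. flux (u z)) F"
    and eq: "AE z in lebesgue_on (cylinder T l). fst (G z) + (\<Sum>i\<in>UNIV. snd (F z) $ i) = 0"
    using u unfolding strong_solution_def by blast
  let ?C = "cylinder T l"
  note fin = finite_measure_cylinder[OF T l]
  note si = set_integral_lebesgue_on[OF cylinder_lebesgue]
  have GL: "L_infty ?C (\<lambda>z. G z \<bullet> e)" "\<psi> \<in> cylinder_tests T l \<Longrightarrow>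
      (LINT z:?C|lebesgue. u z * partial e \<psi> z) = - (LINT z:?C|lebesgue. (G z \<bullet> e) * \<psi> z)" if "e \<in> Basis" for e \<psi>
    using G that unfolding weak_gradient_def by auto
  have FL: "L_infty ?C (\<lambda>z. F z \<bullet> e)" "\<psi> \<in> cylinder_tests T l \<Longrightarrow>
      (LINT z:?C|lebesgue. flux (u z) * partial e \<psi> z) = - (LINT z:?C|lebesgue. (F z \<bullet> e) * \<psi> z)" if "e \<in> Basis" for e \<psi>
    using F that unfolding weak_gradient_def by auto
  obtain MU where MU: "0 \<le> MU" "\<And>t x. t \<in> {0..T} \<Longrightarrow> \<bar>u (t, x)\<bar> \<le> MU"
    using periodic_bounded[OF l cont per] by blast
  have "\<forall>e\<in>Basis. \<exists>M. AE z in lebesgue_on ?C. \<bar>G z \<bullet> e\<bar> \<le> M" using GL(1) unfolding L_infty_def by blast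
  then obtain m where m: "\<And>e. e \<in> Basis \<Longrightarrow> AE z in lebesgue_on ?C. \<bar>G z \<bullet> e\<bar> \<le> m e" by metis
  \<comment> \<open>A sum over the basis bounds all directional constants at once.\<close>
  define MG where "MG = (\<Sum>e\<in>(Basis :: (real \<times> (real ^ 'd)) set). \<bar>m e\<bar>)"
  have mMG: "m e \<le> MG" if "e \<in> Basis" for e
    using member_le_sum[OF that, of "\<lambda>e. \<bar>m e\<bar>"] unfolding MG_def by auto
  have cont': "continuous_on ({0<..<T} \<times> UNIV) u" by (rule continuous_on_subset[OF cont]) auto
  have per': "periodic l (\<lambda>x. u (t, x))" if "t \<in> {0<..<T}" for t using that by (intro per) auto
  have "weak_burgers l T MG MU u"
  proof
    show "0 \<le> MG" unfolding MG_def by (intro sum_nonneg) auto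
    fix \<psi> assume \<psi>: "\<psi> \<in> cylinder_tests T l"
    note a\<psi> = admissible_test[OF \<psi> T]
    obtain B where B: "\<And>z. \<bar>\<psi> z\<bar> \<le> B" by (rule admissible_bounded[OF l a\<psi>(1)]) (rule that)
    have iG: "integrable (lebesgue_on ?C) (\<lambda>z. (G z \<bullet> e) * \<psi> z)" if "e \<in> Basis" for e
      by (rule L_infty_times_integrable[OF fin GL(1)[OF that] admissible_borel[OF a\<psi>(1)] B])
    have iF: "integrable (lebesgue_on ?C) (\<lambda>z. (F z \<bullet> e) * \<psi> z)" if "e \<in> Basis" for e
      by (rule L_infty_times_integrable[OF fin FL(1)[OF that] admissible_borel[OF a\<psi>(1)] B])
    show "(LINT z:?C|lebesgue. u z * partial e_t \<psi> z + flux (u z) * (\<Sum>i\<in>UNIV. partial (e_x i) \<psi> z)) = 0"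
    proof -
      have a1: "admissible T l (\<lambda>z. u z * partial e_t \<psi> z)"
        by (rule admissible_mult[OF a\<psi>(2)[OF e_Basis(1)] cont' per'])
      have fl: "continuous_on ({0<..<T} \<times> UNIV) (\<lambda>z. flux (u z))" "t \<in> {0<..<T} \<Longrightarrow> periodic l (\<lambda>x. flux (u (t, x)))" for t
        using cont' per' by (auto simp: flux_def periodic_def intro!: continuous_intros)
      have a2: "admissible T l (\<lambda>z. flux (u z) * partial (e_x i) \<psi> z)" for i
        by (rule admissible_mult[OF a\<psi>(2)[OF e_Basis(2)] fl(1) fl(2)])
      have a3: "admissible T l (\<lambda>z. \<Sum>i\<in>UNIV. flux (u z) * partial (e_x i) \<psi> z)" by (rule admissible_sum[OF _ _ a2]) auto
      have "(LINT z:?C|lebesgue. u z * partial e_t \<psi> z + flux (u z) * (\<Sum>i\<in>UNIV. partial (e_x i) \<psi> z))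
        = strip_integral l (\<lambda>z. u z * partial e_t \<psi> z + (\<Sum>i\<in>UNIV. flux (u z) * partial (e_x i) \<psi> z))"
        unfolding sum_distrib_left by (rule admissible_cylinder_integral[OF admissible_add[OF a1 a3]])
      also have "\<dots> = strip_integral l (\<lambda>z. u z * partial e_t \<psi> z) + (\<Sum>i\<in>UNIV. strip_integral l (\<lambda>z. flux (u z) * partial (e_x i) \<psi> z))"
        unfolding strip_integral_add[OF l a1 a3]
        using strip_integral_sum[OF l, of UNIV T "\<lambda>i z. flux (u z) * partial (e_x i) \<psi> z"] a2 by simp
      also have "\<dots> = - (integral\<^sup>L (lebesgue_on ?C) (\<lambda>z. (G z \<bullet> e_t) * \<psi> z)
          + (\<Sum>i\<in>UNIV. integral\<^sup>L (lebesgue_on ?C) (\<lambda>z. (F z \<bullet> e_x i) * \<psi> z)))"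
        unfolding admissible_cylinder_integral[OF a1, symmetric] admissible_cylinder_integral[OF a2, symmetric]
          si GL(2)[OF e_Basis(1) \<psi>, unfolded si] FL(2)[OF e_Basis(2) \<psi>, unfolded si] by (simp add: sum_negf)
      also have "\<dots> = - integral\<^sup>L (lebesgue_on ?C) (\<lambda>z. (G z \<bullet> e_t) * \<psi> z + (\<Sum>i\<in>UNIV. (F z \<bullet> e_x i) * \<psi> z))"
        by (subst Bochner_Integration.integral_add[OF iG[OF e_Basis(1)] Bochner_Integration.integrable_sum[OF iF[OF e_Basis(2)]]])
          (simp add: Bochner_Integration.integral_sum[OF iF[OF e_Basis(2)]])
      also have "integral\<^sup>L (lebesgue_on ?C) (\<lambda>z. (G z \<bullet> e_t) * \<psi> z + (\<Sum>i\<in>UNIV. (F z \<bullet> e_x i) * \<psi> z)) = 0"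
      proof (rule integral_eq_zero_AE)
        show "AE z in lebesgue_on ?C. (G z \<bullet> e_t) * \<psi> z + (\<Sum>i\<in>UNIV. (F z \<bullet> e_x i) * \<psi> z) = 0"
          using eq
        proof eventually_elim
          case (elim z)
          have "(G z \<bullet> e_t) * \<psi> z + (\<Sum>i\<in>UNIV. (F z \<bullet> e_x i) * \<psi> z) = (fst (G z) + (\<Sum>i\<in>UNIV. snd (F z) $ i)) * \<psi> z"
            by (simp add: inner_prod_def inner_axis distrib_right sum_distrib_right)
          then show ?case using elim by simp
        qed
      qed
      finally show ?thesis by simp
    qed
    fix e :: "real \<times> (real ^ 'd)" assume e: "e \<in> Basis" and nn: "\<And>z. 0 \<le> \<psi> z"
    have i\<psi>: "integrable (lebesgue_on ?C) (\<lambda>z. MG * \<psi> z)"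
    proof -
      have "L_infty ?C (\<lambda>_. MG)" unfolding L_infty_def by auto
      from L_infty_times_integrable[OF fin this admissible_borel[OF a\<psi>(1)] B] show ?thesis .
    qed
    have "\<bar>integral\<^sup>L (lebesgue_on ?C) (\<lambda>z. (G z \<bullet> e) * \<psi> z)\<bar> \<le> integral\<^sup>L (lebesgue_on ?C) (\<lambda>z. \<bar>(G z \<bullet> e) * \<psi> z\<bar>)"
      by (rule integral_abs_bound)
    also have "\<dots> \<le> integral\<^sup>L (lebesgue_on ?C) (\<lambda>z. MG * \<psi> z)"
    proof (rule integral_mono_AE)
      show "integrable (lebesgue_on ?C) (\<lambda>z. \<bar>(G z \<bullet> e) * \<psi> z\<bar>)" using iG[OF e] by (rule integrable_abs)
      show "AE z in lebesgue_on ?C. \<bar>(G z \<bullet> e) * \<psi> z\<bar> \<le> MG * \<psi> z"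
        using m[OF e]
      proof eventually_elim
        case (elim z)
        then have "\<bar>G z \<bullet> e\<bar> * \<psi> z \<le> MG * \<psi> z" using mMG[OF e] nn[of z] by (intro mult_right_mono) auto
        then show ?case unfolding abs_mult using nn[of z] by simp
      qed
    qed (rule i\<psi>)
    also have "\<dots> = MG * (LINT z:?C|lebesgue. \<psi> z)" unfolding si by simp
    finally show "\<bar>LINT z:?C|lebesgue. u z * partial e \<psi> z\<bar> \<le> MG * (LINT z:?C|lebesgue. \<psi> z)"
      unfolding si GL(2)[OF e \<psi>, unfolded si] by simp
  qed (use l T cont per MU in auto)
  then show ?thesis by blast
qed

section \<open>Continuously differentiable solutions\<close>

lemma periodic_add: "periodic l f \<Longrightarrow> periodic l g \<Longrightarrow> periodic l (\<lambda>x. f x + g x)"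
  and periodic_mult: "periodic l f \<Longrightarrow> periodic l g \<Longrightarrow> periodic l (\<lambda>x. f x * g x)"
  and periodic_sum: "(\<And>i. i \<in> I \<Longrightarrow> periodic l (k i)) \<Longrightarrow> periodic l (\<lambda>x. \<Sum>i\<in>I. k i x)"
  by (simp_all add: periodic_def)

lemma L_infty_bounded:
  fixes v :: "'a::euclidean_space \<Rightarrow> real"
  assumes m: "v \<in> borel_measurable borel" and b: "\<And>z. z \<in> D \<Longrightarrow> \<bar>v z\<bar> \<le> B"
  shows "L_infty D v"
  unfolding L_infty_def
proof
  show "v \<in> borel_measurable (lebesgue_on D)"
    using m by (intro measurable_restrict_space1) (simp add: measurable_completion)
  have "AE z in lebesgue_on D. \<bar>v z\<bar> \<le> B" by (rule AE_I2) (use b in \<open>auto simp: space_restrict_space\<close>)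
  then show "\<exists>M. AE z in lebesgue_on D. \<bar>v z\<bar> \<le> M" by blast
qed

lemma smooth_periodic_L_infty:
  fixes v :: "real \<times> (real ^ 'd) \<Rightarrow> real"
  assumes l: "\<And>i. 0 < l $ i" and v: "continuous_on UNIV v" "\<And>t. periodic l (\<lambda>x. v (t, x))"
  shows "L_infty (cylinder T l) v"
proof -
  obtain B where "\<And>t x. t \<in> {0..T} \<Longrightarrow> \<bar>v (t, x)\<bar> \<le> B"
    using periodic_bounded[OF l continuous_on_subset[OF v(1)] v(2), of 0 T] by blast
  then show ?thesis
    using v(1) by (intro L_infty_bounded[of _ _ B] borel_measurable_continuous_onI) (auto simp: cylinder_def)
qed

abbreviation gradient :: "('a::euclidean_space \<Rightarrow> real) \<Rightarrow> 'a \<Rightarrow> 'a" where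
  "gradient v z \<equiv> (\<Sum>e\<in>Basis. partial e v z *\<^sub>R e)"

lemma gradient_inner: "e \<in> Basis \<Longrightarrow> gradient v z \<bullet> e = partial e v z"
  by (simp add: inner_sum_left inner_Basis if_distrib cong: if_cong)

lemma gradient_components:
  fixes v :: "real \<times> (real ^ 'd) \<Rightarrow> real"
  shows "fst (gradient v z) = partial e_t v z" "snd (gradient v z) $ i = partial (e_x i) v z"
proof -
  have "fst g = g \<bullet> e_t" "snd g $ i = g \<bullet> e_x i" for g :: "real \<times> (real ^ 'd)"
    by (simp_all add: inner_prod_def inner_axis)
  then show "fst (gradient v z) = partial e_t v z" "snd (gradient v z) $ i = partial (e_x i) v z"
    by (simp_all only: gradient_inner[OF e_Basis(1)] gradient_inner[OF e_Basis(2)])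
qed

lemma smooth_W1_infty:
  fixes v :: "real \<times> (real ^ 'd) \<Rightarrow> real"
  assumes l: "\<And>i. 0 < l $ i" and T: "0 < T" and s: "smooth v" and per: "\<And>t. periodic l (\<lambda>x. v (t, x))"
  shows "weak_gradient (cylinder_tests T l) (cylinder T l) v (gradient v)" and "W1_infty T l v"
proof -
  show g: "weak_gradient (cylinder_tests T l) (cylinder T l) v (gradient v)"
    unfolding weak_gradient_def
  proof (intro ballI conjI)
    fix e :: "real \<times> (real ^ 'd)" assume e: "e \<in> Basis"
    show "L_infty (cylinder T l) (\<lambda>z. gradient v z \<bullet> e)"
      unfolding gradient_inner[OF e]
      by (rule smooth_periodic_L_infty[OF l smooth_continuous[OF smooth_partial[OF s e]] partial_periodic[OF s per]])
    fix \<psi> assume \<psi>: "\<psi> \<in> cylinder_tests T l"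
    show "(LINT z:cylinder T l|lebesgue. v z * partial e \<psi> z) = - (LINT z:cylinder T l|lebesgue. gradient v z \<bullet> e * \<psi> z)"
      unfolding gradient_inner[OF e]
      by (rule integration_by_parts[OF l T e \<psi> smooth_has_derivative[OF s]
            continuous_on_subset[OF smooth_continuous[OF smooth_partial[OF s e]]] per partial_periodic[OF s per]]) simp
  qed
  show "W1_infty T l v"
    unfolding W1_infty_def
    using per continuous_on_subset[OF smooth_continuous[OF s]] smooth_periodic_L_infty[OF l smooth_continuous[OF s] per] g
    by blast
qed

text \<open>Periodicity of \<open>G\<close> is not part of the \<open>C1\<close> condition; it
  follows from uniqueness of derivatives, also at times 0 and \<open>T\<close> where they are
  one-sided in time.\<close>

lemma C1_cylinder_gradient:
  fixes l :: "real ^ 'd"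
  assumes T: "0 < T" and u: "C1_cylinder T l u"
  obtains G where "continuous_on ({0..T} \<times> UNIV) G"
    "\<And>z. fst z \<in> {0..T} \<Longrightarrow> (u has_derivative (\<lambda>w. G z \<bullet> w)) (at z within {0..T} \<times> UNIV)"
    "\<And>z. fst z \<in> {0<..<T} \<Longrightarrow> (u has_derivative (\<lambda>w. G z \<bullet> w)) (at z)"
    "\<And>t e. t \<in> {0..T} \<Longrightarrow> periodic l (\<lambda>x. G (t, x) \<bullet> e)"
proof -
  let ?S = "{0..T} \<times> UNIV :: (real \<times> (real ^ 'd)) set"
  obtain G where cont: "continuous_on ?S G" and D: "\<And>z. z \<in> ?S \<Longrightarrow> (u has_derivative (\<lambda>w. G z \<bullet> w)) (at z within ?S)"
    using u unfolding C1_cylinder_def C1_on_def by blast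
  have per: "\<And>t. t \<in> {0..T} \<Longrightarrow> periodic l (\<lambda>x. u (t, x))" using u unfolding C1_cylinder_def by blast
  have "(u has_derivative (\<lambda>w. G z \<bullet> w)) (at z)" if "fst z \<in> {0<..<T}" for z
  proof -
    have "open ({0<..<T} \<times> UNIV :: (real \<times> (real ^ 'd)) set)" by (intro open_Times) auto
    moreover have "z \<in> {0<..<T} \<times> UNIV" using that by (simp add: mem_Times_iff)
    moreover have "{0<..<T} \<times> UNIV \<subseteq> ?S" by auto
    ultimately have z: "z \<in> interior ?S" using interior_maximal by blast
    then have "z \<in> ?S" by (rule interior_subset[THEN subsetD])
    from D[OF this] show ?thesis unfolding at_within_interior[OF z] .
  qed
  moreover have "periodic l (\<lambda>x. G (t, x) \<bullet> e)" if t: "t \<in> {0..T}" for t e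
    unfolding periodic_def
  proof (intro allI)
    fix x :: "real ^ 'd" and i
    let ?p = "(0, axis i (l $ i)) :: real \<times> (real ^ 'd)" and ?z = "(t, x)"
    have im: "(\<lambda>z. z + ?p) ` ?S = ?S"
    proof
      show "?S \<subseteq> (\<lambda>z. z + ?p) ` ?S"
      proof
        fix z assume "z \<in> ?S"
        then show "z \<in> (\<lambda>z. z + ?p) ` ?S" by (intro image_eqI[of _ _ "z - ?p"]) (auto simp: mem_Times_iff)
      qed
    qed auto
    have z: "?z \<in> ?S" "?z + ?p \<in> ?S" using t by auto
    have "((\<lambda>z. u (z + ?p)) has_derivative (\<lambda>w. G (?z + ?p) \<bullet> w)) (at ?z within ?S)"
    proof (rule has_derivative_in_compose[where f = "\<lambda>z. z + ?p" and f' = "\<lambda>w. w"])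
      show "((\<lambda>z. z + ?p) has_derivative (\<lambda>w. w)) (at ?z within ?S)" by (auto intro!: derivative_eq_intros)
      show "(u has_derivative (\<lambda>w. G (?z + ?p) \<bullet> w)) (at (?z + ?p) within (\<lambda>z. z + ?p) ` ?S)"
        unfolding im by (rule D[OF z(2)])
    qed
    then have "(u has_derivative (\<lambda>w. G (?z + ?p) \<bullet> w)) (at ?z within ?S)"
      by (rule has_derivative_transform[OF z(1), rotated]) (use per in \<open>auto simp: periodic_def\<close>)
    with D[OF z(1)] have "(\<lambda>w. G ?z \<bullet> w) = (\<lambda>w. G (?z + ?p) \<bullet> w)"
    proof (rule frechet_derivative_unique_within)
      fix e :: "real \<times> (real ^ 'd)" and \<epsilon> :: real assume e: "e \<in> Basis" "0 < \<epsilon>"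
      \<comment> \<open>Uniqueness within the slab needs short steps along each basis vector:
        forward in time before \<open>T\<close>, backward at \<open>T\<close>.\<close>
      show "\<exists>d. 0 < \<bar>d\<bar> \<and> \<bar>d\<bar> < \<epsilon> \<and> ?z + d *\<^sub>R e \<in> ?S"
      proof (cases "t < T")
        case True
        define d where "d = min (\<epsilon> / 2) (T - t)"
        have "0 < d" "d < \<epsilon>" "d \<le> T - t" using True e unfolding d_def by auto
        then show ?thesis using e t by (intro exI[of _ d]) (auto simp: Basis_prod_def)
      next
        case False
        define d where "d = min (\<epsilon> / 2) T"
        have "0 < d" "d < \<epsilon>" "d \<le> T" using T e unfolding d_def by auto
        then show ?thesis using e t False by (intro exI[of _ "- d"]) (auto simp: Basis_prod_def)
      qed
    qed
    from fun_cong[OF this, of e] show "G (t, x + axis i (l $ i)) \<bullet> e = G (t, x) \<bullet> e" by simp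
  qed
  moreover have "(u has_derivative (\<lambda>w. G z \<bullet> w)) (at z within ?S)" if "fst z \<in> {0..T}" for z
    using that by (intro D) (simp add: mem_Times_iff)
  ultimately show thesis using cont by (intro that[of G])
qed

section \<open>The equation for continuously differentiable weak solutions\<close>

abbreviation residual :: "(real \<times> (real ^ 'd) \<Rightarrow> real) \<Rightarrow> (real \<times> (real ^ 'd) \<Rightarrow> real \<times> (real ^ 'd)) \<Rightarrow> real \<times> (real ^ 'd) \<Rightarrow> real" where
  "residual u G z \<equiv> G z \<bullet> e_t + (\<Sum>i\<in>UNIV. u z * (G z \<bullet> e_x i))"

text \<open>The kernel is an admissible test function whose support avoids the end times, so
  integration by parts moves all derivatives back onto \<open>u\<close>.\<close>

lemma residual_kernel_integral:
  fixes l :: "real ^ 'd"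
  assumes l: "\<And>i. 0 < l $ i" and T: "0 < T" and w: "weak_entropy_solution T l u0 u"
    and cu: "continuous_on ({0..T} \<times> UNIV) u" and cG: "continuous_on ({0..T} \<times> UNIV) G"
    and D: "\<And>z. fst z \<in> {0<..<T} \<Longrightarrow> (u has_derivative (\<lambda>w. G z \<bullet> w)) (at z)"
    and per: "\<And>t. t \<in> {0..T} \<Longrightarrow> periodic l (\<lambda>x. u (t, x))" "\<And>t e. t \<in> {0..T} \<Longrightarrow> periodic l (\<lambda>x. G (t, x) \<bullet> e)"
    and r: "0 < r" "r < fst c" "fst c + r < T"
  shows "strip_integral l (\<lambda>z. residual u G z * kernel_at l r c z) = 0"
proof -
  \<comment> \<open>Halfway between the end of the kernel's support and \<open>T\<close>: the
    brackets at 0 and \<open>\<tau>\<close> vanish, and \<open>\<tau>\<close> is still an allowed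
    time below \<open>T\<close>.\<close>
  define \<tau> where "\<tau> = (fst c + r + T) / 2"
  have \<tau>: "0 < \<tau>" "\<tau> < T" "fst c + r < \<tau>" using r unfolding \<tau>_def by auto
  let ?k = "kernel_at l r c"
  have sub: "{0<..<\<tau>} \<times> UNIV \<subseteq> {0..T} \<times> (UNIV :: (real ^ 'd) set)" using \<tau> by auto
  note cu' = continuous_on_subset[OF cu sub] and cG' = continuous_on_subset[OF cG sub]
  have per': "periodic l (\<lambda>x. u (t, x))" "periodic l (\<lambda>x. G (t, x) \<bullet> e)" if "t \<in> {0<..<\<tau>}" for t e
    using that \<tau> per by auto
  have D': "(u has_derivative (\<lambda>w. G z \<bullet> w)) (at z)" if "fst z \<in> {0<..<\<tau>}" for z using that \<tau> by (intro D) auto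
  have k: "?k \<in> cylinder_tests \<tau> l" by (rule kernel_at_test[OF l r(1,2) \<tau>(3)])
  note ak = admissible_test[OF k \<tau>(1)]
  have zero: "?k (\<tau>, x) = 0" "?k (0, x) = 0" for x using r \<tau> by (auto intro!: kernel_at_zero[OF r(1)])
  have fl: "continuous_on ({0<..<\<tau>} \<times> UNIV) (\<lambda>z. flux (u z))" "t \<in> {0<..<\<tau>} \<Longrightarrow> periodic l (\<lambda>x. flux (u (t, x)))" for t
    using cu' per' by (auto simp: flux_def periodic_def intro!: continuous_intros)
  have a1: "admissible \<tau> l (\<lambda>z. u z * partial e_t ?k z)" by (rule admissible_mult[OF ak(2)[OF e_Basis(1)] cu' per'(1)])
  have a2: "admissible \<tau> l (\<lambda>z. flux (u z) * partial (e_x i) ?k z)" for i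
    by (rule admissible_mult[OF ak(2)[OF e_Basis(2)] fl])
  have cGe: "continuous_on ({0<..<\<tau>} \<times> UNIV) (\<lambda>z. G z \<bullet> e)" "continuous_on ({0<..<\<tau>} \<times> UNIV) (\<lambda>z. u z * (G z \<bullet> e))" for e
    by (intro continuous_intros cG' cu')+
  have pGe: "periodic l (\<lambda>x. u (t, x) * (G (t, x) \<bullet> e))" if "t \<in> {0<..<\<tau>}" for t e
    by (intro periodic_mult per' that)
  have a3: "admissible \<tau> l (\<lambda>z. (G z \<bullet> e_t) * ?k z)" by (rule admissible_mult[OF ak(1) cGe(1) per'(2)])
  have a4: "admissible \<tau> l (\<lambda>z. u z * (G z \<bullet> e_x i) * ?k z)" for i by (rule admissible_mult[OF ak(1) cGe(2) pGe])
  have a2s: "admissible \<tau> l (\<lambda>z. \<Sum>i\<in>UNIV. flux (u z) * partial (e_x i) ?k z)" by (rule admissible_sum[OF _ _ a2]) auto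
  have a4s: "admissible \<tau> l (\<lambda>z. \<Sum>i\<in>UNIV. u z * (G z \<bullet> e_x i) * ?k z)" by (rule admissible_sum[OF _ _ a4]) auto
  have s2: "strip_integral l (\<lambda>z. \<Sum>i\<in>UNIV. flux (u z) * partial (e_x i) ?k z)
      = (\<Sum>i\<in>UNIV. strip_integral l (\<lambda>z. flux (u z) * partial (e_x i) ?k z))"
    using strip_integral_sum[OF l, of UNIV \<tau> "\<lambda>i z. flux (u z) * partial (e_x i) ?k z"] a2 by simp
  have s4: "strip_integral l (\<lambda>z. \<Sum>i\<in>UNIV. u z * (G z \<bullet> e_x i) * ?k z)
      = (\<Sum>i\<in>UNIV. strip_integral l (\<lambda>z. u z * (G z \<bullet> e_x i) * ?k z))"
    using strip_integral_sum[OF l, of UNIV \<tau> "\<lambda>i z. u z * (G z \<bullet> e_x i) * ?k z"] a4 by simp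
  have ibp1: "strip_integral l (\<lambda>z. u z * partial e_t ?k z) = - strip_integral l (\<lambda>z. (G z \<bullet> e_t) * ?k z)"
    unfolding admissible_cylinder_integral[OF a1, symmetric] admissible_cylinder_integral[OF a3, symmetric]
    by (rule integration_by_parts[OF l \<tau>(1) e_Basis(1) k, where D = "\<lambda>z w. G z \<bullet> w", OF D' cGe(1) per'])
  have ibp2: "strip_integral l (\<lambda>z. flux (u z) * partial (e_x i) ?k z) = - strip_integral l (\<lambda>z. u z * (G z \<bullet> e_x i) * ?k z)" for i
    unfolding admissible_cylinder_integral[OF a2, symmetric] admissible_cylinder_integral[OF a4, symmetric]
  proof (rule integration_by_parts[OF l \<tau>(1) e_Basis(2) k, where D = "\<lambda>z w. u z * (G z \<bullet> w)", OF _ cGe(2) fl(2) pGe])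
    fix z :: "real \<times> (real ^ 'd)" assume "fst z \<in> {0<..<\<tau>}"
    from D'[OF this] show "((\<lambda>z. flux (u z)) has_derivative (\<lambda>w. u z * (G z \<bullet> w))) (at z)"
      unfolding flux_def by (auto intro!: derivative_eq_intros simp: field_simps)
  qed
  have "W1_infty T l ?k" "weak_gradient (cylinder_tests T l) (cylinder T l) ?k (gradient ?k)"
    by (rule smooth_W1_infty[OF l T smooth_kernel_at periodic_kernel_at[OF l]])+
  then have "(LINT z:cylinder \<tau> l|lebesgue. u z * fst (gradient ?k z) + flux (u z) * (\<Sum>i\<in>UNIV. snd (gradient ?k z) $ i))
      = (LINT x:torus l|lebesgue. u (\<tau>, x) * ?k (\<tau>, x)) - (LINT x:torus l|lebesgue. u0 x * ?k (0, x))"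
    using w \<tau> unfolding weak_entropy_solution_def by auto
  also have "\<dots> = 0" unfolding zero by simp
  finally have "(LINT z:cylinder \<tau> l|lebesgue. u z * partial e_t ?k z + (\<Sum>i\<in>UNIV. flux (u z) * partial (e_x i) ?k z)) = 0"
    unfolding gradient_components sum_distrib_left .
  then have "strip_integral l (\<lambda>z. (G z \<bullet> e_t) * ?k z) + (\<Sum>i\<in>UNIV. strip_integral l (\<lambda>z. u z * (G z \<bullet> e_x i) * ?k z)) = 0"
    unfolding admissible_cylinder_integral[OF admissible_add[OF a1 a2s]] strip_integral_add[OF l a1 a2s] s2 ibp1 ibp2
    by (simp add: sum_negf)
  then have "strip_integral l (\<lambda>z. (G z \<bullet> e_t) * ?k z + (\<Sum>i\<in>UNIV. u z * (G z \<bullet> e_x i) * ?k z)) = 0"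
    unfolding strip_integral_add[OF l a3 a4s] s4 .
  then show ?thesis by (simp add: distrib_right sum_distrib_right)
qed

text \<open>Inside the cylinder, the kernel averages of the continuous residual vanish while they
  approximate its value at the centre. Time 0, needed for the comparison with the scheme, follows by
  continuity.\<close>

lemma residual_zero:
  fixes l :: "real ^ 'd"
  assumes l: "\<And>i. 0 < l $ i" and T: "0 < T" and w: "weak_entropy_solution T l u0 u"
    and cu: "continuous_on ({0..T} \<times> UNIV) u" and cG: "continuous_on ({0..T} \<times> UNIV) G"
    and D: "\<And>z. fst z \<in> {0<..<T} \<Longrightarrow> (u has_derivative (\<lambda>w. G z \<bullet> w)) (at z)"
    and per: "\<And>t. t \<in> {0..T} \<Longrightarrow> periodic l (\<lambda>x. u (t, x))" "\<And>t e. t \<in> {0..T} \<Longrightarrow> periodic l (\<lambda>x. G (t, x) \<bullet> e)"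
    and z: "fst z \<in> {0..<T}"
  shows "residual u G z = 0"
proof -
  let ?R = "residual u G" and ?d = "real CARD('d)"
  have d: "1 \<le> ?d" using zero_less_card_finite[where 'a = 'd] by linarith
  have cR: "continuous_on ({0..T} \<times> UNIV) ?R" by (intro continuous_intros cG cu)
  have pR: "periodic l (\<lambda>x. ?R (t, x))" if "t \<in> {0..T}" for t
    by (intro periodic_add periodic_sum periodic_mult per that)
  have cR': "continuous_on ({0<..<T} \<times> UNIV) ?R" by (rule continuous_on_subset[OF cR]) auto
  have pR': "periodic l (\<lambda>x. ?R (t, x))" if "t \<in> {0<..<T}" for t using that by (intro pR) auto
  have small: "\<bar>?R c\<bar> \<le> \<epsilon>" if c: "fst c \<in> {0<..<T}" and \<epsilon>: "0 < \<epsilon>" for c \<epsilon>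
  proof -
    obtain \<rho> where \<rho>: "0 < \<rho>" and uc: "\<And>t s x y. t \<in> {0..T} \<Longrightarrow> s \<in> {0..T} \<Longrightarrow> \<bar>t - s\<bar> < \<rho> \<Longrightarrow> dist x y < \<rho> \<Longrightarrow>
        \<bar>?R (t, x) - ?R (s, y)\<bar> < \<epsilon>"
      using periodic_uniformly_continuous[OF l cR pR \<epsilon>] by metis
    define m where "m = Min (range (\<lambda>i. l $ i / 2))"
    have "m \<in> range (\<lambda>i. l $ i / 2)" unfolding m_def by (rule Min_in) auto
    then have m0: "0 < m" using l by auto
    have m: "m \<le> l $ i / 2" for i unfolding m_def by (rule Min_le) auto
    define r where "r = Min {m, \<rho> / (2 * ?d), fst c / 2, (T - fst c) / 2}"
    have rle: "r \<le> m" "r \<le> \<rho> / (2 * ?d)" "r \<le> fst c / 2" "r \<le> (T - fst c) / 2" unfolding r_def by (intro Min_le; simp)+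
    have "0 < r" unfolding r_def using m0 \<rho> d c by simp
    then have r: "0 < r" "r < fst c" "fst c + r < T" using rle c by auto
    have rl: "r \<le> l $ i / 2" for i using m[of i] rle(1) by linarith
    have dr: "?d * r < \<rho>"
    proof -
      have "?d * r \<le> ?d * (\<rho> / (2 * ?d))" using rle(2) d by (intro mult_left_mono) auto
      also have "\<dots> = \<rho> / 2" using d by simp
      finally show ?thesis using \<rho> by linarith
    qed
    have rr: "r < \<rho>" using mult_right_mono[OF d, of r] r dr by linarith
    have osc: "\<bar>?R v - ?R c\<bar> \<le> \<epsilon>" if "kernel_at l r c v \<noteq> 0" for v
    proof -
      have "\<bar>fst (c - v)\<bar> < r" and "\<exists>\<nu>\<in>lattice l. norm (snd (c - v) + \<nu>) \<le> ?d * r"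
        using kernel_support[OF l r(1) rl] that unfolding kernel_at_def by blast+
      then obtain \<nu> where t: "\<bar>fst c - fst v\<bar> < r" and \<nu>: "\<nu> \<in> lattice l" "norm (snd c - snd v + \<nu>) \<le> ?d * r" by auto
      have ct: "fst c \<in> {0..T}" using c by auto
      have "dist (snd v) (snd c + \<nu>) < \<rho>" using \<nu>(2) dr by (simp add: dist_norm norm_minus_commute algebra_simps)
      moreover have "fst v \<in> {0..T}" using t r by (auto simp: abs_less_iff)
      ultimately have "\<bar>?R (fst v, snd v) - ?R (fst c, snd c + \<nu>)\<bar> < \<epsilon>" using ct t rr by (intro uc) (auto simp: abs_minus_commute)
      then show ?thesis using periodic_lattice[OF pR[OF ct] \<nu>(1), of "snd c"] by simp
    qed
    have "\<bar>strip_integral l (\<lambda>w. ?R w * kernel_at l r c w) - ?R c * kernel_mass l r\<bar> \<le> \<epsilon> * kernel_mass l r"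
      by (rule kernel_average[OF l r cR' pR' osc])
    moreover have "strip_integral l (\<lambda>w. ?R w * kernel_at l r c w) = 0"
      by (rule residual_kernel_integral[OF l T w cu cG D per r])
    ultimately have "\<bar>?R c\<bar> * kernel_mass l r \<le> \<epsilon> * kernel_mass l r"
      using kernel_mass_pos[OF l r(1) rl] by (simp add: abs_mult)
    then show ?thesis using kernel_mass_pos[OF l r(1) rl] by simp
  qed
  \<comment> \<open>The point is moved slightly forward in time, off the initial slice.\<close>
  have "\<bar>?R z\<bar> \<le> \<epsilon>" if \<epsilon>: "0 < \<epsilon>" for \<epsilon>
  proof -
    obtain \<rho> where \<rho>: "0 < \<rho>" and uc: "\<And>t s x y. t \<in> {0..T} \<Longrightarrow> s \<in> {0..T} \<Longrightarrow> \<bar>t - s\<bar> < \<rho> \<Longrightarrow> dist x y < \<rho> \<Longrightarrow>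
        \<bar>?R (t, x) - ?R (s, y)\<bar> < \<epsilon> / 2"
      using periodic_uniformly_continuous[OF l cR pR, of "\<epsilon> / 2"] \<epsilon> by (metis half_gt_zero)
    define \<delta> where "\<delta> = min (\<rho> / 2) ((T - fst z) / 2)"
    have \<delta>: "\<delta> \<le> (T - fst z) / 2" unfolding \<delta>_def by (rule min.cobounded2)
    have "0 < \<delta>" "\<delta> < \<rho>" unfolding \<delta>_def using \<rho> z by (auto simp: min_less_iff_disj)
    note \<delta> = this \<delta>
    then have "\<bar>?R (fst z, snd z) - ?R (fst z + \<delta>, snd z)\<bar> < \<epsilon> / 2" using z \<rho> by (intro uc) auto
    moreover have "\<bar>?R (fst z + \<delta>, snd z)\<bar> \<le> \<epsilon> / 2" using z \<delta> \<epsilon> by (intro small) auto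
    ultimately show ?thesis unfolding prod.collapse by linarith
  qed
  from this[of "\<bar>?R z\<bar> / 2"] show ?thesis by (cases "?R z = 0") auto
qed

lemma directional_derivative:
  fixes v :: "'a::euclidean_space \<Rightarrow> real"
  assumes "(v has_derivative D) (at (z + (a - b) *\<^sub>R e))"
  shows "((\<lambda>s. v (z + (s - b) *\<^sub>R e)) has_real_derivative D e) (at a)"
proof -
  have "((\<lambda>s. z + (s - b) *\<^sub>R e) has_derivative (\<lambda>s. s *\<^sub>R e)) (at a)"
    by (auto intro!: derivative_eq_intros simp: algebra_simps)
  from has_derivative_compose[OF this assms]
  have "((\<lambda>s. v (z + (s - b) *\<^sub>R e)) has_derivative (\<lambda>s. D (s *\<^sub>R e))) (at a)" .
  moreover have "(\<lambda>s. D (s *\<^sub>R e)) = (\<lambda>s. D e * s)"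
    using has_derivative_linear[OF assms] by (simp add: linear_cmul mult.commute)
  ultimately show ?thesis by (simp add: has_field_derivative_def)
qed

text \<open>The solution is its own comparison function with residual zero. \<open>T' < T\<close>
  keeps clear of the final time, where the equation has not been established.\<close>

lemma C1_approx_solution:
  fixes l :: "real ^ 'd"
  assumes l: "\<And>i. 0 < l $ i"
    and cu: "continuous_on ({0..T} \<times> UNIV) u" and cG: "continuous_on ({0..T} \<times> UNIV) G"
    and D: "\<And>z. fst z \<in> {0..T} \<Longrightarrow> (u has_derivative (\<lambda>w. G z \<bullet> w)) (at z within {0..T} \<times> UNIV)"
    and per: "\<And>t. t \<in> {0..T} \<Longrightarrow> periodic l (\<lambda>x. u (t, x))" "\<And>t e. t \<in> {0..T} \<Longrightarrow> periodic l (\<lambda>x. G (t, x) \<bullet> e)"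
    and res: "\<And>z. fst z \<in> {0..<T} \<Longrightarrow> residual u G z = 0"
  shows "\<exists>M. \<forall>T' \<delta>. T' < T \<and> 0 < \<delta> \<longrightarrow> approx_solution T' l M \<delta> u"
proof -
  have cGe: "continuous_on ({0..T} \<times> UNIV) (\<lambda>z. G z \<bullet> e)" for e by (intro continuous_intros cG)
  obtain Bu where Bu: "0 \<le> Bu" "\<And>t x. t \<in> {0..T} \<Longrightarrow> \<bar>u (t, x)\<bar> \<le> Bu"
    using periodic_bounded[OF l cu per(1)] by blast
  have "\<exists>B\<ge>0. \<forall>t x. t \<in> {0..T} \<longrightarrow> \<bar>G (t, x) \<bullet> e\<bar> \<le> B" for e
    using periodic_bounded[OF l cGe per(2)] by metis
  then obtain B where B: "\<And>e. 0 \<le> B e" "\<And>t x e. t \<in> {0..T} \<Longrightarrow> \<bar>G (t, x) \<bullet> e\<bar> \<le> B e" by metis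
  define M where "M = Bu + B e_t + (\<Sum>i\<in>UNIV. B (e_x i))"
  have BS: "\<And>i. B (e_x i) \<le> (\<Sum>i\<in>UNIV. B (e_x i))" "0 \<le> (\<Sum>i\<in>UNIV. B (e_x i))"
    by (rule member_le_sum) (auto simp: B(1) intro: sum_nonneg)
  have M: "Bu \<le> M" "B e_t \<le> M" "B (e_x i) \<le> M" for i
    using BS(1)[of i] BS(2) B(1)[where e = e_t] Bu(1) unfolding M_def by linarith+
  have "approx_solution T' l M \<delta> u" if T': "T' < T" and \<delta>: "0 < \<delta>" for T' \<delta>
    unfolding approx_solution_def
  proof (intro conjI ballI exI[of _ "\<lambda>z. G z \<bullet> e_t"] exI[of _ "\<lambda>i z. G z \<bullet> e_x i"] allI impI)
    fix t assume "t \<in> {0..T'}"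
    then have t: "t \<in> {0..T}" "t \<in> {0..<T}" using T' by auto
    show "periodic l (\<lambda>x. u (t, x))" by (rule per(1)[OF t(1)])
    fix x
    show "\<bar>u (t, x)\<bar> \<le> M" "\<bar>G (t, x) \<bullet> e_t\<bar> \<le> M" "\<And>i. \<bar>G (t, x) \<bullet> e_x i\<bar> \<le> M"
      using Bu(2)[OF t(1)] B(2)[OF t(1)] M by (meson order_trans)+
    have "G (t, x) \<bullet> e_t + u (t, x) * (\<Sum>i\<in>UNIV. G (t, x) \<bullet> e_x i) = 0"
      using res[of "(t, x)"] t(2) by (simp add: sum_distrib_left)
    then show "\<bar>G (t, x) \<bullet> e_t + u (t, x) * (\<Sum>i\<in>UNIV. G (t, x) \<bullet> e_x i)\<bar> \<le> \<delta>" using \<delta> by simp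
  next
    fix \<eta> :: real assume \<eta>: "0 < \<eta>"
    have "\<exists>\<rho>>0. \<forall>z s. 0 < s \<and> s < \<rho> \<and> fst z \<in> {0..T} \<and> fst (z + s *\<^sub>R e) \<in> {0..T} \<longrightarrow>
       \<bar>u (z + s *\<^sub>R e) - u z - s * (G z \<bullet> e)\<bar> \<le> \<eta> * s" if "e \<in> Basis" for e
      by (rule periodic_uniform_taylor[OF l that D refl cGe per(2) \<eta>])
    then have "\<forall>e\<in>Basis. \<exists>\<rho>>0. \<forall>z s. 0 < s \<and> s < \<rho> \<and> fst z \<in> {0..T} \<and> fst (z + s *\<^sub>R e) \<in> {0..T} \<longrightarrow>
       \<bar>u (z + s *\<^sub>R e) - u z - s * (G z \<bullet> e)\<bar> \<le> \<eta> * s" by blast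
    then obtain \<rho>e where \<rho>e: "\<And>e. e \<in> Basis \<Longrightarrow> 0 < \<rho>e e" "\<And>e z s. e \<in> Basis \<Longrightarrow> 0 < s \<Longrightarrow> s < \<rho>e e \<Longrightarrow>
        fst z \<in> {0..T} \<Longrightarrow> fst (z + s *\<^sub>R e) \<in> {0..T} \<Longrightarrow> \<bar>u (z + s *\<^sub>R e) - u z - s * (G z \<bullet> e)\<bar> \<le> \<eta> * s"
      by metis
    define \<rho> where "\<rho> = Min (\<rho>e ` Basis)"
    have "\<rho> \<in> \<rho>e ` Basis" unfolding \<rho>_def by (rule Min_in) auto
    then have \<rho>: "0 < \<rho>" using \<rho>e(1) by auto
    have \<rho>le: "\<rho> \<le> \<rho>e e" if "e \<in> Basis" for e unfolding \<rho>_def using that by (intro Min_le) auto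
    show "\<exists>\<rho>>0. \<forall>s t x. 0 < s \<and> s < \<rho> \<and> t \<in> {0..T'} \<longrightarrow>
         (t + s \<le> T' \<longrightarrow> \<bar>u (t + s, x) - u (t, x) - s * (G (t, x) \<bullet> e_t)\<bar> \<le> \<eta> * s) \<and>
         (\<forall>i. \<bar>u (t, x + s *\<^sub>R axis i 1) - u (t, x) - s * (G (t, x) \<bullet> e_x i)\<bar> \<le> \<eta> * s)"
    proof (intro exI[of _ \<rho>] conjI allI impI \<rho>; (elim conjE)?)
      fix s t x assume s: "0 < s" "s < \<rho>" "t \<in> {0..T'}"
      have st: "s < \<rho>e e" if "e \<in> Basis" for e using s(2) \<rho>le[OF that] by linarith
      show "\<bar>u (t + s, x) - u (t, x) - s * (G (t, x) \<bullet> e_t)\<bar> \<le> \<eta> * s" if "t + s \<le> T'"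
        using \<rho>e(2)[OF e_Basis(1) s(1) st[OF e_Basis(1)], of "(t, x)"] s that T' by simp
      show "\<bar>u (t, x + s *\<^sub>R axis i 1) - u (t, x) - s * (G (t, x) \<bullet> e_x i)\<bar> \<le> \<eta> * s" for i
        using \<rho>e(2)[OF e_Basis(2) s(1) st[OF e_Basis(2)], of "(t, x)"] s T' by simp
    qed
  qed
  then show ?thesis by blast
qed

lemma C1_residual_zero_pointwise:
  fixes l :: "real ^ 'd"
  assumes D: "\<And>z. fst z \<in> {0<..<T} \<Longrightarrow> (u has_derivative (\<lambda>w. G z \<bullet> w)) (at z)"
    and res: "\<And>z. fst z \<in> {0..<T} \<Longrightarrow> residual u G z = 0" and t: "t \<in> {0<..<T}"
  shows "deriv (\<lambda>s. u (s, x)) t + (\<Sum>i\<in>UNIV. deriv (\<lambda>s. flux (u (t, x + s *\<^sub>R axis i 1))) 0) = 0"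
proof -
  note Dz = D[of "(t, x)", simplified, OF t[simplified]]
  have "((\<lambda>s. u ((t, x) + (s - t) *\<^sub>R e_t)) has_real_derivative G (t, x) \<bullet> e_t) (at t)"
    by (rule directional_derivative) (use Dz in simp)
  then have 1: "deriv (\<lambda>s. u (s, x)) t = G (t, x) \<bullet> e_t" by (intro DERIV_imp_deriv) simp
  have "deriv (\<lambda>s. flux (u (t, x + s *\<^sub>R axis i 1))) 0 = u (t, x) * (G (t, x) \<bullet> e_x i)" for i
  proof -
    have "((\<lambda>s. u ((t, x) + (s - 0) *\<^sub>R e_x i)) has_real_derivative G (t, x) \<bullet> e_x i) (at 0)"
      by (rule directional_derivative) (use Dz in simp)
    then have "((\<lambda>s. u (t, x + s *\<^sub>R axis i 1)) has_real_derivative G (t, x) \<bullet> e_x i) (at 0)" by simp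
    then show ?thesis unfolding flux_def by (intro DERIV_imp_deriv) (auto intro!: derivative_eq_intros)
  qed
  then show ?thesis using 1 res[of "(t, x)"] t by simp
qed

lemma C1_on_slice:
  fixes u :: "real \<times> (real ^ 'd) \<Rightarrow> real"
  assumes cG: "continuous_on ({0..T} \<times> UNIV) G" and T: "0 < T"
    and D: "\<And>z. fst z \<in> {0..T} \<Longrightarrow> (u has_derivative (\<lambda>w. G z \<bullet> w)) (at z within {0..T} \<times> UNIV)"
  shows "C1_on UNIV (\<lambda>x. u (0, x))"
  unfolding C1_on_def
proof (intro exI[of _ "\<lambda>x. snd (G (0, x))"] conjI ballI)
  show "continuous_on UNIV (\<lambda>x. snd (G (0, x)))"
    by (intro continuous_on_snd continuous_on_compose2[OF cG]) (use T in \<open>auto intro!: continuous_intros\<close>)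
  fix x :: "real ^ 'd"
  have "((\<lambda>x. u (0, x)) has_derivative (\<lambda>w. G (0, x) \<bullet> (0, w))) (at x within UNIV)"
  proof (rule has_derivative_in_compose[where f = "\<lambda>x. (0, x)"])
    show "((\<lambda>x. (0, x)) has_derivative (\<lambda>w. (0, w))) (at x within UNIV)" by (auto intro!: derivative_eq_intros)
    show "(u has_derivative (\<lambda>w. G (0, x) \<bullet> w)) (at (0, x) within range (Pair 0))"
      by (rule has_derivative_subset[OF D]) (use T in auto)
  qed
  then show "((\<lambda>x. u (0, x)) has_derivative (\<lambda>w. snd (G (0, x)) \<bullet> w)) (at x within UNIV)"
    by (simp add: inner_prod_def)
qed

section \<open>The initial datum of a weak solution\<close>

lemma set_integral_abs_le:
  fixes f :: "'a::euclidean_space \<Rightarrow> real"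
  assumes D: "D \<in> sets lebesgue" "emeasure lebesgue D \<le> ennreal V" and V: "0 \<le> V" and B: "0 \<le> B"
    and f: "\<And>z. z \<in> D \<Longrightarrow> \<bar>f z\<bar> \<le> B"
  shows "\<bar>LINT z:D|lebesgue. f z\<bar> \<le> B * V"
proof -
  have "emeasure lebesgue D < \<infinity>" using D(2) by (simp add: le_less_trans)
  then have i: "integrable lebesgue (\<lambda>z. B * indicator D z)"
    using D(1) by (intro integrable_mult_right integrable_real_indicator)
  have "\<bar>LINT z:D|lebesgue. f z\<bar> \<le> (\<integral>z. \<bar>indicator D z *\<^sub>R f z\<bar> \<partial>lebesgue)"
    unfolding set_lebesgue_integral_def by (rule integral_abs_bound)
  also have "\<dots> \<le> (\<integral>z. B * indicator D z \<partial>lebesgue)"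
    by (rule integral_mono'[OF i]) (use f B in \<open>auto simp: indicator_def\<close>)
  also have "\<dots> = B * measure lebesgue D" using D(1) by simp
  also have "\<dots> \<le> B * V" using D(2) V B unfolding measure_def by (intro mult_left_mono enn2real_leI) auto
  finally show ?thesis .
qed

lemma torus_lebesgue: "torus l \<in> sets lebesgue"
  using torus_measurable by simp

lemma finite_measure_torus:
  assumes "\<And>i. 0 < l $ i" shows "finite_measure (lebesgue_on (torus l))"
proof
  have "emeasure lebesgue (torus l) = ennreal (\<Prod>i\<in>UNIV. l $ i)" using emeasure_torus[OF assms] by simp
  then show "emeasure (lebesgue_on (torus l)) (space (lebesgue_on (torus l))) \<noteq> \<infinity>"
    by (simp add: emeasure_restrict_space torus_lebesgue space_restrict_space)
qed

text \<open>With a time-independent test the weak form says that the pairings at time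
  \<open>\<tau>\<close> and with \<open>u0\<close> differ by \<open>O(\<tau>)\<close>; continuity of
  \<open>u\<close> takes \<open>\<tau>\<close> to 0.\<close>

lemma weak_initial_datum:
  fixes l :: "real ^ 'd" and \<theta> :: "real \<times> (real ^ 'd) \<Rightarrow> real"
  assumes l: "\<And>i. 0 < l $ i" and T: "0 < T" and w: "weak_entropy_solution T l u0 u" and u0: "L_infty (torus l) u0"
    and cu: "continuous_on ({0..T} \<times> UNIV) u" and per: "\<And>t. t \<in> {0..T} \<Longrightarrow> periodic l (\<lambda>x. u (t, x))"
    and \<theta>: "smooth \<theta>" "\<And>t. periodic l (\<lambda>x. \<theta> (t, x))" "\<And>t x. \<theta> (t, x) = \<theta> (0, x)"
  shows "integral\<^sup>L (lebesgue_on (torus l)) (\<lambda>x. (u (0, x) - u0 x) * \<theta> (0, x)) = 0"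
proof -
  define V where "V = (\<Prod>i\<in>UNIV. l $ i)"
  have V: "0 < V" unfolding V_def by (intro prod_pos l)
  let ?I = "\<lambda>f. integral\<^sup>L (lebesgue_on (torus l)) f"
  note fin = finite_measure_torus[OF l]
  have em: "emeasure lebesgue (torus l) \<le> ennreal V" using emeasure_torus[OF l] unfolding V_def by simp
  have c\<theta>: "continuous_on UNIV \<theta>" by (rule smooth_continuous[OF \<theta>(1)])
  have c\<theta>0: "continuous_on UNIV (\<lambda>x. \<theta> (0, x))" by (rule continuous_on_compose2[OF c\<theta>]) (auto intro!: continuous_intros)
  obtain B\<theta> where B\<theta>: "0 \<le> B\<theta>" "\<And>t x. t \<in> {0..T} \<Longrightarrow> \<bar>\<theta> (t, x)\<bar> \<le> B\<theta>"
    by (rule periodic_bounded[OF l continuous_on_subset[OF c\<theta>] \<theta>(2), of 0 T]) (auto intro: that)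
  have b\<theta>: "\<bar>\<theta> (0, x)\<bar> \<le> B\<theta>" for x using B\<theta>(2)[of 0 x] T by simp
  obtain Bu where Bu: "\<And>t x. t \<in> {0..T} \<Longrightarrow> \<bar>u (t, x)\<bar> \<le> Bu"
    using periodic_bounded[OF l cu per] by blast
  have iu: "integrable (lebesgue_on (torus l)) (\<lambda>x. u (t, x) * \<theta> (0, x))" if t: "t \<in> {0..T}" for t
  proof (rule L_infty_times_integrable[OF fin _ borel_measurable_continuous_onI[OF c\<theta>0] b\<theta>])
    show "L_infty (torus l) (\<lambda>x. u (t, x))"
      by (rule L_infty_bounded[OF borel_measurable_continuous_onI[OF continuous_slice[OF cu t]] Bu[OF t]])
  qed
  have iu0: "integrable (lebesgue_on (torus l)) (\<lambda>x. u0 x * \<theta> (0, x))"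
    by (rule L_infty_times_integrable[OF fin u0 borel_measurable_continuous_onI[OF c\<theta>0] b\<theta>])
  let ?F = "\<lambda>z. u z * partial e_t \<theta> z + flux (u z) * (\<Sum>i\<in>UNIV. partial (e_x i) \<theta> z)"
  have cF: "continuous_on ({0..T} \<times> UNIV) ?F"
    unfolding flux_def
    by (intro continuous_intros cu continuous_on_subset[OF smooth_continuous[OF smooth_partial[OF \<theta>(1)]]] e_Basis) auto
  have pF: "periodic l (\<lambda>x. ?F (t, x))" if t: "t \<in> {0..T}" for t
    using per[OF t] partial_periodic[OF \<theta>(1,2)] unfolding periodic_def by simp
  obtain BF where BF: "0 \<le> BF" "\<And>t x. t \<in> {0..T} \<Longrightarrow> \<bar>?F (t, x)\<bar> \<le> BF"
    using periodic_bounded[OF l cF pF] by metis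
  have step: "\<bar>?I (\<lambda>x. u (\<tau>, x) * \<theta> (0, x)) - ?I (\<lambda>x. u0 x * \<theta> (0, x))\<bar> \<le> BF * (\<tau> * V)" if \<tau>: "0 < \<tau>" "\<tau> < T" for \<tau>
  proof -
    have "W1_infty T l \<theta>" "weak_gradient (cylinder_tests T l) (cylinder T l) \<theta> (gradient \<theta>)"
      by (rule smooth_W1_infty[OF l T \<theta>(1,2)])+
    then have "(LINT x:torus l|lebesgue. u (\<tau>, x) * \<theta> (\<tau>, x)) - (LINT x:torus l|lebesgue. u0 x * \<theta> (0, x))
        = (LINT z:cylinder \<tau> l|lebesgue. u z * fst (gradient \<theta> z) + flux (u z) * (\<Sum>i\<in>UNIV. snd (gradient \<theta> z) $ i))"
      using w \<tau> unfolding weak_entropy_solution_def by auto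
    then have "?I (\<lambda>x. u (\<tau>, x) * \<theta> (0, x)) - ?I (\<lambda>x. u0 x * \<theta> (0, x)) = (LINT z:cylinder \<tau> l|lebesgue. ?F z)"
      unfolding gradient_components set_integral_lebesgue_on[OF torus_lebesgue] \<theta>(3)[of \<tau>] .
    moreover have "\<bar>LINT z:cylinder \<tau> l|lebesgue. ?F z\<bar> \<le> BF * (\<tau> * V)"
    proof (rule set_integral_abs_le[OF cylinder_lebesgue])
      have "emeasure lborel (cylinder \<tau> l) \<le> emeasure lborel ({0..\<tau>} \<times> torus l)"
        unfolding cylinder_def borel_prod[symmetric] lborel_prod[symmetric]
        by (intro emeasure_mono) (auto intro!: pair_measureI)
      also have "\<dots> = ennreal (\<tau> * V)" using strip_box_emeasure[OF l, of 0 \<tau>] \<tau> unfolding V_def by simp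
      finally show "emeasure lebesgue (cylinder \<tau> l) \<le> ennreal (\<tau> * V)" by simp
    qed (use \<tau> V BF in \<open>auto simp: cylinder_def\<close>)
    ultimately show ?thesis by simp
  qed
  have "\<bar>?I (\<lambda>x. u (0, x) * \<theta> (0, x)) - ?I (\<lambda>x. u0 x * \<theta> (0, x))\<bar> \<le> 0 + \<epsilon>" if \<epsilon>: "0 < \<epsilon>" for \<epsilon>
  proof -
    define \<epsilon>1 where "\<epsilon>1 = \<epsilon> / (2 * (B\<theta> * V + 1))"
    have pos: "0 < B\<theta> * V + 1" "0 < BF * V + 1" using B\<theta>(1) BF(1) V by (auto intro!: add_nonneg_pos)
    have \<epsilon>1: "0 < \<epsilon>1" unfolding \<epsilon>1_def using \<epsilon> pos by simp
    obtain \<rho> where \<rho>: "0 < \<rho>" and uc: "\<And>t s x y. t \<in> {0..T} \<Longrightarrow> s \<in> {0..T} \<Longrightarrow> \<bar>t - s\<bar> < \<rho> \<Longrightarrow> dist x y < \<rho> \<Longrightarrow>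
        \<bar>u (t, x) - u (s, y)\<bar> < \<epsilon>1"
      using periodic_uniformly_continuous[OF l cu per \<epsilon>1] by metis
    \<comment> \<open>Bounded by half the modulus, by half the final time, and by what makes the
      space-time integral at most \<open>\<epsilon> / 2\<close>.\<close>
    define \<tau> where "\<tau> = Min {\<rho> / 2, T / 2, \<epsilon> / (2 * (BF * V + 1))}"
    have "0 < \<tau>" unfolding \<tau>_def using \<rho> T \<epsilon> pos by simp
    moreover have "\<tau> \<le> \<rho> / 2" "\<tau> \<le> T / 2" and \<tau>3: "\<tau> \<le> \<epsilon> / (2 * (BF * V + 1))" unfolding \<tau>_def by (intro Min_le; simp)+
    ultimately have \<tau>: "0 < \<tau>" "\<tau> < T" "\<tau> < \<rho>" using T \<rho> by auto
    have t: "\<tau> \<in> {0..T}" "0 \<in> {0..T}" using \<tau> T by auto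
    have "\<bar>LINT x:torus l|lebesgue. u (0, x) * \<theta> (0, x) - u (\<tau>, x) * \<theta> (0, x)\<bar> \<le> (\<epsilon>1 * B\<theta>) * V"
    proof (rule set_integral_abs_le[OF torus_lebesgue em])
      fix x
      have "\<bar>u (0, x) - u (\<tau>, x)\<bar> < \<epsilon>1" using \<tau> \<rho> t by (intro uc) auto
      then show "\<bar>u (0, x) * \<theta> (0, x) - u (\<tau>, x) * \<theta> (0, x)\<bar> \<le> \<epsilon>1 * B\<theta>"
        unfolding left_diff_distrib[symmetric] abs_mult using b\<theta>[of x] \<epsilon>1 by (intro mult_mono) auto
    qed (use V \<epsilon>1 B\<theta> in auto)
    then have 1: "\<bar>?I (\<lambda>x. u (0, x) * \<theta> (0, x)) - ?I (\<lambda>x. u (\<tau>, x) * \<theta> (0, x))\<bar> \<le> \<epsilon>1 * B\<theta> * V"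
      unfolding set_integral_lebesgue_on[OF torus_lebesgue] Bochner_Integration.integral_diff[OF iu[OF t(2)] iu[OF t(1)]] .
    have "\<epsilon>1 * (B\<theta> * V) \<le> \<epsilon>1 * (B\<theta> * V + 1)" using \<epsilon>1 by (intro mult_left_mono) auto
    also have "\<dots> = \<epsilon> / 2" unfolding \<epsilon>1_def using pos by (simp add: field_simps)
    finally have 2: "\<epsilon>1 * B\<theta> * V \<le> \<epsilon> / 2" by (simp only: mult.assoc)
    have "(BF * V) * \<tau> \<le> (BF * V + 1) * (\<epsilon> / (2 * (BF * V + 1)))" using \<tau>3 \<tau>(1) pos by (intro mult_mono) auto
    also have "\<dots> = \<epsilon> / 2"
    proof -
      have "y * (\<epsilon> / (2 * y)) = \<epsilon> / 2" if "0 < y" for y :: real using that by simp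
      from this[OF pos(2)] show ?thesis .
    qed
    finally have "BF * (\<tau> * V) \<le> \<epsilon> / 2" by (simp only: mult_ac)
    then show ?thesis using 1 2 step[OF \<tau>(1,2)] by linarith
  qed
  then have "\<bar>?I (\<lambda>x. u (0, x) * \<theta> (0, x)) - ?I (\<lambda>x. u0 x * \<theta> (0, x))\<bar> \<le> 0" by (rule field_le_epsilon)
  then show ?thesis
    using T unfolding left_diff_distrib by (subst Bochner_Integration.integral_diff[OF iu iu0]) auto
qed

text \<open>Smooth functions with values in \<open>[0, 1]\<close> that converge pointwise to the
  indicator of the open half-line.\<close>

lemma bump_scaled_tendsto: "(\<lambda>n. bump (real n * s)) \<longlonglongrightarrow> (if 0 < s then 1 else 0)"
proof (cases "0 < s")
  case True
  have "(\<lambda>n. exp (- (1 / s * inverse (real n)))) \<longlonglongrightarrow> exp (- (1 / s * 0))"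
    by (intro tendsto_intros lim_inverse_n)
  moreover have "\<forall>\<^sub>F n in sequentially. exp (- (1 / s * inverse (real n))) = bump (real n * s)"
    using eventually_gt_at_top[of 0] by eventually_elim (use True in \<open>simp add: bump_def field_simps\<close>)
  ultimately show ?thesis using True by (simp add: tendsto_cong)
next
  case False
  then have "bump (real n * s) = 0" for n by (simp add: bump_eq_0_iff mult_nonneg_nonpos)
  with False show ?thesis by simp
qed

text \<open>The cosine condition says that \<open>x $ i\<close> lies within half the side length of
  the midpoint, modulo \<open>l $ i\<close>. For a box inside the period cell only the zero multiple
  is possible.\<close>

lemma box_indicator_cos:
  fixes l :: "real ^ 'd"
  assumes l: "\<And>i. 0 < l $ i" and ab: "\<And>i. 0 \<le> a $ i" "\<And>i. a $ i < b $ i" "\<And>i. b $ i \<le> l $ i" and x: "x \<in> torus l"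
  shows "(\<Prod>i\<in>UNIV. if 0 < cos (2 * pi / l $ i * (x $ i - (a $ i + b $ i) / 2)) - cos (2 * pi / l $ i * ((b $ i - a $ i) / 2)) then 1 else 0)
    = (indicator (box a b) x :: real)"
proof -
  have iff: "0 < cos (2 * pi / l $ i * (x $ i - (a $ i + b $ i) / 2)) - cos (2 * pi / l $ i * ((b $ i - a $ i) / 2))
      \<longleftrightarrow> a $ i < x $ i \<and> x $ i < b $ i" (is "?P i \<longleftrightarrow> _") for i
  proof
    let ?y = "x $ i - (a $ i + b $ i) / 2" and ?r = "(b $ i - a $ i) / 2"
    have r: "0 < ?r" "?r \<le> l $ i / 2" using ab[of i] by auto
    assume "?P i"
    then obtain n :: int where n: "\<bar>?y + of_int n * l $ i\<bar> < ?r" using cos_near_period[OF l[of i] r, of ?y] by auto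
    then have "?y + of_int n * l $ i < ?r" "- ?r < ?y + of_int n * l $ i" by linarith+
    then have y: "x $ i + of_int n * l $ i < b $ i" "a $ i < x $ i + of_int n * l $ i"
      by (simp_all add: diff_divide_distrib add_divide_distrib)
    have xi: "0 \<le> x $ i" "x $ i < l $ i" using x by (auto simp: torus_def)
    have "n < 1"
    proof (rule ccontr)
      assume "\<not> n < 1"
      then have "1 * l $ i \<le> of_int n * l $ i" using l[of i] by (intro mult_right_mono) auto
      then show False using y xi ab[of i] by linarith
    qed
    moreover have "- 1 < n"
    proof (rule ccontr)
      assume "\<not> - 1 < n"
      then have "of_int n * l $ i \<le> (- 1) * l $ i" using l[of i] by (intro mult_right_mono) auto
      then show False using y xi ab[of i] by linarith
    qed
    ultimately have "n = 0" by simp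
    then show "a $ i < x $ i \<and> x $ i < b $ i" using y by simp
  next
    let ?y = "x $ i - (a $ i + b $ i) / 2" and ?r = "(b $ i - a $ i) / 2" and ?w = "2 * pi / l $ i"
    assume ax: "a $ i < x $ i \<and> x $ i < b $ i"
    have w: "0 < ?w" using l[of i] by simp
    have y: "\<bar>?y\<bar> < ?r" using ax by (auto simp: abs_less_iff field_simps)
    have "cos (?w * ?r) < cos (?w * \<bar>?y\<bar>)"
    proof (rule cos_monotone_0_pi)
      show "0 \<le> ?w * \<bar>?y\<bar>" by (rule mult_nonneg_nonneg[OF less_imp_le[OF w] abs_ge_zero])
      show "?w * \<bar>?y\<bar> < ?w * ?r" by (rule mult_strict_left_mono[OF y w])
      have "?w * ?r \<le> ?w * (l $ i / 2)" using ab[of i] w by (intro mult_left_mono) auto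
      then show "?w * ?r \<le> pi" using l[of i] by simp
    qed
    moreover have "?w * \<bar>?y\<bar> = \<bar>?w * ?y\<bar>" by (simp only: abs_mult[of ?w] abs_of_pos[OF w])
    ultimately show "?P i" using cos_abs_real[of "?w * ?y"] by simp
  qed
  show ?thesis
  proof (cases "x \<in> box a b")
    case True
    then show ?thesis unfolding iff by (auto simp: mem_box_cart)
  next
    case False
    then obtain i where "\<not> (a $ i < x $ i \<and> x $ i < b $ i)" by (auto simp: mem_box_cart)
    then have "(\<Prod>i\<in>UNIV. if a $ i < x $ i \<and> x $ i < b $ i then 1 else 0 :: real) = 0"
      by (intro prod_zero) auto
    then show ?thesis unfolding iff using False by simp
  qed
qed

text \<open>Products of scaled bumps of cosines are smooth, periodic and bounded by 1 and converge
  to the indicator of the box on the torus, so dominated convergence applies.\<close>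

lemma integral_zero_on_boxes:
  fixes l :: "real ^ 'd"
  assumes l: "\<And>i. 0 < l $ i" and g: "integrable (lebesgue_on (torus l)) g"
    and test: "\<And>\<theta> :: real \<times> (real ^ 'd) \<Rightarrow> real. smooth \<theta> \<Longrightarrow> (\<And>t. periodic l (\<lambda>x. \<theta> (t, x))) \<Longrightarrow> (\<And>t x. \<theta> (t, x) = \<theta> (0, x)) \<Longrightarrow>
        integral\<^sup>L (lebesgue_on (torus l)) (\<lambda>x. g x * \<theta> (0, x)) = 0"
    and ab: "\<And>i. 0 \<le> a $ i" "\<And>i. a $ i < b $ i" "\<And>i. b $ i \<le> l $ i"
  shows "integral\<^sup>L (lebesgue_on (torus l)) (\<lambda>x. g x * indicator (box a b) x) = 0"
proof -
  let ?s = "\<lambda>i x. cos (2 * pi / l $ i * (x $ i - (a $ i + b $ i) / 2)) - cos (2 * pi / l $ i * ((b $ i - a $ i) / 2))"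
  let ?\<theta> = "\<lambda>n (z :: real \<times> (real ^ 'd)). \<Prod>i\<in>UNIV. bump (real n * ?s i (snd z))"
  have s: "smooth (?\<theta> n)" for n
  proof (intro smooth_prod smooth_bump)
    fix i
    have "smooth (\<lambda>z :: real \<times> (real ^ 'd). real n * (cos (z \<bullet> (0, axis i (2 * pi / l $ i)) + - (2 * pi / l $ i * ((a $ i + b $ i) / 2)))
        + - cos (2 * pi / l $ i * ((b $ i - a $ i) / 2))))"
      by (intro smooth_mult smooth_const smooth_add smooth_cos smooth_affine)
    then show "smooth (\<lambda>z :: real \<times> (real ^ 'd). real n * ?s i (snd z))"
      by (simp add: inner_prod_def inner_axis mult.commute right_diff_distrib)
  qed
  have p: "periodic l (\<lambda>x. ?\<theta> n (t, x))" for n t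
    unfolding periodic_def
  proof (intro allI)
    fix x i
    have "cos (2 * pi / l $ j * ((x + axis i (l $ i)) $ j - m)) = cos (2 * pi / l $ j * (x $ j - m))" for j m
    proof (cases "j = i")
      case True
      then have "2 * pi / l $ j * ((x + axis i (l $ i)) $ j - m) = 2 * pi / l $ j * (x $ j - m) + 2 * pi"
        using l[of j] by (simp add: axis_def field_simps)
      then show ?thesis by (simp only: cos_periodic)
    qed (simp add: axis_def)
    then show "?\<theta> n (t, x + axis i (l $ i)) = ?\<theta> n (t, x)" by simp
  qed
  have zero: "integral\<^sup>L (lebesgue_on (torus l)) (\<lambda>x. g x * ?\<theta> n (0, x)) = 0" for n
    by (rule test[OF s p]) simp
  have m: "(\<lambda>x. ?\<theta> n (0, x)) \<in> borel_measurable (lebesgue_on (torus l))" for n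
  proof -
    have "continuous_on UNIV (\<lambda>x. ?\<theta> n (0, x))"
      by (rule continuous_on_compose2[OF smooth_continuous[OF s]]) (auto intro!: continuous_intros)
    then show ?thesis
      by (intro measurable_restrict_space1) (simp add: measurable_completion borel_measurable_continuous_onI)
  qed
  have "(\<lambda>n. integral\<^sup>L (lebesgue_on (torus l)) (\<lambda>x. g x * ?\<theta> n (0, x))) \<longlonglongrightarrow>
      integral\<^sup>L (lebesgue_on (torus l)) (\<lambda>x. g x * indicator (box a b) x)"
  proof (rule integral_dominated_convergence)
    have gm: "g \<in> borel_measurable (lebesgue_on (torus l))" using g by auto
    show "(\<lambda>x. g x * ?\<theta> n (0, x)) \<in> borel_measurable (lebesgue_on (torus l))" for n
      by (rule borel_measurable_times[OF gm m])
    have "(indicator (box a b) :: real ^ 'd \<Rightarrow> real) \<in> borel_measurable (lebesgue_on (torus l))"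
      by (intro measurable_restrict_space1) (simp add: measurable_completion)
    then show "(\<lambda>x. g x * indicator (box a b) x) \<in> borel_measurable (lebesgue_on (torus l))"
      by (rule borel_measurable_times[OF gm])
    show "integrable (lebesgue_on (torus l)) (\<lambda>x. norm (g x))" using g by (rule integrable_norm)
    show "AE x in lebesgue_on (torus l). norm (g x * ?\<theta> n (0, x)) \<le> norm (g x)" for n
    proof (rule AE_I2)
      fix x
      have "0 \<le> ?\<theta> n (0, x)" "?\<theta> n (0, x) \<le> 1"
        by (auto intro!: prod_nonneg prod_le_1 simp: bump_nonneg bump_le_1)
      then show "norm (g x * ?\<theta> n (0, x)) \<le> norm (g x)" by (simp add: abs_mult mult_left_le)
    qed
    show "AE x in lebesgue_on (torus l). (\<lambda>n. g x * ?\<theta> n (0, x)) \<longlonglongrightarrow> g x * indicator (box a b) x"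
    proof (rule AE_I2)
      fix x assume "x \<in> space (lebesgue_on (torus l))"
      then have x: "x \<in> torus l" by (simp add: space_restrict_space)
      have "(\<lambda>n. ?\<theta> n (0, x)) \<longlonglongrightarrow> (\<Prod>i\<in>UNIV. if 0 < ?s i x then 1 else 0)"
        unfolding snd_conv by (intro tendsto_prod bump_scaled_tendsto)
      then show "(\<lambda>n. g x * ?\<theta> n (0, x)) \<longlonglongrightarrow> g x * indicator (box a b) x"
        unfolding box_indicator_cos[OF l ab x] by (intro tendsto_mult_left)
    qed
  qed
  then show ?thesis unfolding zero by (simp add: LIMSEQ_const_iff)
qed

text \<open>Boxes are stable under intersection and generate the Borel sets, so vanishing integrals
  extend from boxes to all Borel sets, for a Borel version of \<open>f\<close>.\<close>

lemma AE_zero_of_box_integrals: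
  fixes f :: "'a::euclidean_space \<Rightarrow> real"
  assumes f: "integrable lebesgue f" and supp: "\<And>x. x \<notin> box p q \<Longrightarrow> f x = 0"
    and box: "\<And>a b. (LINT x:box a b|lebesgue. f x) = 0"
  shows "AE x in lebesgue. f x = 0"
proof -
  obtain f' where f': "f' \<in> borel_measurable borel" and ff': "AE x in lborel. f x = f' x"
    using completion_ex_borel_measurable_real[OF borel_measurable_integrable[OF f]] by auto
  have eqA: "set_lebesgue_integral lborel A f' = (LINT x:A|lebesgue. f x)" if A: "A \<in> sets borel" for A
  proof -
    have m: "(\<lambda>x. indicator A x *\<^sub>R f' x) \<in> borel_measurable lborel" using A f' by measurable
    have "set_lebesgue_integral lborel A f' = integral\<^sup>L lebesgue (\<lambda>x. indicator A x *\<^sub>R f' x)"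
      unfolding set_lebesgue_integral_def by (rule integral_completion[OF m, symmetric])
    also have "\<dots> = (LINT x:A|lebesgue. f x)"
      unfolding set_lebesgue_integral_def
    proof (rule integral_cong_AE)
      show "(\<lambda>x. indicator A x *\<^sub>R f' x) \<in> borel_measurable lebesgue" using m by (simp add: measurable_completion)
      show "(\<lambda>x. indicator A x *\<^sub>R f x) \<in> borel_measurable lebesgue"
      proof (intro borel_measurable_scaleR borel_measurable_indicator borel_measurable_integrable[OF f])
        show "A \<in> sets lebesgue" using A by simp
      qed
      show "AE x in lebesgue. indicator A x *\<^sub>R f' x = indicator A x *\<^sub>R f x"
        using AE_completion[OF ff'] by eventually_elim simp
    qed
    finally show ?thesis .
  qed
  have int: "integrable lborel f'"
  proof -
    have "integrable lebesgue f'"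
      using f f' AE_completion[OF ff'] by (subst integrable_cong_AE[of _ _ f]) (auto simp: measurable_completion)
    then show ?thesis using f' by (simp add: integrable_completion)
  qed
  have intA: "set_integrable lborel A f'" if "A \<in> sets borel" for A
    using that int unfolding set_integrable_def by (intro integrable_mult_indicator) auto
  \<comment> \<open>The integral over the whole space is what the complement step of the induction
    needs; the support condition reduces it to a box.\<close>
  have UN: "set_lebesgue_integral lborel UNIV f' = 0"
  proof -
    have "(\<lambda>x. indicator UNIV x *\<^sub>R f x) = (\<lambda>x. indicator (box p q) x *\<^sub>R f x)"
      using supp by (auto simp: fun_eq_iff indicator_def)
    then have "(LINT x:UNIV|lebesgue. f x) = (LINT x:box p q|lebesgue. f x)" unfolding set_lebesgue_integral_def by (rule arg_cong)
    then show ?thesis using box eqA[of UNIV] by simp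
  qed
  have zero: "set_lebesgue_integral lborel A f' = 0" if A: "A \<in> sets borel" for A
  proof -
    let ?E = "range (\<lambda>(a, b). box a b :: 'a set)"
    have st: "Int_stable ?E" by (auto simp: Int_stable_def box_Int_box)
    have sE: "sigma_sets UNIV ?E = sets borel" unfolding borel_eq_box by (simp add: sets_measure_of)
    have A': "A \<in> sigma_sets UNIV ?E" using A unfolding sE .
    show ?thesis
      using st Pow_UNIV[THEN equalityD2, THEN subset_trans[OF subset_UNIV]] A'
    proof (induction rule: sigma_sets_induct_disjoint)
      case (basic A)
      then show ?case using box eqA by auto
    next
      case empty
      then show ?case by (simp add: set_lebesgue_integral_def)
    next
      case (compl A)
      then have A: "A \<in> sets borel" unfolding sE by blast
      have "set_lebesgue_integral lborel (A \<union> (UNIV - A)) f'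
          = set_lebesgue_integral lborel A f' + set_lebesgue_integral lborel (UNIV - A) f'"
        using A by (intro set_integral_Un intA) auto
      then show ?case using compl UN by (simp add: Un_commute)
    next
      case (union A)
      then have "A i \<in> sets borel" for i unfolding sE by blast
      then have "set_lebesgue_integral lborel (\<Union>i. A i) f' = (\<Sum>i. set_lebesgue_integral lborel (A i) f')"
        using union(1) by (intro lebesgue_integral_countable_add intA) (auto simp: disjoint_family_on_def)
      then show ?case using union by simp
    qed
  qed
  have "AE x in lborel. f' x = 0" by (rule sigma_finite_measure.density_zero[OF lborel.sigma_finite_measure_axioms int]) (use zero in auto)
  with ff' have "AE x in lborel. f x = 0" by eventually_elim simp
  then show ?thesis by (rule AE_completion)
qed

text \<open>Every point is a lattice translate of one in the torus, and countably many translates of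
  a null set are null.\<close>

lemma AE_periodic:
  fixes l :: "real ^ 'd"
  assumes l: "\<And>i. 0 < l $ i" and g: "periodic l g" and ae: "AE x in lebesgue. x \<in> box 0 l \<longrightarrow> g x = 0"
  shows "AE x in lebesgue. g x = 0"
proof -
  obtain N where N: "negligible N" "{x. \<not> (x \<in> box 0 l \<longrightarrow> g x = 0)} \<subseteq> N"
    using ae unfolding eventually_ae_filter_negligible by blast
  \<comment> \<open>The coordinate hyperplanes account for the faces of the half-open torus that the
    open box omits.\<close>
  define M where "M = N \<union> (\<Union>i. {x. x \<bullet> axis i 1 = 0})"
  have "negligible {x :: real ^ 'd. x \<bullet> axis i 1 = 0}" for i
    by (rule negligible_standard_hyperplane) (simp add: axis_in_Basis_iff)
  then have M: "negligible M" unfolding M_def using N(1) by (intro negligible_Un negligible_Union) auto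
  have "negligible (\<Union>\<nu>\<in>lattice l. (+) \<nu> ` M)"
    using countable_lattice[of l] negligible_translation[OF M] by (intro negligible_countable_Union) auto
  moreover have "{x. g x \<noteq> 0} \<subseteq> (\<Union>\<nu>\<in>lattice l. (+) \<nu> ` M)"
  proof
    fix x assume "x \<in> {x. g x \<noteq> 0}"
    then have gx: "g x \<noteq> 0" by simp
    obtain \<nu> where \<nu>: "\<nu> \<in> lattice l" "x + \<nu> \<in> torus l" using lattice_reduction[OF l] by blast
    have "g (x + \<nu>) \<noteq> 0" using gx periodic_lattice[OF g \<nu>(1)] by simp
    moreover have "x + \<nu> \<in> box 0 l" if "\<And>i. (x + \<nu>) $ i \<noteq> 0"
      using \<nu>(2) that unfolding torus_def mem_box_cart by (metis (mono_tags, lifting) mem_Collect_eq order_le_less zero_index)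
    ultimately have "x + \<nu> \<in> M" using N(2) unfolding M_def by (auto simp: inner_axis)
    moreover have "x = - \<nu> + (x + \<nu>)" by simp
    ultimately show "x \<in> (\<Union>\<nu>\<in>lattice l. (+) \<nu> ` M)" using uminus_in_lattice[OF \<nu>(1)] by blast
  qed
  ultimately show ?thesis unfolding eventually_ae_filter_negligible by blast
qed

text \<open>The difference of \<open>u\<close> at time 0 and \<open>u0\<close> has zero integral
  over all boxes in the period cell, hence vanishes there almost everywhere, and then everywhere
  outside a null set by periodicity.\<close>

lemma initial_datum_AE:
  fixes l :: "real ^ 'd"
  assumes l: "\<And>i. 0 < l $ i" and T: "0 < T" and w: "weak_entropy_solution T l u0 u"
    and u0: "L_infty (torus l) u0" "periodic l u0"
    and cu: "continuous_on ({0..T} \<times> UNIV) u" and per: "\<And>t. t \<in> {0..T} \<Longrightarrow> periodic l (\<lambda>x. u (t, x))"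
  shows "AE x in lebesgue. u (0, x) = u0 x"
proof -
  define g where "g = (\<lambda>x. u (0, x) - u0 x)"
  have t0: "0 \<in> {0..T}" using T by simp
  note fin = finite_measure_torus[OF l]
  obtain Bu where Bu: "\<And>t x. t \<in> {0..T} \<Longrightarrow> \<bar>u (t, x)\<bar> \<le> Bu"
    using periodic_bounded[OF l cu per] by blast
  have "L_infty (torus l) (\<lambda>x. u (0, x))"
    by (rule L_infty_bounded[OF borel_measurable_continuous_onI[OF continuous_slice[OF cu t0]] Bu[OF t0]])
  then have "integrable (lebesgue_on (torus l)) (\<lambda>x. u (0, x) * 1)"
    by (rule L_infty_times_integrable[OF fin, of _ "\<lambda>_. 1" 1]) auto
  moreover have "integrable (lebesgue_on (torus l)) (\<lambda>x. u0 x * 1)"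
    by (rule L_infty_times_integrable[OF fin u0(1), of "\<lambda>_. 1" 1]) auto
  ultimately have gi: "integrable (lebesgue_on (torus l)) g" unfolding g_def by simp
  have test: "integral\<^sup>L (lebesgue_on (torus l)) (\<lambda>x. g x * \<theta> (0, x)) = 0"
    if "smooth \<theta>" "\<And>t. periodic l (\<lambda>x. \<theta> (t, x))" "\<And>t x. \<theta> (t, x) = \<theta> (0, x)" for \<theta> :: "real \<times> (real ^ 'd) \<Rightarrow> real"
    unfolding g_def by (rule weak_initial_datum[OF l T w u0(1) cu per that])
  define f where "f = (\<lambda>x. indicator (box 0 l) x * g x)"
  have sub: "box 0 l \<subseteq> torus l" by (auto simp: torus_def mem_box_cart less_imp_le)
  have fi: "integrable lebesgue f"
  proof -
    have "integrable lebesgue (\<lambda>x. indicator (torus l) x *\<^sub>R g x)"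
      using gi torus_lebesgue[of l] by (subst (asm) integrable_restrict_space) auto
    then have "integrable lebesgue (\<lambda>x. indicator (box 0 l) x *\<^sub>R (indicator (torus l) x *\<^sub>R g x))"
      by (rule integrable_mult_indicator[rotated]) simp
    moreover have "indicator (box 0 l) x *\<^sub>R (indicator (torus l) x *\<^sub>R g x) = f x" for x
      unfolding f_def using sub by (auto simp: indicator_def)
    ultimately show ?thesis by simp
  qed
  have "AE x in lebesgue. f x = 0"
  proof (rule AE_zero_of_box_integrals[OF fi, of 0 l])
    fix a b :: "real ^ 'd"
    \<comment> \<open>An arbitrary box is clipped to the period cell; if nothing is left the
      integral is zero trivially.\<close>
    let ?a = "\<chi> i. max (a $ i) 0" and ?b = "\<chi> i. min (b $ i) (l $ i)"
    have int: "indicator (box a b) x * indicator (box 0 l) x = (indicator (box ?a ?b) x :: real)" for x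
      by (auto simp: indicator_def mem_box_cart)
    show "(LINT x:box a b|lebesgue. f x) = 0"
    proof (cases "\<forall>i. ?a $ i < ?b $ i")
      case True
      then have "integral\<^sup>L (lebesgue_on (torus l)) (\<lambda>x. g x * indicator (box ?a ?b) x) = 0"
        by (intro integral_zero_on_boxes[OF l gi test]) auto
      then have "(LINT x:torus l|lebesgue. g x * indicator (box ?a ?b) x) = 0"
        unfolding set_integral_lebesgue_on[OF torus_lebesgue] .
      moreover have "indicator (torus l) x *\<^sub>R (g x * indicator (box ?a ?b) x) = indicator (box a b) x *\<^sub>R f x" for x
        unfolding f_def int[symmetric] using sub by (auto simp: indicator_def)
      ultimately show ?thesis unfolding set_lebesgue_integral_def by simp
    next
      case False
      then have "box ?a ?b = {}" unfolding interval_eq_empty_cart(1) using not_less by blast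
      then have "indicator (box a b) x *\<^sub>R f x = 0" for x
        unfolding f_def using int[of x] by (simp add: mult.assoc[symmetric])
      then show ?thesis unfolding set_lebesgue_integral_def by (simp only:) simp
    qed
  qed (simp add: f_def)
  then have "AE x in lebesgue. x \<in> box 0 l \<longrightarrow> g x = 0" by eventually_elim (auto simp: f_def)
  moreover have "periodic l g" using per[OF t0] u0(2) unfolding g_def periodic_def by simp
  ultimately have "AE x in lebesgue. g x = 0" by (intro AE_periodic[OF l])
  then show ?thesis by eventually_elim (simp add: g_def)
qed

section \<open>Convergence of the stabilized GRP scheme\<close>

theorem theorem4p8:
  fixes l :: "real ^ 'd" and T C1 C2 \<alpha> ubar :: real
    and u0 :: "real ^ 'd \<Rightarrow> real"
    and org :: "nat \<Rightarrow> real ^ 'd" and h dt :: "nat \<Rightarrow> real" and N :: "nat \<Rightarrow> nat"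
    and uh :: "nat \<Rightarrow> real \<times> (real ^ 'd) \<Rightarrow> real"
  assumes "CARD('d) = 2 \<or> CARD('d) = 3"
    and "0 < T" and "\<And>i. 0 < l $ i"
    and "0 < C1" and "C1 \<le> 1 / 24"
    and "periodic l u0" and "L_infty (torus l) u0"
    and "h \<longlonglongrightarrow> 0"
    and "\<And>n. 0 < N n" and "\<And>n. dt n = T / real (N n)"
    and "\<And>n. stabilized_GRP_solution T l C1 (org n) (h n) (N n) u0 (uh n)"
    and "\<And>n t x. 0 \<le> t \<Longrightarrow> t < T \<Longrightarrow> \<bar>uh n (t, x)\<bar> \<le> ubar"
    and "\<And>n. 0 < dt n \<and> dt n \<le> 1 \<and> 0 < h n \<and> h n \<le> 1"
    and "4 / 3 < \<alpha>" and "\<And>n. dt n \<le> C2 * h n powr \<alpha>"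
  shows "(\<forall>u s. strict_mono s \<and> weak_star_converges (cylinder T l) (\<lambda>n. uh (s n)) u \<and>
            weak_entropy_solution T l u0 u \<and> C1_cylinder T l u \<longrightarrow>
            classical_solution T l u0 u \<and> (\<forall>p\<ge>1. Lp_converges (cylinder T l) p uh u))
       \<and> (W1_infty_torus l u0 \<longrightarrow>
            (\<forall>u. strong_solution T l u0 u \<longrightarrow> (\<forall>p\<ge>1. Lp_converges (cylinder T l) p uh u)))"
proof -
  note T = assms(2) and l = assms(3)
  \<comment> \<open>\<open>M\<close> is fixed here ahead of \<open>T'\<close> and
    \<open>\<delta>\<close>, which is the uniformity demanded by
    \<open>scheme_converges\<close>.\<close>
  have converges: "Lp_converges (cylinder T l) p uh u"
    if "continuous_on ({0..T} \<times> UNIV) u" "\<And>t. t \<in> {0..T} \<Longrightarrow> periodic l (\<lambda>x. u (t, x))"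
      "AE x in lebesgue. u (0, x) = u0 x" "\<And>T' \<delta>. 0 < T' \<Longrightarrow> T' < T \<Longrightarrow> 0 < \<delta> \<Longrightarrow>
        \<exists>V. approx_solution T' l M \<delta> V \<and> (\<forall>t\<in>{0..T'}. \<forall>x. \<bar>V (t, x) - u (t, x)\<bar> \<le> \<delta>)" "1 \<le> p" for u M p
    by (rule scheme_converges[OF T l assms(4,5,8-15) that])
  have "classical_solution T l u0 u \<and> (\<forall>p\<ge>1. Lp_converges (cylinder T l) p uh u)"
    if w: "weak_entropy_solution T l u0 u" and C1: "C1_cylinder T l u" for u
  proof -
    obtain G where G: "continuous_on ({0..T} \<times> UNIV) G"
      "\<And>z. fst z \<in> {0..T} \<Longrightarrow> (u has_derivative (\<lambda>w. G z \<bullet> w)) (at z within {0..T} \<times> UNIV)"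
      "\<And>z. fst z \<in> {0<..<T} \<Longrightarrow> (u has_derivative (\<lambda>w. G z \<bullet> w)) (at z)"
      "\<And>t e. t \<in> {0..T} \<Longrightarrow> periodic l (\<lambda>x. G (t, x) \<bullet> e)"
      by (rule C1_cylinder_gradient[OF T C1]) (rule that)
    have per: "periodic l (\<lambda>x. u (t, x))" if "t \<in> {0..T}" for t using C1 that unfolding C1_cylinder_def by blast
    have cu: "continuous_on ({0..T} \<times> UNIV) u"
      unfolding continuous_on_eq_continuous_within using has_derivative_continuous[OF G(2)] by auto
    have res: "residual u G z = 0" if "fst z \<in> {0..<T}" for z
      by (rule residual_zero[OF l T w cu G(1) G(3) per G(4) that])
    have ae: "AE x in lebesgue. u (0, x) = u0 x" by (rule initial_datum_AE[OF l T w assms(7,6) cu per])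
    have "classical_solution T l u0 u"
      unfolding classical_solution_def
      using C1 C1_residual_zero_pointwise[OF G(3) res] C1_on_slice[OF G(1) T G(2)] ae by blast
    moreover obtain M where "\<And>T' \<delta>. T' < T \<and> 0 < \<delta> \<Longrightarrow> approx_solution T' l M \<delta> u"
      using C1_approx_solution[OF l cu G(1,2) per G(4) res] by blast
    \<comment> \<open>The comparison function is \<open>u\<close> itself, at distance zero.\<close>
    then have "Lp_converges (cylinder T l) p uh u" if "1 \<le> p" for p
      by (intro converges[OF cu per ae _ that, of M] exI[of _ u]) auto
    ultimately show ?thesis by blast
  qed
  moreover have "Lp_converges (cylinder T l) p uh u" if u: "strong_solution T l u0 u" and p: "1 \<le> p" for u p
  proof -
    obtain MG MU where "weak_burgers l T MG MU u" using strong_solution_weak_burgers[OF l T u] by blast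
    then interpret weak_burgers l T MG MU u .
    have ae: "AE x in lebesgue. u (0, x) = u0 x" using u unfolding strong_solution_def by blast
    show ?thesis by (rule converges[OF cont per ae approximate_solutions p])
  qed
  ultimately show ?thesis by blast
qed

end
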